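(* Let $\varepsilon\in(0,1)$. If $n=1$, set $u_0=\chi_{[-1/2,1/2]}$ (or the characteristic function of any interval) and, if $n=2$, let $u_0=\chi_\Omega$ for a domain $\Omega\subset B$ with smooth boundary $\Gamma$ (or a finite combination of such characteristic functions of non-intersecting domains). Then, for $n=1,2$, one has that $$|\nabla|^{-\varepsilon}|\nabla u_0|(x)\sim d(x,\Gamma)^{\varepsilon-1}\quad\text{for }d(x,\Gamma)\sim0.$$
   Context: $B=[-1,1)^n$ is the periodicity box: functions and measures on $B$ are identified with objects on $\mathbb{R}^n$ that are $2$-periodic in each variable. $\chi_S$ is the characteristic function of $S$. When $n=1$, $\Gamma$ is the set of end points of the interval; for a combination of characteristic functions, $\Gamma$ is the union of the boundaries of the domains. $d(x,\Gamma)=\inf_{y\in\Gamma}|x-y|$. $\nabla u_0$ is the distributional gradient ($\partial u_0$ when $n=1$), a vector-valued Radon measure, and $|\nabla u_0|$ is its total variation measure (e.g. $|\nabla\chi_\Omega|=\delta_\Gamma$, the line measure on $\Gamma$, when $n=2$; $|\partial\chi_{[-1/2,1/2]}|=\delta_{-1/2}+\delta_{1/2}$ when $n=1$). The operator $$|\nabla|^{-\varepsilon}=N_\varepsilon=\mathcal{F}^{-1}\operatorname{diag}\bigl[(|k|^{-\varepsilon})_{k\in\mathbb{Z}^n\setminus\{0\}}\bigr]\mathcal{F},$$ with $\mathcal{F}$ the Fourier transform of periodic functions, acts on periodic functions or measures by multiplying the $k$-th Fourier coefficient (with respect to $e^{\pi ik\cdot x}$) by $|k|^{-\varepsilon}$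 for $k\ne0$ and sending the $0$-th coefficient to $0$. The relation $f(x)\sim d(x,\Gamma)^{\varepsilon-1}$ for $d(x,\Gamma)\sim0$ means that there are constants $C\ge1$ and $\delta>0$ with $\frac1C d(x,\Gamma)^{\varepsilon-1}\le f(x)\le C\,d(x,\Gamma)^{\varepsilon-1}$ whenever $0<d(x,\Gamma)<\delta$.
   Formalization: Intervals are nondegenerate and not the full period; domains have smooth boundary as periodic sets; combinations have nonzero coefficients, and domains with equal coefficients share boundary only of length zero (otherwise there is no jump on part of the boundary and the claim fails). *)

theory Defs
  imports "HOL-Analysis.Analysis"
begin

section \<open>The periodicity box\<close>

text \<open>
  The dimension is \<open>DIM('a)\<close>; type \<open>real\<close> serves as $n=1$ and \<open>real^2\<close> as $n=2$.
  The torus is represented by the half-open box \<open>pbox\<close>, a fundamental domain of the lattice of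
  periods \<open>2 * int_lattice\<close>.
\<close>

definition pbox :: "'a::euclidean_space set" where
  "pbox = {x. \<forall>i\<in>Basis. -1 \<le> x \<bullet> i \<and> x \<bullet> i < 1}"

definition int_lattice :: "'a::euclidean_space set" where
  "int_lattice = {k. \<forall>i\<in>Basis. k \<bullet> i \<in> \<int>}"

definition periodic :: "('a::euclidean_space \<Rightarrow> 'b) \<Rightarrow> bool" where
  "periodic f \<longleftrightarrow> (\<forall>x. \<forall>i\<in>Basis. f (x + 2 *\<^sub>R i) = f x)"

definition pext :: "'a::euclidean_space set \<Rightarrow> 'a set" where
  "pext S = {x + 2 *\<^sub>R k |x k. x \<in> S \<and> k \<in> int_lattice}"

definition torus_borel :: "'a::euclidean_space measure" where
  "torus_borel = restrict_space borel pbox"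

section \<open>The distributional gradient and its total variation\<close>

text \<open>\<open>Ck k f\<close>: all partial derivatives of \<open>f\<close> of order at most \<open>k\<close> exist and are continuous.\<close>

primrec Ck :: "nat \<Rightarrow> ('a::euclidean_space \<Rightarrow> real) \<Rightarrow> bool" where
  "Ck 0 f \<longleftrightarrow> continuous_on UNIV f"
| "Ck (Suc k) f \<longleftrightarrow> (\<forall>x. f differentiable (at x)) \<and>
     (\<forall>i\<in>Basis. Ck k (\<lambda>x. frechet_derivative f (at x) i))"

definition smooth :: "('a::euclidean_space \<Rightarrow> real) \<Rightarrow> bool" where
  "smooth f \<longleftrightarrow> (\<forall>k. Ck k f)"

text \<open>
  \<open>gradient_measure u \<nu>\<close>: the distributional gradient on the torus of the integrable function \<open>u\<close>
  is the vector-valued Radon measure \<open>\<nu>\<close>, a set function on the Borel subsets of \<open>pbox\<close> (its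
  values on other sets are irrelevant). Each component of \<open>\<nu>\<close> is a signed measure, given
  as a difference \<open>P - N\<close> of two finite measures, and integration with respect to it is the
  difference of the two integrals, which does not depend on the choice of \<open>P\<close> and \<open>N\<close>.
  The test functions on the torus are the smooth periodic functions.
\<close>

definition gradient_measure ::
  "('a::euclidean_space \<Rightarrow> real) \<Rightarrow> ('a set \<Rightarrow> 'a) \<Rightarrow> bool" where
  "gradient_measure u \<nu> \<longleftrightarrow> set_integrable lborel pbox u \<and>
     (\<forall>i\<in>Basis. \<exists>P N. finite_measure P \<and> finite_measure N \<and>
        sets P = sets torus_borel \<and> sets N = sets torus_borel \<and>
        (\<forall>A\<in>sets torus_borel. \<nu> A \<bullet> i = measure P A - measure N A) \<and>
        (\<forall>\<phi>. smooth \<phi> \<and> periodic \<phi> \<longrightarrow>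
           (LINT x:pbox|lborel. u x * frechet_derivative \<phi> (at x) i) =
             - ((LINT x|P. \<phi> x) - (LINT x|N. \<phi> x))))"

definition total_variation :: "('a::euclidean_space set \<Rightarrow> 'a) \<Rightarrow> 'a measure" where
  "total_variation \<nu> = measure_of pbox (sets torus_borel)
     (\<lambda>A. SUP E \<in> {E :: nat \<Rightarrow> 'a set. range E \<subseteq> sets torus_borel \<and>
                      disjoint_family E \<and> (\<Union>n. E n) = A}.
            \<Sum>n. ennreal (norm (\<nu> (E n))))"

section \<open>Fourier coefficients and the operator $|\nabla|^{-\varepsilon}$\<close>

definition fourier_coeff_measure :: "'a::euclidean_space measure \<Rightarrow> 'a \<Rightarrow> complex" where
  "fourier_coeff_measure \<mu> k = (LINT x|\<mu>. cis (- (pi * (k \<bullet> x)))) / 2 ^ DIM('a)"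

definition fourier_coeff :: "('a::euclidean_space \<Rightarrow> real) \<Rightarrow> 'a \<Rightarrow> complex" where
  "fourier_coeff f k =
     (LINT x:pbox|lborel. complex_of_real (f x) * cis (- (pi * (k \<bullet> x)))) / 2 ^ DIM('a)"

text \<open>
  \<open>inv_frac_grad \<epsilon> \<mu> f\<close>: the periodic distribution obtained by applying $|\nabla|^{-\varepsilon}$
  to the measure \<open>\<mu>\<close> is the integrable function \<open>f\<close>. A periodic distribution is determined by its
  Fourier coefficients, so \<open>f\<close> is unique up to null sets.
\<close>

definition inv_frac_grad ::
  "real \<Rightarrow> 'a::euclidean_space measure \<Rightarrow> ('a \<Rightarrow> real) \<Rightarrow> bool" where
  "inv_frac_grad \<epsilon> \<mu> f \<longleftrightarrow> periodic f \<and> set_integrable lborel pbox f \<and>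
     (\<forall>k\<in>int_lattice. fourier_coeff f k =
        (if k = 0 then 0 else complex_of_real (norm k powr (-\<epsilon>)) * fourier_coeff_measure \<mu> k))"

section \<open>Behaviour near a closed set, and smooth domains\<close>

text \<open>
  If \<open>\<Gamma>\<close> is empty, then \<open>infdist x \<Gamma> = 0\<close> and the condition is void, exactly as with the
  convention that the distance to the empty set is infinite.
\<close>

definition comparable_near ::
  "'a::euclidean_space set \<Rightarrow> ('a \<Rightarrow> real) \<Rightarrow> ('a \<Rightarrow> real) \<Rightarrow> bool" where
  "comparable_near \<Gamma> f g \<longleftrightarrow> (\<exists>C\<ge>1. \<exists>\<delta>>0. \<forall>x. 0 < infdist x \<Gamma> \<and> infdist x \<Gamma> < \<delta> \<longrightarrow>
     1 / C * g x \<le> f x \<and> f x \<le> C * g x)"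

text \<open>
  The boundary is smooth if, near each of its points and after relabelling and reorienting the
  coordinate axes, the set is the part of the plane strictly above the graph of a smooth function.
  In particular the set lies locally on one side of its boundary.
\<close>

definition smooth_boundary :: "(real^2) set \<Rightarrow> bool" where
  "smooth_boundary D \<longleftrightarrow> (\<forall>p\<in>frontier D. \<exists>r>0. \<exists>g::real \<Rightarrow> real. \<exists>i j. \<exists>s\<in>{-1, 1}.
     smooth g \<and> i \<noteq> j \<and> (\<forall>x\<in>ball p r. x \<in> D \<longleftrightarrow> g (x $ j) < s * x $ i))"

definition torus_map :: "real^2 \<Rightarrow> complex^2" where
  "torus_map x = (\<chi> j. cis (pi * x $ j))"

text \<open>
  A domain with smooth boundary in the torus, i.e. openness, connectedness and boundary are those
  of the periodic extension modulo periods. \<open>torus_map\<close> induces an embedding of the torus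
  (the plane modulo periods), so connectedness of the image is connectedness in the torus; \<open>\<Omega>\<close>
  may wrap around \<open>pbox\<close>. The boundary, as a periodic set, is \<open>frontier (pext \<Omega>)\<close>.
\<close>

definition smooth_domain :: "(real^2) set \<Rightarrow> bool" where
  "smooth_domain \<Omega> \<longleftrightarrow> \<Omega> \<noteq> {} \<and> \<Omega> \<subseteq> pbox \<and> open (pext \<Omega>) \<and>
     connected (torus_map ` \<Omega>) \<and> smooth_boundary (pext \<Omega>)"

text \<open>
  Finitely many pairwise disjoint domains (as subsets of the torus), with nonzero coefficients. If
  two domains carry the same coefficient, there is no jump where their boundaries coincide;
  the last condition says that, for such a pair, this happens only on a set of length zero,
  length being measured by the total variation of the gradient of the characteristic
  function. Without it \<open>\<Gamma>\<close> would contain parts of the boundaries that the gradient of the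
  combination does not see.
\<close>

definition admissible_combination ::
  "nat \<Rightarrow> (nat \<Rightarrow> real) \<Rightarrow> (nat \<Rightarrow> (real^2) set) \<Rightarrow> bool" where
  "admissible_combination m c \<Omega> \<longleftrightarrow>
     (\<forall>i<m. smooth_domain (\<Omega> i) \<and> c i \<noteq> 0) \<and> disjoint_family_on \<Omega> {..<m} \<and>
     (\<forall>i<m. \<forall>j<m. i \<noteq> j \<and> c i = c j \<longrightarrow>
        (\<forall>\<nu>. gradient_measure (indicator (\<Omega> i)) \<nu> \<longrightarrow>
           emeasure (total_variation \<nu>) (pbox \<inter> frontier (pext (\<Omega> j))) = 0))"

end

(*
  The kernel of the operator with symbol |k|^(-eps) is a mixture of periodic heat kernels with weight
  t^(eps/2 - 1) / Gamma(eps/2) dt; times t >= 1 only contribute a bounded continuous remainder. If a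
  finite measure is carried by a closed periodic set and the mass of balls of radius r centred on the
  set is comparable to r^(n-1), then its heat flow at time t < 1 is, at distance d from the set, at most
  C t^(-1/2) exp(-a d^2/t), and at least of this order when t is comparable to d^2. Integrating over t
  bounds the potential above and below by multiples of d^(eps - 1).

  It remains to see that |grad u| has this regularity. For an interval it is the sum of two point masses.
  For smooth domains the divergence theorem under graphs, localised by a periodic partition of unity,
  writes grad u as a sum of curve integrals of normal vectors. The upper bound is immediate. For the
  lower bound, at most two of the disjoint domains meet at a boundary point, with opposite normals;
  the density there is c_l or c_l - c_l', and c_l = c_l' occurs only on a null set.
*)

theory Submission
  imports Defs "HOL-Probability.Probability"
begin

section \<open>Periods and fundamental domains\<close>

text \<open>The exponent \<open>\<epsilon> - 1\<close> does not depend on the dimension n: the heat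
  kernel contributes t^(-n/2), the mass of a ball of radius \<open>sqrt t\<close> contributes
  t^((n-1)/2), and together they leave t^(-1/2). Integration against the mixing weight then gives
  (d^2)^((\<epsilon>-1)/2). As this exponent is negative, the singular part tends to infinity at the
  set, and the remainder, of which nothing but boundedness is known, is absorbed by going close
  enough.

  The delicate point is the lower bound for the total variation, a supremum over partitions of norms
  of vectors, since contributions of overlapping charts or of neighbouring domains might cancel.
  Neither a density nor a Hahn decomposition is computed: one coordinate of the gradient suffices,
  because near a boundary point all charts of a domain give it the same sign. This is why all
  domains share one coordinate axis in each chart. The partition of unity is only of class C1, since
  the divergence theorem takes a single derivative.\<close>

definition cell :: "'a::euclidean_space \<Rightarrow> real \<Rightarrow> 'a \<Rightarrow> 'a set" where
  "cell z \<rho> k = {x. \<forall>i\<in>Basis. \<rho> * (k \<bullet> i) \<le> (x - z) \<bullet> i \<and> (x - z) \<bullet> i < \<rho> * (k \<bullet> i) + \<rho>}"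

lemma countable_int_lattice: "countable (int_lattice :: 'a::euclidean_space set)"
proof -
  have "(int_lattice :: 'a set) \<subseteq> (\<lambda>f. \<Sum>i\<in>Basis. of_int (f i) *\<^sub>R i) ` (Basis \<rightarrow>\<^sub>E (UNIV :: int set))"
  proof
    fix k :: 'a assume k: "k \<in> int_lattice"
    have "k = (\<Sum>i\<in>Basis. of_int (restrict (\<lambda>i. \<lfloor>k \<bullet> i\<rfloor>) Basis i) *\<^sub>R i)"
    proof (rule euclidean_eqI)
      fix i :: 'a assume i: "i \<in> Basis"
      then obtain n :: int where n: "k \<bullet> i = of_int n" using k by (auto simp: int_lattice_def elim: Ints_cases)
      show "k \<bullet> i = (\<Sum>i\<in>Basis. of_int (restrict (\<lambda>i. \<lfloor>k \<bullet> i\<rfloor>) Basis i) *\<^sub>R i) \<bullet> i"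
        unfolding inner_sum_left_Basis[OF i] using i n by simp
    qed
    then show "k \<in> (\<lambda>f. \<Sum>i\<in>Basis. of_int (f i) *\<^sub>R i) ` (Basis \<rightarrow>\<^sub>E (UNIV :: int set))"
      by (intro image_eqI[where x="restrict (\<lambda>i. \<lfloor>k \<bullet> i\<rfloor>) Basis"]) auto
  qed
  then show ?thesis
    by (rule countable_subset) (intro countable_image countable_PiE, auto)
qed

lemma int_lattice_add: "j \<in> int_lattice \<Longrightarrow> k \<in> int_lattice \<Longrightarrow> j + k \<in> int_lattice"
  and int_lattice_diff: "j \<in> int_lattice \<Longrightarrow> k \<in> int_lattice \<Longrightarrow> j - k \<in> int_lattice"
  and int_lattice_uminus: "k \<in> int_lattice \<Longrightarrow> - k \<in> int_lattice"
  and int_lattice_0: "0 \<in> int_lattice"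
  by (auto simp: int_lattice_def inner_simps)

text \<open>Coordinatewise this is the floor function; half-open cells leave no overlap. Side 2
  gives the period boxes, small sides give the grids used for comparing sums with integrals.\<close>

lemma cell_unique:
  fixes x :: "'a::euclidean_space"
  assumes "\<rho> > 0"
  shows "\<exists>!k. k \<in> int_lattice \<and> x \<in> cell z \<rho> k"
proof (rule ex1I)
  let ?k = "\<Sum>i\<in>Basis. of_int \<lfloor>((x - z) \<bullet> i) / \<rho>\<rfloor> *\<^sub>R (i :: 'a)"
  have *: "?k \<bullet> i = of_int \<lfloor>((x - z) \<bullet> i) / \<rho>\<rfloor>" if "i \<in> Basis" for i
    using that by (rule inner_sum_left_Basis)
  show "?k \<in> int_lattice \<and> x \<in> cell z \<rho> ?k"
  proof
    show "?k \<in> int_lattice" using * unfolding int_lattice_def by auto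
    show "x \<in> cell z \<rho> ?k"
      unfolding cell_def
    proof (safe, unfold *)
      fix i :: 'a
      let ?t = "((x - z) \<bullet> i) / \<rho>"
      have t: "(x - z) \<bullet> i = \<rho> * ?t" using assms by simp
      show "\<rho> * of_int \<lfloor>?t\<rfloor> \<le> (x - z) \<bullet> i"
        by (subst t, rule mult_left_mono) (use assms in auto)
      have "?t < of_int \<lfloor>?t\<rfloor> + 1" by linarith
      then have "\<rho> * ?t < \<rho> * (of_int \<lfloor>?t\<rfloor> + 1)" using assms by (intro mult_strict_left_mono)
      then show "(x - z) \<bullet> i < \<rho> * of_int \<lfloor>?t\<rfloor> + \<rho>"
        using t by (simp only: ring_distribs mult_1_right)
    qed
  qed
  fix k :: 'a assume k: "k \<in> int_lattice \<and> x \<in> cell z \<rho> k"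
  show "k = ?k"
  proof (rule euclidean_eqI)
    fix i :: 'a assume i: "i \<in> Basis"
    have kI: "k \<bullet> i \<in> \<int>" using k i by (auto simp: int_lattice_def)
    then obtain n :: int where n: "k \<bullet> i = of_int n" by (auto elim: Ints_cases)
    have "\<rho> * of_int n \<le> (x - z) \<bullet> i" "(x - z) \<bullet> i < \<rho> * of_int n + \<rho>"
      using k i n by (auto simp: cell_def)
    then have "of_int n \<le> ((x - z) \<bullet> i) / \<rho>" "((x - z) \<bullet> i) / \<rho> < of_int n + 1"
      using assms by (auto simp: field_simps)
    then have "\<lfloor>((x - z) \<bullet> i) / \<rho>\<rfloor> = n" by linarith
    then show "k \<bullet> i = ?k \<bullet> i" unfolding *[OF i] n by simp
  qed
qed

lemma cell_measurable [measurable]: "cell z \<rho> k \<in> sets borel"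
proof -
  have "cell z \<rho> k = (\<Inter>i\<in>Basis. {x. \<rho> * (k \<bullet> i) \<le> (x - z) \<bullet> i} \<inter> {x. (x - z) \<bullet> i < \<rho> * (k \<bullet> i) + \<rho>})"
    by (auto simp: cell_def)
  also have "\<dots> \<in> sets borel" by (intro sets.finite_INT) auto
  finally show ?thesis .
qed

text \<open>Stated for any Borel measure, because it is applied both to Lebesgue measure and, at the
  scale \<open>sqrt t\<close>, to the periodised measure.\<close>

lemma nn_integral_cells:
  fixes h :: "'a::euclidean_space \<Rightarrow> ennreal"
  assumes "\<rho> > 0" and M [measurable_cong]: "sets M = sets borel"
    and h [measurable]: "h \<in> borel_measurable borel"
  shows "(\<integral>\<^sup>+x. h x \<partial>M) = (\<integral>\<^sup>+k. (\<integral>\<^sup>+x. h x * indicator (cell z \<rho> k) x \<partial>M) \<partial>count_space int_lattice)"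
proof -
  have "h x = (\<integral>\<^sup>+k. h x * indicator (cell z \<rho> k) x \<partial>count_space int_lattice)" for x
  proof -
    obtain k where k: "k \<in> int_lattice" "x \<in> cell z \<rho> k"
      and u: "\<And>j. j \<in> int_lattice \<Longrightarrow> x \<in> cell z \<rho> j \<Longrightarrow> j = k"
      using cell_unique[OF assms(1), of x z] by auto
    have ind: "indicator (cell z \<rho> j) x = (indicator {k} j :: ennreal)" if "j \<in> int_lattice" for j
      using u[OF that] k by (cases "j = k") (auto simp: indicator_def)
    have "(\<integral>\<^sup>+j. h x * indicator (cell z \<rho> j) x \<partial>count_space int_lattice)
       = (\<integral>\<^sup>+j. h x * indicator {k} j \<partial>count_space int_lattice)"
      by (intro nn_integral_cong) (simp add: ind)
    also have "\<dots> = h x"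
      using k by (subst nn_integral_cmult_indicator) auto
    finally show ?thesis by simp
  qed
  then have "(\<integral>\<^sup>+x. h x \<partial>M) = (\<integral>\<^sup>+x. (\<integral>\<^sup>+k. h x * indicator (cell z \<rho> k) x \<partial>count_space int_lattice) \<partial>M)"
    by simp
  also have "\<dots> = (\<integral>\<^sup>+k. (\<integral>\<^sup>+x. h x * indicator (cell z \<rho> k) x \<partial>M) \<partial>count_space int_lattice)"
    by (intro nn_integral_count_space_nn_integral countable_int_lattice) measurable
  finally show ?thesis .
qed

lemma mem_cell_pbox: "x \<in> cell (- One) 2 k \<longleftrightarrow> x - 2 *\<^sub>R k \<in> pbox"
proof -
  have "One \<bullet> i = 1" if "i \<in> Basis" for i :: 'a
    using inner_sum_left_Basis[OF that, of "\<lambda>_. 1"] by simp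
  then show ?thesis
    unfolding cell_def pbox_def mem_Collect_eq
    by (intro ball_cong refl) (auto simp: inner_diff_left inner_add_left)
qed

lemma pbox_eq_cell: "(pbox :: 'a::euclidean_space set) = cell (- One) 2 0"
  using mem_cell_pbox[where k=0] by auto

lemma pbox_measurable [measurable]: "pbox \<in> sets borel"
  unfolding pbox_eq_cell by measurable

lemma space_torus_borel [simp]: "space torus_borel = pbox"
  by (simp add: torus_borel_def space_restrict_space)

lemma sets_torus_borel: "A \<in> sets torus_borel \<longleftrightarrow> A \<in> sets borel \<and> A \<subseteq> pbox"
  unfolding torus_borel_def by (subst sets_restrict_space_iff) auto


lemma mem_pext: "x \<in> pext A \<longleftrightarrow> (\<exists>k\<in>int_lattice. x + 2 *\<^sub>R k \<in> A)"
proof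
  assume "x \<in> pext A"
  then obtain a k where "x = a + 2 *\<^sub>R k" "a \<in> A" "k \<in> int_lattice" by (auto simp: pext_def)
  then show "\<exists>k\<in>int_lattice. x + 2 *\<^sub>R k \<in> A" by (intro bexI[of _ "-k"]) (auto simp: int_lattice_uminus)
next
  assume "\<exists>k\<in>int_lattice. x + 2 *\<^sub>R k \<in> A"
  then obtain k where "k\<in>int_lattice" "x + 2 *\<^sub>R k \<in> A" by auto
  then have "x = (x + 2 *\<^sub>R k) + 2 *\<^sub>R (-k)" "-k \<in> int_lattice" by (auto simp: int_lattice_uminus)
  then show "x \<in> pext A" unfolding pext_def using \<open>x + 2 *\<^sub>R k \<in> A\<close> by blast
qed

lemma pext_shift:
  "k \<in> int_lattice \<Longrightarrow> x + 2 *\<^sub>R k \<in> pext A \<longleftrightarrow> x \<in> pext A"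
proof -
  have *: "x + 2 *\<^sub>R k \<in> pext A" if x: "x \<in> pext A" and k: "k \<in> int_lattice" for x k
  proof -
    obtain a j where "x = a + 2 *\<^sub>R j" "a \<in> A" "j \<in> int_lattice" using x by (auto simp: pext_def)
    then have "x + 2 *\<^sub>R k = a + 2 *\<^sub>R (j + k)" "a \<in> A" "j + k \<in> int_lattice"
      using k by (auto simp: scaleR_right_distrib int_lattice_add)
    then show ?thesis unfolding pext_def by blast
  qed
  show "k \<in> int_lattice \<Longrightarrow> x + 2 *\<^sub>R k \<in> pext A \<longleftrightarrow> x \<in> pext A"
    using *[of x k] *[of "x + 2 *\<^sub>R k" "-k"] by (auto simp: int_lattice_uminus)
qed

lemma pext_measurable [measurable]: "A \<in> sets borel \<Longrightarrow> pext A \<in> sets (borel :: 'a::euclidean_space measure)"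
proof -
  assume A: "A \<in> sets borel"
  have "pext A = (\<Union>k\<in>int_lattice. (\<lambda>x. x + 2 *\<^sub>R k) -` A \<inter> space borel)" by (auto simp: mem_pext)
  also have "\<dots> \<in> sets borel"
    by (intro sets.countable_UN'' countable_int_lattice measurable_sets[OF _ A]) auto
  finally show ?thesis .
qed

lemma periodic_int_lattice:
  fixes f :: "'a::euclidean_space \<Rightarrow> 'b"
  assumes f: "periodic f" and k: "k \<in> int_lattice"
  shows "f (x + 2 *\<^sub>R k) = f x"
proof -
  have 1: "f (x + (2 * of_nat n) *\<^sub>R i) = f x" if "i \<in> Basis" for x i n
  proof (induction n)
    case (Suc n)
    have "f (x + (2 * of_nat (Suc n)) *\<^sub>R i) = f ((x + (2 * of_nat n) *\<^sub>R i) + 2 *\<^sub>R i)"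
      by (simp add: algebra_simps)
    then show ?case using f that Suc by (simp add: periodic_def)
  qed simp
  have 2: "f (x + (2 * of_int n) *\<^sub>R i) = f x" if "i \<in> Basis" for x i n
  proof (cases n rule: int_cases2)
    case (nonneg m) then show ?thesis using 1[OF that] by simp
  next
    case (nonpos m) then show ?thesis
      using 1[OF that, of "x + (2 * of_int n) *\<^sub>R i" m] by (simp add: algebra_simps)
  qed
  have 3: "f (x + 2 *\<^sub>R (\<Sum>i\<in>B. (k \<bullet> i) *\<^sub>R i)) = f x" if "B \<subseteq> Basis" for B x
    using finite_subset[OF that finite_Basis] that
  proof (induction B arbitrary: x)
    case (insert i B)
    have "k \<bullet> i \<in> \<int>" using k insert by (auto simp: int_lattice_def)
    then obtain n where n: "k \<bullet> i = of_int n" by (auto elim: Ints_cases)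
    have "f (x + 2 *\<^sub>R (\<Sum>i\<in>insert i B. (k \<bullet> i) *\<^sub>R i)) =
       f ((x + (2 * of_int n) *\<^sub>R i) + 2 *\<^sub>R (\<Sum>i\<in>B. (k \<bullet> i) *\<^sub>R i))"
      using insert n by (simp add: algebra_simps)
    then show ?case using insert 2 by simp
  qed simp
  show ?thesis using 3[OF order_refl, of x] by (simp add: euclidean_representation)
qed

text \<open>The sum of all period translates of \<mu>, an infinite measure in general. Integrating a
  Gaussian on the whole space against it is the same as integrating the periodised Gaussian against
  \<mu>. The push-forward of a product is chosen so that Tonelli computes its integrals.\<close>

definition periodization :: "'a::euclidean_space measure \<Rightarrow> 'a measure" where
  "periodization \<mu> = distr (count_space int_lattice \<Otimes>\<^sub>M \<mu>) borel (\<lambda>(m, y). y + 2 *\<^sub>R m)"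

lemma sigma_finite_lattice: "sigma_finite_measure (count_space (int_lattice :: 'a::euclidean_space set))"
  by (rule sigma_finite_measure_count_space_countable[OF countable_int_lattice])

lemma shift_measurable [measurable]:
  assumes [measurable_cong]: "sets \<mu> = sets (torus_borel :: 'a::euclidean_space measure)"
  shows "(\<lambda>(m, y). y + 2 *\<^sub>R m) \<in> count_space int_lattice \<Otimes>\<^sub>M \<mu> \<rightarrow>\<^sub>M borel"
proof (rule measurable_pair_measure_countable1[OF countable_int_lattice])
  fix m :: 'a
  have "(\<lambda>y. y) \<in> \<mu> \<rightarrow>\<^sub>M borel"
    using measurable_restrict_space1[OF measurable_ident_sets[OF refl], of borel pbox]
    by (simp add: assms torus_borel_def cong: measurable_cong_sets)
  then show "(\<lambda>y. case (m, y) of (m, y) \<Rightarrow> y + 2 *\<^sub>R m) \<in> \<mu> \<rightarrow>\<^sub>M borel" by simp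
qed

lemma sets_periodization [simp, measurable_cong]: "sets (periodization \<mu>) = sets borel"
  by (simp add: periodization_def)

lemma nn_integral_periodization:
  fixes \<mu> :: "'a::euclidean_space measure"
  assumes "sigma_finite_measure \<mu>" and [measurable_cong]: "sets \<mu> = sets torus_borel"
    and h [measurable]: "h \<in> borel_measurable borel"
  shows "(\<integral>\<^sup>+y. h y \<partial>periodization \<mu>) = (\<integral>\<^sup>+m. \<integral>\<^sup>+y. h (y + 2 *\<^sub>R m) \<partial>\<mu> \<partial>count_space int_lattice)"
proof -
  interpret sigma_finite_measure \<mu> by fact
  note [measurable] = shift_measurable[OF assms(2)]
  have "(\<integral>\<^sup>+y. h y \<partial>periodization \<mu>) = (\<integral>\<^sup>+p. h (case p of (m, y) \<Rightarrow> y + 2 *\<^sub>R m) \<partial>(count_space int_lattice \<Otimes>\<^sub>M \<mu>))"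
    unfolding periodization_def by (subst nn_integral_distr) auto
  also have "\<dots> = (\<integral>\<^sup>+m. \<integral>\<^sup>+y. h (case (m, y) of (m, y) \<Rightarrow> y + 2 *\<^sub>R m) \<partial>\<mu> \<partial>count_space int_lattice)"
    by (subst nn_integral_fst[symmetric]) auto
  finally show ?thesis by simp
qed

text \<open>The translate of \<open>pbox\<close> by \<open>2 *\<^sub>R m\<close> is the cell with
  index m, and these cells tile the space. This is what later unfolds a lattice sum of integrals
  over the torus into one integral over the space.\<close>

lemma periodization_lborel:
  "periodization (restrict_space lborel pbox) = (lborel :: 'a::euclidean_space measure)"
proof (rule measure_eqI)
  let ?\<mu> = "restrict_space lborel pbox :: 'a measure"
  have s: "sets ?\<mu> = sets torus_borel" by (simp add: torus_borel_def cong: sets_restrict_space_cong)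
  have sf: "sigma_finite_measure ?\<mu>"
    by (rule sigma_finite_measure_restrict_space) (auto intro: lborel.sigma_finite_measure_axioms)
  fix A :: "'a set" assume "A \<in> sets (periodization ?\<mu>)"
  then have A [measurable]: "A \<in> sets borel" by simp
  have "emeasure (periodization ?\<mu>) A = (\<integral>\<^sup>+y. indicator A y \<partial>periodization ?\<mu>)" by simp
  also have "\<dots> = (\<integral>\<^sup>+m. \<integral>\<^sup>+y. indicator A (y + 2 *\<^sub>R m) \<partial>?\<mu> \<partial>count_space int_lattice)"
    by (rule nn_integral_periodization[OF sf s]) simp
  also have "\<dots> = (\<integral>\<^sup>+m. (\<integral>\<^sup>+x. indicator A x * indicator (cell (- One) 2 m) x \<partial>lborel) \<partial>count_space int_lattice)"
  proof (rule nn_integral_cong)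
    fix m :: 'a
    have "(\<integral>\<^sup>+y. indicator A (y + 2 *\<^sub>R m) \<partial>?\<mu>) = (\<integral>\<^sup>+y. indicator A (y + 2 *\<^sub>R m) * indicator pbox y \<partial>lborel)"
      by (subst nn_integral_restrict_space) auto
    also have "\<dots> = (\<integral>\<^sup>+y. indicator A (2 *\<^sub>R m + y) * indicator (cell (- One) 2 m) (2 *\<^sub>R m + y) \<partial>lborel)"
      by (intro nn_integral_cong) (auto simp: mem_cell_pbox add.commute split: split_indicator)
    also have "\<dots> = (\<integral>\<^sup>+x. indicator A x * indicator (cell (- One) 2 m) x \<partial>distr lborel borel ((+) (2 *\<^sub>R m)))"
      by (subst nn_integral_distr) auto
    finally show "(\<integral>\<^sup>+y. indicator A (y + 2 *\<^sub>R m) \<partial>?\<mu>) =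
        (\<integral>\<^sup>+x. indicator A x * indicator (cell (- One) 2 m) x \<partial>lborel)"
      by (simp add: lborel_distr_plus)
  qed
  also have "\<dots> = (\<integral>\<^sup>+x. indicator A x \<partial>lborel)"
    by (rule nn_integral_cells[symmetric]) auto
  finally show "emeasure (periodization ?\<mu>) A = emeasure lborel A" by simp
qed simp

lemma cell_subset_ball:
  fixes k :: "'a::euclidean_space"
  shows "cell z \<rho> k \<subseteq> ball (z + \<rho> *\<^sub>R k) (\<rho> * real DIM('a))"
proof
  fix x assume x: "x \<in> cell z \<rho> k"
  let ?y = "x - (z + \<rho> *\<^sub>R k)"
  have y: "0 \<le> ?y \<bullet> i \<and> ?y \<bullet> i < \<rho>" if "i \<in> Basis" for i
    using x that by (auto simp: cell_def inner_simps)
  have "norm ?y \<le> (\<Sum>i\<in>Basis. \<bar>?y \<bullet> i\<bar>)" by (rule norm_le_l1)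
  also have "\<dots> < (\<Sum>i\<in>(Basis :: 'a set). \<rho>)" using y by (intro sum_strict_mono) auto
  finally show "x \<in> ball (z + \<rho> *\<^sub>R k) (\<rho> * real DIM('a))"
    by (simp add: dist_norm norm_minus_commute mult.commute)
qed

section \<open>Gaussians and lattice sums\<close>

lemma
  fixes h :: "'a::euclidean_space \<Rightarrow> real \<Rightarrow> complex"
  assumes h: "\<And>i. i \<in> Basis \<Longrightarrow> integrable lborel (h i)"
  shows integrable_lborel_prod: "integrable lborel (\<lambda>x. \<Prod>i\<in>Basis. h i (x \<bullet> i))"
    and integral_lborel_prod: "(\<integral>x. (\<Prod>i\<in>Basis. h i (x \<bullet> i)) \<partial>lborel) = (\<Prod>i\<in>Basis. \<integral>x. h i x \<partial>lborel)"
proof -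
  interpret product_sigma_finite "\<lambda>_::'a. lborel :: real measure" ..
  let ?P = "\<Pi>\<^sub>M b\<in>(Basis::'a set). (lborel :: real measure)"
  let ?T = "\<lambda>f. \<Sum>b\<in>(Basis::'a set). f b *\<^sub>R b"
  have L: "(lborel :: 'a measure) = distr ?P borel ?T" by (rule lborel_eq)
  have T: "?T \<in> ?P \<rightarrow>\<^sub>M borel" by measurable
  have m: "(\<lambda>x::'a. \<Prod>i\<in>Basis. h i (x \<bullet> i)) \<in> borel_measurable borel"
  proof (rule borel_measurable_prod)
    fix i :: 'a assume "i \<in> Basis"
    then have [measurable]: "h i \<in> borel_measurable borel" using h by (auto dest: borel_measurable_integrable)
    show "(\<lambda>x::'a. h i (x \<bullet> i)) \<in> borel_measurable borel" by measurable
  qed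
  have eq: "(\<Prod>i\<in>Basis. h i (?T f \<bullet> i)) = (\<Prod>i\<in>Basis. h i (f i))" for f
    by (intro prod.cong refl) (simp only: inner_sum_left_Basis)
  show "integrable lborel (\<lambda>x. \<Prod>i\<in>Basis. h i (x \<bullet> i))"
    unfolding L integrable_distr_eq[OF T m] eq by (rule product_integrable_prod[OF finite_Basis h])
  show "(\<integral>x. (\<Prod>i\<in>Basis. h i (x \<bullet> i)) \<partial>lborel) = (\<Prod>i\<in>Basis. \<integral>x. h i x \<partial>lborel)"
    unfolding L integral_distr[OF T m] eq by (rule product_integral_prod[OF finite_Basis h])
qed

lemma cis_measurable [measurable]: "cis \<in> borel_measurable borel"
  by (intro borel_measurable_continuous_onI continuous_intros)

text \<open>The substitution with factor \<open>sqrt (2 * \<alpha>)\<close> turns the integrand into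
  the standard normal density times a character, so the value is read off from the characteristic
  function of the normal distribution.\<close>

lemma
  fixes \<alpha> b :: real
  assumes \<alpha>: "\<alpha> > 0"
  shows integrable_gauss_1d: "integrable lborel (\<lambda>x. exp (-(\<alpha> * x\<^sup>2)) * cis (-(b * x)))"
    and integral_gauss_1d:
      "(\<integral>x. exp (-(\<alpha> * x\<^sup>2)) * cis (-(b * x)) \<partial>lborel) = sqrt (pi / \<alpha>) * exp (-(b\<^sup>2 / (4 * \<alpha>)))"
proof -
  define c where "c = sqrt (2 * \<alpha>)"
  have c: "c > 0" "c\<^sup>2 = 2 * \<alpha>" using \<alpha> by (auto simp: c_def)
  let ?f = "\<lambda>x. std_normal_density x *\<^sub>R cis (-(b / c * x))"
  have f: "integrable lborel ?f"
    by (rule Bochner_Integration.integrable_bound[OF integrable_normal_density[of 1 0]]) auto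
  have "(\<integral>x. ?f x \<partial>lborel) = (CLINT x|std_normal_distribution. iexp (-(b / c) * x))"
    by (subst integral_density) (auto simp: cis_conv_exp)
  also have "\<dots> = exp (-((b / c)\<^sup>2 / 2))"
    using char_std_normal_distribution unfolding char_def fun_eq_iff by (auto dest: spec[of _ "-(b/c)"])
  also have "(b / c)\<^sup>2 / 2 = b\<^sup>2 / (4 * \<alpha>)" using \<alpha> by (simp add: power_divide c)
  finally have I: "(\<integral>x. ?f x \<partial>lborel) = exp (-(b\<^sup>2 / (4 * \<alpha>)))" .
  have eq: "?f (0 + c * x) = (1 / sqrt (2 * pi)) *\<^sub>R (exp (-(\<alpha> * x\<^sup>2)) * cis (-(b * x)))" for x
    using c(1) unfolding std_normal_density_def by (simp add: scaleR_conv_of_real power_mult_distrib c(2))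
  have "integrable lborel (\<lambda>x. ?f (0 + c * x))"
    using f c by (intro lborel_integrable_real_affine) auto
  then have "integrable lborel (\<lambda>x. sqrt (2 * pi) *\<^sub>R ?f (0 + c * x))" by (intro integrable_scaleR_right)
  then show "integrable lborel (\<lambda>x. exp (-(\<alpha> * x\<^sup>2)) * cis (-(b * x)))" unfolding eq by simp
  have "(\<integral>x. ?f x \<partial>lborel) = \<bar>c\<bar> *\<^sub>R (\<integral>x. ?f (0 + c * x) \<partial>lborel)"
    using c by (intro lborel_integral_real_affine) auto
  also have "\<dots> = (c / sqrt (2 * pi)) *\<^sub>R (\<integral>x. exp (-(\<alpha> * x\<^sup>2)) * cis (-(b * x)) \<partial>lborel)"
    unfolding eq using c by simp
  finally have "(\<integral>x. exp (-(\<alpha> * x\<^sup>2)) * cis (-(b * x)) \<partial>lborel) = (sqrt (2 * pi) / c) *\<^sub>R complex_of_real (exp (-(b\<^sup>2 / (4 * \<alpha>))))"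
    unfolding I using c by (simp add: scaleR_conv_of_real)
  also have "sqrt (2 * pi) / c = sqrt (pi / \<alpha>)"
    unfolding c_def by (simp flip: real_sqrt_divide)
  finally show "(\<integral>x. exp (-(\<alpha> * x\<^sup>2)) * cis (-(b * x)) \<partial>lborel) = sqrt (pi / \<alpha>) * exp (-(b\<^sup>2 / (4 * \<alpha>)))"
    by (simp add: scaleR_conv_of_real)
qed

lemma norm_sq_Basis: "(norm (x::'a::euclidean_space))\<^sup>2 = (\<Sum>i\<in>Basis. (x \<bullet> i)\<^sup>2)"
  unfolding power2_norm_eq_inner by (subst euclidean_inner) (simp add: power2_eq_square)

lemma prod_cis: "finite A \<Longrightarrow> (\<Prod>i\<in>A. cis (f i)) = cis (\<Sum>i\<in>A. f i)"
  by (induction A rule: finite_induct) (auto simp: cis_mult)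

text \<open>The usual heat kernel (4 pi s)^(-n/2) exp(-|z|^2/(4 s)) at time s = t/pi^2. With this
  choice of time the mode with frequency pi k decays exactly like exp(-t |k|^2).\<close>

definition heat :: "real \<Rightarrow> 'a::euclidean_space \<Rightarrow> real" where
  "heat t z = (4 * t / pi) powr (- real DIM('a) / 2) * exp (-(pi\<^sup>2 / 4 * (norm z)\<^sup>2 / t))"

lemma heat_nonneg: "0 \<le> heat t z" by (simp add: heat_def)

lemma heat_measurable [measurable]:
  "(\<lambda>(t, z). heat t (z :: 'a::euclidean_space)) \<in> borel_measurable (borel \<Otimes>\<^sub>M borel)"
  unfolding heat_def by measurable

lemma
  fixes k :: "'a::euclidean_space"
  assumes t: "t > 0"
  shows integrable_heat_cis: "integrable lborel (\<lambda>z. heat t z *\<^sub>R cis (-(pi * (k \<bullet> z))))"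
    and integral_heat_cis: "(\<integral>z. heat t z *\<^sub>R cis (-(pi * (k \<bullet> z))) \<partial>lborel) = exp (- (t * (norm k)\<^sup>2))"
proof -
  define \<alpha> where "\<alpha> = pi\<^sup>2 / (4 * t)"
  have \<alpha>: "\<alpha> > 0" using t by (simp add: \<alpha>_def)
  define A where "A = (4 * t / pi) powr (- real DIM('a) / 2)"
  let ?h = "\<lambda>(i::'a) x. complex_of_real (exp (-(\<alpha> * x\<^sup>2))) * cis (-(pi * (k \<bullet> i) * x))"
  have eq: "heat t z *\<^sub>R cis (-(pi * (k \<bullet> z))) = A *\<^sub>R (\<Prod>i\<in>Basis. ?h i (z \<bullet> i))" for z :: 'a
  proof -
    have "(\<Prod>i\<in>Basis. ?h i (z \<bullet> i)) = of_real (exp (\<Sum>i\<in>Basis. -(\<alpha> * (z \<bullet> i)\<^sup>2))) * cis (\<Sum>i\<in>Basis. -(pi * (k \<bullet> i) * (z \<bullet> i)))"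
      by (simp add: prod.distrib prod_cis exp_sum)
    also have "(\<Sum>i\<in>Basis. -(\<alpha> * (z \<bullet> i)\<^sup>2)) = -(pi\<^sup>2 / 4 * (norm z)\<^sup>2 / t)"
      by (simp add: norm_sq_Basis sum_negf sum_distrib_left sum_divide_distrib \<alpha>_def field_simps)
    also have "(\<Sum>i\<in>Basis. -(pi * (k \<bullet> i) * (z \<bullet> i))) = -(pi * (k \<bullet> z))"
      by (subst euclidean_inner[of k z]) (simp add: sum_negf sum_distrib_left mult.assoc)
    finally show ?thesis by (simp add: heat_def A_def scaleR_conv_of_real)
  qed
  show "integrable lborel (\<lambda>z. heat t z *\<^sub>R cis (-(pi * (k \<bullet> z))))"
    unfolding eq by (intro integrable_scaleR_right integrable_lborel_prod integrable_gauss_1d \<alpha>)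
  have "(\<integral>z. heat t z *\<^sub>R cis (-(pi * (k \<bullet> z))) \<partial>lborel) = A *\<^sub>R (\<Prod>i\<in>Basis. \<integral>x. ?h i x \<partial>lborel)"
    unfolding eq integral_scaleR_right by (subst integral_lborel_prod) (auto intro!: integrable_gauss_1d \<alpha>)
  also have "(\<Prod>i\<in>Basis. \<integral>x. ?h i x \<partial>lborel) = (\<Prod>i\<in>(Basis::'a set). complex_of_real (sqrt (pi / \<alpha>)) * of_real (exp (-((pi * (k \<bullet> i))\<^sup>2 / (4 * \<alpha>)))))"
    by (intro prod.cong refl) (subst integral_gauss_1d[OF \<alpha>], simp)
  also have "\<dots> = of_real (sqrt (pi / \<alpha>) ^ DIM('a) * exp (\<Sum>i\<in>Basis. -((pi * (k \<bullet> i))\<^sup>2 / (4 * \<alpha>))))"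
    by (simp add: prod.distrib exp_sum)
  also have "(\<Sum>i\<in>Basis. -((pi * (k \<bullet> i))\<^sup>2 / (4 * \<alpha>))) = - (t * (norm k)\<^sup>2)"
    using t by (simp add: norm_sq_Basis sum_negf sum_distrib_left sum_divide_distrib \<alpha>_def field_simps)
  also have "sqrt (pi / \<alpha>) ^ DIM('a) = (4 * t / pi) powr (real DIM('a) / 2)"
  proof -
    have "pi / \<alpha> = 4 * t / pi" using t by (simp add: \<alpha>_def power2_eq_square field_simps)
    then show ?thesis using t by (simp add: powr_half_sqrt[symmetric] powr_realpow[symmetric] powr_powr)
  qed
  also have "A *\<^sub>R complex_of_real ((4 * t / pi) powr (real DIM('a) / 2) * exp (- (t * (norm k)\<^sup>2))) = exp (- (t * (norm k)\<^sup>2))"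
    using t by (simp add: A_def scaleR_conv_of_real powr_minus field_simps)
  finally show "(\<integral>z. heat t z *\<^sub>R cis (-(pi * (k \<bullet> z))) \<partial>lborel) = exp (- (t * (norm k)\<^sup>2))" .
qed

lemma integrable_heat: "t > 0 \<Longrightarrow> integrable lborel (heat t :: 'a::euclidean_space \<Rightarrow> real)"
  and integral_heat: "t > 0 \<Longrightarrow> (\<integral>z. heat t (z::'a) \<partial>lborel) = 1"
proof -
  assume t: "t > 0"
  have i: "integrable lborel (\<lambda>z::'a. complex_of_real (heat t z))"
    using integrable_heat_cis[OF t, of "0::'a"] by (simp add: scaleR_conv_of_real)
  then show "integrable lborel (heat t :: 'a \<Rightarrow> real)" by (simp only: complex_of_real_integrable_eq)
  have "complex_of_real (\<integral>z. heat t (z::'a) \<partial>lborel) = 1"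
    using integral_heat_cis[OF t, of "0::'a"] by (simp add: scaleR_conv_of_real)
  then show "(\<integral>z. heat t (z::'a) \<partial>lborel) = 1" by (simp only: of_real_eq_1_iff)
qed

lemma nn_integral_heat: "t > 0 \<Longrightarrow> (\<integral>\<^sup>+z. heat t (z::'a::euclidean_space) \<partial>lborel) = 1"
  by (subst nn_integral_eq_integral) (auto simp: integrable_heat integral_heat heat_nonneg)

lemma nn_integral_lborel_shift:
  fixes h :: "'a::euclidean_space \<Rightarrow> ennreal"
  assumes [measurable]: "h \<in> borel_measurable borel"
  shows "(\<integral>\<^sup>+x. h (x + w) \<partial>lborel) = (\<integral>\<^sup>+x. h x \<partial>lborel)"
proof -
  have "(\<integral>\<^sup>+x. h x \<partial>lborel) = (\<integral>\<^sup>+x. h x \<partial>distr lborel borel ((+) w))" by (simp add: lborel_distr_plus)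
  also have "\<dots> = (\<integral>\<^sup>+x. h (x + w) \<partial>lborel)" by (subst nn_integral_distr) (auto simp: add.commute)
  finally show ?thesis by simp
qed

section \<open>Orthogonality of the characters on the periodicity box\<close>

lemma integral_cis_1d:
  fixes n :: int
  shows "(\<integral>x. indicator {-1..<1::real} x *\<^sub>R cis (pi * of_int n * x) \<partial>lborel) = (if n = 0 then 2 else 0)"
proof -
  have "(\<integral>x. indicator {-1..<1::real} x *\<^sub>R cis (pi * of_int n * x) \<partial>lborel)
      = (\<integral>x. indicator {-1..1::real} x *\<^sub>R cis (pi * of_int n * x) \<partial>lborel)"
    using AE_lborel_singleton[of "1::real"]
    by (intro integral_cong_AE) (auto simp: indicator_def)
  also have "\<dots> = (if n = 0 then 2 else 0)"
  proof (cases "n = 0")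
    case True
    then show ?thesis by (simp add: scaleR_conv_of_real)
  next
    case False
    let ?F = "\<lambda>x. cis (pi * of_int n * x) / (\<i> * of_real (pi * of_int n))"
    have "(\<integral>x. indicator {-1..1::real} x *\<^sub>R cis (pi * of_int n * x) \<partial>lborel) = ?F 1 - ?F (-1)"
    proof (rule integral_FTC_Icc)
      fix x :: real
      have "((\<lambda>x. cis (pi * of_int n * x)) has_vector_derivative (pi * of_int n) *\<^sub>R (\<i> * cis (pi * of_int n * x))) (at x within {-1..1})"
        using exp_scaleR_has_vector_derivative_right[of "\<i> * of_real (pi * of_int n)" x "{-1..1}"]
        by (simp add: cis_conv_exp scaleR_conv_of_real mult_ac)
      then have "(?F has_vector_derivative ((pi * of_int n) *\<^sub>R (\<i> * cis (pi * of_int n * x))) / (\<i> * of_real (pi * of_int n))) (at x within {-1..1})"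
        by (rule has_vector_derivative_divide)
      then show "(?F has_vector_derivative cis (pi * of_int n * x)) (at x within {-1..1})"
        using False by (simp add: scaleR_conv_of_real)
    qed (auto intro!: continuous_intros)
    also have "cis (pi * of_int n * 1) = cis (pi * of_int n * (-1))"
    proof -
      have "sin (pi * of_int n) = 0" by (simp add: sin_zero_iff_int2)
      then show ?thesis by (simp add: complex_eq_iff)
    qed
    finally show ?thesis using False by simp
  qed
  finally show ?thesis .
qed

lemma integral_pbox_cis:
  fixes k :: "'a::euclidean_space"
  assumes k: "k \<in> int_lattice"
  shows "(LINT x:pbox|lborel. cis (pi * (k \<bullet> x))) = (if k = 0 then 2 ^ DIM('a) else 0)"
proof -
  let ?h = "\<lambda>(i::'a) x. indicator {-1..<1::real} x *\<^sub>R cis (pi * (k \<bullet> i) * x)"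
  have "indicator pbox x *\<^sub>R cis (pi * (k \<bullet> x)) = (\<Prod>i\<in>Basis. ?h i (x \<bullet> i))" for x :: 'a
  proof -
    have "(\<Prod>i\<in>Basis. ?h i (x \<bullet> i)) = (\<Prod>i\<in>Basis. of_real (indicator {-1..<1::real} (x \<bullet> i))) * cis (\<Sum>i\<in>Basis. pi * (k \<bullet> i) * (x \<bullet> i))"
      by (simp add: prod.distrib prod_cis scaleR_conv_of_real)
    also have "(\<Prod>i\<in>Basis. complex_of_real (indicator {-1..<1::real} (x \<bullet> i))) = indicator pbox x"
      by (auto simp: indicator_def pbox_def)
    also have "(\<Sum>i\<in>Basis. pi * (k \<bullet> i) * (x \<bullet> i)) = pi * (k \<bullet> x)"
      by (subst euclidean_inner[of k x]) (simp add: sum_distrib_left mult.assoc)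
    finally show ?thesis by (simp add: indicator_def)
  qed
  then have "(LINT x:pbox|lborel. cis (pi * (k \<bullet> x))) = (\<integral>x. (\<Prod>i\<in>Basis. ?h i (x \<bullet> i)) \<partial>lborel)"
    by (simp add: set_lebesgue_integral_def)
  also have "\<dots> = (\<Prod>i\<in>Basis. \<integral>x. ?h i x \<partial>lborel)"
  proof (rule integral_lborel_prod)
    fix i :: 'a
    show "integrable lborel (?h i)"
      by (rule Bochner_Integration.integrable_bound[of _ "indicator {-1..<1::real} :: real \<Rightarrow> real"]) (auto simp: indicator_def)
  qed
  also have "\<dots> = (\<Prod>i\<in>Basis. if k \<bullet> i = 0 then 2 else 0)"
  proof (rule prod.cong[OF refl])
    fix i :: 'a assume "i \<in> Basis"
    then have "k \<bullet> i \<in> \<int>" using k by (auto simp: int_lattice_def)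
    then obtain n where n: "k \<bullet> i = of_int n" by (auto elim: Ints_cases)
    show "(\<integral>x. ?h i x \<partial>lborel) = (if k \<bullet> i = 0 then 2 else 0)" unfolding n integral_cis_1d by simp
  qed
  also have "\<dots> = (if k = 0 then 2 ^ DIM('a) else 0)"
  proof (cases "k = 0")
    case False
    then obtain i where "i \<in> Basis" "k \<bullet> i \<noteq> 0" using euclidean_all_zero_iff by blast
    then show ?thesis using False by (auto intro!: prod_zero)
  qed simp
  finally show ?thesis .
qed

lemma norm_sq_triangle: "(norm (a + b :: 'a::real_inner))\<^sup>2 \<le> 2 * (norm a)\<^sup>2 + 2 * (norm b)\<^sup>2"
proof -
  have "(norm (a + b))\<^sup>2 \<le> (norm a + norm b)\<^sup>2" by (intro power_mono norm_triangle_ineq) auto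
  also have "\<dots> \<le> 2 * (norm a)\<^sup>2 + 2 * (norm b)\<^sup>2" by (smt (verit) sum_squares_bound power2_sum)
  finally show ?thesis .
qed

text \<open>Comparison of the sum with the integral of a wider Gaussian over unit cells.\<close>

lemma lattice_gauss_bound:
  fixes b :: real
  assumes b: "b > 0"
  obtains C where "C \<ge> 0"
    "\<And>w::'a::euclidean_space. (\<integral>\<^sup>+j. exp (-(b * (norm (w - j))\<^sup>2)) \<partial>count_space int_lattice) \<le> ennreal C"
proof -
  let ?g = "\<lambda>x::'a. ennreal (exp (-(b / 2 * (norm x)\<^sup>2)))"
  \<comment> \<open>The time at which the exponent of \<open>heat t\<close> is b/2 times the squared
    norm, so that the integral of the wider Gaussian is known.\<close>
  define t where "t = pi\<^sup>2 / (2 * b)"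
  have t: "t > 0" using b by (simp add: t_def)
  define A where "A = (4 * t / pi) powr (real DIM('a) / 2)"
  have g: "?g x = ennreal A * heat t x" for x
    using t b by (simp add: A_def heat_def ennreal_mult[symmetric] powr_minus t_def)
  have I: "(\<integral>\<^sup>+x. ?g x \<partial>lborel) = A"
    unfolding g using t by (subst nn_integral_cmult) (auto simp: nn_integral_heat)
  \<comment> \<open>A point of a unit cell has distance at most n from the corner j. Hence |x-w|^2
    is at most 2 n^2 + 2 |w-j|^2, which costs half of b and the factor
    \<open>exp (b * n\<^sup>2)\<close>.\<close>
  define n where "n = real DIM('a)"
  define C where "C = exp (b * n\<^sup>2) * A"
  have "(\<integral>\<^sup>+j. exp (-(b * (norm (w - j))\<^sup>2)) \<partial>count_space int_lattice) \<le> ennreal C" for w :: 'a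
  proof -
    have "(\<integral>\<^sup>+j. exp (-(b * (norm (w - j))\<^sup>2)) \<partial>count_space int_lattice)
       \<le> (\<integral>\<^sup>+j. ennreal (exp (b * n\<^sup>2)) * (\<integral>\<^sup>+x. ?g (x - w) * indicator (cell 0 1 j) x \<partial>lborel) \<partial>count_space int_lattice)"
    proof (rule nn_integral_mono)
      fix j :: 'a assume "j \<in> space (count_space int_lattice)"
      have sub: "box j (j + One) \<subseteq> cell 0 1 j"
        by (auto simp: cell_def mem_box inner_add_left less_imp_le)
      have "ennreal (exp (-(b * (norm (w - j))\<^sup>2) - b * n\<^sup>2)) = ennreal (exp (-(b * (norm (w - j))\<^sup>2) - b * n\<^sup>2)) * emeasure lborel (box j (j + One))"
        by (subst emeasure_lborel_box) (auto simp: inner_add_left)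
      also have "\<dots> = (\<integral>\<^sup>+x. ennreal (exp (-(b * (norm (w - j))\<^sup>2) - b * n\<^sup>2)) * indicator (box j (j + One)) x \<partial>lborel)"
        by (subst nn_integral_cmult_indicator) auto
      also have "\<dots> \<le> (\<integral>\<^sup>+x. ?g (x - w) * indicator (cell 0 1 j) x \<partial>lborel)"
      proof (rule nn_integral_mono)
        fix x
        show "ennreal (exp (-(b * (norm (w - j))\<^sup>2) - b * n\<^sup>2)) * indicator (box j (j + One)) x \<le> ?g (x - w) * indicator (cell 0 1 j) x"
        proof (cases "x \<in> box j (j + One)")
          case True
          then have x: "x \<in> cell 0 1 j" using sub by auto
          then have "norm (x - j) \<le> n"
            using cell_subset_ball[of 0 1 j] by (force simp: dist_norm norm_minus_commute n_def)
          then have "(norm (x - j))\<^sup>2 \<le> n\<^sup>2" by (intro power_mono) auto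
          moreover have "(norm (x - w))\<^sup>2 \<le> 2 * (norm (x - j))\<^sup>2 + 2 * (norm (w - j))\<^sup>2"
            using norm_sq_triangle[of "x - j" "j - w"] by (simp add: norm_minus_commute)
          ultimately have "(norm (x - w))\<^sup>2 \<le> 2 * n\<^sup>2 + 2 * (norm (w - j))\<^sup>2" by linarith
          then have "b / 2 * (norm (x - w))\<^sup>2 \<le> b / 2 * (2 * n\<^sup>2 + 2 * (norm (w - j))\<^sup>2)"
            using b by (intro mult_left_mono) auto
          then have "- (b * (norm (w - j))\<^sup>2) - b * n\<^sup>2 \<le> -(b / 2 * (norm (x - w))\<^sup>2)"
            by (simp add: algebra_simps)
          then show ?thesis using x True by (auto intro!: ennreal_leI)
        qed simp
      qed
      finally have "ennreal (exp (b * n\<^sup>2)) * ennreal (exp (-(b * (norm (w - j))\<^sup>2) - b * n\<^sup>2))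
        \<le> ennreal (exp (b * n\<^sup>2)) * (\<integral>\<^sup>+x. ?g (x - w) * indicator (cell 0 1 j) x \<partial>lborel)"
        by (intro mult_left_mono) auto
      then show "ennreal (exp (-(b * (norm (w - j))\<^sup>2)))
        \<le> ennreal (exp (b * n\<^sup>2)) * (\<integral>\<^sup>+x. ?g (x - w) * indicator (cell 0 1 j) x \<partial>lborel)"
        by (simp add: ennreal_mult[symmetric] exp_add[symmetric])
    qed
    also have "\<dots> = ennreal (exp (b * n\<^sup>2)) * (\<integral>\<^sup>+j. (\<integral>\<^sup>+x. ?g (x - w) * indicator (cell 0 1 j) x \<partial>lborel) \<partial>count_space int_lattice)"
      by (rule nn_integral_cmult) simp
    also have "(\<integral>\<^sup>+j. (\<integral>\<^sup>+x. ?g (x - w) * indicator (cell 0 1 j) x \<partial>lborel) \<partial>count_space int_lattice)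
       = (\<integral>\<^sup>+x. ?g (x - w) \<partial>lborel)"
      by (rule nn_integral_cells[symmetric]) auto
    also have "\<dots> = A" using nn_integral_lborel_shift[of ?g "-w"] I by simp
    finally show ?thesis by (simp add: C_def ennreal_mult A_def)
  qed
  moreover have "C \<ge> 0" by (simp add: C_def A_def)
  ultimately show thesis using that by blast
qed

text \<open>At the length scale \<open>sqrt t\<close> the Gaussian is essentially constant on grid
  cells, and each cell has mass at most a multiple of \<open>sqrt t ^ (DIM('a) - 1)\<close>. After
  rescaling, what remains is a Gaussian sum over the integer lattice, bounded uniformly in its
  centre and hence in x and t.\<close>

lemma heat_estimate:
  fixes M :: "'a::euclidean_space measure" and a :: real
  assumes M: "sets M = sets borel" and a: "a > 0" and K: "K \<ge> 0"
    and ball: "\<And>z r. 0 < r \<Longrightarrow> r \<le> 1 \<Longrightarrow> emeasure M (ball z r) \<le> ennreal (K * r ^ (DIM('a) - 1))"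
  obtains C where "C \<ge> 0"
    "\<And>x t. 0 < t \<Longrightarrow> t \<le> 1 \<Longrightarrow> (\<integral>\<^sup>+y. exp (-(a * (norm (x - y))\<^sup>2 / t)) \<partial>M) \<le> ennreal (C * sqrt t ^ (DIM('a) - 1))"
proof -
  note [measurable_cong] = M
  define n where "n = real DIM('a)"
  have n: "n > 0" by (simp add: n_def)
  \<comment> \<open>On a cell, |x - \<rho> j|^2 is at most 2 |x-y|^2 + 2 t. Multiplying by a/(2t)
    and inserting \<rho>^2 = t/n^2 leaves the coefficient a/(2 n^2), and the term 2 t turns into the
    factor \<open>exp a\<close>.\<close>
  define b where "b = a / (2 * n\<^sup>2)"
  have b: "b > 0" using a n by (simp add: b_def)
  obtain C0 where C0: "C0 \<ge> 0"
    "\<And>w::'a. (\<integral>\<^sup>+j. exp (-(b * (norm (w - j))\<^sup>2)) \<partial>count_space int_lattice) \<le> ennreal C0"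
    using lattice_gauss_bound[OF b] by metis
  define C where "C = C0 * exp a * K"
  have "(\<integral>\<^sup>+y. exp (-(a * (norm (x - y))\<^sup>2 / t)) \<partial>M) \<le> ennreal (C * sqrt t ^ (DIM('a) - 1))"
    if t: "0 < t" "t \<le> 1" for x t
  proof -
    \<comment> \<open>A cell of side \<rho> lies in the ball of radius \<rho> n round its corner;
      this side makes that radius \<open>sqrt t\<close>.\<close>
    define \<rho> where "\<rho> = sqrt t / n"
    have \<rho>: "\<rho> > 0" using t n by (simp add: \<rho>_def)
    have \<rho>2: "\<rho>\<^sup>2 = t / n\<^sup>2" using t by (simp add: \<rho>_def power_divide)
    let ?h = "\<lambda>y. ennreal (exp (-(a * (norm (x - y))\<^sup>2 / t)))"
    let ?w = "(1 / \<rho>) *\<^sub>R x"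
    let ?D = "ennreal (exp a) * ennreal (K * sqrt t ^ (DIM('a) - 1))"
    have "(\<integral>\<^sup>+y. ?h y \<partial>M) = (\<integral>\<^sup>+j. (\<integral>\<^sup>+y. ?h y * indicator (cell 0 \<rho> j) y \<partial>M) \<partial>count_space int_lattice)"
      by (rule nn_integral_cells[OF \<rho> M]) measurable
    also have "\<dots> \<le> (\<integral>\<^sup>+j. ?D * exp (-(b * (norm (?w - j))\<^sup>2)) \<partial>count_space int_lattice)"
    proof (rule nn_integral_mono)
      fix j :: 'a
      have sub: "cell 0 \<rho> j \<subseteq> ball (\<rho> *\<^sub>R j) (sqrt t)"
        using cell_subset_ball[of 0 \<rho> j] n by (simp add: \<rho>_def n_def)
      let ?e = "ennreal (exp a) * exp (-(b * (norm (?w - j))\<^sup>2))"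
      have "(\<integral>\<^sup>+y. ?h y * indicator (cell 0 \<rho> j) y \<partial>M) \<le> (\<integral>\<^sup>+y. ?e * indicator (ball (\<rho> *\<^sub>R j) (sqrt t)) y \<partial>M)"
      proof (rule nn_integral_mono)
        fix y
        show "?h y * indicator (cell 0 \<rho> j) y \<le> ?e * indicator (ball (\<rho> *\<^sub>R j) (sqrt t)) y"
        proof (cases "y \<in> cell 0 \<rho> j")
          case True
          then have y: "y \<in> ball (\<rho> *\<^sub>R j) (sqrt t)" using sub by auto
          then have "(norm (\<rho> *\<^sub>R j - y))\<^sup>2 \<le> (sqrt t)\<^sup>2" by (intro power_mono) (auto simp: dist_norm)
          then have 1: "(norm (y - \<rho> *\<^sub>R j))\<^sup>2 \<le> t" using t by (simp add: norm_minus_commute)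
          have 2: "(norm (x - \<rho> *\<^sub>R j))\<^sup>2 \<le> 2 * (norm (x - y))\<^sup>2 + 2 * (norm (y - \<rho> *\<^sub>R j))\<^sup>2"
            using norm_sq_triangle[of "x - y" "y - \<rho> *\<^sub>R j"] by simp
          have "x - \<rho> *\<^sub>R j = \<rho> *\<^sub>R (?w - j)" using \<rho> by (simp add: scaleR_right_diff_distrib)
          then have 3: "(norm (x - \<rho> *\<^sub>R j))\<^sup>2 = t / n\<^sup>2 * (norm (?w - j))\<^sup>2"
            by (simp add: power_mult_distrib \<rho>2)
          have "t / n\<^sup>2 * (norm (?w - j))\<^sup>2 \<le> 2 * (norm (x - y))\<^sup>2 + 2 * t" using 1 2 3 by linarith
          then have "a / (2 * t) * (t / n\<^sup>2 * (norm (?w - j))\<^sup>2) \<le> a / (2 * t) * (2 * (norm (x - y))\<^sup>2 + 2 * t)"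
            using a t by (intro mult_left_mono) auto
          then have "b * (norm (?w - j))\<^sup>2 \<le> a * (norm (x - y))\<^sup>2 / t + a"
            using t n by (simp add: b_def field_simps)
          then have "-(a * (norm (x - y))\<^sup>2 / t) \<le> a + -(b * (norm (?w - j))\<^sup>2)" by linarith
          then have "exp (-(a * (norm (x - y))\<^sup>2 / t)) \<le> exp a * exp (-(b * (norm (?w - j))\<^sup>2))"
            by (simp only: exp_add[symmetric] exp_le_cancel_iff)
          then show ?thesis using True y by (simp add: ennreal_mult[symmetric] ennreal_leI)
        qed simp
      qed
      also have "\<dots> = ?e * emeasure M (ball (\<rho> *\<^sub>R j) (sqrt t))"
        by (subst nn_integral_cmult_indicator) (auto simp: M)
      also have "\<dots> \<le> ?e * ennreal (K * sqrt t ^ (DIM('a) - 1))"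
        using t by (intro mult_left_mono ball) auto
      finally show "(\<integral>\<^sup>+y. ?h y * indicator (cell 0 \<rho> j) y \<partial>M) \<le> ?D * exp (-(b * (norm (?w - j))\<^sup>2))"
        by (simp add: mult_ac)
    qed
    also have "\<dots> = ?D * (\<integral>\<^sup>+j. exp (-(b * (norm (?w - j))\<^sup>2)) \<partial>count_space int_lattice)"
      by (rule nn_integral_cmult) simp
    also have "\<dots> \<le> ?D * ennreal C0" by (intro mult_left_mono C0) auto
    also have "\<dots> = ennreal (C * sqrt t ^ (DIM('a) - 1))"
      using K C0(1) t by (simp add: C_def ennreal_mult[symmetric] mult_ac)
    finally show ?thesis .
  qed
  moreover have "C \<ge> 0" using C0 K by (simp add: C_def)
  ultimately show thesis using that by blast
qed

text \<open>Split at t = A. Below, exp(-A/t) is at most t/A, which raises the exponent to p + 1 >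
  -1; above, the exponential is at most 1 and p < -1 makes the tail converge. Both pieces scale like
  \<open>A powr (p + 1)\<close>.\<close>

lemma nn_integral_powr_exp_bound:
  fixes p A :: real
  assumes A: "A > 0" and p: "-2 < p" "p < -1"
  shows "(\<integral>\<^sup>+t. ennreal (indicator {0<..} t * (t powr p * exp (-(A / t)))) \<partial>lborel)
     \<le> ennreal ((1 / (p + 2) - 1 / (p + 1)) * A powr (p + 1))"
proof -
  have i1: "((\<lambda>t. t powr (p + 1)) has_integral (A powr (p + 2) / (p + 2))) {0..A}"
    using has_integral_powr_from_0[of "p + 1" A] p A by (simp add: add.commute)
  have i2: "((\<lambda>t. t powr p) has_integral -(A powr (p + 1)) / (p + 1)) {A..}"
    using has_integral_powr_to_inf[of p A] p A by simp
  have "(\<integral>\<^sup>+t. ennreal (indicator {0<..} t * (t powr p * exp (-(A / t)))) \<partial>lborel)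
     \<le> (\<integral>\<^sup>+t. ennreal (1 / A) * (ennreal (t powr (p + 1)) * indicator {0..A} t) + ennreal (t powr p) * indicator {A..} t \<partial>lborel)"
  proof (rule nn_integral_mono)
    fix t :: real
    show "ennreal (indicator {0<..} t * (t powr p * exp (-(A / t))))
       \<le> ennreal (1 / A) * (ennreal (t powr (p + 1)) * indicator {0..A} t) + ennreal (t powr p) * indicator {A..} t"
    proof (cases "t > 0")
      case t: True
      show ?thesis
      proof (cases "t \<le> A")
        case True
        have "A / t \<le> exp (A / t)" using exp_ge_add_one_self[of "A / t"] by linarith
        then have "exp (-(A / t)) \<le> t / A" using t A by (simp add: exp_minus field_simps)
        then have "t powr p * exp (-(A / t)) \<le> t powr p * (t / A)" by (intro mult_left_mono) auto
        also have "\<dots> = 1 / A * t powr (p + 1)" using t by (simp add: powr_add)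
        finally have "ennreal (t powr p * exp (-(A / t))) \<le> ennreal (1 / A) * ennreal (t powr (p + 1))"
          using A by (simp add: ennreal_mult[symmetric] ennreal_leI)
        also have "\<dots> \<le> ennreal (1 / A) * (ennreal (t powr (p + 1)) * indicator {0..A} t) + ennreal (t powr p) * indicator {A..} t"
          using True t by simp
        finally show ?thesis using t by simp
      next
        case False
        then have "t powr p * exp (-(A / t)) \<le> t powr p * 1" using t A by (intro mult_left_mono) auto
        then show ?thesis using t False by (auto intro: ennreal_leI)
      qed
    qed simp
  qed
  also have "\<dots> = ennreal (1 / A) * ennreal (A powr (p + 2) / (p + 2)) + ennreal (-(A powr (p + 1)) / (p + 1))"
    using nn_integral_has_integral_lebesgue'[OF _ i1] nn_integral_has_integral_lebesgue'[OF _ i2]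
    by (subst nn_integral_add) (auto simp: nn_integral_cmult)
  also have "\<dots> = ennreal ((1 / (p + 2) - 1 / (p + 1)) * A powr (p + 1))"
  proof -
    have "A powr (p + 2) = A * A powr (p + 1)" using A powr_add[of A 1 "p + 1"] by (simp add: add.commute)
    moreover have "-(A powr (p + 1)) / (p + 1) \<ge> 0" using p by (simp add: divide_nonneg_neg)
    ultimately show ?thesis using A p
      by (simp add: ennreal_mult[symmetric] ennreal_plus[symmetric] left_diff_distrib del: ennreal_plus)
  qed
  finally show ?thesis .
qed

text \<open>Euler's integral after the substitution of l t for t. With s = \<epsilon>/2 and l =
  |k|^2 the right-hand side is the symbol |k|^(-\<epsilon>), so this identity is the source of the
  mixture of heat kernels.\<close>

lemma nn_integral_Gamma_scaled:
  fixes s l :: real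
  assumes s: "s > 0" and l: "l > 0"
  shows "(\<integral>\<^sup>+t. ennreal (indicator {0<..} t * (t powr (s - 1) / Gamma s * exp (-(t * l)))) \<partial>lborel) = ennreal (l powr (- s))"
proof -
  have G: "Gamma s > 0" using s by (rule Gamma_real_pos)
  let ?f = "\<lambda>t. ennreal (indicator {0..} t * t powr (s - 1) / exp t)"
  let ?I = "(\<integral>\<^sup>+t. ennreal (indicator {0<..} t * (t powr (s - 1) / Gamma s * exp (-(t * l)))) \<partial>lborel)"
  have "ennreal (Gamma s) = (\<integral>\<^sup>+t. ?f t \<partial>lborel)" using s by (rule Gamma_conv_nn_integral_real)
  also have "\<dots> = \<bar>l\<bar> * (\<integral>\<^sup>+t. ?f (0 + l * t) \<partial>lborel)"
    using l by (intro nn_integral_real_affine) auto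
  also have "(\<integral>\<^sup>+t. ?f (0 + l * t) \<partial>lborel) = (\<integral>\<^sup>+t. ennreal (l powr (s - 1) * Gamma s) * ennreal (indicator {0<..} t * (t powr (s - 1) / Gamma s * exp (-(t * l)))) \<partial>lborel)"
  proof (rule nn_integral_cong)
    fix t :: real
    have "indicator {0..} (l * t) * (l * t) powr (s - 1) / exp (l * t) = l powr (s - 1) * Gamma s * (indicator {0<..} t * (t powr (s - 1) / Gamma s * exp (-(t * l))))"
      using l G by (cases "t > 0"; cases "t = 0")
        (auto simp: powr_mult exp_minus field_simps indicator_def zero_le_mult_iff)
    then show "?f (0 + l * t) = ennreal (l powr (s - 1) * Gamma s) * ennreal (indicator {0<..} t * (t powr (s - 1) / Gamma s * exp (-(t * l))))"
      using G by (simp add: ennreal_mult[symmetric])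
  qed
  also have "\<dots> = ennreal (l powr (s - 1) * Gamma s) * ?I" by (rule nn_integral_cmult) measurable
  finally have "ennreal (Gamma s) = ennreal (l powr s * Gamma s) * ?I"
    using l G by (simp add: mult.assoc[symmetric] ennreal_mult[symmetric] powr_diff)
  then have "ennreal (1 / (l powr s * Gamma s)) * ennreal (Gamma s) = ennreal (1 / (l powr s * Gamma s)) * ennreal (l powr s * Gamma s) * ?I"
    by (simp add: mult.assoc)
  then show ?thesis using G l by (simp add: ennreal_mult[symmetric] powr_minus field_simps)
qed

section \<open>The fractional inverse gradient of a regular measure\<close>

lemma isCont_integral_dominated:
  fixes F :: "'x::metric_space \<Rightarrow> 'b \<Rightarrow> real"
  assumes \<delta>: "\<delta> > 0" and F [measurable]: "\<And>x. F x \<in> borel_measurable M" and w: "integrable M w"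
    and dom: "\<And>x. dist x x0 < \<delta> \<Longrightarrow> AE p in M. \<bar>F x p\<bar> \<le> w p"
    and cont: "AE p in M. isCont (\<lambda>x. F x p) x0"
  shows "isCont (\<lambda>x. \<integral>p. F x p \<partial>M) x0"
proof -
  have "(\<lambda>n. \<integral>p. F (s n) p \<partial>M) \<longlonglongrightarrow> (\<integral>p. F x0 p \<partial>M)" if s: "s \<longlonglongrightarrow> x0" for s
  proof -
    \<comment> \<open>Terms outside the ball are replaced by \<open>x0\<close>, so that the
      domination holds for every index and not only eventually.\<close>
    define s' where "s' n = (if dist (s n) x0 < \<delta> then s n else x0)" for n
    have ev: "\<forall>\<^sub>F n in sequentially. s' n = s n"
      using tendstoD[OF s \<delta>] by eventually_elim (simp add: s'_def)
    have s': "s' \<longlonglongrightarrow> x0"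
      by (rule Lim_transform_eventually[OF s]) (use ev in eventually_elim, simp)
    have d: "dist (s' n) x0 < \<delta>" for n using \<delta> by (simp add: s'_def)
    have "(\<lambda>n. \<integral>p. F (s' n) p \<partial>M) \<longlonglongrightarrow> (\<integral>p. F x0 p \<partial>M)"
    proof (rule integral_dominated_convergence[where w=w])
      show "AE p in M. (\<lambda>n. F (s' n) p) \<longlonglongrightarrow> F x0 p"
        using cont by eventually_elim (rule isCont_tendsto_compose[OF _ s'])
      show "AE p in M. norm (F (s' n) p) \<le> w p" for n using dom[OF d] by simp
    qed (use w in auto)
    then show ?thesis
      by (rule Lim_transform_eventually) (use ev in eventually_elim, simp)
  qed
  then show ?thesis by (simp add: continuous_at_sequentially comp_def)
qed

lemma int_lattice_norm_less_one:
  fixes k :: "'a::euclidean_space"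
  assumes k: "k \<in> int_lattice" and n: "norm k < 1"
  shows "k = 0"
proof (rule euclidean_eqI)
  fix i :: 'a assume i: "i \<in> Basis"
  have "k \<bullet> i \<in> \<int>" using k i by (auto simp: int_lattice_def)
  then obtain m :: int where m: "k \<bullet> i = of_int m" by (auto elim: Ints_cases)
  have "\<bar>k \<bullet> i\<bar> < 1" using Basis_le_norm[OF i, of k] n by linarith
  then show "k \<bullet> i = 0 \<bullet> i" using m by simp
qed

lemma inner_int_lattice:
  fixes k m :: "'a::euclidean_space"
  assumes "k \<in> int_lattice" "m \<in> int_lattice"
  shows "k \<bullet> m \<in> \<int>"
  using assms by (subst euclidean_inner) (auto simp: int_lattice_def intro!: Ints_sum Ints_mult)

lemma cis_lattice_period:
  fixes k m :: "'a::euclidean_space"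
  assumes "k \<in> int_lattice" "m \<in> int_lattice"
  shows "cis (-(pi * (k \<bullet> (x + 2 *\<^sub>R m)))) = cis (-(pi * (k \<bullet> x)))"
proof -
  obtain n :: int where n: "k \<bullet> m = of_int n" using inner_int_lattice[OF assms] by (auto elim: Ints_cases)
  have "cis (-(pi * (k \<bullet> (x + 2 *\<^sub>R m)))) = cis (-(pi * (k \<bullet> x))) * cis (2 * pi * of_int (- n))"
    by (simp add: cis_mult inner_add_right n algebra_simps)
  also have "cis (2 * pi * of_int (- n)) = 1" by (rule cis_multiple_2pi) simp
  finally show ?thesis by simp
qed

lemma measurable_torus_borel:
  "f \<in> borel \<rightarrow>\<^sub>M N \<Longrightarrow> sets \<mu> = sets torus_borel \<Longrightarrow> f \<in> \<mu> \<rightarrow>\<^sub>M N"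
  by (simp add: torus_borel_def measurable_restrict_space1 cong: measurable_cong_sets)

text \<open>Two period translates of a point that lie in one ball of radius at most 1 have distance
  less than 2, whereas distinct translates are at least 2 apart. So each point is counted at most
  once.\<close>

lemma emeasure_periodization_ball:
  fixes \<mu> :: "'a::euclidean_space measure"
  assumes sf: "sigma_finite_measure \<mu>" and s [measurable_cong]: "sets \<mu> = sets torus_borel" and r: "r \<le> 1"
  shows "emeasure (periodization \<mu>) (ball z r) = emeasure \<mu> (pbox \<inter> pext (ball z r))"
proof -
  have sp: "space \<mu> = pbox" using sets_eq_imp_space_eq[OF s] by simp
  have one: "(\<integral>\<^sup>+m. indicator (ball z r) (y + 2 *\<^sub>R m) \<partial>count_space int_lattice) = indicator (pext (ball z r)) y" for y
  proof (cases "y \<in> pext (ball z r)")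
    case True
    then obtain m where m: "m \<in> int_lattice" "y + 2 *\<^sub>R m \<in> ball z r" by (auto simp: mem_pext)
    have u: "j = m" if j: "j \<in> int_lattice" "y + 2 *\<^sub>R j \<in> ball z r" for j
    proof -
      have "dist (y + 2 *\<^sub>R j) (y + 2 *\<^sub>R m) < 2"
        using m(2) j(2) r dist_triangle3[of "y + 2 *\<^sub>R j" "y + 2 *\<^sub>R m" z]
        unfolding mem_ball by linarith
      also have "dist (y + 2 *\<^sub>R j) (y + 2 *\<^sub>R m) = 2 * norm (j - m)"
        by (simp add: dist_norm flip: scaleR_right_diff_distrib)
      finally show ?thesis
        using int_lattice_norm_less_one[OF int_lattice_diff[OF j(1) m(1)]] by simp
    qed
    have "(\<integral>\<^sup>+j. indicator (ball z r) (y + 2 *\<^sub>R j) \<partial>count_space int_lattice) = (\<integral>\<^sup>+j. indicator {m} j \<partial>count_space int_lattice)"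
    proof (rule nn_integral_cong)
      fix j assume j: "j \<in> space (count_space (int_lattice :: 'a set))"
      show "indicator (ball z r) (y + 2 *\<^sub>R j) = (indicator {m} j :: ennreal)"
      proof (cases "j = m")
        case False
        then have "y + 2 *\<^sub>R j \<notin> ball z r" using u j by auto
        then show ?thesis using False by simp
      qed (use m in simp)
    qed
    then show ?thesis using True m by simp
  next
    case False
    then have "(\<integral>\<^sup>+j. indicator (ball z r) (y + 2 *\<^sub>R j) \<partial>count_space int_lattice) = (\<integral>\<^sup>+j. 0 \<partial>count_space (int_lattice :: 'a set))"
      by (intro nn_integral_cong) (auto simp: mem_pext indicator_def)
    then show ?thesis using False by simp
  qed
  have "emeasure (periodization \<mu>) (ball z r) = (\<integral>\<^sup>+y. indicator (ball z r) y \<partial>periodization \<mu>)" by simp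
  also have "\<dots> = (\<integral>\<^sup>+m. \<integral>\<^sup>+y. indicator (ball z r) (y + 2 *\<^sub>R m) \<partial>\<mu> \<partial>count_space int_lattice)"
    by (rule nn_integral_periodization[OF sf s]) (intro borel_measurable_indicator, simp)
  also have "\<dots> = (\<integral>\<^sup>+y. \<integral>\<^sup>+m. indicator (ball z r) (y + 2 *\<^sub>R m) \<partial>count_space int_lattice \<partial>\<mu>)"
    by (rule nn_integral_count_space_nn_integral[symmetric, OF countable_int_lattice]) (rule measurable_torus_borel[OF _ s], rule measurable_compose[where N=borel and g="indicator (ball z r)"], auto intro!: borel_measurable_indicator)
  also have "\<dots> = (\<integral>\<^sup>+y. indicator (pbox \<inter> pext (ball z r)) y \<partial>\<mu>)"
    unfolding one by (intro nn_integral_cong) (simp add: sp indicator_def)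
  also have "\<dots> = emeasure \<mu> (pbox \<inter> pext (ball z r))"
    by (intro nn_integral_indicator) (simp add: s sets_torus_borel)
  finally show ?thesis .
qed

text \<open>
  The measure with density $t^{\varepsilon/2-1}/\Gamma(\varepsilon/2)$ on $(0,1)$. Mixing the heat
  kernels with it gives the singular part of the kernel of $|\nabla|^{-\varepsilon}$; the
  rest of the mixture, over $t\ge 1$, has rapidly decaying Fourier coefficients.
\<close>

definition gamma_mix :: "real \<Rightarrow> real measure" where
  "gamma_mix \<epsilon> = density lborel (\<lambda>t. ennreal (indicator {0<..<1} t * (t powr (\<epsilon> / 2 - 1) / Gamma (\<epsilon> / 2))))"

lemma sets_gamma_mix [simp, measurable_cong]: "sets (gamma_mix \<epsilon>) = sets borel"
  by (simp add: gamma_mix_def)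

lemma space_gamma_mix [simp]: "space (gamma_mix \<epsilon>) = UNIV"
  by (simp add: gamma_mix_def)

lemma AE_gamma_mix: "AE t in gamma_mix \<epsilon>. 0 < t \<and> t < 1"
  unfolding gamma_mix_def by (subst AE_density) (auto simp: indicator_def)

lemma nn_integral_gamma_mix:
  assumes "\<epsilon> > 0" and [measurable]: "h \<in> borel_measurable borel"
  shows "(\<integral>\<^sup>+t. h t \<partial>gamma_mix \<epsilon>) = (\<integral>\<^sup>+t. ennreal (indicator {0<..<1} t * (t powr (\<epsilon> / 2 - 1) / Gamma (\<epsilon> / 2))) * h t \<partial>lborel)"
  unfolding gamma_mix_def by (rule nn_integral_density) measurable

lemma finite_measure_gamma_mix:
  assumes e: "\<epsilon> > 0"
  shows "finite_measure (gamma_mix \<epsilon>)"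
proof
  have G: "Gamma (\<epsilon> / 2) > 0" using e by (intro Gamma_real_pos) simp
  have "emeasure (gamma_mix \<epsilon>) (space (gamma_mix \<epsilon>)) = (\<integral>\<^sup>+t. 1 \<partial>gamma_mix \<epsilon>)" by simp
  also have "\<dots> = (\<integral>\<^sup>+t. ennreal (indicator {0<..<1} t * (t powr (\<epsilon> / 2 - 1) / Gamma (\<epsilon> / 2))) * 1 \<partial>lborel)"
    by (rule nn_integral_gamma_mix[OF e]) simp
  \<comment> \<open>On (0,1) the factor \<open>exp (1 - t)\<close> is at least 1; inserting it
    compares the weight with a multiple of the Gamma integrand.\<close>
  also have "\<dots> \<le> (\<integral>\<^sup>+t. ennreal (exp 1) * ennreal (indicator {0<..} t * (t powr (\<epsilon> / 2 - 1) / Gamma (\<epsilon> / 2) * exp (-(t * 1)))) \<partial>lborel)"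
  proof (rule nn_integral_mono)
    fix t :: real
    have "t powr (\<epsilon> / 2 - 1) / Gamma (\<epsilon> / 2) * 1 \<le> t powr (\<epsilon> / 2 - 1) / Gamma (\<epsilon> / 2) * exp (1 - t)" if "t < 1"
      using that G by (intro mult_left_mono) auto
    moreover have "exp (1 - t) = exp 1 * exp (- t)" by (simp flip: exp_add)
    ultimately show "ennreal (indicator {0<..<1} t * (t powr (\<epsilon> / 2 - 1) / Gamma (\<epsilon> / 2))) * 1 \<le>
       ennreal (exp 1) * ennreal (indicator {0<..} t * (t powr (\<epsilon> / 2 - 1) / Gamma (\<epsilon> / 2) * exp (-(t * 1))))"
      using G by (cases "0 < t \<and> t < 1") (auto simp: ennreal_mult[symmetric] indicator_def mult_ac intro!: ennreal_leI)
  qed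
  also have "\<dots> = ennreal (exp 1) * ennreal (1 powr (-(\<epsilon> / 2)))"
    using e by (subst nn_integral_cmult, measurable) (subst nn_integral_Gamma_scaled, simp_all)
  finally show "emeasure (gamma_mix \<epsilon>) (space (gamma_mix \<epsilon>)) \<noteq> \<infinity>"
    by (auto simp: top_unique)
qed

definition mix_coeff :: "real \<Rightarrow> 'a::euclidean_space \<Rightarrow> real" where
  "mix_coeff \<epsilon> k = (\<integral>t. exp (-(t * (norm k)\<^sup>2)) \<partial>gamma_mix \<epsilon>)"

text \<open>For k different from 0 this is the contribution of the times t \<ge> 1. At k = 0 it is
  minus the total mass of the mixture: the heat kernels preserve the mean, whereas the operator
  removes it.\<close>

definition rest_coeff :: "real \<Rightarrow> 'a::euclidean_space \<Rightarrow> real" where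
  "rest_coeff \<epsilon> k = (if k = 0 then 0 else norm k powr (-\<epsilon>)) - mix_coeff \<epsilon> k"

lemma integrable_gamma_mix_exp:
  assumes e: "\<epsilon> > 0"
  shows "integrable (gamma_mix \<epsilon>) (\<lambda>t. exp (-(t * (norm k)\<^sup>2)))"
proof -
  interpret finite_measure "gamma_mix \<epsilon>" by (rule finite_measure_gamma_mix[OF e])
  show ?thesis
  proof (rule integrable_const_bound[where B=1])
    show "AE t in gamma_mix \<epsilon>. norm (exp (-(t * (norm k)\<^sup>2))) \<le> 1"
      using AE_gamma_mix by eventually_elim simp
  qed simp
qed

lemma mix_coeff_nonneg: "0 \<le> mix_coeff \<epsilon> k"
  unfolding mix_coeff_def by (intro integral_nonneg_AE) simp

lemma rest_coeff_uminus [simp]: "rest_coeff \<epsilon> (- k) = rest_coeff \<epsilon> k"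
  by (simp add: rest_coeff_def mix_coeff_def)

text \<open>For t \<ge> 1 and l = |k|^2 \<ge> 1 one has t l \<ge> l/2 + t/2. The first term gives
  the Gaussian decay in k; the second leaves a convergent Gamma integral at 1/2, which is the second
  summand of B. The first summand of B covers k = 0.\<close>

lemma rest_coeff_bound:
  assumes e: "\<epsilon> > 0"
  obtains B where "B \<ge> 0"
    "\<And>k::'a::euclidean_space. k \<in> int_lattice \<Longrightarrow> \<bar>rest_coeff \<epsilon> k\<bar> \<le> B * exp (-(1 / 2 * (norm k)\<^sup>2))"
proof -
  define B where "B = mix_coeff \<epsilon> (0::'a) + (1 / 2) powr (-(\<epsilon> / 2))"
  have G: "Gamma (\<epsilon> / 2) > 0" using e by (intro Gamma_real_pos) simp
  let ?w = "\<lambda>t::real. t powr (\<epsilon> / 2 - 1) / Gamma (\<epsilon> / 2)"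
  have "\<bar>rest_coeff \<epsilon> k\<bar> \<le> B * exp (-(1 / 2 * (norm k)\<^sup>2))" if k: "k \<in> int_lattice" for k :: 'a
  proof (cases "k = 0")
    case True
    then show ?thesis by (simp add: rest_coeff_def B_def mix_coeff_nonneg)
  next
    case False
    define l where "l = (norm k)\<^sup>2"
    have n1: "norm k \<ge> 1" using int_lattice_norm_less_one[OF k] False by force
    then have l: "l \<ge> 1" by (simp add: l_def)
    have "l powr (-(\<epsilon> / 2)) = norm k powr (-\<epsilon>)"
      using n1 powr_powr[of "norm k" 2 "-(\<epsilon> / 2)"] by (simp add: l_def)
    then have "ennreal (norm k powr (-\<epsilon>)) = (\<integral>\<^sup>+t. ennreal (indicator {0<..} t * (?w t * exp (-(t * l)))) \<partial>lborel)"
      using nn_integral_Gamma_scaled[of "\<epsilon> / 2" l] e l by simp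
    also have "\<dots> = (\<integral>\<^sup>+t. ennreal (indicator {0<..<1} t * ?w t) * ennreal (exp (-(t * l))) + ennreal (indicator {1..} t * (?w t * exp (-(t * l)))) \<partial>lborel)"
      using G by (intro nn_integral_cong) (auto simp: indicator_def ennreal_mult[symmetric])
    also have "\<dots> = (\<integral>\<^sup>+t. ennreal (indicator {0<..<1} t * ?w t) * ennreal (exp (-(t * l))) \<partial>lborel) + (\<integral>\<^sup>+t. ennreal (indicator {1..} t * (?w t * exp (-(t * l)))) \<partial>lborel)"
      by (rule nn_integral_add) measurable
    also have "(\<integral>\<^sup>+t. ennreal (indicator {0<..<1} t * ?w t) * ennreal (exp (-(t * l))) \<partial>lborel) = (\<integral>\<^sup>+t. ennreal (exp (-(t * l))) \<partial>gamma_mix \<epsilon>)"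
      by (rule nn_integral_gamma_mix[OF e, symmetric]) measurable
    also have "\<dots> = ennreal (mix_coeff \<epsilon> k)"
      unfolding mix_coeff_def l_def by (intro nn_integral_eq_integral integrable_gamma_mix_exp e) simp
    finally have eq: "ennreal (norm k powr (-\<epsilon>)) = ennreal (mix_coeff \<epsilon> k) + (\<integral>\<^sup>+t. ennreal (indicator {1..} t * (?w t * exp (-(t * l)))) \<partial>lborel)" .
    have "(\<integral>\<^sup>+t. ennreal (indicator {1..} t * (?w t * exp (-(t * l)))) \<partial>lborel)
      \<le> (\<integral>\<^sup>+t. ennreal (exp (-(1 / 2 * l))) * ennreal (indicator {0<..} t * (?w t * exp (-(t * (1 / 2))))) \<partial>lborel)"
    proof (rule nn_integral_mono)
      fix t :: real
      have "?w t * exp (-(t * l)) \<le> exp (-(1 / 2 * l)) * (?w t * exp (-(t * (1 / 2))))" if t: "t \<ge> 1"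
      proof -
        have "t * (l - 1 / 2) \<ge> 1 * (l - 1 / 2)" using t l by (intro mult_right_mono) auto
        then have "-(t * l) \<le> -(1 / 2 * l) + -(t * (1 / 2))" using l by (simp add: algebra_simps)
        then have "exp (-(t * l)) \<le> exp (-(1 / 2 * l)) * exp (-(t * (1 / 2)))"
          by (simp only: exp_add[symmetric] exp_le_cancel_iff)
        then have "?w t * exp (-(t * l)) \<le> ?w t * (exp (-(1 / 2 * l)) * exp (-(t * (1 / 2))))"
          using G by (intro mult_left_mono) auto
        then show ?thesis by (simp add: mult_ac)
      qed
      then show "ennreal (indicator {1..} t * (?w t * exp (-(t * l)))) \<le> ennreal (exp (-(1 / 2 * l))) * ennreal (indicator {0<..} t * (?w t * exp (-(t * (1 / 2)))))"
        using G by (cases "t \<ge> 1") (auto simp: ennreal_mult[symmetric] indicator_def intro!: ennreal_leI)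
    qed
    also have "\<dots> = ennreal (exp (-(1 / 2 * l))) * ennreal ((1 / 2) powr (-(\<epsilon> / 2)))"
      using e by (subst nn_integral_cmult) (auto simp: nn_integral_Gamma_scaled[of "\<epsilon> / 2" "1 / 2", simplified])
    finally have "ennreal (norm k powr (-\<epsilon>)) \<le> ennreal (mix_coeff \<epsilon> k) + ennreal (exp (-(1 / 2 * l)) * (1 / 2) powr (-(\<epsilon> / 2)))"
      unfolding eq by (intro add_left_mono) (simp add: ennreal_mult)
    then have up: "norm k powr (-\<epsilon>) \<le> mix_coeff \<epsilon> k + exp (-(1 / 2 * l)) * (1 / 2) powr (-(\<epsilon> / 2))"
      by (simp add: ennreal_plus[symmetric] mix_coeff_nonneg del: ennreal_plus)
    have "ennreal (mix_coeff \<epsilon> k) \<le> ennreal (norm k powr (-\<epsilon>))" unfolding eq by simp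
    then have lo: "mix_coeff \<epsilon> k \<le> norm k powr (-\<epsilon>)" by simp
    have "\<bar>rest_coeff \<epsilon> k\<bar> \<le> exp (-(1 / 2 * l)) * (1 / 2) powr (-(\<epsilon> / 2))"
      using up lo False by (simp add: rest_coeff_def)
    also have "\<dots> \<le> exp (-(1 / 2 * l)) * B"
      by (intro mult_left_mono) (simp_all add: B_def mix_coeff_nonneg)
    finally show ?thesis by (simp add: l_def mult.commute)
  qed
  moreover have "B \<ge> 0" by (simp add: B_def mix_coeff_nonneg)
  ultimately show thesis using that by blast
qed

lemma integrable_rest_coeff:
  assumes e: "\<epsilon> > 0"
  shows "integrable (count_space (int_lattice :: 'a::euclidean_space set)) (rest_coeff \<epsilon>)"
proof -
  obtain B where B: "B \<ge> 0"
    "\<And>k::'a. k \<in> int_lattice \<Longrightarrow> \<bar>rest_coeff \<epsilon> k\<bar> \<le> B * exp (-(1 / 2 * (norm k)\<^sup>2))"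
    using rest_coeff_bound[OF e] by metis
  obtain C where C: "C \<ge> 0"
    "\<And>w::'a. (\<integral>\<^sup>+j. exp (-(1 / 2 * (norm (w - j))\<^sup>2)) \<partial>count_space int_lattice) \<le> ennreal C"
    using lattice_gauss_bound[of "1/2"] by (metis half_gt_zero_iff zero_less_one)
  have "(\<integral>\<^sup>+k. ennreal (norm (rest_coeff \<epsilon> (k::'a))) \<partial>count_space int_lattice)
    \<le> (\<integral>\<^sup>+k. ennreal B * ennreal (exp (-(1 / 2 * (norm (0 - k::'a))\<^sup>2))) \<partial>count_space int_lattice)"
    using B by (intro nn_integral_mono) (auto simp: ennreal_mult[symmetric] intro!: ennreal_leI)
  also have "\<dots> \<le> ennreal B * ennreal C"
    using C(2)[of 0] by (subst nn_integral_cmult) (auto intro!: mult_left_mono)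
  also have "\<dots> < \<infinity>" by (simp add: ennreal_mult_less_top)
  finally show ?thesis by (intro integrableI_bounded) auto
qed

lemma norm_rest_cos_le: "\<bar>b * cos x\<bar> \<le> \<bar>b\<bar>" for b x :: real
  by (simp add: abs_mult mult_left_le)

section \<open>The potential of a finite measure as a singular part plus a continuous part\<close>

locale torus_measure =
  fixes \<mu> :: "'a::euclidean_space measure" and \<epsilon> :: real
  assumes finite_mu: "finite_measure \<mu>" and sets_mu [measurable_cong]: "sets \<mu> = sets torus_borel"
    and eps: "0 < \<epsilon>"
begin

abbreviation "L \<equiv> count_space (int_lattice :: 'a set)"
abbreviation "T \<equiv> gamma_mix \<epsilon>"
abbreviation "M \<equiv> periodization \<mu>"

sublocale \<mu>: finite_measure \<mu> by (rule finite_mu)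
sublocale T: finite_measure T by (rule finite_measure_gamma_mix[OF eps])
sublocale L: sigma_finite_measure L by (rule sigma_finite_lattice)
sublocale TM: pair_sigma_finite T \<mu> ..
sublocale TMf: finite_measure "T \<Otimes>\<^sub>M \<mu>"
  by (rule finite_measure_pair_measure) (rule finite_mu, rule T.finite_measure_axioms)
sublocale LU: pair_sigma_finite L "T \<Otimes>\<^sub>M \<mu>" ..
sublocale Lm: pair_sigma_finite L \<mu> ..

lemma sigma_TM: "sigma_finite_measure (T \<Otimes>\<^sub>M \<mu>)" by unfold_locales

lemma space_mu: "space \<mu> = pbox"
  using sets_eq_imp_space_eq[OF sets_mu] by simp

lemma id_mu: "(\<lambda>y. y) \<in> \<mu> \<rightarrow>\<^sub>M borel"
  by (rule measurable_torus_borel[OF _ sets_mu]) simp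

lemma L_id: "(\<lambda>m. m) \<in> L \<rightarrow>\<^sub>M borel"
  by simp

text \<open>Lattice point, time and source are collected in one variable p, so that the periodised
  mixture is a single integral over a product and Fubini can be applied in any order.\<close>

definition sing :: "'a \<Rightarrow> 'a \<times> real \<times> 'a \<Rightarrow> real" where
  "sing x = (\<lambda>(m, t, y). heat t (x + 2 *\<^sub>R m - y))"

text \<open>Where the mixture diverges, the value is 0 by the convention for non-integrable
  functions. The bound \<open>nn_integral_sing\<close> confines this to a null set.\<close>

definition f1 :: "'a \<Rightarrow> real" where
  "f1 x = (\<integral>p. sing x p \<partial>(L \<Otimes>\<^sub>M (T \<Otimes>\<^sub>M \<mu>)))"

text \<open>A Fourier series in real form: \<open>rest_coeff\<close> is even in k, so the
  exponentials for k and -k combine to a cosine. The normalising factor 1/2^n is applied only at the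
  end.\<close>

definition f2 :: "'a \<Rightarrow> real" where
  "f2 x = (\<integral>(k, y). rest_coeff \<epsilon> k * cos (pi * (k \<bullet> (x - y))) \<partial>(L \<Otimes>\<^sub>M \<mu>))"

lemma lattice_pair_measurable:
  fixes h :: "'a \<Rightarrow> 'b \<Rightarrow> 'c"
  assumes "\<And>m. m \<in> int_lattice \<Longrightarrow> h m \<in> measurable N K"
  shows "(\<lambda>(m, u). h m u) \<in> measurable (L \<Otimes>\<^sub>M N) K"
  by (rule measurable_pair_measure_countable1[OF countable_int_lattice]) (use assms in auto)

lemma fst_L [measurable]: "fst \<in> borel_measurable (L \<Otimes>\<^sub>M N)"
  using measurable_comp[OF measurable_fst L_id] by (simp add: comp_def)

lemma snd_id_mu [measurable]: "(\<lambda>p. snd p) \<in> borel_measurable (N \<Otimes>\<^sub>M \<mu>)"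
  using measurable_comp[OF measurable_snd id_mu] by (simp add: comp_def)

lemma sing_measurable [measurable]:
  assumes [measurable]: "f \<in> borel_measurable N" "g \<in> measurable N (L \<Otimes>\<^sub>M (T \<Otimes>\<^sub>M \<mu>))"
  shows "(\<lambda>p. sing (f p) (g p)) \<in> borel_measurable N"
proof -
  have [measurable]: "(\<lambda>p. fst (g p)) \<in> borel_measurable N" "(\<lambda>p. fst (snd (g p))) \<in> borel_measurable N"
      "(\<lambda>p. snd (snd (g p))) \<in> borel_measurable N"
    using measurable_comp[OF assms(2) fst_L] measurable_comp[OF measurable_comp[OF assms(2) measurable_snd] measurable_fst]
      measurable_comp[OF measurable_comp[OF assms(2) measurable_snd] snd_id_mu]
    by (simp_all add: comp_def cong: measurable_cong_sets)
  show ?thesis unfolding sing_def split_beta by measurable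
qed

lemma sing_nonneg: "0 \<le> sing x p"
  by (auto simp: sing_def split_beta heat_nonneg)

lemma f1_eq: "f1 x = enn2real (\<integral>\<^sup>+p. sing x p \<partial>(L \<Otimes>\<^sub>M (T \<Otimes>\<^sub>M \<mu>)))"
  unfolding f1_def by (rule integral_eq_nn_integral) (auto simp: sing_nonneg)

text \<open>Moving the lattice sum next to \<mu> merges the two into the periodised measure. The
  shift sits on x in the integrand but on y in the periodisation, hence the substitution of -m for
  m.\<close>

lemma nn_integral_lattice_fubini:
  fixes g :: "real \<Rightarrow> 'a \<Rightarrow> ennreal"
  assumes [measurable]: "(\<lambda>(t, z). g t z) \<in> borel_measurable (borel \<Otimes>\<^sub>M borel)"
  shows "(\<integral>\<^sup>+(m, t, y). g t (x + 2 *\<^sub>R m - y) \<partial>(L \<Otimes>\<^sub>M (T \<Otimes>\<^sub>M \<mu>))) = (\<integral>\<^sup>+t. \<integral>\<^sup>+y. g t (x - y) \<partial>M \<partial>T)"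
proof -
  have [measurable]: "(\<lambda>p. g (f p) (h p)) \<in> borel_measurable N"
    if [measurable]: "f \<in> borel_measurable N" "h \<in> borel_measurable N" for f h and N :: "'z measure"
    using measurable_compose[OF _ assms, of "\<lambda>p. (f p, h p)" N] by simp
  note m' = measurable_compose_rev
  have gm [measurable]: "(\<lambda>p. g (fst p) (x + 2 *\<^sub>R m - snd p)) \<in> borel_measurable (T \<Otimes>\<^sub>M \<mu>)" for m
    using measurable_compose[OF _ assms, of "\<lambda>p. (fst p, x + 2 *\<^sub>R m - snd p)" "T \<Otimes>\<^sub>M \<mu>"] by simp
  have gm2 [measurable]: "(\<lambda>y. g t (c - y)) \<in> borel_measurable borel" for t c
    using measurable_compose[OF _ assms, of "\<lambda>y. (t, c - y)" borel] by simp
  have gm4 [measurable]: "(\<lambda>y. g t (c - y)) \<in> borel_measurable \<mu>" for t c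
    by (rule measurable_torus_borel[OF gm2 sets_mu])
  have gm3: "(\<lambda>t. \<integral>\<^sup>+y. g t (x + 2 *\<^sub>R m - y) \<partial>\<mu>) \<in> borel_measurable T" for m
    using \<mu>.borel_measurable_nn_integral_fst[OF gm[of m]] by simp
  have "(\<integral>\<^sup>+(m, t, y). g t (x + 2 *\<^sub>R m - y) \<partial>(L \<Otimes>\<^sub>M (T \<Otimes>\<^sub>M \<mu>)))
      = (\<integral>\<^sup>+m. \<integral>\<^sup>+(t, y). g t (x + 2 *\<^sub>R m - y) \<partial>(T \<Otimes>\<^sub>M \<mu>) \<partial>L)"
    by (subst sigma_finite_measure.nn_integral_fst[OF sigma_TM, symmetric]) (auto simp: case_prod_unfold intro!: lattice_pair_measurable[unfolded split_beta])
  also have "\<dots> = (\<integral>\<^sup>+m. \<integral>\<^sup>+t. \<integral>\<^sup>+y. g t (x + 2 *\<^sub>R m - y) \<partial>\<mu> \<partial>T \<partial>L)"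
    by (intro nn_integral_cong, subst \<mu>.nn_integral_fst[symmetric]) (auto simp: split_beta)
  also have "\<dots> = (\<integral>\<^sup>+t. \<integral>\<^sup>+m. \<integral>\<^sup>+y. g t (x + 2 *\<^sub>R m - y) \<partial>\<mu> \<partial>L \<partial>T)"
    by (rule nn_integral_count_space_nn_integral[symmetric, OF countable_int_lattice gm3])
  also have "\<dots> = (\<integral>\<^sup>+t. \<integral>\<^sup>+y. g t (x - y) \<partial>M \<partial>T)"
  proof (rule nn_integral_cong)
    fix t
    have bij: "bij_betw uminus (int_lattice :: 'a set) int_lattice"
      by (rule bij_betw_byWitness[where f'=uminus]) (auto simp: int_lattice_uminus)
    have "(\<integral>\<^sup>+m. \<integral>\<^sup>+y. g t (x + 2 *\<^sub>R m - y) \<partial>\<mu> \<partial>L) = (\<integral>\<^sup>+m. \<integral>\<^sup>+y. g t (x + 2 *\<^sub>R (- m) - y) \<partial>\<mu> \<partial>L)"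
      by (rule nn_integral_bij_count_space[OF bij, symmetric])
    also have "\<dots> = (\<integral>\<^sup>+m. \<integral>\<^sup>+y. g t (x - (y + 2 *\<^sub>R m)) \<partial>\<mu> \<partial>L)"
      by (simp add: algebra_simps)
    also have "\<dots> = (\<integral>\<^sup>+y. g t (x - y) \<partial>M)"
      by (rule nn_integral_periodization[symmetric, OF \<mu>.sigma_finite_measure_axioms sets_mu gm2])
    finally show "(\<integral>\<^sup>+m. \<integral>\<^sup>+y. g t (x + 2 *\<^sub>R m - y) \<partial>\<mu> \<partial>L) = (\<integral>\<^sup>+y. g t (x - y) \<partial>M)" .
  qed
  finally show ?thesis .
qed

lemma f1_eq': "f1 x = enn2real (\<integral>\<^sup>+t. \<integral>\<^sup>+y. heat t (x - y) \<partial>M \<partial>T)"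
  unfolding f1_eq using nn_integral_lattice_fubini[of "\<lambda>t z. ennreal (heat t z)" x]
  by (simp add: sing_def case_prod_unfold)

lemma M_shift:
  fixes h :: "'a \<Rightarrow> ennreal"
  assumes i: "i \<in> int_lattice" and [measurable]: "h \<in> borel_measurable borel"
  shows "(\<integral>\<^sup>+y. h (y + 2 *\<^sub>R i) \<partial>M) = (\<integral>\<^sup>+y. h y \<partial>M)"
proof -
  have bij: "bij_betw (\<lambda>m. m + i) (int_lattice :: 'a set) int_lattice"
    by (rule bij_betw_byWitness[where f'="\<lambda>m. m - i"]) (auto simp: int_lattice_add int_lattice_diff i)
  have "(\<integral>\<^sup>+y. h (y + 2 *\<^sub>R i) \<partial>M) = (\<integral>\<^sup>+m. \<integral>\<^sup>+y. h (y + 2 *\<^sub>R m + 2 *\<^sub>R i) \<partial>\<mu> \<partial>L)"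
    by (rule nn_integral_periodization[OF \<mu>.sigma_finite_measure_axioms sets_mu]) measurable
  also have "\<dots> = (\<integral>\<^sup>+m. \<integral>\<^sup>+y. h (y + 2 *\<^sub>R (m + i)) \<partial>\<mu> \<partial>L)"
    by (simp add: algebra_simps)
  also have "\<dots> = (\<integral>\<^sup>+m. \<integral>\<^sup>+y. h (y + 2 *\<^sub>R m) \<partial>\<mu> \<partial>L)"
    by (rule nn_integral_bij_count_space[OF bij])
  also have "\<dots> = (\<integral>\<^sup>+y. h y \<partial>M)"
    by (rule nn_integral_periodization[symmetric, OF \<mu>.sigma_finite_measure_axioms sets_mu]) measurable
  finally show ?thesis .
qed

lemma Basis_int_lattice: "i \<in> Basis \<Longrightarrow> i \<in> (int_lattice :: 'a set)"
  by (auto simp: int_lattice_def inner_Basis)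

lemma periodic_f1: "periodic f1"
  unfolding periodic_def
proof (intro allI ballI)
  fix x i :: 'a assume i: "i \<in> Basis"
  have "(\<integral>\<^sup>+y. heat t (x + 2 *\<^sub>R i - y) \<partial>M) = (\<integral>\<^sup>+y. heat t (x - y) \<partial>M)" for t
    using M_shift[OF Basis_int_lattice[OF i], of "\<lambda>y. heat t (x + 2 *\<^sub>R i - y)"] by simp
  then show "f1 (x + 2 *\<^sub>R i) = f1 x" unfolding f1_eq' by simp
qed

lemma integrable_rest_pair: "integrable (L \<Otimes>\<^sub>M \<mu>) (\<lambda>(k, y). \<bar>rest_coeff \<epsilon> k\<bar>)"
proof (rule Lm.Fubini_integrable)
  show "(\<lambda>(k, y). \<bar>rest_coeff \<epsilon> k\<bar>) \<in> borel_measurable (L \<Otimes>\<^sub>M \<mu>)" by (rule lattice_pair_measurable) simp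
  have "integrable L (\<lambda>k. measure \<mu> (space \<mu>) * \<bar>rest_coeff \<epsilon> k\<bar>)"
    using integrable_rest_coeff[OF eps, where 'a='a] by auto
  then show "integrable L (\<lambda>k. \<integral>y. norm (case (k, y) of (k, y) \<Rightarrow> \<bar>rest_coeff \<epsilon> k\<bar>) \<partial>\<mu>)" by simp
qed simp

lemma rest_measurable [measurable]: "rest_coeff \<epsilon> \<in> borel_measurable L" by simp

lemma f2_integrand_measurable:
  "(\<lambda>(k, y). rest_coeff \<epsilon> k * cos (pi * (k \<bullet> (x - y)))) \<in> borel_measurable (L \<Otimes>\<^sub>M \<mu>)"
  by (rule lattice_pair_measurable, rule measurable_torus_borel[OF _ sets_mu]) measurable

lemma integrable_f2: "integrable (L \<Otimes>\<^sub>M \<mu>) (\<lambda>(k, y). rest_coeff \<epsilon> k * cos (pi * (k \<bullet> (x - y))))"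
  by (rule Bochner_Integration.integrable_bound[OF integrable_rest_pair f2_integrand_measurable])
     (auto simp: norm_rest_cos_le)

lemma f2_bounded: "\<bar>f2 x\<bar> \<le> (\<integral>(k, y). \<bar>rest_coeff \<epsilon> k\<bar> \<partial>(L \<Otimes>\<^sub>M \<mu>))"
proof -
  have "norm (f2 x) \<le> (\<integral>p. norm (case p of (k, y) \<Rightarrow> rest_coeff \<epsilon> k * cos (pi * (k \<bullet> (x - y)))) \<partial>(L \<Otimes>\<^sub>M \<mu>))"
    unfolding f2_def by (rule integral_norm_bound)
  also have "\<dots> \<le> (\<integral>(k, y). \<bar>rest_coeff \<epsilon> k\<bar> \<partial>(L \<Otimes>\<^sub>M \<mu>))"
    by (intro integral_mono integrable_norm integrable_f2 integrable_rest_pair) (auto simp: norm_rest_cos_le)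
  finally show ?thesis by simp
qed

lemma isCont_f2: "isCont f2 x"
  unfolding f2_def
proof (rule isCont_integral_dominated[where \<delta>=1, OF _ f2_integrand_measurable integrable_rest_pair])
  show "AE p in L \<Otimes>\<^sub>M \<mu>. isCont (\<lambda>x. case p of (k, y) \<Rightarrow> rest_coeff \<epsilon> k * cos (pi * (k \<bullet> (x - y)))) x"
    by (auto simp: split_beta intro!: continuous_intros)
qed (auto simp: norm_rest_cos_le)

lemma periodic_f2: "periodic f2"
  unfolding periodic_def f2_def
proof (intro allI ballI Bochner_Integration.integral_cong refl)
  fix x i :: 'a and p assume i: "i \<in> Basis" and p: "p \<in> space (L \<Otimes>\<^sub>M \<mu>)"
  obtain k y where ky: "p = (k, y)" "k \<in> int_lattice" using p by (auto simp: space_pair_measure)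
  obtain n :: int where n: "k \<bullet> i = of_int n"
    using inner_int_lattice[OF ky(2) Basis_int_lattice[OF i]] by (auto elim: Ints_cases)
  have "pi * (k \<bullet> (x + 2 *\<^sub>R i - y)) = pi * (k \<bullet> (x - y)) + 2 * pi * of_int n"
    by (simp add: inner_simps n algebra_simps)
  then have "cos (pi * (k \<bullet> (x + 2 *\<^sub>R i - y))) = cos (pi * (k \<bullet> (x - y)))"
    by (simp only: cos_add sin_int_2pin cos_int_2pin mult_1_right mult_zero_right diff_zero)
  then show "(case p of (k, y) \<Rightarrow> rest_coeff \<epsilon> k * cos (pi * (k \<bullet> (x + 2 *\<^sub>R i - y)))) =
     (case p of (k, y) \<Rightarrow> rest_coeff \<epsilon> k * cos (pi * (k \<bullet> (x - y))))" by (simp add: ky)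
qed

end

lemma
  fixes G :: "'a::euclidean_space \<Rightarrow> 'b::{banach, second_countable_topology}"
  assumes G: "integrable lborel G"
  shows integrable_lborel_shift: "integrable lborel (\<lambda>z. G (z + w))"
    and integral_lborel_shift: "(\<integral>z. G (z + w) \<partial>lborel) = (\<integral>z. G z \<partial>lborel)"
proof -
  have "integrable (distr lborel borel ((+) w)) G" using G by (simp add: lborel_distr_plus)
  then show "integrable lborel (\<lambda>z. G (z + w))"
    by (subst (asm) integrable_distr_eq) (use G in \<open>auto simp: add.commute\<close>)
  have "(\<integral>z. G z \<partial>lborel) = (\<integral>z. G z \<partial>distr lborel borel ((+) w))" by (simp add: lborel_distr_plus)
  also have "\<dots> = (\<integral>z. G (z + w) \<partial>lborel)"
    by (subst integral_distr) (use G in \<open>auto simp: add.commute\<close>)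
  finally show "(\<integral>z. G (z + w) \<partial>lborel) = (\<integral>z. G z \<partial>lborel)" by simp
qed

section \<open>Fourier coefficients of the two parts\<close>

context torus_measure
begin

abbreviation "X \<equiv> restrict_space lborel (pbox :: 'a set)"

lemma sets_X [measurable_cong]: "sets X = sets torus_borel"
  by (simp add: torus_borel_def cong: sets_restrict_space_cong)

lemma finite_X: "finite_measure X"
proof
  have "(pbox :: 'a set) \<subseteq> cbox (- One) One"
    by (auto simp: pbox_def mem_box less_imp_le)
  then have "emeasure lborel (pbox :: 'a set) \<le> emeasure lborel (cbox (- One) (One :: 'a))"
    by (intro emeasure_mono) auto
  also have "\<dots> < \<infinity>" by (rule emeasure_lborel_cbox_finite)
  finally show "emeasure X (space X) \<noteq> \<infinity>"
    by (simp add: emeasure_restrict_space space_restrict_space)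
qed

sublocale X: finite_measure X by (rule finite_X)
sublocale XY: pair_sigma_finite X "L \<Otimes>\<^sub>M (T \<Otimes>\<^sub>M \<mu>)" ..
sublocale XZ: pair_sigma_finite X "L \<Otimes>\<^sub>M \<mu>" ..
sublocale LX: pair_sigma_finite L X ..

lemma fst_X: "fst \<in> borel_measurable (X \<Otimes>\<^sub>M N)"
  using measurable_comp[OF measurable_fst measurable_torus_borel[OF measurable_ident sets_X]] by (simp add: comp_def)

lemma snd_X: "snd \<in> borel_measurable (N \<Otimes>\<^sub>M X)"
  using measurable_comp[OF measurable_snd measurable_torus_borel[OF measurable_ident sets_X]] by (simp add: comp_def)

lemma AE_TM: "AE u in T \<Otimes>\<^sub>M \<mu>. 0 < fst u"
proof (rule TM.AE_pair_measure)
  show "AE t in T. AE y in \<mu>. 0 < fst (t, y)" using AE_gamma_mix by eventually_elim simp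
qed measurable

lemma unfold_nn_integral:
  assumes [measurable]: "h \<in> borel_measurable borel"
  shows "(\<integral>\<^sup>+m. \<integral>\<^sup>+x. h (x + 2 *\<^sub>R m) \<partial>X \<partial>L) = (\<integral>\<^sup>+z. h z \<partial>lborel)"
  using nn_integral_periodization[OF X.sigma_finite_measure_axioms sets_X assms] by (simp add: periodization_lborel)

lemma unfold_integral:
  fixes H :: "'a \<Rightarrow> complex"
  assumes H: "integrable lborel H"
  shows "(\<integral>m. \<integral>x. H (x + 2 *\<^sub>R m) \<partial>X \<partial>L) = (\<integral>z. H z \<partial>lborel)"
proof -
  have [measurable]: "H \<in> borel_measurable borel" using H by auto
  note sh = shift_measurable[OF sets_X]
  have i: "integrable (L \<Otimes>\<^sub>M X) (\<lambda>p. H (case p of (m, y) \<Rightarrow> y + 2 *\<^sub>R m))"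
    using H periodization_lborel[where 'a='a, symmetric] integrable_distr_eq[OF sh, of H]
    unfolding periodization_def by simp
  have "(\<integral>z. H z \<partial>lborel) = (\<integral>p. H (case p of (m, y) \<Rightarrow> y + 2 *\<^sub>R m) \<partial>(L \<Otimes>\<^sub>M X))"
    by (subst periodization_lborel[symmetric]) (simp add: periodization_def integral_distr[OF sh])
  also have "\<dots> = (\<integral>m. \<integral>x. H (x + 2 *\<^sub>R m) \<partial>X \<partial>L)"
    using LX.integral_fst'[OF i] by simp
  finally show ?thesis by simp
qed

lemma sing_XY_measurable: "(\<lambda>(x, p). sing x p) \<in> borel_measurable (X \<Otimes>\<^sub>M (L \<Otimes>\<^sub>M (T \<Otimes>\<^sub>M \<mu>)))"
  unfolding split_beta by (intro sing_measurable fst_X) measurable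

text \<open>For a fixed time and source, the lattice sum of integrals over the box unfolds to the
  integral of one heat kernel over the space, which is 1. What remains is the mass of a finite
  product measure.\<close>

lemma nn_integral_sing: "(\<integral>\<^sup>+(x, p). ennreal (sing x p) \<partial>(X \<Otimes>\<^sub>M (L \<Otimes>\<^sub>M (T \<Otimes>\<^sub>M \<mu>)))) < \<infinity>"
proof -
  note [measurable] = sing_XY_measurable
  have m1: "(\<lambda>(x, p). ennreal (sing x p)) \<in> borel_measurable (X \<Otimes>\<^sub>M (L \<Otimes>\<^sub>M (T \<Otimes>\<^sub>M \<mu>)))"
    by measurable
  have m2: "(\<lambda>p. \<integral>\<^sup>+x. ennreal (sing x p) \<partial>X) \<in> borel_measurable (L \<Otimes>\<^sub>M (T \<Otimes>\<^sub>M \<mu>))"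
  proof (rule X.borel_measurable_nn_integral)
    show "(\<lambda>(p, x). ennreal (sing x p)) \<in> borel_measurable ((L \<Otimes>\<^sub>M (T \<Otimes>\<^sub>M \<mu>)) \<Otimes>\<^sub>M X)"
      unfolding split_beta by (intro measurable_compose[OF _ measurable_ennreal] sing_measurable snd_X) measurable
  qed
  have "(\<integral>\<^sup>+(x, p). ennreal (sing x p) \<partial>(X \<Otimes>\<^sub>M (L \<Otimes>\<^sub>M (T \<Otimes>\<^sub>M \<mu>))))
     = (\<integral>\<^sup>+p. \<integral>\<^sup>+x. ennreal (sing x p) \<partial>X \<partial>(L \<Otimes>\<^sub>M (T \<Otimes>\<^sub>M \<mu>)))"
    using XY.nn_integral_snd[OF m1] by simp
  also have "\<dots> = (\<integral>\<^sup>+u. \<integral>\<^sup>+m. \<integral>\<^sup>+x. ennreal (sing x (m, u)) \<partial>X \<partial>L \<partial>(T \<Otimes>\<^sub>M \<mu>))"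
    using LU.nn_integral_snd[of "\<lambda>p. \<integral>\<^sup>+x. ennreal (sing x p) \<partial>X"] m2 by simp
  also have "\<dots> = (\<integral>\<^sup>+u. 1 \<partial>(T \<Otimes>\<^sub>M \<mu>))"
  proof (rule nn_integral_cong_AE)
    show "AE u in T \<Otimes>\<^sub>M \<mu>. (\<integral>\<^sup>+m. \<integral>\<^sup>+x. ennreal (sing x (m, u)) \<partial>X \<partial>L) = 1"
      using AE_TM
    proof eventually_elim
      case (elim u)
      obtain t y where u: "u = (t, y)" by force
      have t: "t > 0" using elim u by simp
      have "(\<integral>\<^sup>+m. \<integral>\<^sup>+x. ennreal (sing x (m, u)) \<partial>X \<partial>L) = (\<integral>\<^sup>+m. \<integral>\<^sup>+x. ennreal (heat t (x + 2 *\<^sub>R m - y)) \<partial>X \<partial>L)"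
        by (simp add: sing_def u)
      also have "\<dots> = (\<integral>\<^sup>+z. ennreal (heat t (z - y)) \<partial>lborel)"
        by (rule unfold_nn_integral[of "\<lambda>z. ennreal (heat t (z - y))"]) measurable
      also have "\<dots> = 1"
        using nn_integral_lborel_shift[of "\<lambda>z. ennreal (heat t z)" "-y"] nn_integral_heat[OF t, where 'a='a] by simp
      finally show ?case .
    qed
  qed
  also have "\<dots> < \<infinity>" by (simp add: top.not_eq_extremum[symmetric] TMf.emeasure_finite)
  finally show ?thesis .
qed

lemma cis_X_measurable: "(\<lambda>x. cis (-(pi * (k \<bullet> x)))) \<in> borel_measurable X"
  by (rule measurable_torus_borel[OF _ sets_X]) measurable

lemma integrable_sing_cis:
  "integrable (X \<Otimes>\<^sub>M (L \<Otimes>\<^sub>M (T \<Otimes>\<^sub>M \<mu>))) (\<lambda>(x, p). complex_of_real (sing x p) * cis (-(pi * (k \<bullet> x))))"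
proof (rule integrableI_bounded)
  note [measurable] = sing_XY_measurable fst_X
  have [measurable]: "(\<lambda>p. sing (fst p) (snd p)) \<in> borel_measurable (X \<Otimes>\<^sub>M (L \<Otimes>\<^sub>M (T \<Otimes>\<^sub>M \<mu>)))"
    using sing_XY_measurable by (simp add: split_beta)
  show "(\<lambda>(x, p). complex_of_real (sing x p) * cis (-(pi * (k \<bullet> x)))) \<in> borel_measurable (X \<Otimes>\<^sub>M (L \<Otimes>\<^sub>M (T \<Otimes>\<^sub>M \<mu>)))"
    unfolding split_beta by measurable
  have "(\<integral>\<^sup>+q. ennreal (norm (case q of (x, p) \<Rightarrow> complex_of_real (sing x p) * cis (-(pi * (k \<bullet> x))))) \<partial>(X \<Otimes>\<^sub>M (L \<Otimes>\<^sub>M (T \<Otimes>\<^sub>M \<mu>))))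
    = (\<integral>\<^sup>+(x, p). ennreal (sing x p) \<partial>(X \<Otimes>\<^sub>M (L \<Otimes>\<^sub>M (T \<Otimes>\<^sub>M \<mu>))))"
    by (intro nn_integral_cong) (auto simp: norm_mult sing_nonneg)
  then show "(\<integral>\<^sup>+q. ennreal (norm (case q of (x, p) \<Rightarrow> complex_of_real (sing x p) * cis (-(pi * (k \<bullet> x))))) \<partial>(X \<Otimes>\<^sub>M (L \<Otimes>\<^sub>M (T \<Otimes>\<^sub>M \<mu>)))) < \<infinity>"
    using nn_integral_sing by simp
qed

lemma integrable_f1: "integrable X f1"
proof -
  have "integrable X (\<lambda>x. \<integral>p. complex_of_real (sing x p) * cis (-(pi * (0 \<bullet> x))) \<partial>(L \<Otimes>\<^sub>M (T \<Otimes>\<^sub>M \<mu>)))"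
    using XY.integrable_fst[OF integrable_sing_cis[of 0]] by simp
  then have "integrable X (\<lambda>x. complex_of_real (f1 x))" by (simp add: f1_def)
  then show ?thesis by (simp only: complex_of_real_integrable_eq)
qed

text \<open>The character does not change under period translations, so it survives the unfolding.
  The transform of a heat kernel centred at y is exp(-t |k|^2) times the character at y; integrating
  over t gives \<open>mix_coeff\<close> and over y the coefficient of \<mu>.\<close>

lemma integral_f1_cis:
  assumes k: "k \<in> int_lattice"
  shows "(\<integral>x. complex_of_real (f1 x) * cis (-(pi * (k \<bullet> x))) \<partial>X)
     = of_real (mix_coeff \<epsilon> k) * (\<integral>y. cis (-(pi * (k \<bullet> y))) \<partial>\<mu>)"
proof -
  let ?c = "\<lambda>x. cis (-(pi * (k \<bullet> x)))"
  let ?\<Phi> = "\<lambda>x p. complex_of_real (sing x p) * ?c x"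
  note I = integrable_sing_cis[of k]
  have "(\<integral>x. complex_of_real (f1 x) * ?c x \<partial>X) = (\<integral>x. \<integral>p. ?\<Phi> x p \<partial>(L \<Otimes>\<^sub>M (T \<Otimes>\<^sub>M \<mu>)) \<partial>X)"
    by (simp add: f1_def)
  also have "\<dots> = (\<integral>p. \<integral>x. ?\<Phi> x p \<partial>X \<partial>(L \<Otimes>\<^sub>M (T \<Otimes>\<^sub>M \<mu>)))"
    using XY.Fubini_integral[OF I] by simp
  also have "\<dots> = (\<integral>u. \<integral>m. \<integral>x. ?\<Phi> x (m, u) \<partial>X \<partial>L \<partial>(T \<Otimes>\<^sub>M \<mu>))"
  proof -
    have "integrable (L \<Otimes>\<^sub>M (T \<Otimes>\<^sub>M \<mu>)) (\<lambda>p. \<integral>x. ?\<Phi> x p \<partial>X)"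
      using XY.integrable_snd[OF I] by simp
    then have i2: "integrable (L \<Otimes>\<^sub>M (T \<Otimes>\<^sub>M \<mu>)) (\<lambda>(m, u). \<integral>x. ?\<Phi> x (m, u) \<partial>X)" by (simp add: split_beta')
    show ?thesis using LU.integral_snd[OF i2] by (simp add: split_beta')
  qed
  also have "\<dots> = (\<integral>(t, y). of_real (exp (-(t * (norm k)\<^sup>2))) * ?c y \<partial>(T \<Otimes>\<^sub>M \<mu>))"
  proof (rule integral_cong_AE)
    show "AE u in T \<Otimes>\<^sub>M \<mu>. (\<integral>m. \<integral>x. ?\<Phi> x (m, u) \<partial>X \<partial>L) = (case u of (t, y) \<Rightarrow> of_real (exp (-(t * (norm k)\<^sup>2))) * ?c y)"
      using AE_TM
    proof eventually_elim
      case (elim u)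
      obtain t y where u: "u = (t, y)" by force
      have t: "t > 0" using elim u by simp
      let ?G = "\<lambda>z. (heat t z *\<^sub>R ?c z) * ?c y"
      let ?H = "\<lambda>z. complex_of_real (heat t (z - y)) * ?c z"
      have iG: "integrable lborel ?G" by (intro integrable_mult_left integrable_heat_cis t)
      have H: "?H = (\<lambda>z. ?G (z + -y))"
      proof
        fix z
        have "?c z = ?c (z + -y) * ?c y" by (simp add: cis_mult inner_diff_right algebra_simps)
        then show "?H z = ?G (z + -y)" by (simp add: scaleR_conv_of_real)
      qed
      have iH: "integrable lborel ?H" unfolding H by (rule integrable_lborel_shift[OF iG])
      have "(\<integral>m. \<integral>x. ?\<Phi> x (m, u) \<partial>X \<partial>L) = (\<integral>m. \<integral>x. ?H (x + 2 *\<^sub>R m) \<partial>X \<partial>L)"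
        by (intro Bochner_Integration.integral_cong refl) (simp add: sing_def u cis_lattice_period[OF k])
      also have "\<dots> = (\<integral>z. ?H z \<partial>lborel)" by (rule unfold_integral[OF iH])
      also have "\<dots> = (\<integral>z. ?G z \<partial>lborel)" unfolding H by (rule integral_lborel_shift[OF iG])
      also have "\<dots> = of_real (exp (-(t * (norm k)\<^sup>2))) * ?c y"
        by (simp only: integral_mult_left_zero integral_heat_cis[OF t])
      finally show ?case by (simp add: u)
    qed
    have "integrable (L \<Otimes>\<^sub>M (T \<Otimes>\<^sub>M \<mu>)) (\<lambda>p. \<integral>x. ?\<Phi> x p \<partial>X)"
      using XY.integrable_snd[OF I] by simp
    then have i2: "integrable (L \<Otimes>\<^sub>M (T \<Otimes>\<^sub>M \<mu>)) (\<lambda>(m, u). \<integral>x. ?\<Phi> x (m, u) \<partial>X)" by (simp add: split_beta')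
    show "(\<lambda>u. \<integral>m. \<integral>x. ?\<Phi> x (m, u) \<partial>X \<partial>L) \<in> borel_measurable (T \<Otimes>\<^sub>M \<mu>)"
      using borel_measurable_integrable[OF LU.integrable_snd[OF i2]] by simp
    show "(\<lambda>(t, y). of_real (exp (-(t * (norm k)\<^sup>2))) * ?c y) \<in> borel_measurable (T \<Otimes>\<^sub>M \<mu>)"
      unfolding split_beta by measurable
  qed
  also have "\<dots> = (\<integral>t. \<integral>y. of_real (exp (-(t * (norm k)\<^sup>2))) * ?c y \<partial>\<mu> \<partial>T)"
  proof -
    have "integrable (T \<Otimes>\<^sub>M \<mu>) (\<lambda>(t, y). complex_of_real (exp (-(t * (norm k)\<^sup>2))) * ?c y)"
    proof (rule TMf.integrable_const_bound[where B=1])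
      show "AE u in T \<Otimes>\<^sub>M \<mu>. norm (case u of (t, y) \<Rightarrow> complex_of_real (exp (-(t * (norm k)\<^sup>2))) * ?c y) \<le> 1"
        using AE_TM by eventually_elim (auto simp: norm_mult)
      show "(\<lambda>(t, y). complex_of_real (exp (-(t * (norm k)\<^sup>2))) * ?c y) \<in> borel_measurable (T \<Otimes>\<^sub>M \<mu>)"
        unfolding split_beta by measurable
    qed
    then show ?thesis using TM.integral_fst[of "\<lambda>t y. complex_of_real (exp (-(t * (norm k)\<^sup>2))) * ?c y"] by simp
  qed
  also have "\<dots> = of_real (mix_coeff \<epsilon> k) * (\<integral>y. ?c y \<partial>\<mu>)"
    by (simp add: mix_coeff_def)
  finally show ?thesis .
qed

lemma integral_X_cis:
  assumes k: "k \<in> int_lattice"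
  shows "(\<integral>x. cis (pi * (k \<bullet> x)) \<partial>X) = (if k = 0 then 2 ^ DIM('a) else 0)"
  using integral_pbox_cis[OF k] by (simp add: integral_restrict_space set_lebesgue_integral_def)

lemma cos_cis: "complex_of_real (cos x) = (cis x + cis (- x)) / 2"
  by (simp add: complex_eq_iff)

text \<open>The cosine carries the two frequencies k and -k, each with weight one half. If j = 0,
  both indicators select k = 0 and their sum 2 restores the full value.\<close>

lemma integral_X_cos_cis:
  assumes k: "k \<in> int_lattice" and j: "j \<in> int_lattice"
  shows "(\<integral>x. complex_of_real (cos (pi * (k \<bullet> (x - y)))) * cis (-(pi * (j \<bullet> x))) \<partial>X)
     = 2 ^ DIM('a) / 2 * (indicator {j} k + indicator {-j} k) * cis (-(pi * (j \<bullet> y)))"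
proof -
  have j0: "j = 0" if "j = - j"
  proof -
    have "2 *\<^sub>R j = j + j" by (simp add: scaleR_2)
    also have "\<dots> = 0" using that by (metis add.right_inverse)
    finally show ?thesis by simp
  qed
  have i: "integrable X (\<lambda>x. c * cis (pi * (m \<bullet> x)))" for m c
    by (rule X.integrable_const_bound[where B="norm c"])
       (auto simp: norm_mult intro!: borel_measurable_times measurable_torus_borel[OF _ sets_X])
  have "(\<integral>x. complex_of_real (cos (pi * (k \<bullet> (x - y)))) * cis (-(pi * (j \<bullet> x))) \<partial>X)
     = (\<integral>x. cis (-(pi * (k \<bullet> y))) / 2 * cis (pi * ((k - j) \<bullet> x)) + cis (pi * (k \<bullet> y)) / 2 * cis (pi * ((- k - j) \<bullet> x)) \<partial>X)"
    by (intro Bochner_Integration.integral_cong refl)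
       (simp add: cos_cis add_divide_distrib distrib_right cis_mult inner_simps algebra_simps)
  also have "\<dots> = cis (-(pi * (k \<bullet> y))) / 2 * (\<integral>x. cis (pi * ((k - j) \<bullet> x)) \<partial>X) + cis (pi * (k \<bullet> y)) / 2 * (\<integral>x. cis (pi * ((- k - j) \<bullet> x)) \<partial>X)"
    by (subst Bochner_Integration.integral_add) (auto intro: i simp: integral_mult_right_zero)
  also have "\<dots> = 2 ^ DIM('a) / 2 * (indicator {j} k + indicator {-j} k) * cis (-(pi * (j \<bullet> y)))"
    using k j by (subst (1 2) integral_X_cis)
      (auto simp: int_lattice_diff int_lattice_uminus indicator_def add_eq_0_iff neg_eq_iff_add_eq_0 field_simps dest: j0)
  finally show ?thesis .
qed

lemma f2_measurable: "f2 \<in> borel_measurable borel"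
  by (intro borel_measurable_continuous_onI continuous_at_imp_continuous_on ballI isCont_f2)

lemma integrable_f2_X: "integrable X f2"
proof (rule X.integrable_const_bound)
  show "AE x in X. norm (f2 x) \<le> (\<integral>(k, y). \<bar>rest_coeff \<epsilon> k\<bar> \<partial>(L \<Otimes>\<^sub>M \<mu>))" using f2_bounded by simp
  show "f2 \<in> borel_measurable X" by (rule measurable_torus_borel[OF f2_measurable sets_X])
qed

lemma has_integral_lattice_indicator:
  assumes "j \<in> int_lattice"
  shows "has_bochner_integral L (indicator {j}) (1 :: complex)"
proof -
  have "has_bochner_integral L (\<lambda>k. indicator {j} k *\<^sub>R (1 :: complex)) (measure L {j} *\<^sub>R 1)"
    using assms by (intro has_bochner_integral_indicator) auto
  moreover have "(\<lambda>k. indicator {j} k *\<^sub>R (1 :: complex)) = indicator {j}"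
    by (auto simp: fun_eq_iff indicator_def)
  ultimately show ?thesis using assms by (simp add: measure_count_space)
qed

lemma integrable_rest_X: "integrable (X \<Otimes>\<^sub>M (L \<Otimes>\<^sub>M \<mu>)) (\<lambda>(x, k, y). \<bar>rest_coeff \<epsilon> k\<bar>)"
proof (rule XZ.Fubini_integrable)
  have "(\<lambda>(k, y). \<bar>rest_coeff \<epsilon> k\<bar>) \<in> borel_measurable (L \<Otimes>\<^sub>M \<mu>)"
    using integrable_rest_pair by auto
  then show "(\<lambda>(x, k, y). \<bar>rest_coeff \<epsilon> k\<bar>) \<in> borel_measurable (X \<Otimes>\<^sub>M (L \<Otimes>\<^sub>M \<mu>))"
    using measurable_compose[OF measurable_snd] by (simp add: split_beta')
qed (use integrable_rest_pair in simp_all)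

text \<open>Of the whole series only k = j and k = -j survive, with equal coefficients and half a
  weight each. The factor 2^n is the volume of the box.\<close>

lemma integral_f2_cis:
  assumes j: "j \<in> int_lattice"
  shows "(\<integral>x. complex_of_real (f2 x) * cis (-(pi * (j \<bullet> x))) \<partial>X)
     = 2 ^ DIM('a) * of_real (rest_coeff \<epsilon> j) * (\<integral>y. cis (-(pi * (j \<bullet> y))) \<partial>\<mu>) "
proof -
  let ?c = "\<lambda>x. cis (-(pi * (j \<bullet> x)))"
  let ?\<Phi> = "\<lambda>x (p :: 'a \<times> 'a). complex_of_real (case p of (k, y) \<Rightarrow> rest_coeff \<epsilon> k * cos (pi * (k \<bullet> (x - y)))) * ?c x"
  have I: "integrable (X \<Otimes>\<^sub>M (L \<Otimes>\<^sub>M \<mu>)) (\<lambda>(x, p). ?\<Phi> x p)"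
  proof (rule Bochner_Integration.integrable_bound[OF integrable_rest_X])
    note [measurable] = fst_X
    have "(\<lambda>q. rest_coeff \<epsilon> (fst (snd q)) * cos (pi * (fst (snd q) \<bullet> (fst q - snd (snd q))))) \<in> borel_measurable (X \<Otimes>\<^sub>M (L \<Otimes>\<^sub>M \<mu>))"
    proof -
      have [measurable]: "(\<lambda>q. fst (snd q)) \<in> borel_measurable (X \<Otimes>\<^sub>M (L \<Otimes>\<^sub>M \<mu>))"
        "(\<lambda>q. snd (snd q)) \<in> borel_measurable (X \<Otimes>\<^sub>M (L \<Otimes>\<^sub>M \<mu>))"
        using measurable_comp[OF measurable_snd fst_L] measurable_comp[OF measurable_snd snd_id_mu]
        by (simp_all add: comp_def)
      have [measurable]: "(\<lambda>q. rest_coeff \<epsilon> (fst (snd q))) \<in> borel_measurable (X \<Otimes>\<^sub>M (L \<Otimes>\<^sub>M \<mu>))"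
        using measurable_compose[OF measurable_compose[OF measurable_snd measurable_fst] rest_measurable] .
      show ?thesis by measurable
    qed
    then show "(\<lambda>(x, p). ?\<Phi> x p) \<in> borel_measurable (X \<Otimes>\<^sub>M (L \<Otimes>\<^sub>M \<mu>))"
      unfolding split_beta by measurable
  qed (intro AE_I2, simp add: case_prod_unfold norm_mult abs_mult mult_left_le)
  have "(\<integral>x. complex_of_real (f2 x) * ?c x \<partial>X) = (\<integral>x. \<integral>p. ?\<Phi> x p \<partial>(L \<Otimes>\<^sub>M \<mu>) \<partial>X)"
    by (simp add: f2_def)
  also have "\<dots> = (\<integral>p. \<integral>x. ?\<Phi> x p \<partial>X \<partial>(L \<Otimes>\<^sub>M \<mu>))"
    using XZ.Fubini_integral[OF I] by simp
  also have "\<dots> = (\<integral>(k, y). (2 ^ DIM('a) / 2 * of_real (rest_coeff \<epsilon> j) * (indicator {j} k + indicator {-j} k)) * ?c y \<partial>(L \<Otimes>\<^sub>M \<mu>))"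
  proof (intro Bochner_Integration.integral_cong refl)
    fix p assume "p \<in> space (L \<Otimes>\<^sub>M \<mu>)"
    then obtain k y where p: "p = (k, y)" "k \<in> int_lattice" by (auto simp: space_pair_measure)
    have "(\<integral>x. ?\<Phi> x p \<partial>X) = (\<integral>x. of_real (rest_coeff \<epsilon> k) * (complex_of_real (cos (pi * (k \<bullet> (x - y)))) * ?c x) \<partial>X)"
      by (intro Bochner_Integration.integral_cong refl) (simp add: p mult.assoc)
    also have "\<dots> = of_real (rest_coeff \<epsilon> k) * (2 ^ DIM('a) / 2 * (indicator {j} k + indicator {-j} k) * ?c y)"
      by (simp only: integral_mult_right_zero integral_X_cos_cis[OF p(2) j])
    also have "\<dots> = (2 ^ DIM('a) / 2 * of_real (rest_coeff \<epsilon> j) * (indicator {j} k + indicator {-j} k)) * ?c y"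
      by (cases "k = j \<or> k = - j") auto
    finally show "(\<integral>x. ?\<Phi> x p \<partial>X) = (case p of (k, y) \<Rightarrow> (2 ^ DIM('a) / 2 * of_real (rest_coeff \<epsilon> j) * (indicator {j} k + indicator {-j} k)) * ?c y)"
      by (simp add: p)
  qed
  also have "\<dots> = (\<integral>k. \<integral>y. (2 ^ DIM('a) / 2 * of_real (rest_coeff \<epsilon> j) * (indicator {j} k + indicator {-j} k)) * ?c y \<partial>\<mu> \<partial>L)"
  proof -
    have "integrable (L \<Otimes>\<^sub>M \<mu>) (\<lambda>(k, y). (2 ^ DIM('a) / 2 * of_real (rest_coeff \<epsilon> j) * (indicator {j} k + indicator {-j} k)) * ?c y)"
    proof (rule Lm.Fubini_integrable)
      show "(\<lambda>(k, y). (2 ^ DIM('a) / 2 * of_real (rest_coeff \<epsilon> j) * (indicator {j} k + indicator {-j} k)) * ?c y) \<in> borel_measurable (L \<Otimes>\<^sub>M \<mu>)"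
        by (rule lattice_pair_measurable, rule measurable_torus_borel[OF _ sets_mu]) measurable
      have "integrable L (\<lambda>k. norm (2 ^ DIM('a) / 2 * of_real (rest_coeff \<epsilon> j) * (indicator {j} k + indicator {-j} k :: complex)) * measure \<mu> (space \<mu>))"
        using has_integral_lattice_indicator[OF j] has_integral_lattice_indicator[OF int_lattice_uminus[OF j]]
        by (auto simp: has_bochner_integral_iff intro!: integrable_norm integrable_mult_left integrable_mult_right)
      then show "integrable L (\<lambda>k. \<integral>y. norm (case (k, y) of (k, y) \<Rightarrow> (2 ^ DIM('a) / 2 * of_real (rest_coeff \<epsilon> j) * (indicator {j} k + indicator {-j} k)) * ?c y) \<partial>\<mu>)"
        by (simp add: norm_mult mult_ac)
      have "integrable \<mu> ?c"
        by (rule \<mu>.integrable_const_bound[where B=1], simp, rule measurable_torus_borel[OF _ sets_mu], measurable)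
      then show "AE k in L. integrable \<mu> (\<lambda>y. case (k, y) of (k, y) \<Rightarrow> (2 ^ DIM('a) / 2 * of_real (rest_coeff \<epsilon> j) * (indicator {j} k + indicator {-j} k)) * ?c y)"
        by (intro AE_I2) (simp only: prod.case integrable_mult_right)
    qed
    then show ?thesis using Lm.integral_fst[of "\<lambda>k y. (2 ^ DIM('a) / 2 * of_real (rest_coeff \<epsilon> j) * (indicator {j} k + indicator {-j} k)) * ?c y"] by simp
  qed
  also have "\<dots> = (\<integral>k. (2 ^ DIM('a) / 2 * of_real (rest_coeff \<epsilon> j)) * ((indicator {j} k + indicator {-j} k) * (\<integral>y. ?c y \<partial>\<mu>)) \<partial>L)"
    by (simp only: integral_mult_right_zero mult.assoc)
  also have "\<dots> = (2 ^ DIM('a) / 2 * of_real (rest_coeff \<epsilon> j)) * ((1 + 1) * (\<integral>y. ?c y \<partial>\<mu>))"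
    using has_bochner_integral_add[OF has_integral_lattice_indicator[OF j] has_integral_lattice_indicator[OF int_lattice_uminus[OF j]]]
    by (simp only: integral_mult_right_zero integral_mult_left_zero has_bochner_integral_iff)
  finally show ?thesis by simp
qed

end

text \<open>Regularity of codimension one. The upper bound is required at every centre, because the
  heat estimate places balls at grid points; the lower bound makes sense only at points of the
  carrier \<Gamma>.\<close>

locale regular_torus_measure = torus_measure +
  fixes \<Gamma> :: "'a set" and K c r0 :: real
  assumes eps1: "\<epsilon> < 1" and closed_\<Gamma>: "closed \<Gamma>"
    and \<Gamma>_shift: "\<And>x k. x \<in> \<Gamma> \<Longrightarrow> k \<in> int_lattice \<Longrightarrow> x + 2 *\<^sub>R k \<in> \<Gamma>"
    and supp: "emeasure \<mu> (pbox - \<Gamma>) = 0"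
    and K: "0 \<le> K" and c: "0 < c" and r0: "0 < r0"
    and upper: "\<And>z r. 0 < r \<Longrightarrow> r \<le> 1 \<Longrightarrow> emeasure \<mu> (pbox \<inter> pext (ball z r)) \<le> ennreal (K * r ^ (DIM('a) - 1))"
    and lower: "\<And>p r. p \<in> \<Gamma> \<Longrightarrow> 0 < r \<Longrightarrow> r \<le> r0 \<Longrightarrow> ennreal (c * r ^ (DIM('a) - 1)) \<le> emeasure \<mu> (pbox \<inter> pext (ball p r))"
begin

lemma \<Gamma>_measurable [measurable]: "\<Gamma> \<in> sets borel"
  using closed_\<Gamma> by simp

lemma M_ball: "r \<le> 1 \<Longrightarrow> emeasure M (ball z r) = emeasure \<mu> (pbox \<inter> pext (ball z r))"
  by (rule emeasure_periodization_ball[OF \<mu>.sigma_finite_measure_axioms sets_mu])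

lemma AE_M: "AE y in M. y \<in> \<Gamma>"
proof (rule AE_I)
  show "{y \<in> space M. y \<notin> \<Gamma>} \<subseteq> - \<Gamma>" by auto
  show "- \<Gamma> \<in> sets M" by simp
  have "emeasure M (- \<Gamma>) = (\<integral>\<^sup>+y. indicator (- \<Gamma>) y \<partial>M)" by simp
  also have "\<dots> = (\<integral>\<^sup>+m. \<integral>\<^sup>+y. indicator (- \<Gamma>) (y + 2 *\<^sub>R m) \<partial>\<mu> \<partial>L)"
    by (rule nn_integral_periodization[OF \<mu>.sigma_finite_measure_axioms sets_mu]) (intro borel_measurable_indicator, simp)
  also have "\<dots> = (\<integral>\<^sup>+m. \<integral>\<^sup>+y. indicator (pbox - \<Gamma>) y \<partial>\<mu> \<partial>L)"
  proof (intro nn_integral_cong)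
    fix m y assume m: "m \<in> space L" and y: "y \<in> space \<mu>"
    have "y + 2 *\<^sub>R m \<in> \<Gamma> \<longleftrightarrow> y \<in> \<Gamma>"
      using \<Gamma>_shift[of y m] \<Gamma>_shift[of "y + 2 *\<^sub>R m" "-m"] m by (auto simp: int_lattice_uminus)
    then show "indicator (- \<Gamma>) (y + 2 *\<^sub>R m) = (indicator (pbox - \<Gamma>) y :: ennreal)"
      using y by (auto simp: indicator_def space_mu)
  qed
  also have "\<dots> = (\<integral>\<^sup>+m. emeasure \<mu> (pbox - \<Gamma>) \<partial>L)"
    by (intro nn_integral_cong nn_integral_indicator) (auto simp: sets_mu sets_torus_borel)
  finally show "emeasure M (- \<Gamma>) = 0" by (simp add: supp)
qed

text \<open>Half of the exponent is spent on the distance: points of \<Gamma> are at least d away,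
  which yields exp(-a d^2/(2t)). The other half stays inside the integral for
  \<open>heat_estimate\<close>. The coefficient a is free because the continuity proof needs a
  flatter Gaussian than the heat kernel.\<close>

lemma gauss_upper:
  assumes a: "a > 0"
  obtains C where "C \<ge> 0"
    "\<And>x d. 0 < d \<Longrightarrow> (\<And>y. y \<in> \<Gamma> \<Longrightarrow> d \<le> dist x y) \<Longrightarrow>
      (\<integral>\<^sup>+t. \<integral>\<^sup>+y. ennreal ((4 * t / pi) powr (- real DIM('a) / 2) * exp (-(a * (norm (x - y))\<^sup>2 / t))) \<partial>M \<partial>T) \<le> ennreal (C * d powr (\<epsilon> - 1))"
proof -
  have G: "Gamma (\<epsilon> / 2) > 0" using eps by (intro Gamma_real_pos) simp
  have a2: "a / 2 > 0" using a by simp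
  have "0 < r \<Longrightarrow> r \<le> 1 \<Longrightarrow> emeasure M (ball z r) \<le> ennreal (K * r ^ (DIM('a) - 1))" for z r
    using upper M_ball by simp
  then obtain C0 where C0: "C0 \<ge> 0"
    "\<And>x t. 0 < t \<Longrightarrow> t \<le> 1 \<Longrightarrow> (\<integral>\<^sup>+y. exp (-(a / 2 * (norm (x - y))\<^sup>2 / t)) \<partial>M) \<le> ennreal (C0 * sqrt t ^ (DIM('a) - 1))"
    using heat_estimate[OF sets_periodization a2 K] by metis
  define n where "n = real DIM('a)"
  \<comment> \<open>The mixing weight has exponent \<epsilon>/2 - 1, and the heat flow adds -1/2.
    The tail in time converges because p < -1, that is \<epsilon> < 1; and 2 (p + 1) = \<epsilon> -
    1 is the exponent of the distance.\<close>
  define p where "p = \<epsilon> / 2 - 3 / 2"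
  have p: "-2 < p" "p < -1" using eps eps1 by (auto simp: p_def)
  define q where "q = (4 / pi) powr (- n / 2)"
  define D where "D = 1 / (p + 2) - 1 / (p + 1)"
  have D: "D \<ge> 0" using p by (auto simp: D_def divide_nonneg_neg intro: order_trans[of _ 0])
  define C where "C = q * C0 / Gamma (\<epsilon> / 2) * D * (a / 2) powr (p + 1)"
  have C: "C \<ge> 0" using C0 G D by (simp add: C_def q_def)
  moreover have "(\<integral>\<^sup>+t. \<integral>\<^sup>+y. ennreal ((4 * t / pi) powr (- real DIM('a) / 2) * exp (-(a * (norm (x - y))\<^sup>2 / t))) \<partial>M \<partial>T) \<le> ennreal (C * d powr (\<epsilon> - 1))"
    if d: "0 < d" and dist: "\<And>y. y \<in> \<Gamma> \<Longrightarrow> d \<le> dist x y" for x d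
  proof -
    define A where "A = a / 2 * d\<^sup>2"
    have A: "A > 0" using a d by (simp add: A_def)
    have inner: "(\<integral>\<^sup>+y. ennreal ((4 * t / pi) powr (- real DIM('a) / 2) * exp (-(a * (norm (x - y))\<^sup>2 / t))) \<partial>M)
       \<le> ennreal (q * C0 * (t powr (- 1 / 2) * exp (-(A / t))))" if t: "0 < t" "t < 1" for t
    proof -
      let ?P = "(4 * t / pi) powr (- n / 2)"
      have "(\<integral>\<^sup>+y. ennreal (?P * exp (-(a * (norm (x - y))\<^sup>2 / t))) \<partial>M)
        \<le> (\<integral>\<^sup>+y. ennreal (?P * exp (-(A / t))) * ennreal (exp (-(a / 2 * (norm (x - y))\<^sup>2 / t))) \<partial>M)"
      proof (rule nn_integral_mono_AE)
        show "AE y in M. ennreal (?P * exp (-(a * (norm (x - y))\<^sup>2 / t))) \<le> ennreal (?P * exp (-(A / t))) * ennreal (exp (-(a / 2 * (norm (x - y))\<^sup>2 / t)))"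
          using AE_M
        proof eventually_elim
          case (elim y)
          have "d\<^sup>2 \<le> (norm (x - y))\<^sup>2" using dist[OF elim] d by (intro power_mono) (auto simp: dist_norm)
          then have "a / (2 * t) * d\<^sup>2 \<le> a / (2 * t) * (norm (x - y))\<^sup>2" using a t by (intro mult_left_mono) auto
          then have "-(a * (norm (x - y))\<^sup>2 / t) \<le> -(A / t) + -(a / 2 * (norm (x - y))\<^sup>2 / t)"
            using t by (simp add: A_def field_simps)
          then have "exp (-(a * (norm (x - y))\<^sup>2 / t)) \<le> exp (-(A / t)) * exp (-(a / 2 * (norm (x - y))\<^sup>2 / t))"
            by (simp only: exp_add[symmetric] exp_le_cancel_iff)
          then have "?P * exp (-(a * (norm (x - y))\<^sup>2 / t)) \<le> ?P * (exp (-(A / t)) * exp (-(a / 2 * (norm (x - y))\<^sup>2 / t)))"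
            by (intro mult_left_mono) auto
          then show ?case by (simp add: ennreal_mult[symmetric] mult.assoc ennreal_leI)
        qed
      qed
      also have "\<dots> = ennreal (?P * exp (-(A / t))) * (\<integral>\<^sup>+y. ennreal (exp (-(a / 2 * (norm (x - y))\<^sup>2 / t))) \<partial>M)"
        by (rule nn_integral_cmult) measurable
      also have "\<dots> \<le> ennreal (?P * exp (-(A / t))) * ennreal (C0 * sqrt t ^ (DIM('a) - 1))"
        using t by (intro mult_left_mono C0) auto
      \<comment> \<open>The dimension cancels here: t^(-n/2) from the kernel times t^((n-1)/2) from
        the ball masses.\<close>
      also have "\<dots> = ennreal (q * C0 * (t powr (- 1 / 2) * exp (-(A / t))))"
      proof -
        have "sqrt t ^ (DIM('a) - 1) = t powr (1 / 2 * real (DIM('a) - 1))"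
          using t by (simp add: powr_half_sqrt[symmetric] powr_realpow[symmetric] powr_powr)
        also have "1 / 2 * real (DIM('a) - 1) = n / 2 - 1 / 2" by (simp add: n_def of_nat_diff DIM_positive Suc_leI diff_divide_distrib)
        finally have s: "sqrt t ^ (DIM('a) - 1) = t powr (n / 2 - 1 / 2)" .
        have "?P = q * t powr (- n / 2)" using t powr_mult[of "4 / pi" t "- n / 2"] by (simp add: q_def)
        then have "?P * exp (-(A / t)) * (C0 * sqrt t ^ (DIM('a) - 1)) = q * C0 * ((t powr (- n / 2) * t powr (n / 2 - 1 / 2)) * exp (-(A / t)))"
          unfolding s by (simp add: mult_ac)
        also have "t powr (- n / 2) * t powr (n / 2 - 1 / 2) = t powr (- 1 / 2)" by (simp flip: powr_add)
        finally have E: "?P * exp (-(A / t)) * (C0 * sqrt t ^ (DIM('a) - 1)) = q * C0 * (t powr (- 1 / 2) * exp (-(A / t)))" .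
        have "ennreal (?P * exp (-(A / t))) * ennreal (C0 * sqrt t ^ (DIM('a) - 1)) = ennreal (?P * exp (-(A / t)) * (C0 * sqrt t ^ (DIM('a) - 1)))"
          using C0(1) t by (intro ennreal_mult[symmetric]) auto
        then show ?thesis by (simp only: E)
      qed
      finally show ?thesis by (simp add: n_def)
    qed
    have "(\<integral>\<^sup>+t. \<integral>\<^sup>+y. ennreal ((4 * t / pi) powr (- real DIM('a) / 2) * exp (-(a * (norm (x - y))\<^sup>2 / t))) \<partial>M \<partial>T)
       \<le> (\<integral>\<^sup>+t. ennreal (q * C0 * (t powr (- 1 / 2) * exp (-(A / t)))) \<partial>T)"
      by (rule nn_integral_mono_AE) (use AE_gamma_mix in eventually_elim, use inner in auto)
    also have "\<dots> = (\<integral>\<^sup>+t. ennreal (indicator {0<..<1} t * (t powr (\<epsilon> / 2 - 1) / Gamma (\<epsilon> / 2))) * ennreal (q * C0 * (t powr (- 1 / 2) * exp (-(A / t)))) \<partial>lborel)"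
      by (rule nn_integral_gamma_mix[OF eps]) measurable
    also have "\<dots> \<le> (\<integral>\<^sup>+t. ennreal (q * C0 / Gamma (\<epsilon> / 2)) * ennreal (indicator {0<..} t * (t powr p * exp (-(A / t)))) \<partial>lborel)"
    proof (rule nn_integral_mono)
      fix t :: real
      have "t powr (\<epsilon> / 2 - 1) * t powr (- 1 / 2) = t powr p" by (simp add: p_def flip: powr_add)
      then have eq: "t powr (\<epsilon> / 2 - 1) / Gamma (\<epsilon> / 2) * (q * C0 * (t powr (- 1 / 2) * exp (-(A / t)))) = q * C0 / Gamma (\<epsilon> / 2) * (t powr p * exp (-(A / t)))"
        by (simp add: field_simps)
      show "ennreal (indicator {0<..<1} t * (t powr (\<epsilon> / 2 - 1) / Gamma (\<epsilon> / 2))) * ennreal (q * C0 * (t powr (- 1 / 2) * exp (-(A / t))))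
        \<le> ennreal (q * C0 / Gamma (\<epsilon> / 2)) * ennreal (indicator {0<..} t * (t powr p * exp (-(A / t))))"
      proof (cases "0 < t \<and> t < 1")
        case True
        then have "ennreal (indicator {0<..<1} t * (t powr (\<epsilon> / 2 - 1) / Gamma (\<epsilon> / 2))) * ennreal (q * C0 * (t powr (- 1 / 2) * exp (-(A / t))))
           = ennreal (t powr (\<epsilon> / 2 - 1) / Gamma (\<epsilon> / 2) * (q * C0 * (t powr (- 1 / 2) * exp (-(A / t)))))"
          using G C0(1) by (subst ennreal_mult) (auto simp: q_def)
        also have "\<dots> = ennreal (q * C0 / Gamma (\<epsilon> / 2)) * ennreal (indicator {0<..} t * (t powr p * exp (-(A / t))))"
          unfolding eq using G C0(1) True by (subst ennreal_mult) (auto simp: q_def)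
        finally show ?thesis by simp
      next
        case False
        then have "indicator {0<..<1} t = (0 :: real)" by simp
        then show ?thesis by simp
      qed
    qed
    also have "\<dots> = ennreal (q * C0 / Gamma (\<epsilon> / 2)) * (\<integral>\<^sup>+t. ennreal (indicator {0<..} t * (t powr p * exp (-(A / t)))) \<partial>lborel)"
      by (rule nn_integral_cmult) measurable
    also have "\<dots> \<le> ennreal (q * C0 / Gamma (\<epsilon> / 2)) * ennreal (D * A powr (p + 1))"
      unfolding D_def by (intro mult_left_mono nn_integral_powr_exp_bound A p) auto
    also have "\<dots> = ennreal (C * d powr (\<epsilon> - 1))"
    proof -
      have "(d\<^sup>2) powr (p + 1) = d powr (2 * (p + 1))" using d powr_powr[of d 2 "p + 1"] by simp
      also have "2 * (p + 1) = \<epsilon> - 1" by (simp add: p_def)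
      finally have "A powr (p + 1) = (a / 2) powr (p + 1) * d powr (\<epsilon> - 1)"
        unfolding A_def using a by (subst powr_mult) auto
      then show ?thesis using C0 G D by (simp add: ennreal_mult[symmetric] C_def q_def mult_ac)
    qed
    finally show ?thesis .
  qed
  ultimately show thesis using that by blast
qed

definition I1 :: "'a \<Rightarrow> ennreal" where
  "I1 x = (\<integral>\<^sup>+t. \<integral>\<^sup>+y. heat t (x - y) \<partial>M \<partial>T)"

lemma I1_upper:
  obtains C where "C \<ge> 0"
    "\<And>x d. 0 < d \<Longrightarrow> (\<And>y. y \<in> \<Gamma> \<Longrightarrow> d \<le> dist x y) \<Longrightarrow> I1 x \<le> ennreal (C * d powr (\<epsilon> - 1))"
proof (rule gauss_upper[of "pi\<^sup>2 / 4"])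
  fix C
  assume "C \<ge> 0" and C: "\<And>x d. 0 < d \<Longrightarrow> (\<And>y. y \<in> \<Gamma> \<Longrightarrow> d \<le> dist x y) \<Longrightarrow>
      (\<integral>\<^sup>+t. \<integral>\<^sup>+y. ennreal ((4 * t / pi) powr (- real DIM('a) / 2) * exp (-(pi\<^sup>2 / 4 * (norm (x - y))\<^sup>2 / t))) \<partial>M \<partial>T) \<le> ennreal (C * d powr (\<epsilon> - 1))"
  show thesis by (rule that[OF \<open>C \<ge> 0\<close>]) (unfold I1_def heat_def, rule C)
qed simp

text \<open>Let p be a nearest point of \<Gamma>, at distance d. The ball of radius d round p lies
  within 2 d of x, and for times between d^2/2 and d^2 the heat kernel is of its maximal order on
  that ball. The mass of the ball times the length of this time window gives the right
  power.\<close>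

lemma I1_lower:
  obtains C where "C > 0"
    "\<And>x. 0 < infdist x \<Gamma> \<Longrightarrow> infdist x \<Gamma> < min r0 1 \<Longrightarrow> ennreal (C * infdist x \<Gamma> powr (\<epsilon> - 1)) \<le> I1 x"
proof -
  have G: "Gamma (\<epsilon> / 2) > 0" using eps by (intro Gamma_real_pos) simp
  define n where "n = real DIM('a)"
  \<comment> \<open>For t > d^2/2 one has (2 d)^2 < 8 t, so the exponent of the heat kernel is at
    least -(pi^2/4) 8 = -2 pi^2. The 2 in the denominator comes from the length d^2/2 of the time
    window.\<close>
  define C where "C = (4 / pi) powr (- n / 2) * exp (-(2 * pi\<^sup>2)) * c / (2 * Gamma (\<epsilon> / 2))"
  have C: "C > 0" using c G by (simp add: C_def)
  moreover have "ennreal (C * infdist x \<Gamma> powr (\<epsilon> - 1)) \<le> I1 x"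
    if x: "0 < infdist x \<Gamma>" "infdist x \<Gamma> < min r0 1" for x
  proof -
    define d where "d = infdist x \<Gamma>"
    have d: "0 < d" "d < r0" "d < 1" using x by (auto simp: d_def)
    have "\<Gamma> \<noteq> {}" using x(1) by (auto simp: infdist_def)
    then obtain p where p: "p \<in> \<Gamma>" "dist x p = d"
      using infdist_attains_inf[OF closed_\<Gamma>, of x] unfolding d_def by metis
    define h0 where "h0 = (4 * d\<^sup>2 / pi) powr (- n / 2) * exp (-(2 * pi\<^sup>2))"
    have d2: "d\<^sup>2 < 1" using d by (simp add: power_less_one_iff abs_square_less_1)
    have inner: "ennreal (h0 * (c * d ^ (DIM('a) - 1))) \<le> (\<integral>\<^sup>+y. heat t (x - y) \<partial>M)"
      if t: "d\<^sup>2 / 2 < t" "t < d\<^sup>2" for t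
    proof -
      have t0: "t > 0" using t d by (smt (verit) zero_le_power2 field_sum_of_halves)
      have "ennreal (h0 * (c * d ^ (DIM('a) - 1))) = ennreal h0 * ennreal (c * d ^ (DIM('a) - 1))"
        using c d by (simp add: ennreal_mult h0_def)
      also have "\<dots> \<le> ennreal h0 * emeasure M (ball p d)"
        using d lower[OF p(1), of d] by (intro mult_left_mono) (simp_all add: M_ball)
      also have "\<dots> = (\<integral>\<^sup>+y. ennreal h0 * indicator (ball p d) y \<partial>M)"
        by (subst nn_integral_cmult_indicator) auto
      also have "\<dots> \<le> (\<integral>\<^sup>+y. heat t (x - y) \<partial>M)"
      proof (rule nn_integral_mono)
        fix y
        show "ennreal h0 * indicator (ball p d) y \<le> ennreal (heat t (x - y))"
        proof (cases "y \<in> ball p d")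
          case True
          then have "norm (x - y) \<le> 2 * d"
            using dist_triangle[of x y p] p by (simp add: dist_norm)
          then have "(norm (x - y))\<^sup>2 \<le> (2 * d)\<^sup>2" by (intro power_mono) auto
          then have "(norm (x - y))\<^sup>2 \<le> 4 * d\<^sup>2" by (simp add: power_mult_distrib)
          also have "\<dots> \<le> 8 * t" using t by simp
          finally have "pi\<^sup>2 / 4 / t * (norm (x - y))\<^sup>2 \<le> pi\<^sup>2 / 4 / t * (8 * t)"
            using t0 by (intro mult_left_mono) auto
          then have 1: "exp (-(2 * pi\<^sup>2)) \<le> exp (-(pi\<^sup>2 / 4 * (norm (x - y))\<^sup>2 / t))" using t0 by simp
          have 2: "(4 * d\<^sup>2 / pi) powr (- n / 2) \<le> (4 * t / pi) powr (- n / 2)"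
            using t t0 by (intro powr_mono2') (auto simp: n_def divide_right_mono)
          have "h0 \<le> heat t (x - y)"
            unfolding h0_def heat_def n_def[symmetric] by (intro mult_mono 1 2) auto
          then show ?thesis using True by (simp add: ennreal_leI)
        qed simp
      qed
      finally show ?thesis .
    qed
    define w where "w = (d\<^sup>2) powr (\<epsilon> / 2 - 1) / Gamma (\<epsilon> / 2)"
    \<comment> \<open>Measurability in t is obtained from the lattice sum of integrals against the
      finite measure \<mu>, so that no sigma-finiteness of the periodised measure has to be
      established.\<close>
    have m2: "(\<lambda>t. \<integral>\<^sup>+y. ennreal (heat t (x - y)) \<partial>M) \<in> borel_measurable borel"
    proof -
      have "(\<lambda>t. \<integral>\<^sup>+m. \<integral>\<^sup>+y. ennreal (heat t (x - (y + 2 *\<^sub>R m))) \<partial>\<mu> \<partial>L) \<in> borel_measurable borel"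
      proof (rule L.borel_measurable_nn_integral)
        have *: "(\<lambda>t. \<integral>\<^sup>+y. ennreal (heat t (x - (y + 2 *\<^sub>R m))) \<partial>\<mu>) \<in> borel_measurable borel" for m
          by (rule \<mu>.borel_measurable_nn_integral) (use id_mu in measurable)
        have "(\<lambda>(m, t). \<integral>\<^sup>+y. ennreal (heat t (x - (y + 2 *\<^sub>R m))) \<partial>\<mu>) \<in> borel_measurable (L \<Otimes>\<^sub>M borel)"
          by (rule lattice_pair_measurable[OF *])
        then show "(\<lambda>(t, m). \<integral>\<^sup>+y. ennreal (heat t (x - (y + 2 *\<^sub>R m))) \<partial>\<mu>) \<in> borel_measurable (borel \<Otimes>\<^sub>M L)"
          by (subst (asm) measurable_pair_swap_iff) (simp add: split_beta')
      qed
      moreover have "(\<integral>\<^sup>+y. ennreal (heat t (x - y)) \<partial>M) = (\<integral>\<^sup>+m. \<integral>\<^sup>+y. ennreal (heat t (x - (y + 2 *\<^sub>R m))) \<partial>\<mu> \<partial>L)" for t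
        by (rule nn_integral_periodization[OF \<mu>.sigma_finite_measure_axioms sets_mu]) measurable
      ultimately show ?thesis by simp
    qed
    have "C * d powr (\<epsilon> - 1) = w * (h0 * (c * d ^ (DIM('a) - 1))) * (d\<^sup>2 / 2)"
    proof -
      have e1: "(d\<^sup>2) powr s = d powr (2 * s)" for s using d powr_powr[of d 2 s] by simp
      have e2: "(4 * d\<^sup>2 / pi) powr (- n / 2) = (4 / pi) powr (- n / 2) * d powr (- n)"
        using powr_mult[of "4 / pi" "d\<^sup>2" "- n / 2"] e1[of "- n / 2"] by simp
      have "real (DIM('a) - 1) = n - 1" by (simp add: n_def of_nat_diff DIM_positive Suc_leI)
      then have e3: "d ^ (DIM('a) - 1) = d powr (n - 1)" using d by (simp add: powr_realpow[symmetric])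
      have e4: "d\<^sup>2 = d powr 2" using d by simp
      have "w * (h0 * (c * d ^ (DIM('a) - 1))) * (d\<^sup>2 / 2) = C * (d powr (2 * (\<epsilon> / 2 - 1)) * (d powr (- n) * (d powr (n - 1) * d powr 2)))"
        unfolding w_def h0_def e3 e2 e1 C_def e4[symmetric] by (simp add: field_simps)
      also have "d powr (2 * (\<epsilon> / 2 - 1)) * (d powr (- n) * (d powr (n - 1) * d powr 2)) = d powr (\<epsilon> - 1)"
        by (simp only: powr_add[symmetric]) (simp add: algebra_simps)
      finally show ?thesis by simp
    qed
    then have "ennreal (C * d powr (\<epsilon> - 1)) = ennreal (w * (h0 * (c * d ^ (DIM('a) - 1)))) * emeasure lborel {d\<^sup>2 / 2<..<d\<^sup>2}"
      using d c G by (simp add: ennreal_mult[symmetric] w_def h0_def)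
    also have "\<dots> = (\<integral>\<^sup>+t. ennreal (w * (h0 * (c * d ^ (DIM('a) - 1)))) * indicator {d\<^sup>2 / 2<..<d\<^sup>2} t \<partial>lborel)"
      by (subst nn_integral_cmult_indicator) auto
    also have "\<dots> \<le> (\<integral>\<^sup>+t. ennreal (indicator {0<..<1} t * (t powr (\<epsilon> / 2 - 1) / Gamma (\<epsilon> / 2))) * (\<integral>\<^sup>+y. heat t (x - y) \<partial>M) \<partial>lborel)"
    proof (rule nn_integral_mono)
      fix t :: real
      show "ennreal (w * (h0 * (c * d ^ (DIM('a) - 1)))) * indicator {d\<^sup>2 / 2<..<d\<^sup>2} t
        \<le> ennreal (indicator {0<..<1} t * (t powr (\<epsilon> / 2 - 1) / Gamma (\<epsilon> / 2))) * (\<integral>\<^sup>+y. heat t (x - y) \<partial>M)"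
      proof (cases "d\<^sup>2 / 2 < t \<and> t < d\<^sup>2")
        case True
        have t01: "0 < t" "t < 1" using True d d2 by (smt (verit) zero_le_power2 field_sum_of_halves)+
        have "w \<le> t powr (\<epsilon> / 2 - 1) / Gamma (\<epsilon> / 2)"
          unfolding w_def using True t01 G eps1 by (intro divide_right_mono powr_mono2') auto
        then have "ennreal w \<le> ennreal (t powr (\<epsilon> / 2 - 1) / Gamma (\<epsilon> / 2))" by (rule ennreal_leI)
        then have "ennreal w * ennreal (h0 * (c * d ^ (DIM('a) - 1))) \<le> ennreal (t powr (\<epsilon> / 2 - 1) / Gamma (\<epsilon> / 2)) * (\<integral>\<^sup>+y. heat t (x - y) \<partial>M)"
          using True by (intro mult_mono inner) auto
        moreover have "ennreal (w * (h0 * (c * d ^ (DIM('a) - 1)))) = ennreal w * ennreal (h0 * (c * d ^ (DIM('a) - 1)))"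
          using d c G by (intro ennreal_mult) (auto simp: w_def h0_def)
        ultimately show ?thesis using True t01 by simp
      qed simp
    qed
    also have "\<dots> = I1 x"
      unfolding I1_def by (rule nn_integral_gamma_mix[OF eps m2, symmetric])
    finally show ?thesis by (simp add: d_def)
  qed
  ultimately show thesis using that by blast
qed

lemma f1_I1: "f1 x = enn2real (I1 x)"
  by (simp add: f1_eq' I1_def)

text \<open>Dominated convergence. If \<open>x0\<close> has distance at least d from \<Gamma> and x
  is within d/2 of \<open>x0\<close>, then |x-y| is at least half of |x0-y| for y on \<Gamma>.
  Halving the distance divides the exponent by 4, which is where the coefficient pi^2/16 of the
  dominating Gaussian comes from.\<close>

lemma isCont_f1:
  assumes x0: "x0 \<notin> \<Gamma>"
  shows "isCont f1 x0"
proof -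
  have "open (- \<Gamma>)" using closed_\<Gamma> by (rule open_Compl)
  then obtain d where d: "d > 0" "ball x0 d \<subseteq> - \<Gamma>" using x0 by (auto simp: open_contains_ball)
  have dist: "d \<le> dist x0 y" if "y \<in> \<Gamma>" for y using d that by (force simp: subset_eq)
  define g where "g t z = (4 * t / pi) powr (- real DIM('a) / 2) * exp (-(pi\<^sup>2 / 16 * (norm (z::'a))\<^sup>2 / t))" for t z
  have gm [measurable]: "(\<lambda>p. g (f p) (h p)) \<in> borel_measurable N"
    if [measurable]: "f \<in> borel_measurable N" "h \<in> borel_measurable N" for f h and N :: "'z measure"
    unfolding g_def by measurable
  let ?Y = "L \<Otimes>\<^sub>M (T \<Otimes>\<^sub>M \<mu>)"
  let ?w = "\<lambda>(m, t, y). g t (x0 + 2 *\<^sub>R m - y)"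
  have wm: "?w \<in> borel_measurable ?Y"
  proof (rule lattice_pair_measurable)
    fix m
    show "(\<lambda>(t, y). g t (x0 + 2 *\<^sub>R m - y)) \<in> borel_measurable (T \<Otimes>\<^sub>M \<mu>)"
      unfolding g_def split_beta by measurable
  qed
  have iw: "integrable ?Y ?w"
  proof (rule integrableI_bounded[OF wm])
    have C: "(\<integral>\<^sup>+t. \<integral>\<^sup>+y. ennreal (g t (x0 - y)) \<partial>M \<partial>T) < \<infinity>"
    proof (rule gauss_upper[of "pi\<^sup>2 / 16"])
      fix C assume C: "\<And>x d. 0 < d \<Longrightarrow> (\<And>y. y \<in> \<Gamma> \<Longrightarrow> d \<le> dist x y) \<Longrightarrow>
        (\<integral>\<^sup>+t. \<integral>\<^sup>+y. ennreal ((4 * t / pi) powr (- real DIM('a) / 2) * exp (-(pi\<^sup>2 / 16 * (norm (x - y))\<^sup>2 / t))) \<partial>M \<partial>T) \<le> ennreal (C * d powr (\<epsilon> - 1))"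
      show ?thesis unfolding g_def by (rule le_less_trans[OF C[OF d(1) dist]]) auto
    qed simp
    have "(\<integral>\<^sup>+p. ennreal (norm (?w p)) \<partial>?Y) = (\<integral>\<^sup>+(m, t, y). ennreal (g t (x0 + 2 *\<^sub>R m - y)) \<partial>?Y)"
      by (intro nn_integral_cong) (auto simp: g_def)
    also have "\<dots> = (\<integral>\<^sup>+t. \<integral>\<^sup>+y. ennreal (g t (x0 - y)) \<partial>M \<partial>T)"
      by (rule nn_integral_lattice_fubini) (simp add: g_def)
    also note C
    finally show "(\<integral>\<^sup>+p. ennreal (norm (?w p)) \<partial>?Y) < \<infinity>" .
  qed
  \<comment> \<open>The exceptional set is treated as an integrand: its indicator depends only on t
    and on the difference of the points, so the exchange of sums and integrals applies to it as
    well.\<close>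
  have AEY: "AE p in ?Y. (case p of (m, t, y) \<Rightarrow> 0 < t \<and> y - 2 *\<^sub>R m \<in> \<Gamma>)"
  proof -
    let ?B = "{(t, z). t \<le> (0::real) \<or> x0 - z \<notin> \<Gamma>}"
    have B: "?B \<in> sets (borel \<Otimes>\<^sub>M borel)"
    proof -
      have "?B = {p \<in> space (borel \<Otimes>\<^sub>M borel). fst p \<le> (0::real)} \<union> (\<lambda>p. x0 - snd p) -` (- \<Gamma>) \<inter> space (borel \<Otimes>\<^sub>M borel)"
        by (auto simp: space_pair_measure)
      also have "\<dots> \<in> sets (borel \<Otimes>\<^sub>M borel)"
      proof (intro sets.Un measurable_sets)
        show "(\<lambda>p. x0 - snd p) \<in> borel_measurable ((borel :: real measure) \<Otimes>\<^sub>M borel)" by measurable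
        show "- \<Gamma> \<in> sets borel" using \<open>open (- \<Gamma>)\<close> by (rule borel_open)
      qed measurable
      finally show ?thesis .
    qed
    let ?g = "\<lambda>t z. indicator ?B (t, z) :: ennreal"
    have gB: "(\<lambda>(t, z). ?g t z) \<in> borel_measurable (borel \<Otimes>\<^sub>M borel)"
      using B by (simp add: split_beta')
    have "(\<integral>\<^sup>+(m, t, y). ?g t (x0 + 2 *\<^sub>R m - y) \<partial>?Y) = (\<integral>\<^sup>+t. \<integral>\<^sup>+y. ?g t (x0 - y) \<partial>M \<partial>T)"
      by (rule nn_integral_lattice_fubini[OF gB])
    also have "\<dots> = (\<integral>\<^sup>+t. 0 \<partial>T)"
    proof (rule nn_integral_cong_AE)
      show "AE t in T. (\<integral>\<^sup>+y. ?g t (x0 - y) \<partial>M) = 0"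
        using AE_gamma_mix
      proof eventually_elim
        case (elim t)
        have "(\<integral>\<^sup>+y. ?g t (x0 - y) \<partial>M) = (\<integral>\<^sup>+y. 0 \<partial>M)"
          by (rule nn_integral_cong_AE) (use AE_M in eventually_elim, use elim in auto)
        then show ?case by simp
      qed
    qed
    finally have z: "(\<integral>\<^sup>+(m, t, y). ?g t (x0 + 2 *\<^sub>R m - y) \<partial>?Y) = 0" by simp
    have "(\<lambda>(m, t, y). ?g t (x0 + 2 *\<^sub>R m - y)) \<in> borel_measurable ?Y"
    proof (rule lattice_pair_measurable)
      fix m
      have "(\<lambda>u. (fst u, x0 + 2 *\<^sub>R m - snd u)) \<in> T \<Otimes>\<^sub>M \<mu> \<rightarrow>\<^sub>M borel \<Otimes>\<^sub>M borel" by measurable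
      from measurable_compose[OF this gB] show "(\<lambda>(t, y). ?g t (x0 + 2 *\<^sub>R m - y)) \<in> borel_measurable (T \<Otimes>\<^sub>M \<mu>)"
        by (simp add: split_beta')
    qed
    then have "AE p in ?Y. (case p of (m, t, y) \<Rightarrow> ?g t (x0 + 2 *\<^sub>R m - y)) = 0"
      using z by (subst (asm) nn_integral_0_iff_AE) auto
    then show ?thesis
      by eventually_elim (auto simp: indicator_def not_le split: if_splits)
  qed
  show ?thesis
    unfolding f1_def
  proof (rule isCont_integral_dominated[where \<delta>="d / 2", OF _ _ iw])
    show "sing x \<in> borel_measurable ?Y" for x by measurable
    show "AE p in ?Y. \<bar>sing x p\<bar> \<le> ?w p" if x: "dist x x0 < d / 2" for x
      using AEY
    proof eventually_elim
      case (elim p)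
      obtain m t y where p: "p = (m, t, y)" by (metis prod_cases3)
      have t: "t > 0" and y: "y - 2 *\<^sub>R m \<in> \<Gamma>" using elim p by auto
      define y' where "y' = y - 2 *\<^sub>R m"
      have e: "x + 2 *\<^sub>R m - y = x - y'" "x0 + 2 *\<^sub>R m - y = x0 - y'" by (auto simp: y'_def)
      have "d \<le> norm (x0 - y')" using dist[of y'] y by (simp add: y'_def dist_norm)
      moreover have "norm (x0 - y') \<le> norm (x0 - x) + norm (x - y')" by (rule order_trans[OF _ norm_triangle_ineq]) simp
      ultimately have "norm (x0 - y') / 2 \<le> norm (x - y')" using x by (simp add: dist_norm norm_minus_commute)
      then have "(norm (x0 - y') / 2)\<^sup>2 \<le> (norm (x - y'))\<^sup>2" by (intro power_mono) auto
      then have "pi\<^sup>2 / 4 / t * (norm (x0 - y') / 2)\<^sup>2 \<le> pi\<^sup>2 / 4 / t * (norm (x - y'))\<^sup>2"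
        using t by (intro mult_left_mono) auto
      then have "exp (-(pi\<^sup>2 / 4 * (norm (x - y'))\<^sup>2 / t)) \<le> exp (-(pi\<^sup>2 / 16 * (norm (x0 - y'))\<^sup>2 / t))"
        by (simp add: power_divide)
      then have "heat t (x - y') \<le> g t (x0 - y')"
        unfolding heat_def g_def by (intro mult_left_mono) auto
      then show ?case by (simp add: p sing_def e heat_nonneg)
    qed
    show "AE p in ?Y. isCont (\<lambda>x. sing x p) x0"
      using AEY
      by eventually_elim (auto simp: sing_def heat_def split_beta intro!: continuous_intros)
  qed (use d in auto)
qed

theorem inv_frac_grad_regular:
  "\<exists>f. inv_frac_grad \<epsilon> \<mu> f \<and> continuous_on (- \<Gamma>) f \<and> comparable_near \<Gamma> f (\<lambda>x. infdist x \<Gamma> powr (\<epsilon> - 1))"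
proof (intro exI conjI)
  \<comment> \<open>The characters have squared norm 2^n on the box; dividing by it makes the
    coefficients of the two parts add up.\<close>
  define g2 where "g2 x = f2 x / 2 ^ DIM('a)" for x
  let ?f = "\<lambda>x. f1 x + g2 x"
  have ig2: "integrable X g2" unfolding g2_def using integrable_f2_X by simp
  have i: "integrable X ?f" using integrable_f1 ig2 by simp
  show "inv_frac_grad \<epsilon> \<mu> ?f"
    unfolding inv_frac_grad_def
  proof (intro conjI ballI)
    show "periodic ?f" using periodic_f1 periodic_f2 by (simp add: periodic_def g2_def)
    show "set_integrable lborel pbox ?f"
      using i by (simp add: set_integrable_def integrable_restrict_space)
    fix k :: 'a assume k: "k \<in> int_lattice"
    let ?c = "\<lambda>x. cis (-(pi * (k \<bullet> x)))"
    have int: "integrable X (\<lambda>x. complex_of_real (f x) * ?c x)" if "integrable X f" for f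
    proof (rule Bochner_Integration.integrable_bound[OF that])
      have [measurable]: "f \<in> borel_measurable X" using that by auto
      note [measurable] = cis_X_measurable[of k]
      show "(\<lambda>x. complex_of_real (f x) * ?c x) \<in> borel_measurable X" by measurable
    qed (simp add: norm_mult)
    have "(LINT x:pbox|lborel. complex_of_real (?f x) * ?c x) = (\<integral>x. complex_of_real (?f x) * ?c x \<partial>X)"
      by (simp add: integral_restrict_space set_lebesgue_integral_def)
    also have "\<dots> = (\<integral>x. complex_of_real (f1 x) * ?c x + complex_of_real (g2 x) * ?c x \<partial>X)"
      by (simp add: distrib_right)
    also have "\<dots> = (\<integral>x. complex_of_real (f1 x) * ?c x \<partial>X) + (\<integral>x. complex_of_real (g2 x) * ?c x \<partial>X)"
      by (intro Bochner_Integration.integral_add int integrable_f1 ig2)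
    also have "(\<integral>x. complex_of_real (g2 x) * ?c x \<partial>X) = (\<integral>x. 1 / 2 ^ DIM('a) * (complex_of_real (f2 x) * ?c x) \<partial>X)"
      by (simp add: g2_def)
    also have "\<dots> = 1 / 2 ^ DIM('a) * (2 ^ DIM('a) * of_real (rest_coeff \<epsilon> k) * (\<integral>y. ?c y \<partial>\<mu>))"
      by (simp only: integral_mult_right_zero integral_f2_cis[OF k])
    also have "\<dots> = of_real (rest_coeff \<epsilon> k) * (\<integral>y. ?c y \<partial>\<mu>)" by simp
    also have "(\<integral>x. complex_of_real (f1 x) * ?c x \<partial>X) + of_real (rest_coeff \<epsilon> k) * (\<integral>y. ?c y \<partial>\<mu>)
        = complex_of_real (mix_coeff \<epsilon> k + rest_coeff \<epsilon> k) * (\<integral>y. ?c y \<partial>\<mu>)"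
      by (simp add: integral_f1_cis[OF k] distrib_right)
    also have "mix_coeff \<epsilon> k + rest_coeff \<epsilon> k = (if k = 0 then 0 else norm k powr (-\<epsilon>))"
      by (simp add: rest_coeff_def)
    finally show "fourier_coeff ?f k = (if k = 0 then 0 else complex_of_real (norm k powr (-\<epsilon>)) * fourier_coeff_measure \<mu> k)"
      by (simp add: fourier_coeff_def fourier_coeff_measure_def)
  qed
  show "continuous_on (- \<Gamma>) ?f"
    unfolding g2_def
    by (intro continuous_at_imp_continuous_on ballI continuous_add continuous_divide continuous_const isCont_f2 isCont_f1) auto
  show "comparable_near \<Gamma> ?f (\<lambda>x. infdist x \<Gamma> powr (\<epsilon> - 1))"
  proof -
    obtain C1 where C1: "C1 \<ge> 0"
      "\<And>x d. 0 < d \<Longrightarrow> (\<And>y. y \<in> \<Gamma> \<Longrightarrow> d \<le> dist x y) \<Longrightarrow> I1 x \<le> ennreal (C1 * d powr (\<epsilon> - 1))"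
      using I1_upper by metis
    obtain c1 where c1: "c1 > 0"
      "\<And>x. 0 < infdist x \<Gamma> \<Longrightarrow> infdist x \<Gamma> < min r0 1 \<Longrightarrow> ennreal (c1 * infdist x \<Gamma> powr (\<epsilon> - 1)) \<le> I1 x"
      using I1_lower by metis
    obtain C2 where C2: "C2 \<ge> 0" "\<And>x. \<bar>g2 x\<bar> \<le> C2"
    proof
      show "\<bar>g2 x\<bar> \<le> (\<integral>(k, y). \<bar>rest_coeff \<epsilon> k\<bar> \<partial>(L \<Otimes>\<^sub>M \<mu>)) / 2 ^ DIM('a)" for x
        unfolding g2_def using f2_bounded[of x] by (simp add: abs_divide divide_right_mono)
      show "0 \<le> (\<integral>(k, y). \<bar>rest_coeff \<epsilon> k\<bar> \<partial>(L \<Otimes>\<^sub>M \<mu>)) / 2 ^ DIM('a)"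
        using f2_bounded[of 0] by simp
    qed
    \<comment> \<open>Once the power D of the distance is at least s, the continuous part is at most
      half of the lower bound \<open>c1 * D\<close> for the singular part, and D \<ge> 1 absorbs it
      in the upper bound.\<close>
    define s where "s = 2 * C2 / c1 + 1"
    have s: "s \<ge> 1" using C2 c1 by (simp add: s_def)
    \<comment> \<open>As \<epsilon> - 1 is negative, a distance below
      \<open>s powr (1 / (\<epsilon> - 1))\<close> forces D \<ge> s.\<close>
    define \<delta> where "\<delta> = min (min r0 1) (s powr (1 / (\<epsilon> - 1)))"
    define C where "C = max 1 (max (C1 + C2) (2 / c1))"
    have "1 / C * infdist x \<Gamma> powr (\<epsilon> - 1) \<le> ?f x \<and> ?f x \<le> C * infdist x \<Gamma> powr (\<epsilon> - 1)"
      if x: "0 < infdist x \<Gamma>" "infdist x \<Gamma> < \<delta>" for x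
    proof -
      define d where "d = infdist x \<Gamma>"
      have d: "0 < d" "d < min r0 1" "d < s powr (1 / (\<epsilon> - 1))" using x by (auto simp: d_def \<delta>_def)
      define D where "D = d powr (\<epsilon> - 1)"
      have "(s powr (1 / (\<epsilon> - 1))) powr (\<epsilon> - 1) \<le> D"
        unfolding D_def using d eps1 by (intro powr_mono2') auto
      then have Ds: "s \<le> D" using s eps1 by (simp add: powr_powr)
      have up: "I1 x \<le> ennreal (C1 * D)"
        unfolding D_def using d by (intro C1(2)) (auto simp: d_def infdist_le)
      have lo: "ennreal (c1 * D) \<le> I1 x"
        unfolding D_def d_def using d by (intro c1(2)) (auto simp: d_def)
      have up': "f1 x \<le> C1 * D"
        unfolding f1_I1 using up C1 Ds s enn2real_mono[OF up] by (simp add: enn2real_ennreal)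
      \<comment> \<open>The upper bound enters here too: \<open>enn2real\<close> sends infinity to
        0, so finiteness has to be known before a lower bound can be transferred.\<close>
      have lo': "c1 * D \<le> f1 x"
        unfolding f1_I1 using lo up c1 Ds s enn2real_mono[OF lo] by (auto simp: enn2real_ennreal le_less_trans)
      have f2: "- C2 \<le> g2 x" "g2 x \<le> C2" using C2(2)[of x] by auto
      have "2 * C2 / c1 \<le> D" using Ds by (simp add: s_def)
      then have "C2 \<le> c1 / 2 * D" using c1 by (simp add: field_simps)
      then have l: "c1 / 2 * D \<le> ?f x" using lo' f2 by linarith
      have "C2 * 1 \<le> C2 * D" using Ds s C2 by (intro mult_left_mono) auto
      then have u: "?f x \<le> (C1 + C2) * D" using up' f2 by (simp add: distrib_right)
      have D0: "D \<ge> 0" using Ds s by simp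
      have "1 / C \<le> 1 / (2 / c1)" using c1 by (intro divide_left_mono) (auto simp: C_def less_max_iff_disj)
      then have "1 / C * D \<le> c1 / 2 * D" using D0 by (intro mult_right_mono) auto
      moreover have "(C1 + C2) * D \<le> C * D" using D0 by (intro mult_right_mono) (auto simp: C_def)
      ultimately have "1 / C * D \<le> ?f x \<and> ?f x \<le> C * D" using l u by linarith
      then show ?thesis by (simp only: D_def d_def)
    qed
    moreover have "C \<ge> 1" "\<delta> > 0" using r0 s by (auto simp: C_def \<delta>_def)
    ultimately show ?thesis unfolding comparable_near_def by blast
  qed
qed

end

section \<open>Total variation of vector measures\<close>

text \<open>The conditions that \<open>gradient_measure\<close> imposes on the set function alone.\<close>

definition vector_measure :: "('a::euclidean_space set \<Rightarrow> 'a) \<Rightarrow> ('a \<Rightarrow> 'a measure) \<Rightarrow> ('a \<Rightarrow> 'a measure) \<Rightarrow> bool" where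
  "vector_measure \<nu> P N \<longleftrightarrow> (\<forall>i\<in>Basis. finite_measure (P i) \<and> finite_measure (N i) \<and>
     sets (P i) = sets torus_borel \<and> sets (N i) = sets torus_borel \<and>
     (\<forall>A\<in>sets torus_borel. \<nu> A \<bullet> i = measure (P i) A - measure (N i) A))"

context
  fixes \<nu> :: "'a::euclidean_space set \<Rightarrow> 'a" and P N
  assumes vm: "vector_measure \<nu> P N"
begin

lemma vm_fin: "i \<in> Basis \<Longrightarrow> finite_measure (P i)" "i \<in> Basis \<Longrightarrow> finite_measure (N i)"
  and vm_sets: "i \<in> Basis \<Longrightarrow> sets (P i) = sets torus_borel" "i \<in> Basis \<Longrightarrow> sets (N i) = sets torus_borel"
  and vm_eq: "i \<in> Basis \<Longrightarrow> A \<in> sets torus_borel \<Longrightarrow> \<nu> A \<bullet> i = measure (P i) A - measure (N i) A"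
  using vm by (auto simp: vector_measure_def)

lemma vm_component_le: "i \<in> Basis \<Longrightarrow> A \<in> sets torus_borel \<Longrightarrow> \<bar>\<nu> A \<bullet> i\<bar> \<le> measure (P i) A + measure (N i) A"
  unfolding vm_eq by (simp add: abs_le_iff add_increasing add_increasing2)

lemma vm_norm_le: "A \<in> sets torus_borel \<Longrightarrow> norm (\<nu> A) \<le> (\<Sum>i\<in>Basis. measure (P i) A + measure (N i) A)"
  by (rule order_trans[OF norm_le_l1]) (intro sum_mono vm_component_le)

lemma vm_empty: "\<nu> {} = 0"
  by (rule euclidean_eqI) (simp add: vm_eq)

lemma vm_measure_sums:
  assumes E: "range E \<subseteq> sets torus_borel" "disjoint_family E" and i: "i \<in> Basis"
  shows "(\<lambda>n. measure (P i) (E n)) sums measure (P i) (\<Union>n. E n)"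
    and "(\<lambda>n. measure (N i) (E n)) sums measure (N i) (\<Union>n. E n)"
  using E by (auto intro!: finite_measure.finite_measure_UNION vm_fin i simp: vm_sets[OF i])

lemma vm_sums:
  assumes E: "range E \<subseteq> sets torus_borel" "disjoint_family E"
  shows "(\<lambda>n. \<nu> (E n)) sums \<nu> (\<Union>n. E n)" "summable (\<lambda>n. norm (\<nu> (E n)))"
proof -
  have En: "E n \<in> sets torus_borel" for n using E by auto
  have U: "(\<Union>n. E n) \<in> sets torus_borel" using En by auto
  have "(\<lambda>n. \<Sum>i\<in>Basis. (\<nu> (E n) \<bullet> i) *\<^sub>R i) sums (\<Sum>i\<in>Basis. (\<nu> (\<Union>n. E n) \<bullet> i) *\<^sub>R i)"
  proof (intro sums_sum)
    fix i :: 'a assume i: "i \<in> Basis"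
    show "(\<lambda>n. (\<nu> (E n) \<bullet> i) *\<^sub>R i) sums ((\<nu> (\<Union>n. E n) \<bullet> i) *\<^sub>R i)"
      unfolding vm_eq[OF i En] vm_eq[OF i U]
      by (intro sums_scaleR_left sums_diff vm_measure_sums E i)
  qed
  then show "(\<lambda>n. \<nu> (E n)) sums \<nu> (\<Union>n. E n)" by (simp add: euclidean_representation)
  show "summable (\<lambda>n. norm (\<nu> (E n)))"
  proof (rule summable_comparison_test')
    show "summable (\<lambda>n. \<Sum>i\<in>Basis. measure (P i) (E n) + measure (N i) (E n))"
      by (intro summable_sum summable_add sums_summable[OF vm_measure_sums(1)[OF E]] sums_summable[OF vm_measure_sums(2)[OF E]])
    show "\<And>n. n \<ge> 0 \<Longrightarrow> norm (norm (\<nu> (E n))) \<le> (\<Sum>i\<in>Basis. measure (P i) (E n) + measure (N i) (E n))"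
      using vm_norm_le[OF En] by simp
  qed
qed

lemma vm_norm_subadditive:
  assumes E: "range E \<subseteq> sets torus_borel" "disjoint_family E"
  shows "ennreal (norm (\<nu> (\<Union>n. E n))) \<le> (\<Sum>n. ennreal (norm (\<nu> (E n))))"
proof -
  have "norm (\<nu> (\<Union>n. E n)) = norm (\<Sum>n. \<nu> (E n))" using vm_sums(1)[OF E] by (simp add: sums_iff)
  also have "\<dots> \<le> (\<Sum>n. norm (\<nu> (E n)))" by (rule summable_norm[OF vm_sums(2)[OF E]])
  finally have "ennreal (norm (\<nu> (\<Union>n. E n))) \<le> ennreal (\<Sum>n. norm (\<nu> (E n)))" by (rule ennreal_leI)
  also have "\<dots> = (\<Sum>n. ennreal (norm (\<nu> (E n))))"
    by (rule suminf_ennreal2[symmetric]) (auto intro: vm_sums(2)[OF E])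
  finally show ?thesis .
qed

definition partitions :: "'a set \<Rightarrow> (nat \<Rightarrow> 'a set) set" where
  "partitions A = {E. range E \<subseteq> sets torus_borel \<and> disjoint_family E \<and> (\<Union>n. E n) = A}"

definition psum :: "(nat \<Rightarrow> 'a set) \<Rightarrow> ennreal" where
  "psum E = (\<Sum>n. ennreal (norm (\<nu> (E n))))"

text \<open>The supremum from the definition of \<open>total_variation\<close>, kept as a plain set
  function: the measure built from it takes these values only once countable additivity has been
  shown.\<close>

definition tv :: "'a set \<Rightarrow> ennreal" where
  "tv A = (SUP E\<in>partitions A. psum E)"

lemma psum_le_tv: "E \<in> partitions A \<Longrightarrow> psum E \<le> tv A"
  unfolding tv_def by (rule SUP_upper)

lemma trivial_partition:
  assumes A: "A \<in> sets torus_borel"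
  shows "(\<lambda>n::nat. if n = 0 then A else {}) \<in> partitions A" "psum (\<lambda>n::nat. if n = 0 then A else {}) = norm (\<nu> A)"
proof -
  show "(\<lambda>n::nat. if n = 0 then A else {}) \<in> partitions A"
    using A by (auto simp: partitions_def disjoint_family_on_def)
  have "psum (\<lambda>n::nat. if n = 0 then A else {}) = (\<Sum>n\<in>{0}. ennreal (norm (\<nu> (if n = (0::nat) then A else {}))))"
    unfolding psum_def by (rule suminf_finite) (auto simp: vm_empty)
  then show "psum (\<lambda>n::nat. if n = 0 then A else {}) = norm (\<nu> A)" by simp
qed

lemma norm_le_tv: "A \<in> sets torus_borel \<Longrightarrow> ennreal (norm (\<nu> A)) \<le> tv A"
  using psum_le_tv[OF trivial_partition(1)] trivial_partition(2) by metis

lemma tv_empty: "tv {} = 0"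
proof -
  have "psum E = 0" if "E \<in> partitions {}" for E
  proof -
    have "E n = {}" for n using that by (auto simp: partitions_def)
    then show ?thesis by (simp add: psum_def vm_empty)
  qed
  then show ?thesis unfolding tv_def by (intro antisym SUP_least) auto
qed

text \<open>Interleaving the two partitions at even and odd indices gives a partition of the union
  with the same total.\<close>

lemma psum_add_le_tv:
  assumes E: "E \<in> partitions A" and F: "F \<in> partitions B" and AB: "A \<inter> B = {}"
  shows "psum E + psum F \<le> tv (A \<union> B)"
proof -
  define G where "G n = (if even n then E (n div 2) else F (n div 2))" for n
  have "psum E + psum F = (\<Sum>n. ennreal (norm (\<nu> (E n))) + ennreal (norm (\<nu> (F n))))"
    unfolding psum_def by (rule suminf_add) auto
  also have "\<dots> = (SUP n. \<Sum>k<n. ennreal (norm (\<nu> (E k))) + ennreal (norm (\<nu> (F k))))"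
    by (rule suminf_eq_SUP)
  also have "\<dots> \<le> psum G"
  proof (rule SUP_least)
    fix n
    have "(\<Sum>k<n. ennreal (norm (\<nu> (E k))) + ennreal (norm (\<nu> (F k)))) = (\<Sum>k<2 * n. ennreal (norm (\<nu> (G k))))"
      by (induction n) (auto simp: G_def add.assoc)
    also have "\<dots> \<le> psum G" unfolding psum_def by (rule sum_le_suminf) auto
    finally show "(\<Sum>k<n. ennreal (norm (\<nu> (E k))) + ennreal (norm (\<nu> (F k)))) \<le> psum G" .
  qed
  also have "psum G \<le> tv (A \<union> B)"
  proof (rule psum_le_tv)
    have dE: "E m \<inter> E n = {}" and dF: "F m \<inter> F n = {}" if "m \<noteq> n" for m n
      using E F that by (auto simp: partitions_def disjoint_family_on_def)
    have EF: "E m \<inter> F n = {}" for m n using E F AB by (auto simp: partitions_def)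
    have "G m \<inter> G n = {}" if "m \<noteq> n" for m n
    proof (cases "m div 2 = n div 2")
      case True
      then have "even m \<noteq> even n" using that by (metis dvd_mult_div_cancel odd_two_times_div_two_succ)
      then show ?thesis using EF[of "m div 2" "n div 2"] EF[of "n div 2" "m div 2"] True by (auto simp: G_def)
    next
      case False
      then show ?thesis using EF dE[OF False] dF[OF False] by (auto simp: G_def)
    qed
    moreover have "(\<Union>n. G n) = A \<union> B"
    proof
      show "(\<Union>n. G n) \<subseteq> A \<union> B" using E F by (auto simp: G_def partitions_def split: if_splits)
      show "A \<union> B \<subseteq> (\<Union>n. G n)"
      proof
        fix x assume "x \<in> A \<union> B"
        then obtain n where "x \<in> E n \<or> x \<in> F n" using E F by (auto simp: partitions_def)
        moreover have "E n = G (2 * n)" "F n = G (2 * n + 1)" by (auto simp: G_def)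
        ultimately have "x \<in> G (2 * n) \<or> x \<in> G (2 * n + 1)" by simp
        then show "x \<in> (\<Union>n. G n)" by blast
      qed
    qed
    moreover have "range G \<subseteq> sets torus_borel" using E F by (auto simp: G_def partitions_def)
    ultimately show "G \<in> partitions (A \<union> B)" by (auto simp: partitions_def disjoint_family_on_def)
  qed
  finally show ?thesis .
qed

lemma partitions_nonempty: "A \<in> sets torus_borel \<Longrightarrow> partitions A \<noteq> {}"
  using trivial_partition(1) by auto

lemma tv_superadditive:
  assumes "A \<in> sets torus_borel" "B \<in> sets torus_borel" "A \<inter> B = {}"
  shows "tv A + tv B \<le> tv (A \<union> B)"
proof -
  have "tv A + psum F \<le> tv (A \<union> B)" if "F \<in> partitions B" for F
  proof -
    have "tv A + psum F = (SUP E\<in>partitions A. psum E + psum F)"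
      unfolding tv_def by (rule ennreal_SUP_add_left[symmetric]) (use partitions_nonempty assms in auto)
    also have "\<dots> \<le> tv (A \<union> B)" by (intro SUP_least psum_add_le_tv that assms)
    finally show ?thesis .
  qed
  moreover have "tv A + tv B = (SUP F\<in>partitions B. tv A + psum F)"
    unfolding tv_def[of B] by (rule ennreal_SUP_add_right) (use partitions_nonempty assms in auto)
  ultimately show ?thesis by (auto intro: SUP_least)
qed

lemma tv_mono:
  assumes "A \<in> sets torus_borel" "B \<in> sets torus_borel" "A \<subseteq> B"
  shows "tv A \<le> tv B"
proof -
  have "tv A \<le> tv A + tv (B - A)" by simp
  also have "\<dots> \<le> tv (A \<union> (B - A))" using assms by (intro tv_superadditive) auto
  finally show ?thesis using assms by (simp add: Un_absorb1)
qed

text \<open>One inequality passes from finite superadditivity to the supremum of the partial sums.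
  For the other, every partition of the union is refined by the given sets; the norm is countably
  subadditive and sums of nonnegative terms may be exchanged.\<close>

lemma tv_countably_additive: "countably_additive (sets torus_borel) tv"
proof (rule countably_additiveI)
  fix A :: "nat \<Rightarrow> 'a set"
  assume A: "range A \<subseteq> sets torus_borel" "disjoint_family A" and U: "(\<Union>n. A n) \<in> sets torus_borel"
  have Am: "A m \<in> sets torus_borel" for m using A by auto
  show "(\<Sum>m. tv (A m)) = tv (\<Union>m. A m)"
  proof (rule antisym)
    have fin: "(\<Sum>m<n. tv (A m)) \<le> tv (\<Union>m<n. A m)" for n
    proof (induction n)
      case (Suc n)
      have "(\<Sum>m<Suc n. tv (A m)) \<le> tv (\<Union>m<n. A m) + tv (A n)" using Suc by (simp add: add_right_mono)
      also have "\<dots> \<le> tv ((\<Union>m<n. A m) \<union> A n)"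
      proof (intro tv_superadditive)
        have "A m \<inter> A n = {}" if "m < n" for m
          using A(2) that unfolding disjoint_family_on_def by (metis UNIV_I less_irrefl)
        then show "(\<Union>m<n. A m) \<inter> A n = {}" by blast
      qed (use Am in auto)
      also have "(\<Union>m<n. A m) \<union> A n = (\<Union>m<Suc n. A m)" by (auto simp: less_Suc_eq)
      finally show ?case .
    qed (simp add: tv_empty)
    have "(\<Sum>m<n. tv (A m)) \<le> tv (\<Union>m. A m)" for n
      by (rule order_trans[OF fin tv_mono]) (use Am U in auto)
    then show "(\<Sum>m. tv (A m)) \<le> tv (\<Union>m. A m)"
      by (subst suminf_eq_SUP) (auto intro: SUP_least)
    show "tv (\<Union>m. A m) \<le> (\<Sum>m. tv (A m))"
      unfolding tv_def[of "\<Union>m. A m"]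
    proof (rule SUP_least)
      fix E assume E: "E \<in> partitions (\<Union>m. A m)"
      then have En: "E n \<in> sets torus_borel" and dE: "disjoint_family E" and UE: "(\<Union>n. E n) = (\<Union>m. A m)" for n
        by (auto simp: partitions_def)
      have "psum E \<le> (\<Sum>n. \<Sum>m. ennreal (norm (\<nu> (E n \<inter> A m))))"
        unfolding psum_def
      proof (rule suminf_le)
        fix n
        have "E n = (\<Union>m. E n \<inter> A m)" using UE by blast
        then have "ennreal (norm (\<nu> (E n))) = ennreal (norm (\<nu> (\<Union>m. E n \<inter> A m)))" by simp
        also have "\<dots> \<le> (\<Sum>m. ennreal (norm (\<nu> (E n \<inter> A m))))"
          using En Am A(2) by (intro vm_norm_subadditive disjoint_family_on_bisimulation[OF A(2)]) auto
        finally show "ennreal (norm (\<nu> (E n))) \<le> (\<Sum>m. ennreal (norm (\<nu> (E n \<inter> A m))))" .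
      qed auto
      also have "\<dots> = (\<Sum>m. \<Sum>n. ennreal (norm (\<nu> (E n \<inter> A m))))"
        unfolding nn_integral_count_space_nat[symmetric]
        by (rule nn_integral_count_space_nn_integral) auto
      also have "\<dots> \<le> (\<Sum>m. tv (A m))"
      proof (rule suminf_le)
        fix m
        have "(\<lambda>n. E n \<inter> A m) \<in> partitions (A m)"
          unfolding partitions_def using En Am UE by (auto intro: disjoint_family_on_bisimulation[OF dE])
        then show "(\<Sum>n. ennreal (norm (\<nu> (E n \<inter> A m)))) \<le> tv (A m)"
          using psum_le_tv by (fastforce simp: psum_def)
      qed auto
      finally show "psum E \<le> (\<Sum>m. tv (A m))" .
    qed
  qed
qed

lemma total_variation_eq: "total_variation \<nu> = measure_of pbox (sets torus_borel) tv"
  unfolding total_variation_def tv_def partitions_def psum_def by simp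

lemma sets_tv: "sets (total_variation \<nu>) = sets torus_borel"
  unfolding total_variation_eq
  using sets.sets_measure_of_eq[of "torus_borel :: 'a measure"] by simp

lemma emeasure_total_variation: "A \<in> sets torus_borel \<Longrightarrow> emeasure (total_variation \<nu>) A = tv A"
  unfolding total_variation_eq
proof (rule emeasure_measure_of_sigma)
  show "sigma_algebra (pbox :: 'a set) (sets torus_borel)"
    using sets.sigma_algebra_axioms[of "torus_borel :: 'a measure"] by simp
  show "positive (sets torus_borel) tv" by (simp add: positive_def tv_empty)
qed (rule tv_countably_additive)

lemma norm_le_total_variation: "A \<in> sets torus_borel \<Longrightarrow> ennreal (norm (\<nu> A)) \<le> emeasure (total_variation \<nu>) A"
  by (simp add: emeasure_total_variation norm_le_tv)

text \<open>Holds for any representation of the components as differences, minimal or not. It serves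
  all upper bounds, in which cancellation may be ignored.\<close>

lemma total_variation_le:
  assumes A: "A \<in> sets torus_borel"
  shows "emeasure (total_variation \<nu>) A \<le> (\<Sum>i\<in>Basis. emeasure (P i) A + emeasure (N i) A)"
  unfolding emeasure_total_variation[OF A] tv_def
proof (rule SUP_least)
  fix E assume E: "E \<in> partitions A"
  then have En: "E n \<in> sets torus_borel" and dE: "disjoint_family E" and UE: "(\<Union>n. E n) = A" for n
    by (auto simp: partitions_def)
  have "psum E \<le> (\<Sum>n. \<Sum>i\<in>Basis. emeasure (P i) (E n) + emeasure (N i) (E n))"
    unfolding psum_def
  proof (rule suminf_le)
    fix n
    have "ennreal (norm (\<nu> (E n))) \<le> ennreal (\<Sum>i\<in>Basis. measure (P i) (E n) + measure (N i) (E n))"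
      by (intro ennreal_leI vm_norm_le En)
    also have "\<dots> = (\<Sum>i\<in>Basis. emeasure (P i) (E n) + emeasure (N i) (E n))"
      by (subst sum_ennreal[symmetric]) (auto simp: finite_measure.emeasure_eq_measure[OF vm_fin(1)] finite_measure.emeasure_eq_measure[OF vm_fin(2)] intro!: sum.cong)
    finally show "ennreal (norm (\<nu> (E n))) \<le> (\<Sum>i\<in>Basis. emeasure (P i) (E n) + emeasure (N i) (E n))" .
  qed auto
  also have "\<dots> = (\<Sum>i\<in>Basis. (\<Sum>n. emeasure (P i) (E n)) + (\<Sum>n. emeasure (N i) (E n)))"
    by (subst suminf_sum) (auto intro!: sum.cong suminf_add[symmetric])
  also have "\<dots> = (\<Sum>i\<in>Basis. emeasure (P i) A + emeasure (N i) A)"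
    using En dE UE by (intro sum.cong refl arg_cong2[where f="(+)"]) (auto simp: suminf_emeasure vm_sets image_subset_iff)
  finally show "psum E \<le> (\<Sum>i\<in>Basis. emeasure (P i) A + emeasure (N i) A)" .
qed

lemma finite_total_variation: "finite_measure (total_variation \<nu>)"
proof
  have s: "space (total_variation \<nu>) = pbox" using sets_eq_imp_space_eq[OF sets_tv] by simp
  have "emeasure (total_variation \<nu>) pbox \<le> (\<Sum>i\<in>Basis. emeasure (P i) pbox + emeasure (N i) pbox)"
    by (rule total_variation_le) (simp add: sets_torus_borel)
  also have "\<dots> < \<infinity>"
    by (auto simp: finite_measure.emeasure_eq_measure[OF vm_fin(1)] finite_measure.emeasure_eq_measure[OF vm_fin(2)])
  finally show "emeasure (total_variation \<nu>) (space (total_variation \<nu>)) \<noteq> \<infinity>" by (simp add: s)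
qed

end

lemma gradient_measure_vector_measure:
  assumes "gradient_measure u \<nu>"
  shows "\<exists>P N. vector_measure \<nu> P N"
proof -
  have "\<forall>i\<in>Basis. \<exists>P N. finite_measure P \<and> finite_measure N \<and> sets P = sets torus_borel \<and> sets N = sets torus_borel \<and>
     (\<forall>A\<in>sets torus_borel. \<nu> A \<bullet> i = measure P A - measure N A)"
    using assms unfolding gradient_measure_def by blast
  from bchoice[OF this] obtain P where PN: "\<forall>i\<in>Basis. \<exists>N. finite_measure (P i) \<and> finite_measure N \<and> sets (P i) = sets torus_borel \<and> sets N = sets torus_borel \<and>
     (\<forall>A\<in>sets torus_borel. \<nu> A \<bullet> i = measure (P i) A - measure N A)" by blast
  from bchoice[OF PN] obtain N where "\<forall>i\<in>Basis. finite_measure (P i) \<and> finite_measure (N i) \<and> sets (P i) = sets torus_borel \<and> sets (N i) = sets torus_borel \<and>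
     (\<forall>A\<in>sets torus_borel. \<nu> A \<bullet> i = measure (P i) A - measure (N i) A)" by blast
  then show ?thesis unfolding vector_measure_def by blast
qed

text \<open>The interface between analysis and geometry: for intervals and for domains alike, only
  the ball estimates of the total variation remain to be supplied.\<close>

lemma regular_gradient:
  fixes \<Gamma> :: "'a::euclidean_space set"
  assumes "0 < \<epsilon>" "\<epsilon> < 1" and g: "gradient_measure u \<nu>" and "closed \<Gamma>"
    and "\<And>x k. x \<in> \<Gamma> \<Longrightarrow> k \<in> int_lattice \<Longrightarrow> x + 2 *\<^sub>R k \<in> \<Gamma>"
    and "emeasure (total_variation \<nu>) (pbox - \<Gamma>) = 0"
    and "0 \<le> K" "0 < c" "0 < r0"
    and "\<And>z r. 0 < r \<Longrightarrow> r \<le> 1 \<Longrightarrow> emeasure (total_variation \<nu>) (pbox \<inter> pext (ball z r)) \<le> ennreal (K * r ^ (DIM('a) - 1))"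
    and "\<And>p r. p \<in> \<Gamma> \<Longrightarrow> 0 < r \<Longrightarrow> r \<le> r0 \<Longrightarrow> ennreal (c * r ^ (DIM('a) - 1)) \<le> emeasure (total_variation \<nu>) (pbox \<inter> pext (ball p r))"
  shows "\<exists>\<nu> f. gradient_measure u \<nu> \<and> inv_frac_grad \<epsilon> (total_variation \<nu>) f \<and> continuous_on (- \<Gamma>) f \<and>
     comparable_near \<Gamma> f (\<lambda>x. infdist x \<Gamma> powr (\<epsilon> - 1))"
proof -
  obtain P N where vm: "vector_measure \<nu> P N" using gradient_measure_vector_measure[OF g] by auto
  interpret regular_torus_measure "total_variation \<nu>" \<epsilon> \<Gamma> K c r0
    by (intro regular_torus_measure.intro torus_measure.intro regular_torus_measure_axioms.intro)
      (rule finite_total_variation[OF vm] sets_tv[OF vm] | fact)+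
  show ?thesis using inv_frac_grad_regular g by blast
qed

section \<open>Intervals\<close>

lemma int_lattice_real: "(int_lattice :: real set) = \<int>"
  by (auto simp: int_lattice_def)

lemma pbox_real: "(pbox :: real set) = {-1..<1}"
  by (auto simp: pbox_def)

lemma pext_shift_mem: "x \<in> pext A \<Longrightarrow> k \<in> int_lattice \<Longrightarrow> x + 2 *\<^sub>R k \<in> pext A"
  by (simp add: pext_shift)

lemma closed_pext_real:
  fixes a b :: real
  shows "closed (pext {a, b})"
proof -
  have "pext {a, b} = (\<lambda>x. (x - a) / 2) -` \<int> \<union> (\<lambda>x. (x - b) / 2) -` \<int>"
  proof (intro set_eqI)
    fix x
    have "(\<exists>k\<in>\<int>. x + 2 * k = c) \<longleftrightarrow> (x - c) / 2 \<in> \<int>" for c :: real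
    proof
      assume "\<exists>k\<in>\<int>. x + 2 * k = c"
      then obtain k where "k \<in> \<int>" "x + 2 * k = c" by auto
      then have "(x - c) / 2 = - k" by simp
      then show "(x - c) / 2 \<in> \<int>" using \<open>k \<in> \<int>\<close> by simp
    next
      assume "(x - c) / 2 \<in> \<int>"
      then have "- ((x - c) / 2) \<in> \<int>" by (rule Ints_minus)
      then show "\<exists>k\<in>\<int>. x + 2 * k = c" by (intro bexI[of _ "- ((x - c) / 2)"]) (auto simp: field_simps)
    qed
    then show "x \<in> pext {a, b} \<longleftrightarrow> x \<in> (\<lambda>x. (x - a) / 2) -` \<int> \<union> (\<lambda>x. (x - b) / 2) -` \<int>"
      by (auto simp: mem_pext int_lattice_real)
  qed
  also have "closed \<dots>"
    by (intro closed_Un closed_vimage closed_Ints continuous_intros) auto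
  finally show ?thesis .
qed

text \<open>By the fundamental theorem of calculus the gradient is the unit mass at a minus the unit
  mass at b, read modulo periods. Whether I contains its end points does not affect the
  integrals.\<close>

lemma interval_gradient:
  fixes a b :: real
  assumes ab: "a < b" "b - a < 2" and I: "I \<subseteq> pbox" "{a<..<b} \<subseteq> I" "I \<subseteq> {a..b}" and \<Gamma>: "\<Gamma> = pext {a, b}"
    and eps: "0 < \<epsilon>" "\<epsilon> < 1"
  shows "\<exists>\<nu> f. gradient_measure (indicator I) \<nu> \<and> inv_frac_grad \<epsilon> (total_variation \<nu>) f \<and> continuous_on (- \<Gamma>) f \<and>
     comparable_near \<Gamma> f (\<lambda>x. infdist x \<Gamma> powr (\<epsilon> - 1))"
proof -
  have "{a<..<b} \<subseteq> {-1..1}" using I by (auto simp: pbox_real subset_eq less_imp_le)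
  then have a1: "-1 \<le> a" and b1: "b \<le> 1" using ab(1) by (auto simp: greaterThanLessThan_subseteq_atLeastAtMost_iff)
  \<comment> \<open>The right end point may be 1, which is not in the half-open box; its
    representative there is -1.\<close>
  define b' where "b' = (if b = 1 then -1 else b)"
  have ap: "a \<in> pbox" and bp: "b' \<in> pbox" using a1 b1 ab by (auto simp: pbox_real b'_def)
  \<comment> \<open>For b = 1 this is where the length below 2 enters: on the full period the two
    point masses would coincide and cancel.\<close>
  have ab': "a \<noteq> b'" using ab a1 by (auto simp: b'_def)
  have s: "{a} \<in> sets torus_borel" using ap by (simp add: sets_torus_borel)
  define \<nu> where "\<nu> A = indicator A a - (indicator A b' :: real)" for A
  define P where "P = return (torus_borel :: real measure) a"
  define N where "N = return (torus_borel :: real measure) b'"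
  have fin: "finite_measure P" "finite_measure N"
    unfolding P_def N_def using ap bp by (auto intro!: prob_space.finite_measure prob_space_return)
  have sets: "sets P = sets torus_borel" "sets N = sets torus_borel" by (auto simp: P_def N_def)
  have eqn: "\<nu> A = measure P A - measure N A" if "A \<in> sets torus_borel" for A
    using that by (simp add: P_def N_def measure_return \<nu>_def)
  have vm: "vector_measure \<nu> (\<lambda>_. P) (\<lambda>_. N)"
    using fin sets eqn by (auto simp: vector_measure_def)
  have Ib [measurable]: "I \<in> sets borel"
  proof -
    have "I = {a<..<b} \<union> (I \<inter> {a, b})" using I by (auto simp: le_less)
    moreover have "finite (I \<inter> {a, b})" by simp
    ultimately show ?thesis by (metis borel_open finite_imp_closed borel_closed open_greaterThanLessThan sets.Un)
  qed
  have g: "gradient_measure (indicator I) \<nu>"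
    unfolding gradient_measure_def
  proof (intro conjI ballI)
    show "set_integrable lborel pbox (indicator I :: real \<Rightarrow> real)"
      unfolding set_integrable_def
    proof (rule Bochner_Integration.integrable_bound[of _ "indicator {-1..1::real} :: real \<Rightarrow> real"])
      show "AE x in lborel. norm (indicator pbox x *\<^sub>R (indicator I x :: real)) \<le> norm (indicator {-1..1::real} x :: real)"
        by (auto simp: indicator_def pbox_real)
    qed auto
    fix i :: real assume "i \<in> Basis"
    then have i: "i = 1" by simp
    have "(LINT x:pbox|lborel. indicator I x * frechet_derivative \<phi> (at x) 1) = - ((LINT x|P. \<phi> x) - (LINT x|N. \<phi> x))"
      if \<phi>: "smooth \<phi>" "periodic \<phi>" for \<phi> :: "real \<Rightarrow> real"
    proof -
      have "Ck 1 \<phi>" using \<phi> by (simp add: smooth_def)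
      then have d: "\<And>x. \<phi> differentiable (at x)" and c: "continuous_on UNIV (\<lambda>x. frechet_derivative \<phi> (at x) 1)" by auto
      have hd: "(\<phi> has_vector_derivative frechet_derivative \<phi> (at x) 1) (at x)" for x
      proof -
        have *: "(\<phi> has_derivative frechet_derivative \<phi> (at x)) (at x)" using d frechet_derivative_works by blast
        then have "frechet_derivative \<phi> (at x) = (\<lambda>h. h *\<^sub>R frechet_derivative \<phi> (at x) 1)"
          using linear_frechet_derivative[OF d[of x]] by (metis linear_cmul mult.right_neutral real_scaleR_def)
        with * show ?thesis unfolding has_vector_derivative_def by metis
      qed
      have cont: "continuous_on UNIV \<phi>" using d by (meson differentiable_imp_continuous_on differentiable_on_def differentiable_at_withinI)
      have m: "\<phi> \<in> borel_measurable torus_borel"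
        by (rule measurable_torus_borel[OF borel_measurable_continuous_onI[OF cont] refl])
      have "(LINT x:pbox|lborel. indicator I x * frechet_derivative \<phi> (at x) 1) = (LINT x|lborel. indicator {a..b} x *\<^sub>R frechet_derivative \<phi> (at x) 1)"
        unfolding set_lebesgue_integral_def
      proof (rule integral_cong_AE)
        have [measurable]: "(\<lambda>x. frechet_derivative \<phi> (at x) 1) \<in> borel_measurable borel" by (rule borel_measurable_continuous_onI[OF c])
        show "(\<lambda>x. indicator pbox x *\<^sub>R (indicator I x * frechet_derivative \<phi> (at x) 1)) \<in> borel_measurable lborel" by measurable
        show "(\<lambda>x. indicator {a..b} x *\<^sub>R frechet_derivative \<phi> (at x) 1) \<in> borel_measurable lborel" by measurable
        show "AE x in lborel. indicator pbox x *\<^sub>R (indicator I x * frechet_derivative \<phi> (at x) 1) = indicator {a..b} x *\<^sub>R frechet_derivative \<phi> (at x) 1"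
          using AE_lborel_singleton[of a] AE_lborel_singleton[of b]
        proof eventually_elim
          case (elim x)
          have "x \<in> {a<..<b}" if "x \<in> {a..b}" using that elim by auto
          then have "x \<in> pbox \<and> x \<in> I \<longleftrightarrow> x \<in> {a..b}" using I by blast
          then show ?case by (auto simp: indicator_def)
        qed
      qed
      also have "\<dots> = \<phi> b - \<phi> a"
        using ab c by (intro integral_FTC_Icc) (auto intro: has_vector_derivative_at_within[OF hd] continuous_on_subset)
      also have "\<phi> b = \<phi> b'" using periodic_int_lattice[OF \<phi>(2), of 1 "-1"] by (auto simp: b'_def int_lattice_real)
      finally show ?thesis using ap bp m by (simp add: P_def N_def integral_return)
    qed
    then show "\<exists>P N. finite_measure P \<and> finite_measure N \<and> sets P = sets torus_borel \<and> sets N = sets torus_borel \<and>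
        (\<forall>A\<in>sets torus_borel. \<nu> A \<bullet> i = measure P A - measure N A) \<and>
        (\<forall>\<phi>. smooth \<phi> \<and> periodic \<phi> \<longrightarrow>
           (LINT x:pbox|lborel. indicator I x * frechet_derivative \<phi> (at x) i) = - ((LINT x|P. \<phi> x) - (LINT x|N. \<phi> x)))"
      using fin sets eqn unfolding i by (intro exI[of _ P] exI[of _ N]) auto
  qed
  have le: "emeasure (total_variation \<nu>) A \<le> indicator A a + indicator A b'" if "A \<in> sets torus_borel" for A
    using total_variation_le[OF vm that] that by (simp add: P_def N_def)
  have bm: "b' + 2 *\<^sub>R k = b" "k \<in> int_lattice" if "k = (if b = 1 then 1 else 0)" for k
    using that by (auto simp: b'_def int_lattice_real)
  have a\<Gamma>: "a \<in> \<Gamma>" and b\<Gamma>: "b' \<in> \<Gamma>"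
    unfolding \<Gamma> mem_pext using bm[OF refl] int_lattice_0 by (auto intro: bexI[of _ 0])
  have sb: "pbox \<inter> pext (ball z r) \<in> sets torus_borel" for z r :: real
    by (simp add: sets_torus_borel)
  show ?thesis
  \<comment> \<open>In dimension one the power of r is 1. The total mass of the two points is at
    most 2, and each of them has mass at least 1.\<close>
  proof (rule regular_gradient[OF eps g, where K=2 and c=1 and ?r0.0=1])
    show "closed \<Gamma>" unfolding \<Gamma> by (rule closed_pext_real)
    show "x + 2 *\<^sub>R k \<in> \<Gamma>" if "x \<in> \<Gamma>" "k \<in> int_lattice" for x k using that unfolding \<Gamma> by (rule pext_shift_mem)
    have "closed \<Gamma>" unfolding \<Gamma> by (rule closed_pext_real)
    then have "pbox - \<Gamma> \<in> sets torus_borel" by (auto simp: sets_torus_borel)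
    from le[OF this] show "emeasure (total_variation \<nu>) (pbox - \<Gamma>) = 0" using a\<Gamma> b\<Gamma> by simp
    show "emeasure (total_variation \<nu>) (pbox \<inter> pext (ball z r)) \<le> ennreal (2 * r ^ (DIM(real) - 1))" for z r
    proof -
      have "emeasure (total_variation \<nu>) (pbox \<inter> pext (ball z r)) \<le> 1 + 1"
        by (rule order_trans[OF le[OF sb]]) (intro add_mono; simp add: indicator_def)
      then show ?thesis by (simp add: one_add_one)
    qed
    show "ennreal (1 * r ^ (DIM(real) - 1)) \<le> emeasure (total_variation \<nu>) (pbox \<inter> pext (ball p r))" if p: "p \<in> \<Gamma>" and r: "0 < r" for p r
    proof -
      obtain y where y: "y \<in> {a, b'}" "y \<in> pext (ball p r)"
      proof -
        obtain k where k: "k \<in> int_lattice" "p + 2 *\<^sub>R k = a \<or> p + 2 *\<^sub>R k = b" using p by (auto simp: \<Gamma> mem_pext)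
        have "p + 2 *\<^sub>R k \<in> pext (ball p r)"
          by (subst pext_shift[OF k(1)]) (use r int_lattice_0 in \<open>auto simp: mem_pext intro: bexI[of _ 0]\<close>)
        moreover have "b' \<in> pext (ball p r) \<longleftrightarrow> b \<in> pext (ball p r)"
          using pext_shift[OF bm(2)[OF refl], of b' "ball p r"] bm(1)[OF refl] by simp
        ultimately show thesis using k(2) that by auto
      qed
      have yp: "y \<in> pbox" using y ap bp by auto
      then have ys: "{y} \<in> sets torus_borel" by (simp add: sets_torus_borel)
      have "1 = ennreal (norm (\<nu> {y}))" using y ab' by (auto simp: \<nu>_def)
      also have "\<dots> \<le> emeasure (total_variation \<nu>) {y}" by (rule norm_le_total_variation[OF vm ys])
      also have "\<dots> \<le> emeasure (total_variation \<nu>) (pbox \<inter> pext (ball p r))"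
        using y yp sb by (intro emeasure_mono) (auto simp: sets_tv[OF vm])
      finally show ?thesis by simp
    qed
  qed auto
qed

section \<open>The divergence theorem under a graph\<close>

text \<open>The derivative is a parameter, so that product, quotient and cut-off can name theirs.
  Continuity is asked for each fixed direction only, which is what integration of partial
  derivatives needs.\<close>

definition C1_with :: "('a::euclidean_space \<Rightarrow> real) \<Rightarrow> ('a \<Rightarrow> 'a \<Rightarrow> real) \<Rightarrow> bool" where
  "C1_with f D \<longleftrightarrow> (\<forall>x. (f has_derivative D x) (at x)) \<and> (\<forall>h. continuous_on UNIV (\<lambda>x. D x h))"

lemma C1_with_continuous: "C1_with f D \<Longrightarrow> continuous_on UNIV f"
  unfolding C1_with_def by (meson has_derivative_continuous_on has_derivative_at_withinI)

text \<open>In the plane the index i determines the other one, so a single formula serves both roles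
  of the axes: u along axis i, v along the remaining axis.\<close>

definition pt :: "2 \<Rightarrow> real \<Rightarrow> real \<Rightarrow> real^2" where
  "pt i u v = (\<chi> k. if k = i then u else v)"

lemma pt_nth: "pt i u v $ i = u" "k \<noteq> i \<Longrightarrow> pt i u v $ k = v"
  by (simp_all add: pt_def)

lemma two_cases: "i \<noteq> (j::2) \<Longrightarrow> k = i \<or> k = j"
  using exhaust_2[of i] exhaust_2[of j] exhaust_2[of k] by auto

lemma pt_eq: "i \<noteq> j \<Longrightarrow> pt i (x $ i) (x $ j) = x"
  by (auto simp: vec_eq_iff pt_def dest: two_cases)

lemma pt_decomp: "i \<noteq> j \<Longrightarrow> pt i u v = u *\<^sub>R axis i 1 + v *\<^sub>R axis j 1"
  by (auto simp: vec_eq_iff pt_def axis_def dest: two_cases)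

lemma norm_pt_ge: "i \<noteq> j \<Longrightarrow> \<bar>v\<bar> \<le> norm (pt i u v)" "\<bar>u\<bar> \<le> norm (pt i u v)"
  using component_le_norm_cart[of "pt i u v" j] component_le_norm_cart[of "pt i u v" i] by (auto simp: pt_nth)

lemma continuous_on_pt [continuous_intros]:
  assumes "continuous_on S f" "continuous_on S g"
  shows "continuous_on S (\<lambda>x. pt i (f x) (g x))"
  unfolding pt_def
proof (rule continuous_on_vec_lambda)
  show "continuous_on S (\<lambda>x. if k = i then f x else g x)" for k
    using assms by (cases "k = i") auto
qed

lemma pt_measurable [measurable]: "(\<lambda>(u, v). pt i u v) \<in> borel_measurable (borel \<Otimes>\<^sub>M borel)"
proof -
  have "continuous_on UNIV (\<lambda>p. pt i (fst p) (snd p))" by (intro continuous_intros)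
  from borel_measurable_continuous_onI[OF this] show ?thesis by (simp add: split_beta' borel_prod)
qed

lemma Basis_two: "i \<noteq> j \<Longrightarrow> (Basis :: (real^2) set) = {axis i 1, axis j 1}"
  by (auto simp: Basis_vec_def dest: two_cases)

lemma axis_neq: "i \<noteq> j \<Longrightarrow> axis i (1::real) \<noteq> axis j 1"
  by (simp add: axis_eq_axis)

lemma lborel_pt: "distr (lborel \<Otimes>\<^sub>M lborel) borel (\<lambda>(u, v). pt i u v) = lborel"
proof -
  obtain j :: 2 where ij: "i \<noteq> j" by (metis exhaust_2 zero_neq_one)
  show ?thesis
  proof (rule lborel_eqI[symmetric])
    fix l u :: "real^2"
    assume le: "\<And>b. b \<in> Basis \<Longrightarrow> l \<bullet> b \<le> u \<bullet> b"
    have le': "l $ i \<le> u $ i" "l $ j \<le> u $ j"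
      using le[of "axis i 1"] le[of "axis j 1"] by (auto simp: inner_axis)
    have b: "(\<lambda>(u, v). pt i u v) -` box l u \<inter> space (lborel \<Otimes>\<^sub>M lborel) = box (l $ i) (u $ i) \<times> box (l $ j) (u $ j)"
    proof (intro set_eqI)
      fix p :: "real \<times> real"
      have all: "(\<forall>k. Q k) \<longleftrightarrow> Q i \<and> Q j" for Q using two_cases[OF ij] by metis
      show "p \<in> (\<lambda>(u, v). pt i u v) -` box l u \<inter> space (lborel \<Otimes>\<^sub>M lborel) \<longleftrightarrow> p \<in> box (l $ i) (u $ i) \<times> box (l $ j) (u $ j)"
        using ij by (cases p) (simp add: space_pair_measure mem_box_cart all pt_nth box_real)
    qed
    have "emeasure (distr (lborel \<Otimes>\<^sub>M lborel) borel (\<lambda>(u, v). pt i u v)) (box l u) = emeasure (lborel \<Otimes>\<^sub>M lborel) (box (l $ i) (u $ i) \<times> box (l $ j) (u $ j))"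
      by (subst emeasure_distr) (auto simp: b[simplified])
    also have "\<dots> = emeasure lborel (box (l $ i) (u $ i)) * emeasure lborel (box (l $ j) (u $ j))"
      by (rule lborel.emeasure_pair_measure_Times) auto
    also have "\<dots> = ennreal (\<Prod>b\<in>Basis. (u - l) \<bullet> b)"
      using le' ij by (simp add: Basis_two[OF ij] axis_neq inner_axis ennreal_mult box_real)
    finally show "emeasure (distr (lborel \<Otimes>\<^sub>M lborel) borel (\<lambda>(u, v). pt i u v)) (box l u) = ennreal (\<Prod>b\<in>Basis. (u - l) \<bullet> b)" .
  qed simp
qed

lemma integrable_continuous_compact_support:
  fixes f :: "'a::euclidean_space \<Rightarrow> real"
  assumes f: "continuous_on UNIV f" and z: "\<And>x. R < norm x \<Longrightarrow> f x = 0"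
  shows "integrable lborel f"
proof -
  have "integrable lborel (\<lambda>x. indicator (cball 0 R) x *\<^sub>R f x)"
    by (rule borel_integrable_compact) (auto intro: continuous_on_subset[OF f])
  also have "(\<lambda>x. indicator (cball 0 R) x *\<^sub>R f x) = f"
    using z by (auto simp: indicator_def fun_eq_iff)
  finally show ?thesis .
qed

lemma
  fixes F f :: "real \<Rightarrow> real"
  assumes F: "\<And>x. (F has_real_derivative f x) (at x)" and f: "continuous_on UNIV f" and z: "\<And>x. B < \<bar>x\<bar> \<Longrightarrow> F x = 0"
  shows integral_derivative_halfline: "(\<integral>y. indicator {0<..} y * f y \<partial>lborel) = - F 0"
    and integral_derivative_line: "(\<integral>y. f y \<partial>lborel) = 0"
proof -
  define C where "C = \<bar>B\<bar> + 1"
  have C: "C > 0" "B < C" by (auto simp: C_def)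
  have f0: "f x = 0" if x: "C < \<bar>x\<bar>" for x
  proof (rule DERIV_local_const[OF F])
    show "0 < \<bar>x\<bar> - C" using x by simp
    show "\<forall>y. \<bar>x - y\<bar> < \<bar>x\<bar> - C \<longrightarrow> F x = F y"
    proof (intro allI impI)
      fix y assume "\<bar>x - y\<bar> < \<bar>x\<bar> - C"
      then have "B < \<bar>y\<bar>" using C by linarith
      moreover have "B < \<bar>x\<bar>" using x C by linarith
      ultimately show "F x = F y" by (simp add: z)
    qed
  qed
  have FC: "F C = 0" "F (- C) = 0" using C by (auto intro: z)
  have ftc: "(\<integral>y. indicator {a..C} y *\<^sub>R f y \<partial>lborel) = F C - F a" if "a \<le> C" for a
    using that by (intro integral_FTC_Icc continuous_on_subset[OF f])
      (auto intro!: has_vector_derivative_at_within[OF F[unfolded has_real_derivative_iff_has_vector_derivative]])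
  have m: "f \<in> borel_measurable borel" by (rule borel_measurable_continuous_onI[OF f])
  have "(\<integral>y. indicator {0<..} y * f y \<partial>lborel) = (\<integral>y. indicator {0..C} y *\<^sub>R f y \<partial>lborel)"
  proof (rule integral_cong_AE)
    show "AE y in lborel. indicator {0<..} y * f y = indicator {0..C} y *\<^sub>R f y"
      using AE_lborel_singleton[of "0::real"] by eventually_elim (auto simp: indicator_def intro!: f0)
  qed (use m in measurable)
  then show "(\<integral>y. indicator {0<..} y * f y \<partial>lborel) = - F 0" using ftc[of 0] C FC by simp
  have "(\<integral>y. f y \<partial>lborel) = (\<integral>y. indicator {-C..C} y *\<^sub>R f y \<partial>lborel)"
    by (intro Bochner_Integration.integral_cong refl) (auto simp: indicator_def intro!: f0)
  then show "(\<integral>y. f y \<partial>lborel) = 0" using ftc[of "-C"] C FC by simp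
qed

locale graph_divergence =
  fixes i j :: 2 and s :: real and g g' :: "real \<Rightarrow> real" and \<psi> :: "real^2 \<Rightarrow> real" and D and R :: real
  assumes ij: "i \<noteq> j" and s: "s = 1 \<or> s = -1"
    and g: "\<And>v. (g has_real_derivative g' v) (at v)" and g': "continuous_on UNIV g'"
    and \<psi>: "C1_with \<psi> D" and supp: "\<And>x. R < norm x \<Longrightarrow> \<psi> x = 0"
begin

text \<open>Coordinates that straighten the graph: the first entry is the height above the graph,
  the second the parameter. As s is 1 or -1, the map is a shear combined with a reflection, which
  preserves area and carries the half-plane of positive heights onto the region.\<close>

definition flat :: "real \<times> real \<Rightarrow> real^2" where
  "flat p = pt i (s * (fst p + g (snd p))) (snd p)"

lemma s2: "s * s = 1" "\<bar>s\<bar> = 1" using s by auto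

lemma D_zero: "R < norm x \<Longrightarrow> D x h = 0"
proof -
  assume x: "R < norm x"
  have "(\<psi> has_derivative D x) (at x)" using \<psi> by (simp add: C1_with_def)
  moreover have "((\<lambda>_. 0) has_derivative (\<lambda>_. 0)) (at x)" by simp
  then have "(\<psi> has_derivative (\<lambda>_. 0)) (at x)"
  proof (rule has_derivative_transform_within_open)
    show "open {y. R < norm y}" by (intro open_Collect_less continuous_intros)
  qed (use x supp in auto)
  ultimately have "D x = (\<lambda>_. 0)" by (rule has_derivative_unique)
  then show ?thesis by simp
qed

lemma cont_g: "continuous_on S g"
  by (meson DERIV_isCont continuous_at_imp_continuous_on g)

lemma cont_flat [continuous_intros]: "continuous_on S flat"
  unfolding flat_def by (intro continuous_intros continuous_on_compose2[OF cont_g]) auto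

lemma cont_D: "continuous_on S (\<lambda>p. D (flat p) h)"
  using \<psi> unfolding C1_with_def by (intro continuous_on_compose2[OF _ cont_flat]) auto

lemma flat_large: obtains B where "B \<ge> 0" "\<And>p. B < norm p \<Longrightarrow> R < norm (flat p)"
proof -
  have "bounded (g ` {-\<bar>R\<bar>..\<bar>R\<bar>})" by (intro compact_imp_bounded compact_continuous_image cont_g) auto
  then obtain G where G: "\<And>v. \<bar>v\<bar> \<le> \<bar>R\<bar> \<Longrightarrow> \<bar>g v\<bar> \<le> G" unfolding bounded_iff by force
  have G0: "G \<ge> 0" using G[of 0] by simp
  show thesis
  proof
    show "\<bar>R\<bar> + \<bar>R\<bar> + G \<ge> 0" using G0 by simp
    fix p assume p: "\<bar>R\<bar> + \<bar>R\<bar> + G < norm (p :: real \<times> real)"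
    obtain y v where yv: "p = (y, v)" by force
    show "R < norm (flat p)"
    proof (rule ccontr)
      assume "\<not> R < norm (flat p)"
      then have "\<bar>v\<bar> \<le> \<bar>R\<bar>" "\<bar>s * (y + g v)\<bar> \<le> \<bar>R\<bar>"
        using norm_pt_ge(1)[OF ij, of v "s * (y + g v)"] norm_pt_ge(2)[of "s * (y + g v)" i v] by (auto simp: flat_def yv)
      then have "\<bar>y + g v\<bar> \<le> \<bar>R\<bar>" "\<bar>g v\<bar> \<le> G" "\<bar>v\<bar> \<le> \<bar>R\<bar>" using G s by (auto simp: abs_mult)
      moreover have "norm p \<le> \<bar>y\<bar> + \<bar>v\<bar>" using norm_Pair_le[of y v] yv by simp
      ultimately show False using p by linarith
    qed
  qed
qed

lemma integrable_flat:
  assumes F: "continuous_on UNIV F" and z: "\<And>p. R < norm (flat p) \<Longrightarrow> F p = 0"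
  shows "integrable (lborel \<Otimes>\<^sub>M lborel) (F :: real \<times> real \<Rightarrow> real)"
proof -
  obtain B where "\<And>p. B < norm p \<Longrightarrow> R < norm (flat p)" using flat_large by metis
  then show ?thesis using integrable_continuous_compact_support[OF F, of B] z by (simp add: lborel_prod)
qed

lemma deriv_y: "((\<lambda>y. \<psi> (flat (y, v))) has_real_derivative s * D (flat (y, v)) (axis i 1)) (at y)"
proof -
  have "((\<lambda>y. flat (y, v)) has_derivative (\<lambda>h. (h * s) *\<^sub>R axis i 1)) (at y)"
    unfolding flat_def fst_conv snd_conv pt_decomp[OF ij] by (auto intro!: derivative_eq_intros simp: mult.commute)
  from has_derivative_compose[OF this, of \<psi> "D (flat (y, v))"]
  have *: "((\<lambda>y. \<psi> (flat (y, v))) has_derivative (\<lambda>h. D (flat (y, v)) ((h * s) *\<^sub>R axis i 1))) (at y)"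
    using \<psi> by (simp add: C1_with_def)
  have "linear (D (flat (y, v)))" using \<psi> by (auto simp: C1_with_def intro: has_derivative_linear)
  then have "D (flat (y, v)) ((h * s) *\<^sub>R axis i 1) = h * (s * D (flat (y, v)) (axis i 1))" for h
    by (simp add: linear_cmul mult.assoc)
  with * show ?thesis unfolding has_field_derivative_def by (simp add: mult.commute[of _ "s * _"])
qed

lemma deriv_v: "((\<lambda>v. \<psi> (flat (y, v))) has_real_derivative
    s * g' v * D (flat (y, v)) (axis i 1) + D (flat (y, v)) (axis j 1)) (at v)"
proof -
  have gd: "(g has_derivative (\<lambda>h. g' v * h)) (at v)" using g by (simp add: has_field_derivative_def)
  have "((\<lambda>v. flat (y, v)) has_derivative (\<lambda>h. (s * (g' v * h)) *\<^sub>R axis i 1 + h *\<^sub>R axis j 1)) (at v)"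
    unfolding flat_def fst_conv snd_conv pt_decomp[OF ij] by (auto intro!: derivative_eq_intros gd)
  from has_derivative_compose[OF this, of \<psi> "D (flat (y, v))"]
  have *: "((\<lambda>v. \<psi> (flat (y, v))) has_derivative (\<lambda>h. D (flat (y, v)) ((s * (g' v * h)) *\<^sub>R axis i 1 + h *\<^sub>R axis j 1))) (at v)"
    using \<psi> by (simp add: C1_with_def)
  have l: "linear (D (flat (y, v)))" using \<psi> by (auto simp: C1_with_def intro: has_derivative_linear)
  have "D (flat (y, v)) ((s * (g' v * h)) *\<^sub>R axis i 1 + h *\<^sub>R axis j 1) = (s * g' v * D (flat (y, v)) (axis i 1) + D (flat (y, v)) (axis j 1)) * h" for h
    by (simp add: linear_add[OF l] linear_cmul[OF l] algebra_simps)
  with * show ?thesis unfolding has_field_derivative_def by simp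
qed

text \<open>For fixed v the substitution is affine with slope s, so its Jacobian is 1, and the
  condition of lying above the graph becomes positivity of the new variable because s * s =
  1.\<close>

lemma integral_under_graph:
  fixes H :: "real^2 \<Rightarrow> real"
  assumes H: "continuous_on UNIV H" and z: "\<And>x. R < norm x \<Longrightarrow> H x = 0"
  shows "(\<integral>x. indicator {x. g (x $ j) < s * x $ i} x * H x \<partial>lborel) = (\<integral>v. \<integral>y. indicator {0<..} y * H (flat (y, v)) \<partial>lborel \<partial>lborel)"
proof -
  let ?S = "{x. g (x $ j) < s * x $ i}"
  have [measurable]: "?S \<in> sets borel"
    by (intro borel_open open_Collect_less continuous_intros continuous_on_compose2[OF cont_g]) auto
  have [measurable]: "H \<in> borel_measurable borel" by (rule borel_measurable_continuous_onI[OF H])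
  let ?k = "\<lambda>x. indicator ?S x * H x"
  have iH: "integrable lborel ?k"
  proof (rule Bochner_Integration.integrable_bound[OF integrable_continuous_compact_support[OF H z]])
    show "?k \<in> borel_measurable lborel" by measurable
  qed (auto simp: indicator_def)
  have ik: "integrable (lborel \<Otimes>\<^sub>M lborel) (\<lambda>p. ?k (case p of (u, v) \<Rightarrow> pt i u v))"
    using iH lborel_pt[of i, symmetric] integrable_distr_eq[of "\<lambda>(u, v). pt i u v" "lborel \<Otimes>\<^sub>M lborel" borel ?k] by simp
  have "(\<integral>x. ?k x \<partial>lborel) = (\<integral>p. ?k (case p of (u, v) \<Rightarrow> pt i u v) \<partial>(lborel \<Otimes>\<^sub>M lborel))"
    by (subst lborel_pt[of i, symmetric]) (simp add: integral_distr)
  also have "\<dots> = (\<integral>v. \<integral>u. ?k (pt i u v) \<partial>lborel \<partial>lborel)"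
    using lborel_pair.integral_snd[of "\<lambda>u v. ?k (pt i u v)"] ik by (simp add: split_beta')
  also have "\<dots> = (\<integral>v. \<integral>y. indicator {0<..} y * H (flat (y, v)) \<partial>lborel \<partial>lborel)"
  proof (rule Bochner_Integration.integral_cong[OF refl])
    fix v
    have "(\<integral>u. ?k (pt i u v) \<partial>lborel) = \<bar>s\<bar> *\<^sub>R (\<integral>y. ?k (pt i (s * g v + s * y) v) \<partial>lborel)"
      using s by (intro lborel_integral_real_affine) auto
    also have "\<dots> = (\<integral>y. indicator {0<..} y * H (flat (y, v)) \<partial>lborel)"
    proof -
      have "?k (pt i (s * g v + s * y) v) = indicator {0<..} y * H (flat (y, v))" for y
      proof -
        have "s * (s * g v + s * y) = (s * s) * (g v + y)" by (simp add: algebra_simps)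
        then have "s * (s * g v + s * y) = g v + y" using s2 by simp
        then show ?thesis using ij s2 by (simp add: flat_def pt_nth indicator_def distrib_left add.commute)
      qed
      then show ?thesis using s2 by simp
    qed
    finally show "(\<integral>u. ?k (pt i u v) \<partial>lborel) = (\<integral>y. indicator {0<..} y * H (flat (y, v)) \<partial>lborel)" .
  qed
  finally show ?thesis .
qed

lemma half_y: "(\<integral>y. indicator {0<..} y * (s * D (flat (y, v)) (axis i 1)) \<partial>lborel) = - \<psi> (pt i (s * g v) v)"
proof -
  obtain B where B: "\<And>p. B < norm p \<Longrightarrow> R < norm (flat p)" using flat_large by metis
  have "\<psi> (flat (y, v)) = 0" if "B < \<bar>y\<bar>" for y
    using B[of "(y, v)"] that norm_fst_le[of y v] by (intro supp) simp
  from integral_derivative_halfline[OF deriv_y _ this] show ?thesis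
    by (simp add: flat_def[of "(0, v)"] continuous_on_mult_left continuous_on_compose2[OF cont_D[of UNIV]] continuous_intros)
qed

text \<open>For fixed v this is the fundamental theorem on a half-line. The boundary term carries s,
  the i-th component of the normal that points into the region.\<close>

theorem divergence_i:
  "(\<integral>x. indicator {x. g (x $ j) < s * x $ i} x * D x (axis i 1) \<partial>lborel) = - (\<integral>v. \<psi> (pt i (s * g v) v) * s \<partial>lborel)"
proof -
  have cD: "continuous_on UNIV (\<lambda>x. D x (axis i 1))" using \<psi> by (simp add: C1_with_def)
  have "(\<integral>x. indicator {x. g (x $ j) < s * x $ i} x * D x (axis i 1) \<partial>lborel)
     = (\<integral>v. \<integral>y. indicator {0<..} y * D (flat (y, v)) (axis i 1) \<partial>lborel \<partial>lborel)"
    by (rule integral_under_graph[OF cD D_zero])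
  also have "\<dots> = (\<integral>v. - (\<psi> (pt i (s * g v) v) * s) \<partial>lborel)"
  proof (rule Bochner_Integration.integral_cong[OF refl])
    fix v
    have "indicator {0<..} y * D (flat (y, v)) (axis i 1) = s * (indicator {0<..} y * (s * D (flat (y, v)) (axis i 1)))" for y
      using s2 by (simp add: mult.left_commute[of s] mult.assoc[symmetric])
    then show "(\<integral>y. indicator {0<..} y * D (flat (y, v)) (axis i 1) \<partial>lborel) = - (\<psi> (pt i (s * g v) v) * s)"
      by (simp only: integral_mult_right_zero half_y) simp
  qed
  finally show ?thesis by simp
qed

text \<open>By the chain rule the derivative along axis j is the v-derivative of the straightened
  function minus g' times its height derivative. The first term integrates to 0 over v at every
  fixed height; the second is again a half-line integral and leaves -g', the j-th component of the
  same normal.\<close>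

theorem divergence_j:
  "(\<integral>x. indicator {x. g (x $ j) < s * x $ i} x * D x (axis j 1) \<partial>lborel) = - (\<integral>v. \<psi> (pt i (s * g v) v) * - g' v \<partial>lborel)"
proof -
  let ?Dy = "\<lambda>y v. s * D (flat (y, v)) (axis i 1)"
  let ?Dv = "\<lambda>y v. s * g' v * D (flat (y, v)) (axis i 1) + D (flat (y, v)) (axis j 1)"
  have cD: "continuous_on UNIV (\<lambda>x. D x (axis j 1))" using \<psi> by (simp add: C1_with_def)
  have cg: "continuous_on UNIV (\<lambda>p::real\<times>real. g' (snd p))"
    by (intro continuous_on_compose2[OF g'] continuous_intros) auto
  have i0: "integrable (lborel \<Otimes>\<^sub>M lborel) (\<lambda>p. indicator {0<..} (fst p) * F p)"
    if "continuous_on UNIV F" "\<And>p. R < norm (flat p) \<Longrightarrow> F p = 0" for F :: "real \<times> real \<Rightarrow> real"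
  proof (rule Bochner_Integration.integrable_bound[OF integrable_flat[OF that]])
    have [measurable]: "F \<in> borel_measurable (borel \<Otimes>\<^sub>M borel)"
      using borel_measurable_continuous_onI[OF that(1)] by (simp add: borel_prod)
    show "(\<lambda>p. indicator {0<..} (fst p) * F p) \<in> borel_measurable (lborel \<Otimes>\<^sub>M lborel)" by measurable
  qed (auto simp: indicator_def)
  have iv: "integrable (lborel \<Otimes>\<^sub>M lborel) (\<lambda>(y, v). indicator {0<..} y * ?Dv y v)"
    using i0[of "\<lambda>p. s * g' (snd p) * D (flat p) (axis i 1) + D (flat p) (axis j 1)"]
    by (simp add: split_beta' D_zero continuous_on_add continuous_on_mult continuous_on_const cg cont_D)
  have iy: "integrable (lborel \<Otimes>\<^sub>M lborel) (\<lambda>(y, v). indicator {0<..} y * (g' v * ?Dy y v))"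
    using i0[of "\<lambda>p. g' (snd p) * (s * D (flat p) (axis i 1))"]
    by (simp add: split_beta' D_zero continuous_on_mult continuous_on_const cg cont_D)
  have "(\<integral>x. indicator {x. g (x $ j) < s * x $ i} x * D x (axis j 1) \<partial>lborel)
     = (\<integral>v. \<integral>y. indicator {0<..} y * D (flat (y, v)) (axis j 1) \<partial>lborel \<partial>lborel)"
    by (rule integral_under_graph[OF cD D_zero])
  also have "\<dots> = (\<integral>v. \<integral>y. indicator {0<..} y * ?Dv y v - indicator {0<..} y * (g' v * ?Dy y v) \<partial>lborel \<partial>lborel)"
    by (intro Bochner_Integration.integral_cong refl) (simp add: algebra_simps)
  also have "\<dots> = (\<integral>(y, v). indicator {0<..} y * ?Dv y v - indicator {0<..} y * (g' v * ?Dy y v) \<partial>(lborel \<Otimes>\<^sub>M lborel))"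
    using lborel_pair.integral_snd[of "\<lambda>y v. indicator {0<..} y * ?Dv y v - indicator {0<..} y * (g' v * ?Dy y v)"]
      Bochner_Integration.integrable_diff[OF iv iy] by (simp add: split_beta')
  also have "\<dots> = (\<integral>(y, v). indicator {0<..} y * ?Dv y v \<partial>(lborel \<Otimes>\<^sub>M lborel)) - (\<integral>(y, v). indicator {0<..} y * (g' v * ?Dy y v) \<partial>(lborel \<Otimes>\<^sub>M lborel))"
    using Bochner_Integration.integral_diff[OF iv iy] by (simp add: split_beta')
  also have "(\<integral>(y, v). indicator {0<..} y * ?Dv y v \<partial>(lborel \<Otimes>\<^sub>M lborel)) = (\<integral>y. \<integral>v. indicator {0<..} y * ?Dv y v \<partial>lborel \<partial>lborel)"
    using lborel_pair.integral_fst[OF iv] by simp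
  also have "\<dots> = 0"
  proof -
    obtain B where B: "\<And>p. B < norm p \<Longrightarrow> R < norm (flat p)" using flat_large by metis
    have "(\<integral>v. ?Dv y v \<partial>lborel) = 0" for y
    proof (rule integral_derivative_line[OF deriv_v])
      show "continuous_on UNIV (\<lambda>v. ?Dv y v)"
        by (intro continuous_intros g' continuous_on_compose2[OF cont_D[of UNIV]]) auto
      show "\<psi> (flat (y, v)) = 0" if "B < \<bar>v\<bar>" for v
        using B[of "(y, v)"] that norm_snd_le[of v y] by (intro supp) simp
    qed
    then show ?thesis by simp
  qed
  also have "(\<integral>(y, v). indicator {0<..} y * (g' v * ?Dy y v) \<partial>(lborel \<Otimes>\<^sub>M lborel)) = (\<integral>v. \<integral>y. indicator {0<..} y * (g' v * ?Dy y v) \<partial>lborel \<partial>lborel)"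
    using lborel_pair.integral_snd[OF iy] by simp
  also have "\<dots> = (\<integral>v. g' v * (\<integral>y. indicator {0<..} y * ?Dy y v \<partial>lborel) \<partial>lborel)"
    by (simp only: integral_mult_right_zero[symmetric] mult.left_commute[of "g' _"])
  also have "\<dots> = (\<integral>v. \<psi> (pt i (s * g v) v) * - g' v \<partial>lborel)"
    unfolding half_y by (simp add: mult.commute)
  finally show ?thesis by simp
qed

end

section \<open>Integration over shifted periodicity boxes\<close>

lemma cell_shift: "x \<in> cell (p - One) 2 k \<longleftrightarrow> x - p - 2 *\<^sub>R k \<in> pbox"
proof -
  have "x \<in> cell (p - One) 2 k \<longleftrightarrow> x - p \<in> cell (- One) 2 k"
    by (simp add: cell_def algebra_simps)
  then show ?thesis by (simp add: mem_cell_pbox)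
qed

text \<open>All fundamental domains are equivalent for periodic integrands: cut the shifted box by
  the period cells and translate the pieces back. It allows the box to be centred at a chart, so
  that its rim does not cut the chart.\<close>

lemma nn_integral_shifted_pbox:
  fixes h :: "'a::euclidean_space \<Rightarrow> ennreal"
  assumes per: "\<And>x k. k \<in> int_lattice \<Longrightarrow> h (x + 2 *\<^sub>R k) = h x" and [measurable]: "h \<in> borel_measurable borel"
  shows "(\<integral>\<^sup>+x. h x * indicator (cell (p - One) 2 0) x \<partial>lborel) = (\<integral>\<^sup>+x. h x * indicator pbox x \<partial>lborel)"
proof -
  let ?Q = "cell (p - One) 2 0"
  have m: "(\<lambda>x. h x * indicator ?Q x * indicator (cell (- One) 2 k) x) \<in> borel_measurable borel" for k by measurable
  have m2: "(\<lambda>x. h x * indicator pbox x * indicator ?Q (x + 2 *\<^sub>R k)) \<in> borel_measurable borel" for k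
  proof -
    have [measurable]: "(\<lambda>x. indicator ?Q (x + 2 *\<^sub>R k) :: ennreal) \<in> borel_measurable borel"
      by (rule measurable_compose[where N=borel and g="indicator ?Q"]) (auto intro!: borel_measurable_indicator)
    show ?thesis by measurable
  qed
  have "(\<integral>\<^sup>+x. h x * indicator ?Q x \<partial>lborel) = (\<integral>\<^sup>+k. \<integral>\<^sup>+x. h x * indicator ?Q x * indicator (cell (- One) 2 k) x \<partial>lborel \<partial>count_space int_lattice)"
    by (rule nn_integral_cells) auto
  also have "\<dots> = (\<integral>\<^sup>+k. \<integral>\<^sup>+x. h x * indicator pbox x * indicator ?Q (x + 2 *\<^sub>R k) \<partial>lborel \<partial>count_space int_lattice)"
  proof (rule nn_integral_cong)
    fix k :: 'a assume k: "k \<in> space (count_space int_lattice)"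
    have "(\<integral>\<^sup>+x. h x * indicator ?Q x * indicator (cell (- One) 2 k) x \<partial>lborel)
       = (\<integral>\<^sup>+x. h (x + 2 *\<^sub>R k) * indicator ?Q (x + 2 *\<^sub>R k) * indicator (cell (- One) 2 k) (x + 2 *\<^sub>R k) \<partial>lborel)"
      by (rule nn_integral_lborel_shift[OF m, symmetric])
    also have "\<dots> = (\<integral>\<^sup>+x. h x * indicator pbox x * indicator ?Q (x + 2 *\<^sub>R k) \<partial>lborel)"
      using k by (intro nn_integral_cong) (auto simp: per mem_cell_pbox indicator_def)
    finally show "(\<integral>\<^sup>+x. h x * indicator ?Q x * indicator (cell (- One) 2 k) x \<partial>lborel) = \<dots>" .
  qed
  also have "\<dots> = (\<integral>\<^sup>+x. \<integral>\<^sup>+k. h x * indicator pbox x * indicator ?Q (x + 2 *\<^sub>R k) \<partial>count_space int_lattice \<partial>lborel)"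
    by (rule nn_integral_count_space_nn_integral[symmetric, OF countable_int_lattice]) (use m2 in simp)
  also have "\<dots> = (\<integral>\<^sup>+x. h x * indicator pbox x \<partial>lborel)"
  proof (rule nn_integral_cong)
    fix x :: 'a
    obtain k where k: "k \<in> int_lattice" "x \<in> cell (p - One) 2 k"
      and u: "\<And>j. j \<in> int_lattice \<Longrightarrow> x \<in> cell (p - One) 2 j \<Longrightarrow> j = k"
      using cell_unique[of 2 x "p - One"] by auto
    have "indicator ?Q (x + 2 *\<^sub>R j) = (indicator {-k} j :: ennreal)" if j: "j \<in> int_lattice" for j
    proof -
      have "x + 2 *\<^sub>R j \<in> ?Q \<longleftrightarrow> x \<in> cell (p - One) 2 (-j)" by (simp add: cell_shift algebra_simps)
      also have "\<dots> \<longleftrightarrow> j = -k" using u[of "-j"] k j by (auto simp: int_lattice_uminus)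
      finally show ?thesis by (simp add: indicator_def)
    qed
    then have "(\<integral>\<^sup>+j. h x * indicator pbox x * indicator ?Q (x + 2 *\<^sub>R j) \<partial>count_space int_lattice)
      = (\<integral>\<^sup>+j. h x * indicator pbox x * indicator {-k} j \<partial>count_space int_lattice)"
      by (intro nn_integral_cong) auto
    also have "\<dots> = h x * indicator pbox x"
      using k by (subst nn_integral_cmult_indicator) (auto simp: int_lattice_uminus)
    finally show "(\<integral>\<^sup>+j. h x * indicator pbox x * indicator ?Q (x + 2 *\<^sub>R j) \<partial>count_space int_lattice) = h x * indicator pbox x" .
  qed
  finally show ?thesis .
qed

lemma integral_shifted_pbox:
  fixes h :: "'a::euclidean_space \<Rightarrow> real"
  assumes per: "\<And>x k. k \<in> int_lattice \<Longrightarrow> h (x + 2 *\<^sub>R k) = h x" and hm [measurable]: "h \<in> borel_measurable borel"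
    and i: "integrable lborel (\<lambda>x. indicator pbox x * h x)"
  shows "(\<integral>x. indicator (cell (p - One) 2 0) x * h x \<partial>lborel) = (\<integral>x. indicator pbox x * h x \<partial>lborel)"
proof -
  let ?Q = "cell (p - One) 2 0"
  have nn: "(\<integral>\<^sup>+x. ennreal (indicator ?Q x * f x) \<partial>lborel) = (\<integral>\<^sup>+x. ennreal (indicator pbox x * f x) \<partial>lborel)"
    if "\<And>x k. k \<in> int_lattice \<Longrightarrow> f (x + 2 *\<^sub>R k) = f x" and [measurable]: "f \<in> borel_measurable borel" for f :: "'a \<Rightarrow> real"
  proof -
    have "ennreal (indicator S x * f x) = ennreal (f x) * indicator S x" for S x by (simp add: indicator_def)
    then show ?thesis using nn_integral_shifted_pbox[of "\<lambda>x. ennreal (f x)" p] that by simp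
  qed
  have "(\<integral>\<^sup>+x. ennreal (norm (indicator ?Q x * h x)) \<partial>lborel) = (\<integral>\<^sup>+x. ennreal (norm (indicator pbox x * h x)) \<partial>lborel)"
    using nn[of "\<lambda>x. \<bar>h x\<bar>"] per by (simp add: abs_mult)
  then have i2: "integrable lborel (\<lambda>x. indicator ?Q x * h x)"
    using i unfolding integrable_iff_bounded by auto
  have "(\<integral>\<^sup>+x. ennreal (- (indicator ?Q x * h x)) \<partial>lborel) = (\<integral>\<^sup>+x. ennreal (- (indicator pbox x * h x)) \<partial>lborel)"
    using nn[of "\<lambda>x. - h x"] per by simp
  then show ?thesis
    unfolding real_lebesgue_integral_def[OF i] real_lebesgue_integral_def[OF i2] using nn[OF per hm] by simp
qed

section \<open>A periodic partition of unity of class $C^1$\<close>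

lemma C1_with_mult:
  assumes "C1_with f D" "C1_with g E"
  shows "C1_with (\<lambda>x. f x * g x) (\<lambda>x h. f x * E x h + D x h * g x)"
  unfolding C1_with_def
proof safe
  fix x show "((\<lambda>x. f x * g x) has_derivative (\<lambda>h. f x * E x h + D x h * g x)) (at x)"
    using assms by (intro has_derivative_mult) (auto simp: C1_with_def)
next
  fix h show "continuous_on UNIV (\<lambda>x. f x * E x h + D x h * g x)"
    using assms C1_with_continuous[OF assms(1)] C1_with_continuous[OF assms(2)]
    by (intro continuous_intros) (auto simp: C1_with_def)
qed

lemma C1_with_divide:
  assumes "C1_with f D" "C1_with g E" and g: "\<And>x. g x \<noteq> 0"
  shows "C1_with (\<lambda>x. f x / g x) (\<lambda>x h. (D x h * g x - f x * E x h) / (g x * g x))"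
  unfolding C1_with_def
proof safe
  fix x show "((\<lambda>x. f x / g x) has_derivative (\<lambda>h. (D x h * g x - f x * E x h) / (g x * g x))) (at x)"
    using assms g[of x] by (intro has_derivative_divide') (auto simp: C1_with_def)
next
  fix h show "continuous_on UNIV (\<lambda>x. (D x h * g x - f x * E x h) / (g x * g x))"
    using assms C1_with_continuous[OF assms(1)] C1_with_continuous[OF assms(2)]
    by (intro continuous_intros) (auto simp: C1_with_def)
qed

lemma C1_with_sum:
  assumes "\<And>p. p \<in> K \<Longrightarrow> C1_with (f p) (D p)"
  shows "C1_with (\<lambda>x. \<Sum>p\<in>K. f p x) (\<lambda>x h. \<Sum>p\<in>K. D p x h)"
  using assms unfolding C1_with_def
  by (auto intro!: has_derivative_sum continuous_on_sum)

lemma Ck_1_C1_with: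
  assumes "Ck 1 f"
  shows "C1_with f (\<lambda>x. frechet_derivative f (at x))"
  unfolding C1_with_def
proof safe
  have d: "f differentiable (at x)" for x using assms by simp
  show "(f has_derivative frechet_derivative f (at x)) (at x)" for x using d frechet_derivative_works by blast
  fix h
  have "frechet_derivative f (at x) h = (\<Sum>b\<in>Basis. (h \<bullet> b) * frechet_derivative f (at x) b)" for x
  proof -
    have l: "linear (frechet_derivative f (at x))" by (rule linear_frechet_derivative[OF d])
    have "frechet_derivative f (at x) h = frechet_derivative f (at x) (\<Sum>b\<in>Basis. (h \<bullet> b) *\<^sub>R b)"
      by (simp add: euclidean_representation)
    also have "\<dots> = (\<Sum>b\<in>Basis. (h \<bullet> b) * frechet_derivative f (at x) b)"
      by (simp add: linear_sum[OF l] linear_cmul[OF l])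
    finally show ?thesis .
  qed
  then show "continuous_on UNIV (\<lambda>x. frechet_derivative f (at x) h)"
    using assms by (auto intro!: continuous_intros)
qed

text \<open>The squared positive part is the simplest C1 function that vanishes on a half-line
  without vanishing identically; composed with a trigonometric polynomial it yields the
  bumps.\<close>

lemma DERIV_sq_pos_part: "((\<lambda>t::real. (max 0 t)\<^sup>2) has_real_derivative 2 * max 0 t) (at t)"
proof -
  consider "t > 0" | "t < 0" | "t = 0" by linarith
  then show ?thesis
  proof cases
    case 1
    have "((\<lambda>t::real. t\<^sup>2) has_real_derivative 2 * max 0 t) (at t)"
      using 1 by (auto intro!: derivative_eq_intros)
    then show ?thesis
      by (rule has_field_derivative_transform_within_open[of _ _ _ "{0<..}"]) (use 1 in auto)
  next
    case 2
    have "((\<lambda>t::real. 0) has_real_derivative 2 * max 0 t) (at t)" using 2 by simp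
    then show ?thesis
      by (rule has_field_derivative_transform_within_open[of _ _ _ "{..<0}"]) (use 2 in auto)
  next
    case 3
    have "((\<lambda>h::real. (max 0 h)\<^sup>2 / h) \<longlongrightarrow> 0) (at 0)"
    proof (rule Lim_null_comparison[where g="\<lambda>h. \<bar>h\<bar>"])
      show "\<forall>\<^sub>F h in at (0::real). norm ((max 0 h)\<^sup>2 / h) \<le> \<bar>h\<bar>"
        by (intro always_eventually allI) (auto simp: max_def power2_eq_square)
    qed (auto intro!: tendsto_eq_intros)
    then show ?thesis by (simp add: 3 DERIV_def)
  qed
qed

text \<open>The trigonometric polynomial q is nonnegative and vanishes on the closed box centred at
  p only at p itself. Off the ball it therefore has a positive lower bound \<delta>, and the squared
  positive part of \<delta> - q is a periodic bump of class C1.\<close>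

lemma periodic_bump:
  fixes p :: "'a::euclidean_space"
  assumes r: "r > 0"
  obtains \<eta> D where "C1_with \<eta> D" "periodic \<eta>" "\<And>x. 0 \<le> \<eta> x" "0 < \<eta> p" "\<And>x. \<eta> x \<noteq> 0 \<Longrightarrow> x \<in> pext (ball p r)"
proof -
  define q where "q x = (\<Sum>b\<in>Basis. 1 - cos (pi * ((x - p) \<bullet> b)))" for x :: 'a
  define S where "S = cbox (p - One) (p + One) - ball p r"
  have cq: "continuous_on T q" for T unfolding q_def by (intro continuous_intros)
  have q0: "q x \<ge> 0" for x unfolding q_def by (intro sum_nonneg) simp
  have perq: "q (x + 2 *\<^sub>R k) = q x" if k: "k \<in> int_lattice" for x k
    unfolding q_def
  proof (rule sum.cong[OF refl])
    fix b :: 'a assume "b \<in> Basis"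
    then obtain n :: int where n: "k \<bullet> b = of_int n" using k by (force simp: int_lattice_def elim: Ints_cases)
    have "pi * ((x + 2 *\<^sub>R k - p) \<bullet> b) = pi * ((x - p) \<bullet> b) + 2 * pi * of_int n"
      by (simp add: inner_simps n algebra_simps)
    then show "1 - cos (pi * ((x + 2 *\<^sub>R k - p) \<bullet> b)) = 1 - cos (pi * ((x - p) \<bullet> b))"
      by (simp only: cos_add sin_int_2pin cos_int_2pin mult_1_right mult_zero_right diff_zero)
  qed
  have qpos: "q x > 0" if x: "x \<in> S" for x
  proof (rule ccontr)
    assume "\<not> q x > 0"
    then have "q x = 0" using q0[of x] by simp
    then have z: "\<forall>b\<in>Basis. 1 - cos (pi * ((x - p) \<bullet> b)) = 0"
      unfolding q_def by (subst (asm) sum_nonneg_eq_0_iff) auto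
    have "x - p = 0"
    proof (rule euclidean_eqI)
      fix b :: 'a assume b: "b \<in> Basis"
      have One_b: "One \<bullet> b = 1" using inner_sum_left_Basis[OF b, of "\<lambda>_. 1"] by simp
      have "\<bar>(x - p) \<bullet> b\<bar> \<le> 1"
        using x b by (auto simp: S_def mem_box inner_diff_left inner_add_left One_b abs_le_iff)
      moreover obtain n :: int where "pi * ((x - p) \<bullet> b) = of_int n * 2 * pi"
        using z b cos_one_2pi_int by force
      then have "(x - p) \<bullet> b = 2 * of_int n" by simp
      ultimately have "n = 0" by linarith
      then show "(x - p) \<bullet> b = 0 \<bullet> b" using \<open>(x - p) \<bullet> b = 2 * of_int n\<close> by simp
    qed
    then show False using x r by (simp add: S_def)
  qed
  \<comment> \<open>The ball may cover the whole box; then there is nothing to bound and any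
    positive number will do.\<close>
  obtain \<delta> where \<delta>: "\<delta> > 0" "\<And>x. x \<in> S \<Longrightarrow> \<delta> \<le> q x"
  proof (cases "S = {}")
    case True then show thesis using that[of 1] by simp
  next
    case False
    have "compact S" unfolding S_def by (intro compact_diff) auto
    from continuous_attains_inf[OF this False cq] obtain x where "x \<in> S" "\<forall>y\<in>S. q x \<le> q y" by auto
    then show thesis using that[of "q x"] qpos by auto
  qed
  define \<eta> where "\<eta> x = (max 0 (\<delta> - q x))\<^sup>2" for x
  define D where "D x h = 2 * max 0 (\<delta> - q x) * (- (\<Sum>b\<in>Basis. sin (pi * ((x - p) \<bullet> b)) * (pi * (h \<bullet> b))))" for x h
  show thesis
  proof
    show "C1_with \<eta> D"
      unfolding C1_with_def
    proof safe
      fix x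
      have "((\<lambda>x. \<delta> - q x) has_derivative (\<lambda>h. - (\<Sum>b\<in>Basis. sin (pi * ((x - p) \<bullet> b)) * (pi * (h \<bullet> b))))) (at x)"
        unfolding q_def by (auto intro!: derivative_eq_intros simp: sum_negf mult_ac)
      from has_derivative_compose[OF this DERIV_sq_pos_part[unfolded has_field_derivative_def]]
      show "(\<eta> has_derivative D x) (at x)" unfolding \<eta>_def D_def by simp
      show "continuous_on UNIV (\<lambda>x. D x h)" for h
        unfolding D_def by (intro continuous_intros cq)
    qed
    show "periodic \<eta>"
      unfolding periodic_def \<eta>_def using perq by (simp add: int_lattice_def inner_Basis)
    show "0 \<le> \<eta> x" for x by (simp add: \<eta>_def)
    show "0 < \<eta> p" using \<delta> by (simp add: \<eta>_def q_def)
    fix x assume "\<eta> x \<noteq> 0"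
    then have qx: "q x < \<delta>" by (auto simp: \<eta>_def max_def split: if_splits)
    obtain k where k: "k \<in> int_lattice" "x \<in> cell (p - One) 2 k" using cell_unique[of 2 x "p - One"] by auto
    define y where "y = x + 2 *\<^sub>R (- k)"
    have "y - p \<in> pbox" using k by (simp add: cell_shift y_def algebra_simps)
    then have "y \<in> cbox (p - One) (p + One)"
    proof -
      have "One \<bullet> b = 1" if "b \<in> Basis" for b :: 'a using inner_sum_left_Basis[OF that, of "\<lambda>_. 1"] by simp
      then show ?thesis using \<open>y - p \<in> pbox\<close> by (force simp: pbox_def mem_box inner_diff_left inner_add_left)
    qed
    moreover have "q y < \<delta>" unfolding y_def using perq[OF int_lattice_uminus[OF k(1)]] qx by simp
    ultimately have "y \<in> ball p r" using \<delta>(2)[of y] by (force simp: S_def)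
    then show "x \<in> pext (ball p r)" unfolding mem_pext y_def using int_lattice_uminus[OF k(1)] by blast
  qed
qed

text \<open>Finitely many bumps cover the closed box by compactness. By periodicity their sum is
  positive everywhere, and dividing by it keeps both the class C1 and the periods.\<close>

lemma periodic_partition_of_unity:
  fixes r :: "'a::euclidean_space \<Rightarrow> real"
  assumes r: "\<And>p. r p > 0"
  obtains K \<theta> D where "finite K" "\<And>p. p \<in> K \<Longrightarrow> C1_with (\<theta> p) (D p)" "\<And>p. p \<in> K \<Longrightarrow> periodic (\<theta> p)"
    "\<And>p x. p \<in> K \<Longrightarrow> 0 \<le> \<theta> p x" "\<And>p x. p \<in> K \<Longrightarrow> \<theta> p x \<noteq> 0 \<Longrightarrow> x \<in> pext (ball p (r p))"
    "\<And>x. (\<Sum>p\<in>K. \<theta> p x) = 1"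
proof -
  have "\<exists>\<eta> D. C1_with \<eta> D \<and> periodic \<eta> \<and> (\<forall>x. 0 \<le> \<eta> x) \<and> 0 < \<eta> p \<and> (\<forall>x. \<eta> x \<noteq> 0 \<longrightarrow> x \<in> pext (ball p (r p)))" for p
    by (rule periodic_bump[OF r[of p], of p]) blast
  then obtain \<eta> D where \<eta>: "\<And>p. C1_with (\<eta> p) (D p)" "\<And>p. periodic (\<eta> p)" "\<And>p x. 0 \<le> \<eta> p x" "\<And>p. 0 < \<eta> p p"
    "\<And>p x. \<eta> p x \<noteq> 0 \<Longrightarrow> x \<in> pext (ball p (r p))" by metis
  let ?C = "cbox (- One) One :: 'a set"
  have "\<exists>K \<subseteq> ?C. finite K \<and> ?C \<subseteq> (\<Union>p\<in>K. {x. 0 < \<eta> p x})"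
  proof (rule compactE_image[of ?C ?C "\<lambda>p. {x. 0 < \<eta> p x}"])
    show "open {x. 0 < \<eta> p x}" for p
      by (intro open_Collect_less continuous_intros C1_with_continuous[OF \<eta>(1)])
    show "?C \<subseteq> (\<Union>p\<in>?C. {x. 0 < \<eta> p x})" using \<eta>(4) by blast
  qed auto
  then obtain K where K: "finite K" "?C \<subseteq> (\<Union>p\<in>K. {x. 0 < \<eta> p x})" by auto
  define S where "S x = (\<Sum>p\<in>K. \<eta> p x)" for x
  have S: "S x > 0" for x
  proof -
    obtain k where k: "k \<in> int_lattice" "x \<in> cell (- One) 2 k" using cell_unique[of 2 x "- One"] by auto
    define y where "y = x + 2 *\<^sub>R (- k)"
    have "y \<in> pbox" using k by (simp add: mem_cell_pbox y_def)
    then have "y \<in> ?C"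
    proof -
      have "One \<bullet> b = 1" if "b \<in> Basis" for b :: 'a using inner_sum_left_Basis[OF that, of "\<lambda>_. 1"] by simp
      then show ?thesis using \<open>y \<in> pbox\<close> by (force simp: pbox_def mem_box inner_minus_left)
    qed
    then obtain p where p: "p \<in> K" "0 < \<eta> p y" using K by auto
    have "\<eta> p y = \<eta> p x" unfolding y_def by (rule periodic_int_lattice[OF \<eta>(2) int_lattice_uminus[OF k(1)]])
    then show ?thesis unfolding S_def using p K \<eta>(3) by (intro sum_pos2[of K p]) auto
  qed
  have CS: "C1_with S (\<lambda>x h. \<Sum>p\<in>K. D p x h)"
    unfolding S_def by (rule C1_with_sum) (rule \<eta>(1))
  define \<theta> where "\<theta> p x = \<eta> p x / S x" for p x
  show thesis
  proof
    show "finite K" by fact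
    show "C1_with (\<theta> p) (\<lambda>x h. (D p x h * S x - \<eta> p x * (\<Sum>p\<in>K. D p x h)) / (S x * S x))" for p
      unfolding \<theta>_def using S by (intro C1_with_divide[OF \<eta>(1) CS]) (metis less_irrefl)
    show "periodic (\<theta> p)" for p
      using \<eta>(2) unfolding periodic_def \<theta>_def S_def by simp
    show "0 \<le> \<theta> p x" for p x using \<eta>(3) S[of x] by (simp add: \<theta>_def less_imp_le)
    show "\<theta> p x \<noteq> 0 \<Longrightarrow> x \<in> pext (ball p (r p))" for p x using \<eta>(5)[of p x] by (auto simp: \<theta>_def)
    show "(\<Sum>p\<in>K. \<theta> p x) = 1" for x
      using S[of x] by (simp add: \<theta>_def S_def[symmetric] sum_divide_distrib[symmetric])
  qed
qed

section \<open>Vector measures carried by curves\<close>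

definition wrap :: "'a::euclidean_space \<Rightarrow> 'a" where
  "wrap x = x - 2 *\<^sub>R (\<Sum>b\<in>Basis. of_int \<lfloor>(x \<bullet> b + 1) / 2\<rfloor> *\<^sub>R b)"

lemma wrap_mem: "wrap x \<in> pbox"
  unfolding pbox_def
proof safe
  fix b :: 'a assume b: "b \<in> Basis"
  have e: "wrap x \<bullet> b = x \<bullet> b - 2 * of_int \<lfloor>(x \<bullet> b + 1) / 2\<rfloor>"
    unfolding wrap_def by (simp only: inner_diff_left inner_scaleR_left inner_sum_left_Basis[OF b])
  show "-1 \<le> wrap x \<bullet> b" "wrap x \<bullet> b < 1"
    unfolding e using floor_correct[of "(x \<bullet> b + 1) / 2"] by (simp_all add: field_simps)
qed

lemma wrap_shift: "\<exists>k\<in>int_lattice. wrap x = x + 2 *\<^sub>R k"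
proof (intro bexI)
  let ?k = "- (\<Sum>b\<in>Basis. of_int \<lfloor>(x \<bullet> b + 1) / 2\<rfloor> *\<^sub>R b)"
  show "wrap x = x + 2 *\<^sub>R ?k" by (simp add: wrap_def)
  show "?k \<in> int_lattice"
    unfolding int_lattice_def mem_Collect_eq
  proof
    fix b :: 'a assume b: "b \<in> Basis"
    show "?k \<bullet> b \<in> \<int>" unfolding inner_minus_left inner_sum_left_Basis[OF b] by simp
  qed
qed

lemma wrap_pext: "wrap x \<in> pext A \<longleftrightarrow> x \<in> pext A"
  using wrap_shift[of x] by (auto simp: pext_shift)

lemma wrap_periodic: "periodic f \<Longrightarrow> f (wrap x) = f x"
  using wrap_shift[of x] periodic_int_lattice[of f] by auto

lemma wrap_measurable [measurable]: "wrap \<in> borel \<rightarrow>\<^sub>M torus_borel"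
  unfolding torus_borel_def
proof (rule measurable_restrict_space2)
  show "wrap \<in> borel_measurable borel" unfolding wrap_def by measurable
qed (auto simp: wrap_mem)

text \<open>The push-forward of a density on finitely many copies of the line, so that several
  curves are handled as one measure. The bound on the test function makes the integrals over the
  single curves finite.\<close>

lemma curve_measure_nonneg:
  fixes t :: "'j \<Rightarrow> real \<Rightarrow> 'a::euclidean_space" and h :: "'j \<Rightarrow> real \<Rightarrow> real"
  assumes J: "finite J" and t: "\<And>j. j \<in> J \<Longrightarrow> t j \<in> borel \<rightarrow>\<^sub>M torus_borel"
    and h: "\<And>j. j \<in> J \<Longrightarrow> integrable lborel (h j)" "\<And>j v. 0 \<le> h j v"
  obtains P where "finite_measure P" "sets P = sets torus_borel"
    "\<And>A. A \<in> sets torus_borel \<Longrightarrow> emeasure P A = (\<Sum>j\<in>J. \<integral>\<^sup>+v. indicator A (t j v) * ennreal (h j v) \<partial>lborel)"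
    "\<And>\<phi> B. \<phi> \<in> borel_measurable torus_borel \<Longrightarrow> (\<And>x. \<bar>\<phi> x\<bar> \<le> B) \<Longrightarrow>
       (\<integral>x. \<phi> x \<partial>P) = (\<Sum>j\<in>J. \<integral>v. \<phi> (t j v) * h j v \<partial>lborel)"
proof -
  let ?C = "count_space J"
  let ?Q = "?C \<Otimes>\<^sub>M (lborel :: real measure)"
  interpret C: sigma_finite_measure ?C by (rule sigma_finite_measure_count_space_finite[OF J])
  interpret CL: pair_sigma_finite ?C "lborel :: real measure" ..
  have pm: "(\<lambda>(j, v). f j v) \<in> ?Q \<rightarrow>\<^sub>M N" if "\<And>j. j \<in> J \<Longrightarrow> f j \<in> borel \<rightarrow>\<^sub>M N" for f and N :: "'z measure"
    by (rule measurable_pair_measure_countable1) (use J that in \<open>auto intro: countable_finite\<close>)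
  have hm: "h j \<in> borel_measurable borel" if "j \<in> J" for j using h(1)[OF that] by auto
  have tm: "(\<lambda>(j, v). t j v) \<in> ?Q \<rightarrow>\<^sub>M torus_borel" by (rule pm) (rule t)
  have hm2: "(\<lambda>(j, v). h j v) \<in> borel_measurable ?Q" by (rule pm) (rule hm)
  note [measurable] = tm hm2
  define M0 where "M0 = density ?Q (\<lambda>(j, v). ennreal (h j v))"
  define P where "P = distr M0 torus_borel (\<lambda>(j, v). t j v)"
  have tM0: "(\<lambda>(j, v). t j v) \<in> M0 \<rightarrow>\<^sub>M torus_borel" using tm by (simp add: M0_def)
  have hm3: "(\<lambda>(j, v). ennreal (h j v)) \<in> borel_measurable ?Q"
    using measurable_compose[OF hm2 measurable_ennreal] by (simp add: split_beta')
  have e: "emeasure P A = (\<Sum>j\<in>J. \<integral>\<^sup>+v. indicator A (t j v) * ennreal (h j v) \<partial>lborel)" if A: "A \<in> sets torus_borel" for A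
  proof -
    have im: "(\<lambda>p. indicator A (case p of (j, v) \<Rightarrow> t j v) :: ennreal) \<in> borel_measurable ?Q"
      by (rule measurable_compose[OF tm borel_measurable_indicator[OF A]])
    have "emeasure P A = (\<integral>\<^sup>+x. indicator A x \<partial>P)" using A by (simp add: P_def)
    also have "\<dots> = (\<integral>\<^sup>+p. indicator A (case p of (j, v) \<Rightarrow> t j v) \<partial>M0)"
      unfolding P_def by (rule nn_integral_distr[OF tM0]) (use borel_measurable_indicator[OF A] in simp)
    also have "\<dots> = (\<integral>\<^sup>+p. (case p of (j, v) \<Rightarrow> ennreal (h j v)) * indicator A (case p of (j, v) \<Rightarrow> t j v) \<partial>?Q)"
      unfolding M0_def by (rule nn_integral_density[OF hm3 im])
    also have "\<dots> = (\<integral>\<^sup>+j. \<integral>\<^sup>+v. ennreal (h j v) * indicator A (t j v) \<partial>lborel \<partial>?C)"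
      using lborel.nn_integral_fst[OF borel_measurable_times_ennreal[OF hm3 im]] by simp
    also have "\<dots> = (\<Sum>j\<in>J. \<integral>\<^sup>+v. indicator A (t j v) * ennreal (h j v) \<partial>lborel)"
      using J by (simp add: nn_integral_count_space_finite mult.commute)
    finally show ?thesis .
  qed
  show thesis
  proof (rule that[of P])
    show s: "sets P = sets torus_borel" by (simp add: P_def)
    show "finite_measure P"
    proof
      have "emeasure P (space P) = (\<Sum>j\<in>J. \<integral>\<^sup>+v. indicator pbox (t j v) * ennreal (h j v) \<partial>lborel)"
        using e[of pbox] sets_eq_imp_space_eq[OF s] by (simp add: sets_torus_borel)
      also have "\<dots> \<le> (\<Sum>j\<in>J. \<integral>\<^sup>+v. ennreal (norm (h j v)) \<partial>lborel)"
        using h(2) by (intro sum_mono nn_integral_mono) (auto simp: indicator_def)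
      also have "\<dots> < \<infinity>" using h(1) J unfolding integrable_iff_bounded by simp
      finally show "emeasure P (space P) \<noteq> \<infinity>" by simp
    qed
    show "emeasure P A = (\<Sum>j\<in>J. \<integral>\<^sup>+v. indicator A (t j v) * ennreal (h j v) \<partial>lborel)" if A: "A \<in> sets torus_borel" for A
      by (rule e[OF A])
    fix \<phi> :: "'a \<Rightarrow> real" and B assume \<phi>: "\<phi> \<in> borel_measurable torus_borel" and B: "\<And>x. \<bar>\<phi> x\<bar> \<le> B"
    have \<phi>m: "(\<lambda>p. \<phi> (case p of (j, v) \<Rightarrow> t j v)) \<in> borel_measurable ?Q"
      by (rule measurable_compose[OF tm \<phi>])
    have B0: "B \<ge> 0" using B[of undefined] by linarith
    have int: "integrable ?Q (\<lambda>(j, v). \<phi> (t j v) * h j v)"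
    proof (rule CL.Fubini_integrable)
      show "(\<lambda>(j, v). \<phi> (t j v) * h j v) \<in> borel_measurable ?Q"
        using borel_measurable_times[OF \<phi>m hm2] by (simp add: split_beta')
      show "integrable ?C (\<lambda>j. \<integral>v. norm (case (j, v) of (j, v) \<Rightarrow> \<phi> (t j v) * h j v) \<partial>lborel)"
        by (rule integrable_count_space[OF J])
      show "AE j in ?C. integrable lborel (\<lambda>v. case (j, v) of (j, v) \<Rightarrow> \<phi> (t j v) * h j v)"
      proof (rule AE_I2)
        fix j assume "j \<in> space ?C"
        then have j: "j \<in> J" by simp
        have "integrable lborel (\<lambda>v. \<phi> (t j v) * h j v)"
        proof (rule Bochner_Integration.integrable_bound[of _ "\<lambda>v. B * h j v"])
          show "integrable lborel (\<lambda>v. B * h j v)" using h(1)[OF j] by simp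
          show "(\<lambda>v. \<phi> (t j v) * h j v) \<in> borel_measurable lborel"
            using measurable_compose[OF t[OF j] \<phi>] hm[OF j] by simp
          show "AE v in lborel. norm (\<phi> (t j v) * h j v) \<le> norm (B * h j v)"
            using B B0 h(2) by (auto simp: abs_mult intro!: mult_right_mono)
        qed
        then show "integrable lborel (\<lambda>v. case (j, v) of (j, v) \<Rightarrow> \<phi> (t j v) * h j v)" by simp
      qed
    qed
    have "(\<integral>x. \<phi> x \<partial>P) = (\<integral>p. \<phi> (case p of (j, v) \<Rightarrow> t j v) \<partial>M0)"
      unfolding P_def by (rule integral_distr[OF tM0 \<phi>])
    also have "M0 = density ?Q (\<lambda>p. ennreal (case p of (j, v) \<Rightarrow> h j v))" by (simp add: M0_def split_beta')
    also have "(\<integral>p. \<phi> (case p of (j, v) \<Rightarrow> t j v) \<partial>\<dots>) = (\<integral>p. (case p of (j, v) \<Rightarrow> h j v) *\<^sub>R \<phi> (case p of (j, v) \<Rightarrow> t j v) \<partial>?Q)"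
      by (rule integral_density[OF \<phi>m hm2]) (auto simp: h(2))
    also have "\<dots> = (\<integral>(j, v). \<phi> (t j v) * h j v \<partial>?Q)" by (simp add: split_beta' mult.commute)
    also have "\<dots> = (\<integral>j. \<integral>v. \<phi> (t j v) * h j v \<partial>lborel \<partial>?C)" using CL.integral_fst[OF int] by simp
    also have "\<dots> = (\<Sum>j\<in>J. \<integral>v. \<phi> (t j v) * h j v \<partial>lborel)" by (rule lebesgue_integral_count_space_finite[OF J])
    finally show "(\<integral>x. \<phi> x \<partial>P) = (\<Sum>j\<in>J. \<integral>v. \<phi> (t j v) * h j v \<partial>lborel)" .
  qed
qed

section \<open>Local graphs and normal vectors\<close>

text \<open>Of the smoothness of the graph only a continuous derivative is kept, which is what the
  divergence theorem needs and what the exchange of axes by an inverse function provides. The centre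
  p need not lie on the boundary.\<close>

definition is_chart :: "(real^2) set \<Rightarrow> real^2 \<Rightarrow> real \<Rightarrow> 2 \<Rightarrow> 2 \<Rightarrow> real \<Rightarrow> (real \<Rightarrow> real) \<Rightarrow> (real \<Rightarrow> real) \<Rightarrow> bool" where
  "is_chart S p r i j s g g' \<longleftrightarrow> i \<noteq> j \<and> (s = 1 \<or> s = -1) \<and> (\<forall>v. (g has_real_derivative g' v) (at v)) \<and>
     continuous_on UNIV g' \<and> (\<forall>x\<in>ball p r. x \<in> S \<longleftrightarrow> g (x $ j) < s * x $ i)"

lemma is_chart_mono: "is_chart S p r i j s g g' \<Longrightarrow> r' \<le> r \<Longrightarrow> is_chart S p r' i j s g g'"
  by (auto simp: is_chart_def)

text \<open>With d the slope of g, this is the gradient of s * x $ i - g (x $ j), the function that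
  is positive on the set inside the chart. It therefore points inwards.\<close>

definition chart_normal :: "2 \<Rightarrow> 2 \<Rightarrow> real \<Rightarrow> real \<Rightarrow> real^2" where
  "chart_normal i j s d = s *\<^sub>R axis i 1 - d *\<^sub>R axis j 1"

lemma chart_normal_nth: "i \<noteq> j \<Longrightarrow> chart_normal i j s d $ i = s" "i \<noteq> j \<Longrightarrow> chart_normal i j s d $ j = - d"
  by (auto simp: chart_normal_def axis_def)

text \<open>Described by the set alone, without a chart: directions with positive product enter the
  set, those with negative product leave it, and tangential directions are left open. This allows
  comparison of normals between charts with different axes and between different domains.\<close>

definition inner_normal :: "(real^2) set \<Rightarrow> real^2 \<Rightarrow> real^2 \<Rightarrow> bool" where
  "inner_normal S x N \<longleftrightarrow> N \<noteq> 0 \<and>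
     (\<forall>w. 0 < w \<bullet> N \<longrightarrow> (\<exists>\<tau>>0. \<forall>t. 0 < t \<and> t < \<tau> \<longrightarrow> x + t *\<^sub>R w \<in> S)) \<and>
     (\<forall>w. w \<bullet> N < 0 \<longrightarrow> (\<exists>\<tau>>0. \<forall>t. 0 < t \<and> t < \<tau> \<longrightarrow> x + t *\<^sub>R w \<notin> S))"

lemma inner_normal_out: "inner_normal S x N \<Longrightarrow> w \<bullet> N < 0 \<Longrightarrow> \<exists>\<tau>>0. \<forall>t. 0 < t \<and> t < \<tau> \<longrightarrow> x + t *\<^sub>R w \<notin> S"
  by (simp add: inner_normal_def)

text \<open>If the unit vectors a and b of N and N' differed, then w = a - b would have a positive
  product with a and a negative one with b, because a \<bullet> b < 1.\<close>

lemma unit_difference_zero: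
  fixes N N' :: "'a::real_inner"
  assumes "N \<noteq> 0" "N' \<noteq> 0"
    and no: "\<And>w. 0 < w \<bullet> N \<Longrightarrow> w \<bullet> N' < 0 \<Longrightarrow> False"
  shows "\<exists>c>0. N' = c *\<^sub>R N"
proof -
  define a where "a = (1 / norm N) *\<^sub>R N"
  define b where "b = (1 / norm N') *\<^sub>R N'"
  have ab: "norm a = 1" "norm b = 1" using assms by (auto simp: a_def b_def)
  have N: "N = norm N *\<^sub>R a" "N' = norm N' *\<^sub>R b" using assms by (auto simp: a_def b_def)
  have "a = b"
  proof (rule ccontr)
    assume neq: "a \<noteq> b"
    have aa: "a \<bullet> a = 1" "b \<bullet> b = 1" using ab by (auto simp: norm_eq_1)
    have "0 < (a - b) \<bullet> (a - b)" using neq by simp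
    then have lt: "a \<bullet> b < 1" using aa by (simp add: inner_diff inner_commute)
    have "(a - b) \<bullet> N = norm N * (1 - a \<bullet> b)" by (subst N(1)) (simp add: inner_diff aa inner_commute)
    then have "0 < (a - b) \<bullet> N" using lt assms by simp
    moreover have "(a - b) \<bullet> N' = norm N' * (a \<bullet> b - 1)" by (subst N(2)) (simp add: inner_diff aa)
    then have "(a - b) \<bullet> N' < 0" using lt assms by (simp add: mult_pos_neg)
    ultimately show False by (rule no)
  qed
  then have "N' = (norm N' / norm N) *\<^sub>R N" using N assms by (metis divide_inverse_commute inverse_eq_divide scaleR_scaleR a_def b_def mult.commute)
  then show ?thesis using assms by (intro exI[of _ "norm N' / norm N"]) simp
qed

lemma inner_normal_unique:
  assumes "inner_normal S x N" "inner_normal S x N'"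
  shows "\<exists>c>0. N' = c *\<^sub>R N"
proof (rule unit_difference_zero)
  fix w assume w: "0 < w \<bullet> N" "w \<bullet> N' < 0"
  obtain \<tau> where \<tau>: "\<tau> > 0" "\<And>t. 0 < t \<Longrightarrow> t < \<tau> \<Longrightarrow> x + t *\<^sub>R w \<in> S"
    using assms(1) w(1) unfolding inner_normal_def by blast
  obtain \<tau>' where \<tau>': "\<tau>' > 0" "\<And>t. 0 < t \<Longrightarrow> t < \<tau>' \<Longrightarrow> x + t *\<^sub>R w \<notin> S"
    using inner_normal_out[OF assms(2) w(2)] by auto
  define t where "t = min \<tau> \<tau>' / 2"
  have "0 < t" "t < \<tau>" "t < \<tau>'" using \<tau>(1) \<tau>'(1) by (auto simp: t_def)
  then show False using \<tau>(2) \<tau>'(2) by blast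
qed (use assms in \<open>auto simp: inner_normal_def\<close>)

text \<open>A direction with positive products with both normals would lead into both sets at once.
  So no direction separates N from -N' in the sense of the previous comparison, and these are
  positive multiples of each other.\<close>

lemma inner_normal_disjoint:
  assumes "inner_normal S x N" "inner_normal S' x N'" "S \<inter> S' = {}"
  shows "\<exists>c>0. N' = - c *\<^sub>R N"
proof -
  have "\<exists>c>0. - N' = c *\<^sub>R N"
  proof (rule unit_difference_zero)
    fix w assume w: "0 < w \<bullet> N" "w \<bullet> (- N') < 0"
    obtain \<tau> where \<tau>: "\<tau> > 0" "\<And>t. 0 < t \<Longrightarrow> t < \<tau> \<Longrightarrow> x + t *\<^sub>R w \<in> S"
      using assms(1) w(1) unfolding inner_normal_def by blast
    have "0 < w \<bullet> N'" using w(2) by simp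
    then obtain \<tau>' where \<tau>': "\<tau>' > 0" "\<And>t. 0 < t \<Longrightarrow> t < \<tau>' \<Longrightarrow> x + t *\<^sub>R w \<in> S'"
      using assms(2) unfolding inner_normal_def by blast
    define t where "t = min \<tau> \<tau>' / 2"
    have "0 < t" "t < \<tau>" "t < \<tau>'" using \<tau>(1) \<tau>'(1) by (auto simp: t_def)
    then show False using \<tau>(2) \<tau>'(2) assms(3) by blast
  qed (use assms in \<open>auto simp: inner_normal_def\<close>)
  then show ?thesis by (metis minus_equation_iff scaleR_minus_left)
qed

lemma chart_normal_inner:
  "i \<noteq> j \<Longrightarrow> w \<bullet> chart_normal i j s d = s * w $ i - d * w $ j"
  by (simp add: chart_normal_def inner_diff_right inner_axis)

text \<open>At a point of the graph the function s * x $ i - g (x $ j) vanishes, and its derivative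
  in direction w is the product of w with the normal. Its sign decides on which side a small step
  ends.\<close>

lemma is_chart_inner_normal:
  assumes ch: "is_chart S p r i j s g g'" and x: "x \<in> ball p r" "s * x $ i = g (x $ j)"
  shows "inner_normal S x (chart_normal i j s (g' (x $ j)))"
proof -
  have ij: "i \<noteq> j" and s: "s = 1 \<or> s = -1" and g: "\<And>v. (g has_real_derivative g' v) (at v)"
    and S: "\<And>y. y \<in> ball p r \<Longrightarrow> y \<in> S \<longleftrightarrow> g (y $ j) < s * y $ i"
    using ch by (auto simp: is_chart_def)
  let ?N = "chart_normal i j s (g' (x $ j))"
  have N0: "?N \<noteq> 0" using chart_normal_nth(1)[OF ij, of s] s by (metis one_neq_zero zero_index zero_neq_neg_one)
  have d: "((\<lambda>t. s * (x + t *\<^sub>R w) $ i - g ((x + t *\<^sub>R w) $ j)) has_real_derivative w \<bullet> ?N) (at 0)" for w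
  proof -
    have "((\<lambda>t. g (x $ j + t * w $ j)) has_real_derivative g' (x $ j) * w $ j) (at 0)"
      by (rule DERIV_chain2[where g="\<lambda>t. x $ j + t * w $ j" and x=0, simplified])
        (auto intro!: derivative_eq_intros g)
    then show ?thesis
      by (auto simp: chart_normal_inner[OF ij] intro!: derivative_eq_intros)
  qed
  have near: "\<exists>\<tau>>0. \<forall>t. 0 < t \<and> t < \<tau> \<longrightarrow> x + t *\<^sub>R w \<in> ball p r" for w
  proof -
    obtain e where e: "e > 0" "ball x e \<subseteq> ball p r" using x(1) by (meson open_ball open_contains_ball)
    have "x + t *\<^sub>R w \<in> ball p r" if "0 < t" "t < e / (norm w + 1)" for t
    proof -
      have "t * norm w < e / (norm w + 1) * (norm w + 1)"
        using that by (intro mult_strict_mono) auto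
      also have "\<dots> = e"
      proof -
        have "norm w + 1 \<noteq> 0" using norm_ge_zero[of w] by linarith
        then show ?thesis by simp
      qed
      finally show ?thesis using e(2) that by (auto simp: subset_eq dist_norm)
    qed
    moreover have "e / (norm w + 1) > 0" using e(1) by (simp add: add_nonneg_pos)
    ultimately show ?thesis by blast
  qed
  have zero: "s * (x + 0 *\<^sub>R w) $ i - g ((x + 0 *\<^sub>R w) $ j) = 0" for w using x by simp
  show ?thesis
    unfolding inner_normal_def
  proof (intro conjI allI impI N0)
    fix w assume w: "0 < w \<bullet> ?N"
    obtain \<tau> where \<tau>: "\<tau> > 0" "\<And>t. 0 < t \<Longrightarrow> t < \<tau> \<Longrightarrow> x + t *\<^sub>R w \<in> ball p r" using near by blast
    obtain \<sigma> where \<sigma>: "\<sigma> > 0" "\<And>h. 0 < h \<Longrightarrow> h < \<sigma> \<Longrightarrow> 0 < s * (x + h *\<^sub>R w) $ i - g ((x + h *\<^sub>R w) $ j)"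
      using DERIV_pos_inc_right[OF d[of w] w] zero[of w] by auto
    show "\<exists>\<tau>>0. \<forall>t. 0 < t \<and> t < \<tau> \<longrightarrow> x + t *\<^sub>R w \<in> S"
    proof (intro exI[of _ "min \<tau> \<sigma>"] conjI allI impI)
      fix t assume "0 < t \<and> t < min \<tau> \<sigma>"
      then have "x + t *\<^sub>R w \<in> ball p r" "0 < s * (x + t *\<^sub>R w) $ i - g ((x + t *\<^sub>R w) $ j)"
        using \<tau>(2) \<sigma>(2) by auto
      then show "x + t *\<^sub>R w \<in> S" using S by simp
    qed (use \<tau> \<sigma> in auto)
  next
    fix w assume w: "w \<bullet> ?N < 0"
    obtain \<tau> where \<tau>: "\<tau> > 0" "\<And>t. 0 < t \<Longrightarrow> t < \<tau> \<Longrightarrow> x + t *\<^sub>R w \<in> ball p r" using near by blast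
    obtain \<sigma> where \<sigma>: "\<sigma> > 0" "\<And>h. 0 < h \<Longrightarrow> h < \<sigma> \<Longrightarrow> s * (x + h *\<^sub>R w) $ i - g ((x + h *\<^sub>R w) $ j) < 0"
      using DERIV_neg_dec_right[OF d[of w] w] zero[of w] by auto
    show "\<exists>\<tau>>0. \<forall>t. 0 < t \<and> t < \<tau> \<longrightarrow> x + t *\<^sub>R w \<notin> S"
    proof (intro exI[of _ "min \<tau> \<sigma>"] conjI allI impI)
      fix t assume "0 < t \<and> t < min \<tau> \<sigma>"
      then have "x + t *\<^sub>R w \<in> ball p r" "s * (x + t *\<^sub>R w) $ i - g ((x + t *\<^sub>R w) $ j) < 0"
        using \<tau>(2) \<sigma>(2) by auto
      then show "x + t *\<^sub>R w \<notin> S" using S by simp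
    qed (use \<tau> \<sigma> in auto)
  qed
qed

lemma is_chart_frontier:
  assumes ch: "is_chart S p r i j s g g'" and S: "open S" and x: "x \<in> ball p r"
  shows "x \<in> frontier S \<longleftrightarrow> s * x $ i = g (x $ j)"
proof -
  have g: "\<And>v. (g has_real_derivative g' v) (at v)" and Sx: "\<And>y. y \<in> ball p r \<Longrightarrow> y \<in> S \<longleftrightarrow> g (y $ j) < s * y $ i"
    using ch by (auto simp: is_chart_def)
  have cg: "continuous_on T g" for T by (meson DERIV_isCont continuous_at_imp_continuous_on g)
  have fr: "x \<in> frontier S \<longleftrightarrow> x \<in> closure S \<and> x \<notin> S" using S by (auto simp: frontier_def interior_open)
  show ?thesis
  proof
    assume e: "s * x $ i = g (x $ j)"
    let ?N = "chart_normal i j s (g' (x $ j))"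
    have n: "inner_normal S x ?N" by (rule is_chart_inner_normal[OF ch x e])
    then have "0 < ?N \<bullet> ?N" by (simp add: inner_normal_def)
    then obtain \<tau> where \<tau>: "\<tau> > 0" "\<And>t. 0 < t \<Longrightarrow> t < \<tau> \<Longrightarrow> x + t *\<^sub>R ?N \<in> S"
      using n unfolding inner_normal_def by blast
    have "x \<in> closure S"
      unfolding closure_approachable
    proof (intro allI impI)
      fix e :: real assume e: "e > 0"
      have N: "norm ?N > 0" using n by (simp add: inner_normal_def)
      define t where "t = min (\<tau> / 2) (e / (2 * norm ?N))"
      have t: "0 < t" "t < \<tau>" using \<tau>(1) e N by (auto simp: t_def)
      have "t * norm ?N \<le> e / (2 * norm ?N) * norm ?N" using N by (intro mult_right_mono) (auto simp: t_def)
      then have "t * norm ?N < e" using N e by simp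
      then show "\<exists>y\<in>S. dist y x < e" using \<tau>(2)[OF t] t by (intro bexI[of _ "x + t *\<^sub>R ?N"]) (auto simp: dist_norm)
    qed
    then show "x \<in> frontier S" using fr Sx[OF x] e by simp
  next
    assume "x \<in> frontier S"
    then have c: "x \<in> closure S" and n: "x \<notin> S" using fr by auto
    show "s * x $ i = g (x $ j)"
    proof (rule ccontr)
      assume "s * x $ i \<noteq> g (x $ j)"
      then have lt: "s * x $ i < g (x $ j)" using n Sx[OF x] by auto
      let ?U = "{y. s * y $ i < g (y $ j)} \<inter> ball p r"
      have "open ?U" by (intro open_Int open_Collect_less continuous_intros continuous_on_compose2[OF cg]) auto
      moreover have "x \<in> ?U" using lt x by simp
      ultimately have "?U \<inter> S \<noteq> {}" using c open_Int_closure_eq_empty[of ?U S] by blast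
      then obtain y where "y \<in> ball p r" "y \<in> S" "s * y $ i < g (y $ j)" by blast
      then show False using Sx[of y] by simp
    qed
  qed
qed

section \<open>Exchanging the coordinate axes\<close>

text \<open>The slope is frozen outside a neighbourhood of \<open>p\<close>, which makes the inverse globally defined.\<close>

lemma local_inverse_graph:
  fixes g g' :: "real \<Rightarrow> real"
  assumes g: "\<And>v. (g has_real_derivative g' v) (at v)" and g': "continuous_on UNIV g'" and p: "0 < g' p"
  obtains \<delta> h h' where "\<delta> > 0" "\<And>y. (h has_real_derivative h' y) (at y)" "continuous_on UNIV h'"
    "\<And>x y. \<bar>x - p\<bar> < \<delta> \<Longrightarrow> g x < y \<longleftrightarrow> x < h y"
proof -
  define c where "c = g' p / 2"
  have c: "c > 0" using p by (simp add: c_def)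
  have "isCont g' p" using g' by (simp add: continuous_on_eq_continuous_at)
  then obtain \<delta>0 where \<delta>0: "\<delta>0 > 0" "\<And>x. \<bar>x - p\<bar> < \<delta>0 \<Longrightarrow> \<bar>g' x - g' p\<bar> < c"
    using c unfolding continuous_at_eps_delta by (metis dist_real_def)
  define \<delta> where "\<delta> = \<delta>0 / 2"
  have \<delta>: "\<delta> > 0" "\<delta> < \<delta>0" using \<delta>0 by (auto simp: \<delta>_def)
  define cl where "cl t = max (p - \<delta>) (min (p + \<delta>) t)" for t
  define k' where "k' t = g' (cl t)" for t
  have cont_k': "continuous_on UNIV k'"
    unfolding k'_def cl_def by (intro continuous_on_compose2[OF g'] continuous_intros) auto
  have k'c: "k' t \<ge> c" for t
  proof -
    have "\<bar>cl t - p\<bar> < \<delta>0" using \<delta> unfolding cl_def by (simp add: abs_less_iff min_def max_def)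
    from \<delta>0(2)[OF this] show ?thesis unfolding k'_def c_def by linarith
  qed
  obtain k0 where k0: "\<And>t. (k0 has_real_derivative k' t) (at t)"
  proof -
    have "\<exists>F. \<forall>x. -\<infinity> < ereal x \<longrightarrow> ereal x < \<infinity> \<longrightarrow> (F has_vector_derivative k' x) (at x)"
      using cont_k' by (intro einterval_antiderivative) (auto simp: continuous_on_eq_continuous_at)
    then show thesis using that by (auto simp: has_real_derivative_iff_has_vector_derivative)
  qed
  define k where "k t = k0 t - k0 p + g p" for t
  have k: "(k has_real_derivative k' t) (at t)" for t
    unfolding k_def using k0 by (auto intro!: derivative_eq_intros)
  have kg: "k t = g t" if t: "\<bar>t - p\<bar> < \<delta>" for t
  proof -
    have "((\<lambda>t. k t - g t) has_real_derivative 0) (at x)" if "x \<in> {p - \<delta><..<p + \<delta>}" for x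
    proof -
      have "cl x = x" using that by (simp add: cl_def)
      then show ?thesis using DERIV_diff[OF k g, of x] by (simp add: k'_def)
    qed
    then have "(\<lambda>t. k t - g t) constant_on {p - \<delta><..<p + \<delta>}"
      by (intro has_field_derivative_0_imp_constant_on) auto
    then have "k t - g t = k p - g p" using t \<delta> unfolding constant_on_def by (auto simp: abs_less_iff)
    then show ?thesis by (simp add: k_def)
  qed
  \<comment> \<open>A slope of at least c gives injectivity and, with continuity, surjectivity onto
    the whole line.\<close>
  have mono: "c * (y - x) \<le> k y - k x" if "x \<le> y" for x y
  proof (cases "x = y")
    case False
    then have "x < y" using that by simp
    from MVT2[OF this k] obtain z where "k y - k x = (y - x) * k' z" by auto
    then show ?thesis using k'c[of z] that by (simp add: mult.commute mult_right_mono)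
  qed simp
  have strict: "k x < k y \<longleftrightarrow> x < y" for x y
  proof
    assume k: "k x < k y"
    show "x < y"
    proof (rule ccontr)
      assume "\<not> x < y"
      then have "y \<le> x" "0 \<le> c * (x - y)" using c by auto
      then show False using mono[of y x] k by linarith
    qed
  next
    assume "x < y"
    then have "0 < c * (y - x)" using c by simp
    then show "k x < k y" using mono[of x y] \<open>x < y\<close> by linarith
  qed
  have cont_k: "continuous_on T k" for T by (meson DERIV_isCont continuous_at_imp_continuous_on k)
  have surj: "\<exists>x. k x = y" for y
  proof -
    define a where "a = \<bar>y - k p\<bar> / c"
    have a: "a \<ge> 0" "c * a = \<bar>y - k p\<bar>" using c by (auto simp: a_def)
    have "y \<le> k (p + a)" using mono[of p "p + a"] a by simp
    moreover have "k (p - a) \<le> y" using mono[of "p - a" p] a by simp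
    ultimately show ?thesis using IVT'[of k "p - a" y "p + a"] a cont_k by auto
  qed
  define h where "h y = (SOME x. k x = y)" for y
  have kh: "k (h y) = y" for y unfolding h_def by (rule someI_ex[OF surj])
  have hk: "h (k x) = x" for x using kh[of "k x"] strict by (metis linorder_neqE_linordered_idom less_irrefl)
  have cont_h: "isCont h y" for y
  proof -
    have "isCont h (k (h y))"
      by (rule isCont_inverse_function[where d=1]) (auto simp: hk intro: DERIV_isCont[OF k])
    then show ?thesis by (simp add: kh)
  qed
  have h: "(h has_real_derivative inverse (k' (h y))) (at y)" for y
  proof (rule DERIV_inverse_function[where f=k and a="y - 1" and b="y + 1"])
    show "k' (h y) \<noteq> 0" using k'c[of "h y"] c by simp
  qed (auto intro: k cont_h simp: kh)
  show thesis
  proof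
    show "\<delta> > 0" by fact
    show "(h has_real_derivative inverse (k' (h y))) (at y)" for y by (rule h)
    have ch: "continuous_on UNIV h" using cont_h by (simp add: continuous_at_imp_continuous_on)
    have "k' (h y) \<noteq> 0" for y using k'c[of "h y"] c by simp
    then show "continuous_on UNIV (\<lambda>y. inverse (k' (h y)))"
      by (intro continuous_on_inverse continuous_on_compose2[OF cont_k' ch]) auto
    show "g x < y \<longleftrightarrow> x < h y" if "\<bar>x - p\<bar> < \<delta>" for x y
      using strict[of x "h y"] kh[of y] kg[OF that] by simp
  qed
qed

text \<open>Where the slope is nonzero, the curve is also a graph over the other axis. With an
  increasing g the inequality g (x $ j) < s * x $ i becomes x $ j < h (s * x $ i), which needs the
  sign -1. A decreasing g is first reflected in its argument, and the sign becomes 1.\<close>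

lemma is_chart_exchange:
  assumes ch: "is_chart S p r i j s g g'" and r: "r > 0" and n: "g' (p $ j) \<noteq> 0"
  shows "\<exists>r'>0. \<exists>s' h h'. is_chart S p r' j i s' h h'"
proof -
  have ij: "i \<noteq> j" and s: "s = 1 \<or> s = -1" and g: "\<And>v. (g has_real_derivative g' v) (at v)" and g': "continuous_on UNIV g'"
    and S: "\<And>y. y \<in> ball p r \<Longrightarrow> y \<in> S \<longleftrightarrow> g (y $ j) < s * y $ i"
    using ch by (auto simp: is_chart_def)
  have comp: "\<bar>x $ j - p $ j\<bar> < e" if "x \<in> ball p e" for x e
    using component_le_norm_cart[of "x - p" j] that by (simp add: dist_norm norm_minus_commute)
  show ?thesis
  proof (cases "0 < g' (p $ j)")
    case True
    obtain \<delta> h h' where h: "\<delta> > 0" "\<And>y. (h has_real_derivative h' y) (at y)" "continuous_on UNIV h'"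
      "\<And>x y. \<bar>x - p $ j\<bar> < \<delta> \<Longrightarrow> g x < y \<longleftrightarrow> x < h y"
      using local_inverse_graph[OF g g' True] by metis
    have "is_chart S p (min r \<delta>) j i (-1) (\<lambda>v. - h (s * v)) (\<lambda>v. - (h' (s * v) * s))"
      unfolding is_chart_def
    proof (intro conjI allI ballI)
      show "((\<lambda>v. - h (s * v)) has_real_derivative - (h' (s * v) * s)) (at v)" for v
        by (intro DERIV_minus DERIV_chain2[where g="\<lambda>v. s * v"] h(2)) (auto intro!: derivative_eq_intros)
      show "continuous_on UNIV (\<lambda>v. - (h' (s * v) * s))"
        by (intro continuous_intros continuous_on_compose2[OF h(3)]) auto
      fix x assume x: "x \<in> ball p (min r \<delta>)"
      then show "x \<in> S \<longleftrightarrow> - h (s * x $ i) < - 1 * x $ j"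
        using S[of x] h(4)[of "x $ j" "s * x $ i"] comp[of x \<delta>] by auto
    qed (use ij in auto)
    then show ?thesis using r h(1) by (intro exI[of _ "min r \<delta>"]) auto
  next
    case False
    then have neg: "0 < - g' (- (- (p $ j)))" using n by simp
    have gm: "((\<lambda>v. g (- v)) has_real_derivative - g' (- v)) (at v)" for v
    proof -
      have "((\<lambda>v. g (- v)) has_real_derivative g' (- v) * - 1) (at v)"
        by (rule DERIV_chain2[OF g]) (auto intro!: derivative_eq_intros)
      then show ?thesis by simp
    qed
    have gm': "continuous_on UNIV (\<lambda>v. - g' (- v))"
      by (intro continuous_intros continuous_on_compose2[OF g']) auto
    obtain \<delta> h h' where h: "\<delta> > 0" "\<And>y. (h has_real_derivative h' y) (at y)" "continuous_on UNIV h'"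
      "\<And>x y. \<bar>x - - (p $ j)\<bar> < \<delta> \<Longrightarrow> g (- x) < y \<longleftrightarrow> x < h y"
      using local_inverse_graph[OF gm gm' neg] by metis
    have "is_chart S p (min r \<delta>) j i 1 (\<lambda>v. - h (s * v)) (\<lambda>v. - (h' (s * v) * s))"
      unfolding is_chart_def
    proof (intro conjI allI ballI)
      show "((\<lambda>v. - h (s * v)) has_real_derivative - (h' (s * v) * s)) (at v)" for v
        by (intro DERIV_minus DERIV_chain2[where g="\<lambda>v. s * v"] h(2)) (auto intro!: derivative_eq_intros)
      show "continuous_on UNIV (\<lambda>v. - (h' (s * v) * s))"
        by (intro continuous_intros continuous_on_compose2[OF h(3)]) auto
      fix x assume x: "x \<in> ball p (min r \<delta>)"
      then show "x \<in> S \<longleftrightarrow> - h (s * x $ i) < 1 * x $ j"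
        using S[of x] h(4)[of "- x $ j" "s * x $ i"] comp[of x \<delta>] by (auto simp: abs_minus_commute)
    qed (use ij in auto)
    then show ?thesis using r h(1) by (intro exI[of _ "min r \<delta>"]) auto
  qed
qed

lemma smooth_boundary_chart:
  assumes "smooth_boundary S" "p \<in> frontier S"
  shows "\<exists>r>0. \<exists>i j s g g'. is_chart S p r i j s g g'"
proof -
  obtain r and g :: "real \<Rightarrow> real" and i j s where *: "r > 0" "s \<in> {-1, 1}" "smooth g" "i \<noteq> j"
      "\<forall>x\<in>ball p r. x \<in> S \<longleftrightarrow> g (x $ j) < s * x $ i"
    using bspec[OF assms(1)[unfolded smooth_boundary_def] assms(2)] by (elim exE conjE bexE)
  have C: "C1_with g (\<lambda>x. frechet_derivative g (at x))" using *(3) by (intro Ck_1_C1_with) (auto simp: smooth_def)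
  have "is_chart S p r i j s g (\<lambda>v. frechet_derivative g (at v) 1)"
    unfolding is_chart_def
  proof (intro conjI allI ballI)
    fix v
    have d: "(g has_derivative frechet_derivative g (at v)) (at v)" using C by (simp add: C1_with_def)
    have "frechet_derivative g (at v) h = frechet_derivative g (at v) 1 * h" for h
      using linear_cmul[OF has_derivative_linear[OF d], of h 1] by (simp add: mult.commute)
    then have eq: "frechet_derivative g (at v) = times (frechet_derivative g (at v) 1)" by (rule ext)
    show "(g has_real_derivative frechet_derivative g (at v) 1) (at v)"
      unfolding has_field_derivative_def using d by (subst (asm) eq)
    show "continuous_on UNIV (\<lambda>v. frechet_derivative g (at v) 1)" using C by (simp add: C1_with_def)
  qed (use * in auto)
  then show ?thesis using *(1) by blast
qed

text \<open>Away from the frontier the set is locally everything or nothing; a constant graph placed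
  below or above all values of the coordinate on the unit ball describes this with any choice of
  axes.\<close>

lemma trivial_chart:
  assumes S: "open S" and p: "p \<notin> frontier S" and ij: "i \<noteq> j"
  shows "\<exists>r>0. \<exists>s g g'. is_chart S p r i j s g g'"
proof -
  define B where "B = norm p + 1"
  have b: "\<bar>x $ i\<bar> < B" if "x \<in> ball p r" "r \<le> 1" for x r
    using component_le_norm_cart[of x i] norm_triangle_ineq[of p "x - p"] that by (simp add: dist_norm norm_minus_commute B_def)
  have ch: "is_chart S p r i j 1 (\<lambda>_. c) (\<lambda>_. 0)" if "\<And>x. x \<in> ball p r \<Longrightarrow> x \<in> S \<longleftrightarrow> c < x $ i" for r c
    using ij that by (auto simp: is_chart_def)
  show ?thesis
  proof (cases "p \<in> S")
    case True
    then obtain e where e: "e > 0" "ball p e \<subseteq> S" using S by (auto simp: open_contains_ball)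
    have "is_chart S p (min e 1) i j 1 (\<lambda>_. - B) (\<lambda>_. 0)"
    proof (rule ch)
      fix x assume x: "x \<in> ball p (min e 1)"
      then have "x \<in> S" using e by auto
      moreover have "- B < x $ i" using b[OF x] by linarith
      ultimately show "x \<in> S \<longleftrightarrow> - B < x $ i" by simp
    qed
    then show ?thesis using e(1) by (intro exI[of _ "min e 1"]) auto
  next
    case False
    then have "p \<in> - closure S" using p S by (auto simp: frontier_def interior_open)
    then obtain e where e: "e > 0" "ball p e \<subseteq> - closure S" by (meson closed_closure open_Compl open_contains_ball)
    have "is_chart S p (min e 1) i j 1 (\<lambda>_. B) (\<lambda>_. 0)"
    proof (rule ch)
      fix x assume x: "x \<in> ball p (min e 1)"
      then have "x \<notin> S" using e closure_subset[of S] by (auto simp: subset_eq)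
      moreover have "x $ i < B" using b[OF x] by linarith
      ultimately show "x \<in> S \<longleftrightarrow> B < x $ i" by simp
    qed
    then show ?thesis using e(1) by (intro exI[of _ "min e 1"]) auto
  qed
qed

text \<open>Disjoint domains have opposite normals where their boundaries meet, so that one coordinate
  axis serves all of them.\<close>

lemma common_chart:
  fixes S :: "nat \<Rightarrow> (real^2) set"
  assumes S: "\<And>l. l < m \<Longrightarrow> open (S l)" "\<And>l. l < m \<Longrightarrow> smooth_boundary (S l)"
    and dis: "\<And>l l'. l < m \<Longrightarrow> l' < m \<Longrightarrow> l \<noteq> l' \<Longrightarrow> S l \<inter> S l' = {}"
  shows "\<exists>r i j. 0 < r \<and> r \<le> 1/2 \<and> i \<noteq> j \<and> (\<forall>l<m. \<exists>s g g'. is_chart (S l) p r i j s g g')"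
proof -
  have "\<exists>i j. i \<noteq> j \<and> (\<forall>l<m. \<exists>r>0. \<exists>s g g'. is_chart (S l) p r i j s g g')"
  proof (cases "\<exists>l<m. p \<in> frontier (S l)")
    case False
    have "(1::2) \<noteq> 2" by simp
    then show ?thesis using trivial_chart[OF S(1)] False by blast
  next
    case True
    then obtain l0 where l0: "l0 < m" "p \<in> frontier (S l0)" by auto
    obtain r0 i j s0 g0 g0' where c0: "r0 > 0" "is_chart (S l0) p r0 i j s0 g0 g0'"
      using smooth_boundary_chart[OF S(2)[OF l0(1)] l0(2)] by blast
    have ij: "i \<noteq> j" and s0: "s0 = 1 \<or> s0 = -1" using c0 by (auto simp: is_chart_def)
    have pr: "p \<in> ball p r" if "r > 0" for r using that by simp
    have e0: "s0 * p $ i = g0 (p $ j)" using is_chart_frontier[OF c0(2) S(1)[OF l0(1)] pr[OF c0(1)]] l0 by simp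
    have n0: "inner_normal (S l0) p (chart_normal i j s0 (g0' (p $ j)))"
      by (rule is_chart_inner_normal[OF c0(2) pr[OF c0(1)] e0])
    have "\<exists>r>0. \<exists>s g g'. is_chart (S l) p r i j s g g'" if l: "l < m" for l
    proof (cases "p \<in> frontier (S l)")
      case False
      then show ?thesis by (rule trivial_chart[OF S(1)[OF l] _ ij])
    next
      case True
      obtain r i' j' s g g' where c: "r > 0" "is_chart (S l) p r i' j' s g g'"
        using smooth_boundary_chart[OF S(2)[OF l] True] by blast
      have ij': "i' \<noteq> j'" using c by (auto simp: is_chart_def)
      show ?thesis
      proof (cases "i' = i")
        case True
        then have "j' = j" using ij ij' two_cases[OF ij, of j'] by auto
        then show ?thesis using c True by blast
      next
        case False
        then have i': "i' = j" "j' = i" using ij ij' two_cases[OF ij, of i'] two_cases[OF ij, of j'] by auto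
        show ?thesis
        proof (cases "l = l0")
          case True then show ?thesis using c0 by blast
        next
          case False
          have e: "s * p $ i' = g (p $ j')" using is_chart_frontier[OF c(2) S(1)[OF l] pr[OF c(1)]] True by simp
          have n: "inner_normal (S l) p (chart_normal i' j' s (g' (p $ j')))"
            by (rule is_chart_inner_normal[OF c(2) pr[OF c(1)] e])
          \<comment> \<open>Axis i is transversal to the boundary of the domain \<open>l0\<close>,
            since the i-th component of that normal is \<open>s0\<close>. The opposite normal then
            also has a nonzero component along i, which in the chart of l is minus the slope, so its
            axes can be exchanged.\<close>
          obtain c1 where "c1 > 0" "chart_normal i' j' s (g' (p $ j')) = - c1 *\<^sub>R chart_normal i j s0 (g0' (p $ j))"
            using inner_normal_disjoint[OF n0 n dis[OF l0(1) l]] False by blast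
          then have "chart_normal i' j' s (g' (p $ j')) $ j' = - c1 * s0"
            using chart_normal_nth(1)[OF ij, of s0] i' by simp
          then have "g' (p $ j') = c1 * s0" using chart_normal_nth(2)[OF ij'] by simp
          then have "g' (p $ j') \<noteq> 0" using \<open>c1 > 0\<close> s0 by auto
          from is_chart_exchange[OF c(2) c(1) this] show ?thesis unfolding i' by blast
        qed
      qed
    qed
    then show ?thesis using ij by blast
  qed
  then obtain i j where ij: "i \<noteq> j" and ex: "\<forall>l<m. \<exists>r>0. \<exists>s g g'. is_chart (S l) p r i j s g g'" by blast
  then obtain r where r: "\<And>l. l < m \<Longrightarrow> r l > 0" "\<And>l. l < m \<Longrightarrow> \<exists>s g g'. is_chart (S l) p (r l) i j s g g'"
    by metis
  \<comment> \<open>The bound 1/2 keeps a chart inside the period box centred at p and away from the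
    other period translates of itself.\<close>
  define R where "R = Min (insert (1/2) (r ` {..<m}))"
  have "R \<le> 1/2" unfolding R_def by (rule Min_le) auto
  have "0 < R" using r(1) by (auto simp: R_def)
  moreover note \<open>R \<le> 1/2\<close>
  moreover have "\<exists>s g g'. is_chart (S l) p R i j s g g'" if "l < m" for l
  proof -
    have "R \<le> r l" using that by (auto simp: R_def)
    then show ?thesis using r(2)[OF that] is_chart_mono by blast
  qed
  ultimately show ?thesis using ij by blast
qed

section \<open>The gradient of a combination of smooth domains\<close>

lemma C1_with_unique:
  "C1_with f D \<Longrightarrow> (f has_derivative E) (at x) \<Longrightarrow> D x = E"
  unfolding C1_with_def using has_derivative_unique by blast

lemma C1_with_periodic:
  assumes f: "C1_with f D" "periodic f" and k: "k \<in> int_lattice"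
  shows "D (x + 2 *\<^sub>R k) = D x"
proof -
  have "(f has_derivative D (x + 2 *\<^sub>R k)) (at (x + 2 *\<^sub>R k))" using f by (simp add: C1_with_def)
  then have "((\<lambda>y. f (y + 2 *\<^sub>R k)) has_derivative D (x + 2 *\<^sub>R k)) (at x)"
    by (rule has_derivative_compose[OF has_derivative_add_const[OF has_derivative_ident]])
  also have "(\<lambda>y. f (y + 2 *\<^sub>R k)) = f" using periodic_int_lattice[OF f(2) k] by auto
  finally show ?thesis using C1_with_unique[OF f(1)] by simp
qed

text \<open>A zero of a nonnegative function is a minimum. Thus the derivative of a weight vanishes
  wherever the weight does, which is what makes cutting off harmless.\<close>

lemma C1_with_minimum:
  assumes f: "C1_with f D" "\<And>y. 0 \<le> f y" and x: "f x = 0"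
  shows "D x h = 0"
proof -
  have "D x = (\<lambda>v. 0)"
    by (rule differential_zero_maxmin[of x UNIV f]) (use f x in \<open>auto simp: C1_with_def\<close>)
  then show ?thesis by simp
qed

lemma periodic_bounded:
  fixes f :: "'a::euclidean_space \<Rightarrow> real"
  assumes "periodic f" "continuous_on UNIV f"
  obtains B where "\<And>x. \<bar>f x\<bar> \<le> B"
proof -
  have "bounded (f ` cbox (- One) One)"
    by (intro compact_imp_bounded compact_continuous_image continuous_on_subset[OF assms(2)]) auto
  then obtain B where B: "\<And>x. x \<in> cbox (- One) One \<Longrightarrow> \<bar>f x\<bar> \<le> B" unfolding bounded_iff by auto
  have "(pbox :: 'a set) \<subseteq> cbox (- One) One" by (auto simp: pbox_def mem_box less_imp_le)
  then have "\<bar>f x\<bar> \<le> B" for x using B[of "wrap x"] wrap_mem[of x] wrap_periodic[OF assms(1), of x] by auto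
  then show thesis using that by blast
qed

lemma integrable_pbox:
  fixes f :: "'a::euclidean_space \<Rightarrow> real"
  assumes f: "continuous_on UNIV f" and [measurable]: "S \<in> sets borel"
  shows "integrable lborel (\<lambda>x. indicator pbox x * (indicator S x * f x))"
proof (rule Bochner_Integration.integrable_bound)
  show "integrable lborel (\<lambda>x. indicator (cbox (- One) One) x *\<^sub>R f x)"
    by (rule borel_integrable_compact) (auto intro: continuous_on_subset[OF f])
  have [measurable]: "f \<in> borel_measurable borel" by (rule borel_measurable_continuous_onI[OF f])
  show "(\<lambda>x. indicator pbox x * (indicator S x * f x)) \<in> borel_measurable lborel" by measurable
  have "(pbox :: 'a set) \<subseteq> cbox (- One) One" by (auto simp: pbox_def mem_box less_imp_le)
  then show "AE x in lborel. norm (indicator pbox x * (indicator S x * f x)) \<le> norm (indicator (cbox (- One) One) x *\<^sub>R f x)"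
    by (auto simp: indicator_def)
qed

text \<open>In each coordinate x - p is at most 1 in absolute value, and a shift by 2 n brings it
  below 1/2; then |2 n| < 3/2 and n = 0.\<close>

lemma int_lattice_near:
  fixes x p k :: "'a::euclidean_space"
  assumes k: "k \<in> int_lattice" and a: "dist p (x + 2 *\<^sub>R k) < 1/2" and b: "\<And>b. b \<in> Basis \<Longrightarrow> \<bar>(x - p) \<bullet> b\<bar> \<le> 1"
  shows "k = 0"
proof (rule euclidean_eqI)
  fix i :: 'a assume i: "i \<in> Basis"
  have "k \<bullet> i \<in> \<int>" using k i by (auto simp: int_lattice_def)
  then obtain n :: int where n: "k \<bullet> i = of_int n" by (auto elim: Ints_cases)
  have "\<bar>(p - (x + 2 *\<^sub>R k)) \<bullet> i\<bar> < 1/2" using Basis_le_norm[OF i, of "p - (x + 2 *\<^sub>R k)"] a by (simp add: dist_norm)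
  then have "\<bar>(x - p) \<bullet> i + 2 * of_int n\<bar> < 1/2" by (simp add: inner_simps n abs_minus_commute algebra_simps)
  then have "n = 0" using b[OF i] by linarith
  then show "k \<bullet> i = 0 \<bullet> i" using n by simp
qed

lemma frontier_pext:
  fixes S :: "'a::euclidean_space set"
  assumes k: "k \<in> int_lattice"
  shows "x + 2 *\<^sub>R k \<in> frontier (pext S) \<longleftrightarrow> x \<in> frontier (pext S)"
proof -
  have "(\<lambda>y. 2 *\<^sub>R k + y) ` pext S = pext S"
  proof
    show "(\<lambda>y. 2 *\<^sub>R k + y) ` pext S \<subseteq> pext S"
      using pext_shift[OF k] by (auto simp: add.commute)
    show "pext S \<subseteq> (\<lambda>y. 2 *\<^sub>R k + y) ` pext S"
    proof
      fix y assume "y \<in> pext S"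
      then have "y + 2 *\<^sub>R (- k) \<in> pext S" using pext_shift[OF int_lattice_uminus[OF k]] by blast
      then show "y \<in> (\<lambda>y. 2 *\<^sub>R k + y) ` pext S" by (intro image_eqI[of _ _ "y + 2 *\<^sub>R (- k)"]) auto
    qed
  qed
  then have "frontier (pext S) = (\<lambda>y. 2 *\<^sub>R k + y) ` frontier (pext S)"
    using frontier_translation[of "2 *\<^sub>R k" "pext S"] by simp
  then have "x + 2 *\<^sub>R k \<in> frontier (pext S) \<longleftrightarrow> x + 2 *\<^sub>R k \<in> (\<lambda>y. 2 *\<^sub>R k + y) ` frontier (pext S)" by metis
  also have "\<dots> \<longleftrightarrow> x \<in> frontier (pext S)" by (auto simp: add.commute image_iff)
  finally show ?thesis .
qed

lemma wrap_frontier: "wrap x \<in> frontier (pext S) \<longleftrightarrow> x \<in> frontier (pext S)"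
  using wrap_shift[of x] frontier_pext by metis

text \<open>
  All domains share the axes \<open>ii p\<close>, \<open>jj p\<close> of the chart at \<open>p\<close>; the partition of unity is
  supported, modulo periods, in the balls of half the radius, so that it vanishes near the rim of
  the charts.
\<close>

locale smooth_domains =
  fixes \<Omega> :: "nat \<Rightarrow> (real^2) set" and m :: nat and K :: "(real^2) set"
    and \<theta> :: "real^2 \<Rightarrow> real^2 \<Rightarrow> real" and D\<theta> :: "real^2 \<Rightarrow> real^2 \<Rightarrow> real^2 \<Rightarrow> real"
    and rr :: "real^2 \<Rightarrow> real" and ii jj :: "real^2 \<Rightarrow> 2"
    and ss :: "nat \<Rightarrow> real^2 \<Rightarrow> real" and gg gd :: "nat \<Rightarrow> real^2 \<Rightarrow> real \<Rightarrow> real"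
  assumes \<Omega>_sub: "\<And>l. l < m \<Longrightarrow> \<Omega> l \<subseteq> pbox" and \<Omega>_open: "\<And>l. l < m \<Longrightarrow> open (pext (\<Omega> l))"
    and \<Omega>_disj: "\<And>l l'. l < m \<Longrightarrow> l' < m \<Longrightarrow> l \<noteq> l' \<Longrightarrow> pext (\<Omega> l) \<inter> pext (\<Omega> l') = {}"
    and K: "finite K" and \<theta>_C1: "\<And>p. p \<in> K \<Longrightarrow> C1_with (\<theta> p) (D\<theta> p)"
    and \<theta>_per: "\<And>p. p \<in> K \<Longrightarrow> periodic (\<theta> p)" and \<theta>_nonneg: "\<And>p x. p \<in> K \<Longrightarrow> 0 \<le> \<theta> p x"
    and \<theta>_supp: "\<And>p x. p \<in> K \<Longrightarrow> \<theta> p x \<noteq> 0 \<Longrightarrow> x \<in> pext (ball p (rr p / 2))"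
    and \<theta>_sum: "\<And>x. (\<Sum>p\<in>K. \<theta> p x) = 1"
    and rr: "\<And>p. 0 < rr p" "\<And>p. rr p \<le> 1/2"
    and chart: "\<And>l p. l < m \<Longrightarrow> is_chart (pext (\<Omega> l)) p (rr p) (ii p) (jj p) (ss l p) (gg l p) (gd l p)"
    and ij: "\<And>p. ii p \<noteq> jj p"
begin

definition \<gamma> where "\<gamma> l p v = pt (ii p) (ss l p * gg l p v) v"
text \<open>The indicator discards the part of the graph outside the chart ball, where the graph has
  nothing to do with the domain although the periodic weight may well be positive.\<close>

definition w where "w l p v = indicator (ball p (rr p)) (\<gamma> l p v) * \<theta> p (\<gamma> l p v)"
text \<open>
  The normal is not normalised: its length is the density of the line measure with respect to the
  parameter of the graph, so that \<open>h l p b\<close> is the density of the \<open>b\<close>-component of the gradient.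
\<close>

definition nrm where "nrm l p v = chart_normal (ii p) (jj p) (ss l p) (gd l p v)"
definition h where "h l p b v = w l p v * (nrm l p v \<bullet> b)"
abbreviation "\<Gamma>i l \<equiv> frontier (pext (\<Omega> l))"

lemma chartD:
  assumes "l < m"
  shows "ss l p = 1 \<or> ss l p = -1" "(gg l p has_real_derivative gd l p v) (at v)" "continuous_on UNIV (gd l p)"
    "x \<in> ball p (rr p) \<Longrightarrow> x \<in> pext (\<Omega> l) \<longleftrightarrow> gg l p (x $ jj p) < ss l p * x $ ii p"
  using chart[OF assms, of p] by (auto simp: is_chart_def)

lemma ss2: "l < m \<Longrightarrow> ss l p * ss l p = 1"
  using chartD(1)[of l p] by auto

lemma \<gamma>_nth: "\<gamma> l p v $ ii p = ss l p * gg l p v" "\<gamma> l p v $ jj p = v"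
  using ij[of p] by (auto simp: \<gamma>_def pt_nth)

lemma cont_gg: "l < m \<Longrightarrow> continuous_on S (gg l p)"
  by (meson DERIV_isCont continuous_at_imp_continuous_on chartD(2))

lemma cont_\<gamma>: "l < m \<Longrightarrow> continuous_on S (\<gamma> l p)"
  unfolding \<gamma>_def by (intro continuous_intros cont_gg) auto

lemma \<gamma>_measurable: "l < m \<Longrightarrow> \<gamma> l p \<in> borel_measurable borel"
  by (intro borel_measurable_continuous_onI cont_\<gamma>)

lemma frontier_chart: "l < m \<Longrightarrow> x \<in> ball p (rr p) \<Longrightarrow> x \<in> \<Gamma>i l \<longleftrightarrow> ss l p * x $ ii p = gg l p (x $ jj p)"
  by (rule is_chart_frontier[OF chart \<Omega>_open])

lemma frontier_\<gamma>: "l < m \<Longrightarrow> x \<in> ball p (rr p) \<Longrightarrow> x \<in> \<Gamma>i l \<Longrightarrow> \<gamma> l p (x $ jj p) = x"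
proof -
  assume l: "l < m" and x: "x \<in> ball p (rr p)" "x \<in> \<Gamma>i l"
  have "ss l p * x $ ii p = gg l p (x $ jj p)" using frontier_chart[OF l x(1)] x(2) by simp
  then have "x $ ii p = ss l p * gg l p (x $ jj p)" using chartD(1)[OF l, of p] by auto
  then show ?thesis unfolding \<gamma>_def using pt_eq[OF ij[of p], of x] by simp
qed

lemma \<gamma>_frontier: "l < m \<Longrightarrow> \<gamma> l p v \<in> ball p (rr p) \<Longrightarrow> \<gamma> l p v \<in> \<Gamma>i l"
  using frontier_chart[of l "\<gamma> l p v" p] ss2[of l p] by (simp add: \<gamma>_nth mult.assoc[symmetric])

lemma \<gamma>_normal: "l < m \<Longrightarrow> \<gamma> l p v \<in> ball p (rr p) \<Longrightarrow> inner_normal (pext (\<Omega> l)) (\<gamma> l p v) (nrm l p v)"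
  using is_chart_inner_normal[OF chart, of l "\<gamma> l p v" p] ss2[of l p] by (simp add: \<gamma>_nth mult.assoc[symmetric] nrm_def)

lemma \<theta>_le1: "p \<in> K \<Longrightarrow> \<theta> p x \<le> 1"
  using member_le_sum[of p K "\<lambda>p. \<theta> p x"] \<theta>_nonneg K \<theta>_sum[of x] by simp

lemma w_bounds: "p \<in> K \<Longrightarrow> 0 \<le> w l p v" "p \<in> K \<Longrightarrow> w l p v \<le> 1"
  using \<theta>_nonneg \<theta>_le1 by (auto simp: w_def indicator_def)

lemma w_nonzero: "w l p v \<noteq> 0 \<Longrightarrow> \<gamma> l p v \<in> ball p (rr p)"
  by (auto simp: w_def indicator_def split: if_splits)

lemma \<gamma>_ball: "\<gamma> l p v \<in> ball p r \<Longrightarrow> \<bar>v - p $ jj p\<bar> < r"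
  using component_le_norm_cart[of "\<gamma> l p v - p" "jj p"] by (simp add: \<gamma>_nth dist_norm norm_minus_commute)

lemma \<theta>_measurable: "p \<in> K \<Longrightarrow> \<theta> p \<in> borel_measurable borel"
  by (intro borel_measurable_continuous_onI C1_with_continuous[OF \<theta>_C1])

lemma w_measurable: "l < m \<Longrightarrow> p \<in> K \<Longrightarrow> w l p \<in> borel_measurable borel"
proof -
  assume l: "l < m" and p: "p \<in> K"
  have "(\<lambda>v. indicator (ball p (rr p)) (\<gamma> l p v) :: real) \<in> borel_measurable borel"
    by (rule measurable_compose[OF \<gamma>_measurable[OF l] borel_measurable_indicator]) simp
  moreover have "(\<lambda>v. \<theta> p (\<gamma> l p v)) \<in> borel_measurable borel"
    by (rule measurable_compose[OF \<gamma>_measurable[OF l] \<theta>_measurable[OF p]])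
  ultimately show ?thesis unfolding w_def by (rule borel_measurable_times)
qed

lemma nrm_inner: "nrm l p v \<bullet> axis (ii p) 1 = ss l p" "nrm l p v \<bullet> axis (jj p) 1 = - gd l p v"
  using ij[of p] by (auto simp: nrm_def inner_axis chart_normal_nth)

lemma gd_bound: obtains G where "G \<ge> 1" "\<And>l p v. l < m \<Longrightarrow> p \<in> K \<Longrightarrow> \<bar>v - p $ jj p\<bar> \<le> 2 \<Longrightarrow> \<bar>gd l p v\<bar> \<le> G"
proof -
  have "\<exists>G. \<forall>v. \<bar>v - p $ jj p\<bar> \<le> 2 \<longrightarrow> \<bar>gd l p v\<bar> \<le> G" if "l < m" for l p
  proof -
    have "bounded (gd l p ` {p $ jj p - 2..p $ jj p + 2})"
      by (intro compact_imp_bounded compact_continuous_image continuous_on_subset[OF chartD(3)[OF that]]) auto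
    then obtain G where G: "\<forall>x\<in>gd l p ` {p $ jj p - 2..p $ jj p + 2}. norm x \<le> G" unfolding bounded_iff by blast
    have "\<bar>gd l p v\<bar> \<le> G" if "\<bar>v - p $ jj p\<bar> \<le> 2" for v
    proof -
      have "v \<in> {p $ jj p - 2..p $ jj p + 2}" using that by (auto simp: abs_le_iff)
      then show ?thesis using G by force
    qed
    then show ?thesis by blast
  qed
  then obtain G where G: "\<And>l p v. l < m \<Longrightarrow> \<bar>v - p $ jj p\<bar> \<le> 2 \<Longrightarrow> \<bar>gd l p v\<bar> \<le> G l p" by metis
  show thesis
  proof
    let ?G = "1 + (\<Sum>l<m. \<Sum>p\<in>K. \<bar>G l p\<bar>)"
    show "?G \<ge> 1" by (simp add: sum_nonneg)
    fix l p v assume l: "l < m" and p: "p \<in> K" and v: "\<bar>v - p $ jj p\<bar> \<le> 2"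
    have "\<bar>gd l p v\<bar> \<le> \<bar>G l p\<bar>" using G[OF l v] by linarith
    also have "\<dots> \<le> (\<Sum>p\<in>K. \<bar>G l p\<bar>)" using K p by (intro member_le_sum) auto
    also have "\<dots> \<le> (\<Sum>l<m. \<Sum>p\<in>K. \<bar>G l p\<bar>)" using l by (intro member_le_sum[where f="\<lambda>l. \<Sum>p\<in>K. \<bar>G l p\<bar>"]) (auto intro: sum_nonneg)
    finally show "\<bar>gd l p v\<bar> \<le> ?G" by simp
  qed
qed

lemma Basis_cases: "(b :: real^2) \<in> Basis \<Longrightarrow> b = axis (ii p) 1 \<or> b = axis (jj p) 1"
  unfolding Basis_two[OF ij[of p]] by simp

lemma h_bound: obtains G where "G \<ge> 1"
  "\<And>l p b v. l < m \<Longrightarrow> p \<in> K \<Longrightarrow> b \<in> Basis \<Longrightarrow> \<bar>h l p b v\<bar> \<le> G * indicator (ball p (rr p)) (\<gamma> l p v)"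
proof -
  obtain G where G: "G \<ge> 1" "\<And>l p v. l < m \<Longrightarrow> p \<in> K \<Longrightarrow> \<bar>v - p $ jj p\<bar> \<le> 2 \<Longrightarrow> \<bar>gd l p v\<bar> \<le> G" using gd_bound by blast
  show thesis
  proof (rule that[OF G(1)])
    fix l p v and b :: "real^2" assume l: "l < m" and p: "p \<in> K" and b: "b \<in> Basis"
    show "\<bar>h l p b v\<bar> \<le> G * indicator (ball p (rr p)) (\<gamma> l p v)"
    proof (cases "\<gamma> l p v \<in> ball p (rr p)")
      case False
      then have "w l p v = 0" using w_nonzero by blast
      then show ?thesis using G by (simp add: h_def indicator_def)
    next
      case True
      then have "\<bar>v - p $ jj p\<bar> \<le> 2" using \<gamma>_ball[of l p v "rr p"] rr(2)[of p] by linarith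
      then have "\<bar>gd l p v\<bar> \<le> G" using G l p by blast
      then have n: "\<bar>nrm l p v \<bullet> b\<bar> \<le> G"
        using Basis_cases[OF b, of p] nrm_inner[of l p v] chartD(1)[OF l, of p] G(1) by auto
      have "\<bar>h l p b v\<bar> = w l p v * \<bar>nrm l p v \<bullet> b\<bar>" using w_bounds[OF p] by (simp add: h_def abs_mult)
      also have "\<dots> \<le> 1 * G" using w_bounds[OF p] n by (intro mult_mono) auto
      finally show ?thesis using True by simp
    qed
  qed
qed

lemma h_measurable: "l < m \<Longrightarrow> p \<in> K \<Longrightarrow> b \<in> Basis \<Longrightarrow> h l p b \<in> borel_measurable borel"
proof -
  assume l: "l < m" and p: "p \<in> K" and b: "b \<in> Basis"
  have "(\<lambda>v. nrm l p v \<bullet> b) \<in> borel_measurable borel"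
    using Basis_cases[OF b, of p] borel_measurable_continuous_onI[OF chartD(3)[OF l, of p]] by (auto simp: nrm_inner)
  then show ?thesis unfolding h_def using w_measurable[OF l p] by (rule borel_measurable_times[rotated])
qed

lemma h_integrable: "l < m \<Longrightarrow> p \<in> K \<Longrightarrow> b \<in> Basis \<Longrightarrow> integrable lborel (h l p b)"
proof -
  assume l: "l < m" and p: "p \<in> K" and b: "b \<in> Basis"
  obtain G where G: "G \<ge> 1" "\<And>l p b v. l < m \<Longrightarrow> p \<in> K \<Longrightarrow> b \<in> Basis \<Longrightarrow> \<bar>h l p b v\<bar> \<le> G * indicator (ball p (rr p)) (\<gamma> l p v)"
    using h_bound by blast
  show ?thesis
  proof (rule Bochner_Integration.integrable_bound[of _ "\<lambda>v. indicator {p $ jj p - 1..p $ jj p + 1} v *\<^sub>R G"])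
    show "integrable lborel (\<lambda>v. indicator {p $ jj p - 1..p $ jj p + 1} v *\<^sub>R G)" by simp
    show "h l p b \<in> borel_measurable lborel" using h_measurable[OF l p b] by simp
    have "\<bar>h l p b v\<bar> \<le> \<bar>indicator {p $ jj p - 1..p $ jj p + 1} v *\<^sub>R G\<bar>" for v
    proof (cases "\<gamma> l p v \<in> ball p (rr p)")
      case True
      then have "v \<in> {p $ jj p - 1..p $ jj p + 1}" using \<gamma>_ball[of l p v "rr p"] rr(2)[of p] by (auto simp: abs_less_iff)
      then show ?thesis using G(2)[OF l p b, of v] G(1) True by simp
    next
      case False
      then show ?thesis using G(2)[OF l p b, of v] by simp
    qed
    then show "AE v in lborel. norm (h l p b v) \<le> norm (indicator {p $ jj p - 1..p $ jj p + 1} v *\<^sub>R G)" by simp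
  qed
qed

text \<open>The support condition holds only modulo periods; radii of at most 1/2 exclude every
  translate but the one at p.\<close>

lemma \<theta>_zero_ball:
  assumes p: "p \<in> K" and y: "y \<in> ball p (rr p)" "y \<notin> ball p (rr p / 2)"
  shows "\<theta> p y = 0"
proof (rule ccontr)
  assume "\<theta> p y \<noteq> 0"
  then obtain k where k: "k \<in> int_lattice" "y + 2 *\<^sub>R k \<in> ball p (rr p / 2)" using \<theta>_supp[OF p] by (auto simp: mem_pext)
  have "k = 0"
  proof (rule int_lattice_near[OF k(1)])
    show "dist p (y + 2 *\<^sub>R k) < 1/2" using k(2) rr[of p] by simp
    fix b :: "real^2" assume "b \<in> Basis"
    from Basis_le_norm[OF this, of "y - p"] show "\<bar>(y - p) \<bullet> b\<bar> \<le> 1"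
      using y(1) rr(2)[of p] by (simp add: dist_norm norm_minus_commute)
  qed
  then show False using k y by simp
qed

lemma \<theta>_zero_cell:
  assumes p: "p \<in> K" and y: "y \<in> cell (p - One) 2 0" "y \<notin> ball p (rr p)"
  shows "\<theta> p y = 0"
proof (rule ccontr)
  assume "\<theta> p y \<noteq> 0"
  then obtain k where k: "k \<in> int_lattice" "y + 2 *\<^sub>R k \<in> ball p (rr p / 2)" using \<theta>_supp[OF p] by (auto simp: mem_pext)
  have "k = 0"
  proof (rule int_lattice_near[OF k(1)])
    show "dist p (y + 2 *\<^sub>R k) < 1/2" using k(2) rr[of p] by simp
    fix b :: "real^2" assume "b \<in> Basis"
    moreover have "y - p \<in> pbox" using y(1) cell_shift[of y p 0] by simp
    ultimately show "\<bar>(y - p) \<bullet> b\<bar> \<le> 1" by (force simp: pbox_def abs_le_iff)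
  qed
  then show False using k y rr(1)[of p] by simp
qed

text \<open>In the period box centred at p, the product of the test function with the weight is
  supported in the chart ball, where the domain is the region above a graph. Truncated to that ball,
  it is an admissible integrand for the divergence theorem.\<close>

lemma divergence_piece:
  assumes l: "l < m" and p: "p \<in> K" and b: "b \<in> Basis" and \<phi>: "C1_with \<phi> D\<phi>" "periodic \<phi>"
  shows "(\<integral>x. indicator pbox x * (indicator (pext (\<Omega> l)) x * (\<phi> x * D\<theta> p x b + D\<phi> x b * \<theta> p x)) \<partial>lborel)
     = - (\<integral>v. \<phi> (\<gamma> l p v) * h l p b v \<partial>lborel)"
proof -
  let ?S = "pext (\<Omega> l)" and ?B = "ball p (rr p)"
  define E where "E x h = \<phi> x * D\<theta> p x h + D\<phi> x h * \<theta> p x" for x h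
  have CE: "C1_with (\<lambda>x. \<phi> x * \<theta> p x) E" unfolding E_def by (rule C1_with_mult[OF \<phi>(1) \<theta>_C1[OF p]])
  have perE: "E (x + 2 *\<^sub>R k) = E x" if "k \<in> int_lattice" for x k
  proof (rule C1_with_periodic[OF CE _ that])
    show "periodic (\<lambda>x. \<phi> x * \<theta> p x)" using \<phi>(2) \<theta>_per[OF p] by (simp add: periodic_def)
  qed
  have E0: "E x h = 0" if "\<theta> p x = 0" for x h
    using C1_with_minimum[OF \<theta>_C1[OF p] \<theta>_nonneg[OF p] that] that by (simp add: E_def)
  \<comment> \<open>The periodic product lives in all translates of the ball; this keeps one of
    them. The cut is of class C1, because the weight and its derivative vanish in the shell between
    half the radius and the radius.\<close>
  define \<psi> where "\<psi> x = (if x \<in> ?B then \<phi> x * \<theta> p x else 0)" for x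
  define D where "D x h = (if x \<in> ?B then E x h else 0)" for x h
  have \<psi>0: "\<psi> y = 0" "D y h = 0" if "y \<in> - cball p (rr p / 2)" for y h
  proof -
    have "y \<in> ?B \<Longrightarrow> \<theta> p y = 0" using that by (intro \<theta>_zero_ball[OF p]) auto
    then show "\<psi> y = 0" "D y h = 0" by (auto simp: \<psi>_def D_def E0)
  qed
  have cover: "?B \<union> - cball p (rr p / 2) = UNIV" using rr(1)[of p] by auto
  have CD: "C1_with \<psi> D"
    unfolding C1_with_def
  proof safe
    fix x
    show "(\<psi> has_derivative D x) (at x)"
    proof (cases "x \<in> ?B")
      case True
      have "((\<lambda>x. \<phi> x * \<theta> p x) has_derivative E x) (at x)" using CE by (simp add: C1_with_def)
      then have "((\<lambda>x. \<phi> x * \<theta> p x) has_derivative D x) (at x)" using True by (simp add: D_def[abs_def])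
      then show ?thesis
        by (rule has_derivative_transform_within_open[of _ _ _ _ ?B]) (use True in \<open>auto simp: \<psi>_def\<close>)
    next
      case False
      then have x: "x \<in> - cball p (rr p / 2)" using cover by blast
      have "D x = (\<lambda>_. 0)" using \<psi>0(2)[OF x] by (rule ext)
      then have "((\<lambda>_. 0) has_derivative D x) (at x)" by simp
      then show ?thesis
        by (rule has_derivative_transform_within_open[of _ _ _ _ "- cball p (rr p / 2)"]) (use x \<psi>0 in auto)
    qed
    fix h
    have "continuous_on (?B \<union> - cball p (rr p / 2)) (\<lambda>x. D x h)"
    proof (rule continuous_on_open_Un)
      have "continuous_on ?B (\<lambda>x. E x h)" using CE by (auto simp: C1_with_def intro: continuous_on_subset)
      then show "continuous_on ?B (\<lambda>x. D x h)" by (rule continuous_on_eq) (simp add: D_def)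
      have "continuous_on (- cball p (rr p / 2)) (\<lambda>x. 0 :: real)" by simp
      then show "continuous_on (- cball p (rr p / 2)) (\<lambda>x. D x h)" by (rule continuous_on_eq) (simp add: \<psi>0)
    qed auto
    then show "continuous_on UNIV (\<lambda>x. D x h)" by (simp add: cover)
  qed
  have [measurable]: "?S \<in> sets borel" using \<Omega>_open[OF l] by simp
  have cE: "continuous_on UNIV (\<lambda>x. E x b)" using CE by (simp add: C1_with_def)
  \<comment> \<open>The rim of \<open>pbox\<close> may pass through the chart ball, so the integral
    is moved to the box centred at p.\<close>
  have "(\<integral>x. indicator pbox x * (indicator ?S x * E x b) \<partial>lborel) = (\<integral>x. indicator (cell (p - One) 2 0) x * (indicator ?S x * E x b) \<partial>lborel)"
  proof (rule integral_shifted_pbox[symmetric])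
    show "indicator ?S (x + 2 *\<^sub>R k) * E (x + 2 *\<^sub>R k) b = indicator ?S x * E x b" if "k \<in> int_lattice" for x k
      using pext_shift[OF that, of x "\<Omega> l"] perE[OF that, of x] by (simp add: indicator_def)
    have [measurable]: "(\<lambda>x. E x b) \<in> borel_measurable borel" by (rule borel_measurable_continuous_onI[OF cE])
    show "(\<lambda>x. indicator ?S x * E x b) \<in> borel_measurable borel" by measurable
    show "integrable lborel (\<lambda>x. indicator pbox x * (indicator ?S x * E x b))" by (rule integrable_pbox[OF cE]) simp
  qed
  also have "\<dots> = (\<integral>x. indicator {x. gg l p (x $ jj p) < ss l p * x $ ii p} x * D x b \<partial>lborel)"
  proof (rule Bochner_Integration.integral_cong[OF refl])
    fix x
    show "indicator (cell (p - One) 2 0) x * (indicator ?S x * E x b) = indicator {x. gg l p (x $ jj p) < ss l p * x $ ii p} x * D x b"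
    proof (cases "x \<in> ?B")
      case True
      have "x - p \<in> pbox"
        unfolding pbox_def mem_Collect_eq
      proof
        fix b :: "real^2" assume "b \<in> Basis"
        from Basis_le_norm[OF this, of "x - p"] have "\<bar>(x - p) \<bullet> b\<bar> < 1"
          using True rr(2)[of p] by (simp add: dist_norm norm_minus_commute)
        then show "-1 \<le> (x - p) \<bullet> b \<and> (x - p) \<bullet> b < 1" by (simp add: abs_less_iff)
      qed
      then have "x \<in> cell (p - One) 2 0" using cell_shift[of x p 0] by simp
      then show ?thesis using True chartD(4)[OF l True] by (simp add: D_def indicator_def)
    next
      case False
      then have "x \<in> cell (p - One) 2 0 \<Longrightarrow> E x b = 0" using \<theta>_zero_cell[OF p] E0 by blast
      then show ?thesis using False by (simp add: D_def indicator_def)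
    qed
  qed
  also have "\<dots> = - (\<integral>v. \<phi> (\<gamma> l p v) * h l p b v \<partial>lborel)"
  proof -
    interpret graph_divergence "ii p" "jj p" "ss l p" "gg l p" "gd l p" \<psi> D "norm p + 1"
    proof
      show "\<psi> x = 0" if "norm p + 1 < norm x" for x
      proof -
        have "x \<notin> ?B" using that norm_triangle_ineq2[of x p] rr(2)[of p] by (auto simp: dist_norm norm_minus_commute)
        then show ?thesis by (simp add: \<psi>_def)
      qed
    qed (use ij chartD[OF l] CD in auto)
    have w: "\<psi> (pt (ii p) (ss l p * gg l p v) v) = \<phi> (\<gamma> l p v) * w l p v" for v
      by (simp add: \<psi>_def w_def \<gamma>_def indicator_def)
    show ?thesis
      using Basis_cases[OF b, of p]
    proof
      assume b: "b = axis (ii p) 1"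
      show ?thesis unfolding b divergence_i w by (simp add: h_def nrm_inner mult.assoc)
    next
      assume b: "b = axis (jj p) 1"
      show ?thesis unfolding b divergence_j w by (simp add: h_def nrm_inner mult.assoc)
    qed
  qed
  finally show ?thesis by (simp add: E_def)
qed

text \<open>The weights add up to 1 and hence their derivatives to 0, so the product-rule integrands
  of the pieces add up to the derivative of the test function.\<close>

lemma divergence:
  assumes l: "l < m" and b: "b \<in> Basis" and \<phi>: "C1_with \<phi> D\<phi>" "periodic \<phi>"
  shows "(\<integral>x. indicator pbox x * (indicator (\<Omega> l) x * D\<phi> x b) \<partial>lborel) = - (\<Sum>p\<in>K. \<integral>v. \<phi> (\<gamma> l p v) * h l p b v \<partial>lborel)"
proof -
  let ?S = "pext (\<Omega> l)"
  have [measurable]: "?S \<in> sets borel" using \<Omega>_open[OF l] by simp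
  have \<Omega>S: "x \<in> \<Omega> l \<longleftrightarrow> x \<in> ?S" if x: "x \<in> pbox" for x
  proof
    assume "x \<in> \<Omega> l"
    then show "x \<in> ?S" unfolding mem_pext by (intro bexI[of _ 0]) (auto simp: int_lattice_0)
  next
    assume "x \<in> ?S"
    then obtain k where k: "k \<in> int_lattice" "x + 2 *\<^sub>R k \<in> \<Omega> l" by (auto simp: mem_pext)
    then have "x + 2 *\<^sub>R k \<in> pbox" using \<Omega>_sub[OF l] by auto
    then have "x \<in> cell (- One) 2 (- k)" "x \<in> cell (- One) 2 0" using x by (auto simp: mem_cell_pbox)
    moreover obtain k0 where "\<And>j. j \<in> int_lattice \<Longrightarrow> x \<in> cell (- One) 2 j \<Longrightarrow> j = k0"
      using cell_unique[of 2 x "- One"] by auto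
    ultimately have "- k = 0" using int_lattice_uminus[OF k(1)] int_lattice_0 by metis
    then show "x \<in> \<Omega> l" using k by simp
  qed
  have zero: "(\<Sum>p\<in>K. D\<theta> p x b) = 0" for x
  proof -
    have "C1_with (\<lambda>x. \<Sum>p\<in>K. \<theta> p x) (\<lambda>x h. \<Sum>p\<in>K. D\<theta> p x h)" by (rule C1_with_sum) (rule \<theta>_C1)
    then have "C1_with (\<lambda>x. 1) (\<lambda>x h. \<Sum>p\<in>K. D\<theta> p x h)" by (simp add: \<theta>_sum)
    from C1_with_unique[OF this, of "\<lambda>_. 0" x] show ?thesis by (auto dest: fun_cong[of _ _ b])
  qed
  have eq: "indicator pbox x * (indicator (\<Omega> l) x * D\<phi> x b)
     = (\<Sum>p\<in>K. indicator pbox x * (indicator ?S x * (\<phi> x * D\<theta> p x b + D\<phi> x b * \<theta> p x)))" for x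
  proof -
    have "(\<Sum>p\<in>K. \<phi> x * D\<theta> p x b + D\<phi> x b * \<theta> p x) = D\<phi> x b"
      by (simp add: sum.distrib sum_distrib_left[symmetric] zero \<theta>_sum)
    then show ?thesis using \<Omega>S[of x] by (simp add: sum_distrib_left[symmetric] indicator_def)
  qed
  have "(\<integral>x. indicator pbox x * (indicator (\<Omega> l) x * D\<phi> x b) \<partial>lborel)
     = (\<Sum>p\<in>K. \<integral>x. indicator pbox x * (indicator ?S x * (\<phi> x * D\<theta> p x b + D\<phi> x b * \<theta> p x)) \<partial>lborel)"
    unfolding eq
  proof (rule Bochner_Integration.integral_sum)
    fix p assume p: "p \<in> K"
    have "C1_with (\<lambda>x. \<phi> x * \<theta> p x) (\<lambda>x h. \<phi> x * D\<theta> p x h + D\<phi> x h * \<theta> p x)"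
      by (rule C1_with_mult[OF \<phi>(1) \<theta>_C1[OF p]])
    then have "continuous_on UNIV (\<lambda>x. \<phi> x * D\<theta> p x b + D\<phi> x b * \<theta> p x)" by (simp add: C1_with_def)
    then show "integrable lborel (\<lambda>x. indicator pbox x * (indicator ?S x * (\<phi> x * D\<theta> p x b + D\<phi> x b * \<theta> p x)))"
      by (rule integrable_pbox) simp
  qed
  also have "\<dots> = - (\<Sum>p\<in>K. \<integral>v. \<phi> (\<gamma> l p v) * h l p b v \<partial>lborel)"
    using divergence_piece[OF l _ b \<phi>] by (simp add: sum_negf)
  finally show ?thesis .
qed

end

lemma curve_measure_ex:
  fixes t :: "'j \<Rightarrow> real \<Rightarrow> 'a::euclidean_space" and h :: "'j \<Rightarrow> real \<Rightarrow> real"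
  assumes J: "finite J" and t: "\<And>j. j \<in> J \<Longrightarrow> t j \<in> borel \<rightarrow>\<^sub>M torus_borel"
    and h: "\<And>j. j \<in> J \<Longrightarrow> integrable lborel (h j)" "\<And>j v. 0 \<le> h j v"
  shows "\<exists>P. finite_measure P \<and> sets P = sets torus_borel \<and>
    (\<forall>A\<in>sets torus_borel. emeasure P A = (\<Sum>j\<in>J. \<integral>\<^sup>+v. indicator A (t j v) * ennreal (h j v) \<partial>lborel)) \<and>
    (\<forall>(\<phi> :: 'a \<Rightarrow> real) B. \<phi> \<in> borel_measurable torus_borel \<longrightarrow> (\<forall>x. \<bar>\<phi> x\<bar> \<le> B) \<longrightarrow>
       (\<integral>x. \<phi> x \<partial>P) = (\<Sum>j\<in>J. \<integral>v. \<phi> (t j v) * h j v \<partial>lborel))" (is "\<exists>P. ?Q P")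
proof (rule curve_measure_nonneg[OF J t h])
  fix P :: "'a measure"
  assume P: "finite_measure P" "sets P = sets torus_borel"
    "\<And>A. A \<in> sets torus_borel \<Longrightarrow> emeasure P A = (\<Sum>j\<in>J. \<integral>\<^sup>+v. indicator A (t j v) * ennreal (h j v) \<partial>lborel)"
    "\<And>(\<phi> :: 'a \<Rightarrow> real) B. \<phi> \<in> borel_measurable torus_borel \<Longrightarrow> (\<And>x. \<bar>\<phi> x\<bar> \<le> B) \<Longrightarrow>
       (\<integral>x. \<phi> x \<partial>P) = (\<Sum>j\<in>J. \<integral>v. \<phi> (t j v) * h j v \<partial>lborel)"
  have "?Q P"
  proof (intro conjI ballI allI impI P(1) P(2) P(3))
    fix \<phi> :: "'a \<Rightarrow> real" and B assume a: "\<phi> \<in> borel_measurable torus_borel" "\<forall>x. \<bar>\<phi> x\<bar> \<le> B"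
    show "(\<integral>x. \<phi> x \<partial>P) = (\<Sum>j\<in>J. \<integral>v. \<phi> (t j v) * h j v \<partial>lborel)"
      by (rule P(4)[OF a(1)]) (use a(2) in blast)
  qed
  then show "\<exists>P. ?Q P" by (rule exI)
qed

context smooth_domains
begin

abbreviation "J \<equiv> {..<m} \<times> K"

text \<open>The candidate for the gradient, as curve integrals of inner normals. The normal enters
  with a positive sign because a characteristic function increases towards the inside;
  \<open>wrap\<close> brings the curves back into the box.\<close>

definition Nu :: "(nat \<Rightarrow> real) \<Rightarrow> (real^2) set \<Rightarrow> real^2" where
  "Nu c A = (\<Sum>b\<in>Basis. (\<Sum>(l, p)\<in>J. \<integral>v. indicator A (wrap (\<gamma> l p v)) * (c l * h l p b v) \<partial>lborel) *\<^sub>R b)"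

definition hits :: "nat \<Rightarrow> real^2 \<Rightarrow> (real^2) set \<Rightarrow> real set" where
  "hits l p A = {v. \<gamma> l p v \<in> ball p (rr p) \<and> wrap (\<gamma> l p v) \<in> A}"

lemma finite_J: "finite J" using K by simp

lemma Nu_inner: "b \<in> Basis \<Longrightarrow> Nu c A \<bullet> b = (\<Sum>(l, p)\<in>J. \<integral>v. indicator A (wrap (\<gamma> l p v)) * (c l * h l p b v) \<partial>lborel)"
  unfolding Nu_def by (rule inner_sum_left_Basis)

lemma wrap_\<gamma>_measurable: "l < m \<Longrightarrow> (\<lambda>v. wrap (\<gamma> l p v)) \<in> borel \<rightarrow>\<^sub>M torus_borel"
  by (rule measurable_compose[OF \<gamma>_measurable wrap_measurable])

lemma hits_measurable: "l < m \<Longrightarrow> A \<in> sets torus_borel \<Longrightarrow> hits l p A \<in> sets borel"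
proof -
  assume l: "l < m" and A: "A \<in> sets torus_borel"
  have "hits l p A = (\<gamma> l p -` ball p (rr p) \<inter> space borel) \<inter> ((\<lambda>v. wrap (\<gamma> l p v)) -` A \<inter> space borel)"
    by (auto simp: hits_def)
  also have "\<dots> \<in> sets borel"
    by (intro sets.Int measurable_sets[OF \<gamma>_measurable[OF l]] measurable_sets[OF wrap_\<gamma>_measurable[OF l] A]) simp
  finally show ?thesis .
qed

lemma integrable_hits:
  assumes l: "l < m" and p: "p \<in> K" and b: "b \<in> Basis" and A: "A \<in> sets torus_borel"
  shows "integrable lborel (\<lambda>v. indicator A (wrap (\<gamma> l p v)) * (c l * h l p b v))"
proof (rule Bochner_Integration.integrable_bound)
  show "integrable lborel (\<lambda>v. c l * h l p b v)" using h_integrable[OF l p b] by simp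
  have "(\<lambda>v. indicator A (wrap (\<gamma> l p v)) :: real) \<in> borel_measurable borel"
    by (rule measurable_compose[OF wrap_\<gamma>_measurable[OF l] borel_measurable_indicator[OF A]])
  then show "(\<lambda>v. indicator A (wrap (\<gamma> l p v)) * (c l * h l p b v)) \<in> borel_measurable lborel"
    using h_measurable[OF l p b] by simp
qed (auto simp: indicator_def)

text \<open>Each curve piece is split into the positive and negative part of its density. Pieces
  over the same boundary arc are not merged, so P and N may share mass; their sum is used only as an
  upper bound.\<close>

lemma component_measures:
  assumes b: "b \<in> Basis"
  obtains P N where "finite_measure P" "finite_measure N" "sets P = sets torus_borel" "sets N = sets torus_borel"
    "\<And>A. A \<in> sets torus_borel \<Longrightarrow> Nu c A \<bullet> b = measure P A - measure N A"
    "\<And>\<phi> B. \<phi> \<in> borel_measurable torus_borel \<Longrightarrow> (\<And>x. \<bar>\<phi> x\<bar> \<le> B) \<Longrightarrow>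
       (\<integral>x. \<phi> x \<partial>P) - (\<integral>x. \<phi> x \<partial>N) = (\<Sum>(l, p)\<in>J. \<integral>v. \<phi> (wrap (\<gamma> l p v)) * (c l * h l p b v) \<partial>lborel)"
    "\<And>A. A \<in> sets torus_borel \<Longrightarrow> emeasure P A + emeasure N A = (\<Sum>(l, p)\<in>J. \<integral>\<^sup>+v. indicator A (wrap (\<gamma> l p v)) * ennreal \<bar>c l * h l p b v\<bar> \<partial>lborel)"
proof -
  let ?t = "\<lambda>(l, p) v. wrap (\<gamma> l p v)"
  let ?h = "\<lambda>(l, p) v. c l * h l p b v"
  have t: "?t j \<in> borel \<rightarrow>\<^sub>M torus_borel" if "j \<in> J" for j using that wrap_\<gamma>_measurable by (cases j) auto
  have hi: "integrable lborel (?h j)" if "j \<in> J" for j using that h_integrable[OF _ _ b] by (cases j) auto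
  have hm: "?h j \<in> borel_measurable borel" if "j \<in> J" for j using hi[OF that] by auto
  have pos: "integrable lborel (\<lambda>v. max 0 (?h j v))" if "j \<in> J" for j using hi[OF that] by simp
  have neg: "integrable lborel (\<lambda>v. max 0 (- ?h j v))" if "j \<in> J" for j using hi[OF that] by simp
  have "\<exists>P. finite_measure P \<and> sets P = sets torus_borel \<and>
    (\<forall>A\<in>sets torus_borel. emeasure P A = (\<Sum>j\<in>J. \<integral>\<^sup>+v. indicator A (?t j v) * ennreal (max 0 (?h j v)) \<partial>lborel)) \<and>
    (\<forall>\<phi> B. \<phi> \<in> borel_measurable torus_borel \<longrightarrow> (\<forall>x. \<bar>\<phi> x\<bar> \<le> B) \<longrightarrow>
       (\<integral>x. \<phi> x \<partial>P) = (\<Sum>j\<in>J. \<integral>v. \<phi> (?t j v) * max 0 (?h j v) \<partial>lborel))"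
    by (rule curve_measure_ex[OF finite_J]) (use t pos in auto)
  then obtain P where P: "finite_measure P" "sets P = sets torus_borel"
    "\<forall>A\<in>sets torus_borel. emeasure P A = (\<Sum>j\<in>J. \<integral>\<^sup>+v. indicator A (?t j v) * ennreal (max 0 (?h j v)) \<partial>lborel)"
    "\<forall>\<phi> B. \<phi> \<in> borel_measurable torus_borel \<longrightarrow> (\<forall>x. \<bar>\<phi> x\<bar> \<le> B) \<longrightarrow>
       (\<integral>x. \<phi> x \<partial>P) = (\<Sum>j\<in>J. \<integral>v. \<phi> (?t j v) * max 0 (?h j v) \<partial>lborel)"
    by (elim exE conjE) (rule that)
  have "\<exists>P. finite_measure P \<and> sets P = sets torus_borel \<and>
    (\<forall>A\<in>sets torus_borel. emeasure P A = (\<Sum>j\<in>J. \<integral>\<^sup>+v. indicator A (?t j v) * ennreal (max 0 (- ?h j v)) \<partial>lborel)) \<and>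
    (\<forall>\<phi> B. \<phi> \<in> borel_measurable torus_borel \<longrightarrow> (\<forall>x. \<bar>\<phi> x\<bar> \<le> B) \<longrightarrow>
       (\<integral>x. \<phi> x \<partial>P) = (\<Sum>j\<in>J. \<integral>v. \<phi> (?t j v) * max 0 (- ?h j v) \<partial>lborel))"
    by (rule curve_measure_ex[OF finite_J]) (use t neg in auto)
  then obtain N where N: "finite_measure N" "sets N = sets torus_borel"
    "\<forall>A\<in>sets torus_borel. emeasure N A = (\<Sum>j\<in>J. \<integral>\<^sup>+v. indicator A (?t j v) * ennreal (max 0 (- ?h j v)) \<partial>lborel)"
    "\<forall>\<phi> B. \<phi> \<in> borel_measurable torus_borel \<longrightarrow> (\<forall>x. \<bar>\<phi> x\<bar> \<le> B) \<longrightarrow>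
       (\<integral>x. \<phi> x \<partial>N) = (\<Sum>j\<in>J. \<integral>v. \<phi> (?t j v) * max 0 (- ?h j v) \<partial>lborel)"
    by (elim exE conjE) (rule that)
  have diff: "(\<integral>x. \<phi> x \<partial>P) - (\<integral>x. \<phi> x \<partial>N) = (\<Sum>(l, p)\<in>J. \<integral>v. \<phi> (wrap (\<gamma> l p v)) * (c l * h l p b v) \<partial>lborel)"
    if \<phi>: "\<phi> \<in> borel_measurable torus_borel" and B: "\<And>x. \<bar>\<phi> x\<bar> \<le> B" for \<phi> B
  proof -
    have "(\<integral>v. \<phi> (?t j v) * max 0 (?h j v) \<partial>lborel) - (\<integral>v. \<phi> (?t j v) * max 0 (- ?h j v) \<partial>lborel) = (\<integral>v. \<phi> (?t j v) * ?h j v \<partial>lborel)"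
      if j: "j \<in> J" for j
    proof -
      have B0: "B \<ge> 0" using B[of 0] by linarith
      have i: "integrable lborel (\<lambda>v. \<phi> (?t j v) * k v)" if k: "integrable lborel k" for k :: "real \<Rightarrow> real"
      proof (rule Bochner_Integration.integrable_bound[of _ "\<lambda>v. B * k v"])
        show "integrable lborel (\<lambda>v. B * k v)" using k by simp
        show "(\<lambda>v. \<phi> (?t j v) * k v) \<in> borel_measurable lborel"
          using measurable_compose[OF t[OF j] \<phi>] k by (intro borel_measurable_times) auto
        show "AE v in lborel. norm (\<phi> (?t j v) * k v) \<le> norm (B * k v)"
          using B B0 by (auto simp: abs_mult intro!: mult_right_mono)
      qed
      have "(\<integral>v. \<phi> (?t j v) * max 0 (?h j v) \<partial>lborel) - (\<integral>v. \<phi> (?t j v) * max 0 (- ?h j v) \<partial>lborel)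
        = (\<integral>v. \<phi> (?t j v) * max 0 (?h j v) - \<phi> (?t j v) * max 0 (- ?h j v) \<partial>lborel)"
        by (rule Bochner_Integration.integral_diff[symmetric]) (intro i pos[OF j] neg[OF j])+
      also have "\<dots> = (\<integral>v. \<phi> (?t j v) * ?h j v \<partial>lborel)"
        by (intro Bochner_Integration.integral_cong refl) (simp add: right_diff_distrib[symmetric] max_def)
      finally show ?thesis .
    qed
    then have "(\<Sum>j\<in>J. \<integral>v. \<phi> (?t j v) * max 0 (?h j v) \<partial>lborel) - (\<Sum>j\<in>J. \<integral>v. \<phi> (?t j v) * max 0 (- ?h j v) \<partial>lborel)
       = (\<Sum>j\<in>J. \<integral>v. \<phi> (?t j v) * ?h j v \<partial>lborel)"
      unfolding sum_subtractf[symmetric] by (rule sum.cong[OF refl])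
    then show ?thesis using P(4)[rule_format, OF \<phi> B] N(4)[rule_format, OF \<phi> B] by (simp add: split_beta)
  qed
  show thesis
  proof (rule that[OF P(1) N(1) P(2) N(2)])
    show "Nu c A \<bullet> b = measure P A - measure N A" if A: "A \<in> sets torus_borel" for A
    proof -
      have "(\<integral>x. indicator A x \<partial>P) - (\<integral>x. indicator A x \<partial>N) = Nu c A \<bullet> b"
        unfolding Nu_inner[OF b] by (rule diff[OF borel_measurable_indicator[OF A], of 1]) (simp add: indicator_def)
      moreover have "(\<integral>x. indicator A x \<partial>P) = measure P A" "(\<integral>x. indicator A x \<partial>N) = measure N A"
        using A P(2) N(2) sets.sets_into_space[OF A] sets_eq_imp_space_eq[OF P(2)] sets_eq_imp_space_eq[OF N(2)] by (auto simp: Int_absorb2)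
      ultimately show ?thesis by simp
    qed
    show "(\<integral>x. \<phi> x \<partial>P) - (\<integral>x. \<phi> x \<partial>N) = (\<Sum>(l, p)\<in>J. \<integral>v. \<phi> (wrap (\<gamma> l p v)) * (c l * h l p b v) \<partial>lborel)"
      if "\<phi> \<in> borel_measurable torus_borel" "\<And>x. \<bar>\<phi> x\<bar> \<le> B" for \<phi> B
      using diff that by blast
    show "emeasure P A + emeasure N A = (\<Sum>(l, p)\<in>J. \<integral>\<^sup>+v. indicator A (wrap (\<gamma> l p v)) * ennreal \<bar>c l * h l p b v\<bar> \<partial>lborel)"
      if A: "A \<in> sets torus_borel" for A
    proof -
      have "(\<integral>\<^sup>+v. indicator A (?t j v) * ennreal (max 0 (?h j v)) \<partial>lborel) + (\<integral>\<^sup>+v. indicator A (?t j v) * ennreal (max 0 (- ?h j v)) \<partial>lborel)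
        = (\<integral>\<^sup>+v. indicator A (?t j v) * ennreal \<bar>?h j v\<bar> \<partial>lborel)" if j: "j \<in> J" for j
      proof -
        have im: "(\<lambda>v. indicator A (?t j v) :: ennreal) \<in> borel_measurable lborel"
          using measurable_compose[OF t[OF j] borel_measurable_indicator[OF A]] by simp
        have m1: "(\<lambda>v. ennreal (max 0 (?h j v))) \<in> borel_measurable lborel" "(\<lambda>v. ennreal (max 0 (- ?h j v))) \<in> borel_measurable lborel"
          using hm[OF j] by measurable
        have "(\<integral>\<^sup>+v. indicator A (?t j v) * ennreal (max 0 (?h j v)) \<partial>lborel) + (\<integral>\<^sup>+v. indicator A (?t j v) * ennreal (max 0 (- ?h j v)) \<partial>lborel)
          = (\<integral>\<^sup>+v. indicator A (?t j v) * ennreal (max 0 (?h j v)) + indicator A (?t j v) * ennreal (max 0 (- ?h j v)) \<partial>lborel)"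
          by (rule nn_integral_add[symmetric]; rule borel_measurable_times_ennreal[OF im]; rule m1)
        also have "\<dots> = (\<integral>\<^sup>+v. indicator A (?t j v) * ennreal \<bar>?h j v\<bar> \<partial>lborel)"
          by (intro nn_integral_cong) (auto simp: distrib_left[symmetric] ennreal_plus[symmetric] max_def simp del: ennreal_plus)
        finally show ?thesis .
      qed
      then show ?thesis unfolding P(3)[rule_format, OF A] N(3)[rule_format, OF A] sum.distrib[symmetric] by (simp add: split_beta)
    qed
  qed
qed

definition u where "u c x = (\<Sum>l<m. c l * indicator (\<Omega> l) x)" for c :: "nat \<Rightarrow> real" and x

lemma \<Omega>_measurable: "l < m \<Longrightarrow> \<Omega> l \<in> sets borel"
proof -
  assume l: "l < m"
  have "\<Omega> l = pbox \<inter> pext (\<Omega> l)"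
  proof
    show "\<Omega> l \<subseteq> pbox \<inter> pext (\<Omega> l)"
      using \<Omega>_sub[OF l] int_lattice_0 by (force simp: mem_pext intro: bexI[of _ 0])
    show "pbox \<inter> pext (\<Omega> l) \<subseteq> \<Omega> l"
    proof
      fix x assume x: "x \<in> pbox \<inter> pext (\<Omega> l)"
      then obtain k where k: "k \<in> int_lattice" "x + 2 *\<^sub>R k \<in> \<Omega> l" by (auto simp: mem_pext)
      then have "x + 2 *\<^sub>R k \<in> pbox" using \<Omega>_sub[OF l] by auto
      then have "x \<in> cell (- One) 2 (- k)" "x \<in> cell (- One) 2 0" using x by (auto simp: mem_cell_pbox)
      moreover obtain k0 where "\<And>j. j \<in> int_lattice \<Longrightarrow> x \<in> cell (- One) 2 j \<Longrightarrow> j = k0"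
        using cell_unique[of 2 x "- One"] by auto
      ultimately have "- k = 0" using int_lattice_uminus[OF k(1)] int_lattice_0 by metis
      then show "x \<in> \<Omega> l" using k by simp
    qed
  qed
  moreover have "pbox \<inter> pext (\<Omega> l) \<in> sets borel" using \<Omega>_open[OF l] by (intro sets.Int) auto
  ultimately show ?thesis by simp
qed

lemma gradient_Nu: "gradient_measure (u c) (Nu c)"
  unfolding gradient_measure_def
proof (intro conjI ballI)
  have \<Omega>i: "integrable lborel (\<lambda>x. indicator pbox x * (indicator (\<Omega> l) x * (1::real)))" if "l < m" for l
    by (rule integrable_pbox) (use \<Omega>_measurable[OF that] in auto)
  have "integrable lborel (\<lambda>x. \<Sum>l<m. c l * (indicator pbox x * (indicator (\<Omega> l) x * (1::real))))"
    using \<Omega>i by (intro Bochner_Integration.integrable_sum integrable_mult_right) auto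
  also have "(\<lambda>x. \<Sum>l<m. c l * (indicator pbox x * (indicator (\<Omega> l) x * (1::real)))) = (\<lambda>x. indicator pbox x *\<^sub>R u c x)"
  proof
    fix x :: "real^2"
    show "(\<Sum>l<m. c l * (indicator pbox x * (indicator (\<Omega> l) x * (1::real)))) = indicator pbox x *\<^sub>R u c x"
      by (cases "x \<in> pbox") (simp_all add: u_def)
  qed
  finally show "set_integrable lborel pbox (u c)" by (simp add: set_integrable_def)
  fix b :: "real^2" assume b: "b \<in> Basis"
  obtain P N where PN: "finite_measure P" "finite_measure N" "sets P = sets torus_borel" "sets N = sets torus_borel"
    "\<And>A. A \<in> sets torus_borel \<Longrightarrow> Nu c A \<bullet> b = measure P A - measure N A"
    "\<And>\<phi> B. \<phi> \<in> borel_measurable torus_borel \<Longrightarrow> (\<And>x. \<bar>\<phi> x\<bar> \<le> B) \<Longrightarrow>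
       (\<integral>x. \<phi> x \<partial>P) - (\<integral>x. \<phi> x \<partial>N) = (\<Sum>(l, p)\<in>J. \<integral>v. \<phi> (wrap (\<gamma> l p v)) * (c l * h l p b v) \<partial>lborel)"
    by (rule component_measures[OF b, of c]) blast
  have "(LINT x:pbox|lborel. u c x * frechet_derivative \<phi> (at x) b) = - ((LINT x|P. \<phi> x) - (LINT x|N. \<phi> x))"
    if \<phi>: "smooth \<phi>" "periodic \<phi>" for \<phi>
  proof -
    have "Ck 1 \<phi>" using \<phi> by (simp only: smooth_def)
    then have C: "C1_with \<phi> (\<lambda>x. frechet_derivative \<phi> (at x))" by (rule Ck_1_C1_with)
    let ?d = "\<lambda>x. frechet_derivative \<phi> (at x) b"
    have cd: "continuous_on UNIV ?d" using C by (simp add: C1_with_def)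
    obtain B where B: "\<And>x. \<bar>\<phi> x\<bar> \<le> B" using periodic_bounded[OF \<phi>(2) C1_with_continuous[OF C]] by blast
    have \<phi>m: "\<phi> \<in> borel_measurable torus_borel"
      by (rule measurable_torus_borel[OF borel_measurable_continuous_onI[OF C1_with_continuous[OF C]] refl])
    have "(LINT x:pbox|lborel. u c x * ?d x) = (\<integral>x. (\<Sum>l<m. c l * (indicator pbox x * (indicator (\<Omega> l) x * ?d x))) \<partial>lborel)"
      unfolding set_lebesgue_integral_def by (intro Bochner_Integration.integral_cong refl)
        (unfold u_def sum_distrib_left sum_distrib_right real_scaleR_def, intro sum.cong refl, simp only: mult_ac)
    also have "\<dots> = (\<Sum>l<m. c l * (\<integral>x. indicator pbox x * (indicator (\<Omega> l) x * ?d x) \<partial>lborel))"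
      using \<Omega>_measurable by (subst Bochner_Integration.integral_sum) (auto intro!: integrable_mult_right integrable_pbox[OF cd])
    also have "\<dots> = (\<Sum>l<m. c l * - (\<Sum>p\<in>K. \<integral>v. \<phi> (\<gamma> l p v) * h l p b v \<partial>lborel))"
      using divergence[OF _ b C \<phi>(2)] by simp
    also have "\<dots> = - (\<Sum>l<m. \<Sum>p\<in>K. \<integral>v. c l * (\<phi> (\<gamma> l p v) * h l p b v) \<partial>lborel)"
      by (simp add: sum_distrib_left sum_negf)
    also have "\<dots> = - (\<Sum>(l, p)\<in>J. \<integral>v. \<phi> (wrap (\<gamma> l p v)) * (c l * h l p b v) \<partial>lborel)"
      by (subst sum.cartesian_product) (simp add: wrap_periodic[OF \<phi>(2)] mult_ac)
    finally show ?thesis using PN(6)[OF \<phi>m B] by simp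
  qed
  then show "\<exists>P N. finite_measure P \<and> finite_measure N \<and> sets P = sets torus_borel \<and> sets N = sets torus_borel \<and>
      (\<forall>A\<in>sets torus_borel. Nu c A \<bullet> b = measure P A - measure N A) \<and>
      (\<forall>\<phi>. smooth \<phi> \<and> periodic \<phi> \<longrightarrow>
         (LINT x:pbox|lborel. u c x * frechet_derivative \<phi> (at x) b) = - ((LINT x|P. \<phi> x) - (LINT x|N. \<phi> x)))"
    using PN(1-5) by (intro exI[of _ P] exI[of _ N]) auto
qed

text \<open>All densities are bounded and live in the chart balls, so the total variation is at most
  a constant times the length of the parameter sets. The factor 2 in the constant counts the
  coordinates.\<close>

lemma Nu_vector_measure:
  obtains P N C where "vector_measure (Nu c) P N" "0 \<le> C"
    "\<forall>A\<in>sets torus_borel. emeasure (total_variation (Nu c)) A \<le> ennreal C * (\<Sum>(l, p)\<in>J. emeasure lborel (hits l p A))"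
proof -
  obtain G where G: "G \<ge> 1" "\<And>l p b v. l < m \<Longrightarrow> p \<in> K \<Longrightarrow> b \<in> Basis \<Longrightarrow> \<bar>h l p b v\<bar> \<le> G * indicator (ball p (rr p)) (\<gamma> l p v)"
    using h_bound by blast
  define E where "E = (\<Sum>l<m. \<bar>c l\<bar>) * G"
  have E: "0 \<le> E" using G(1) by (simp add: E_def sum_nonneg)
  define R where "R b P N \<longleftrightarrow> finite_measure P \<and> finite_measure N \<and> sets P = sets torus_borel \<and> sets N = sets torus_borel \<and>
      (\<forall>A\<in>sets torus_borel. Nu c A \<bullet> b = measure P A - measure N A) \<and>
      (\<forall>A\<in>sets torus_borel. emeasure P A + emeasure N A = (\<Sum>(l, p)\<in>J. \<integral>\<^sup>+v. indicator A (wrap (\<gamma> l p v)) * ennreal \<bar>c l * h l p b v\<bar> \<partial>lborel))"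
    for b P N
  have "\<exists>P N. R b P N" if "b \<in> Basis" for b
    unfolding R_def by (rule component_measures[OF that, of c]) blast
  then obtain P N where PN0: "\<And>b. b \<in> Basis \<Longrightarrow> R b (P b) (N b)" by metis
  note PN = PN0[unfolded R_def]
  have vm: "vector_measure (Nu c) P N" using PN by (simp add: vector_measure_def)
  have "emeasure (total_variation (Nu c)) A \<le> ennreal (2 * E) * (\<Sum>(l, p)\<in>J. emeasure lborel (hits l p A))"
    if A: "A \<in> sets torus_borel" for A
  proof -
    have one: "(\<integral>\<^sup>+v. indicator A (wrap (\<gamma> l p v)) * ennreal \<bar>c l * h l p b v\<bar> \<partial>lborel) \<le> ennreal E * emeasure lborel (hits l p A)"
      if l: "l < m" and p: "p \<in> K" and b: "b \<in> Basis" for l p b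
    proof -
      have "(\<integral>\<^sup>+v. indicator A (wrap (\<gamma> l p v)) * ennreal \<bar>c l * h l p b v\<bar> \<partial>lborel) \<le> (\<integral>\<^sup>+v. ennreal E * indicator (hits l p A) v \<partial>lborel)"
      proof (rule nn_integral_mono)
        fix v
        show "indicator A (wrap (\<gamma> l p v)) * ennreal \<bar>c l * h l p b v\<bar> \<le> ennreal E * indicator (hits l p A) v"
        proof (cases "v \<in> hits l p A")
          case True
          have "\<bar>c l\<bar> \<le> (\<Sum>l<m. \<bar>c l\<bar>)" using l by (intro member_le_sum) auto
          moreover have "\<bar>h l p b v\<bar> \<le> G" using G(2)[OF l p b, of v] True by (simp add: hits_def)
          ultimately have "\<bar>c l * h l p b v\<bar> \<le> E" unfolding E_def abs_mult using G(1) by (intro mult_mono) auto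
          then show ?thesis using True by (simp add: hits_def ennreal_leI)
        next
          case False
          then have "wrap (\<gamma> l p v) \<notin> A \<or> h l p b v = 0" using G(2)[OF l p b, of v] by (auto simp: hits_def)
          then show ?thesis by auto
        qed
      qed
      also have "\<dots> = ennreal E * emeasure lborel (hits l p A)"
        using hits_measurable[OF l A] by (subst nn_integral_cmult_indicator) auto
      finally show ?thesis .
    qed
    have "emeasure (total_variation (Nu c)) A \<le> (\<Sum>b\<in>Basis. emeasure (P b) A + emeasure (N b) A)"
      by (rule total_variation_le[OF vm A])
    also have "\<dots> = (\<Sum>b\<in>Basis. \<Sum>(l, p)\<in>J. \<integral>\<^sup>+v. indicator A (wrap (\<gamma> l p v)) * ennreal \<bar>c l * h l p b v\<bar> \<partial>lborel)"
      using PN A by (intro sum.cong) auto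
    also have "\<dots> \<le> (\<Sum>b\<in>(Basis :: (real^2) set). \<Sum>(l, p)\<in>J. ennreal E * emeasure lborel (hits l p A))"
      by (intro sum_mono) (auto intro: one)
    also have "\<dots> = 2 * (ennreal E * (\<Sum>(l, p)\<in>J. emeasure lborel (hits l p A)))"
      by (simp add: sum_distrib_left split_beta)
    also have "\<dots> = ennreal (2 * E) * (\<Sum>(l, p)\<in>J. emeasure lborel (hits l p A))"
      using E by (simp add: ennreal_mult mult.assoc)
    finally show ?thesis .
  qed
  then have "\<forall>A\<in>sets torus_borel. emeasure (total_variation (Nu c)) A \<le> ennreal (2 * E) * (\<Sum>(l, p)\<in>J. emeasure lborel (hits l p A))" ..
  then show thesis using E by (intro that[OF vm, of "2 * E"]) auto
qed

definition "\<Gamma> = (\<Union>l<m. \<Gamma>i l)"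

lemma hits_frontier:
  assumes l: "l < m" and v: "v \<in> hits l p A"
  shows "wrap (\<gamma> l p v) \<in> A \<inter> \<Gamma>i l"
  using v \<gamma>_frontier[OF l] wrap_frontier by (auto simp: hits_def)

lemma closed_\<Gamma>: "closed \<Gamma>" unfolding \<Gamma>_def by (intro closed_UN) auto

lemma \<Gamma>_shift: "x \<in> \<Gamma> \<Longrightarrow> k \<in> int_lattice \<Longrightarrow> x + 2 *\<^sub>R k \<in> \<Gamma>"
  unfolding \<Gamma>_def by (auto simp: frontier_pext)

lemma total_variation_supp: "emeasure (total_variation (Nu c)) (pbox - \<Gamma>) = 0"
proof -
  have A: "pbox - \<Gamma> \<in> sets torus_borel" using closed_\<Gamma> by (auto simp: sets_torus_borel)
  obtain P N C where C: "vector_measure (Nu c) P N" "0 \<le> C"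
    "\<forall>A\<in>sets torus_borel. emeasure (total_variation (Nu c)) A \<le> ennreal C * (\<Sum>(l, p)\<in>J. emeasure lborel (hits l p A))"
    by (rule Nu_vector_measure[of c])
  have "hits l p (pbox - \<Gamma>) = {}" if "l < m" for l p
    using hits_frontier[OF that] that unfolding \<Gamma>_def by blast
  then have "(\<Sum>(l, p)\<in>J. emeasure lborel (hits l p (pbox - \<Gamma>))) = 0" by (intro sum.neutral) auto
  then show ?thesis using C(3)[rule_format, OF A] by simp
qed

text \<open>The parameter is a coordinate of the curve point, so it lies within r of a period
  translate of the corresponding coordinate of z. The parameters of one chart spread over less than
  1, which leaves at most three translates, each with an interval of length 2 r.\<close>

lemma hits_ball_small:
  assumes r: "0 < r" "r \<le> 1" and l: "l < m"
  shows "emeasure lborel (hits l p (pbox \<inter> pext (ball z r))) \<le> ennreal (6 * r)"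
proof (cases "hits l p (pbox \<inter> pext (ball z r)) = {}")
  case False
  let ?j = "jj p"
  have near: "\<exists>n::int. \<bar>v + 2 * of_int n - z $ ?j\<bar> < r \<and> \<bar>v - p $ ?j\<bar> < 1/2" if v: "v \<in> hits l p (pbox \<inter> pext (ball z r))" for v
  proof -
    have "\<gamma> l p v \<in> pext (ball z r)" using v by (simp add: hits_def wrap_pext)
    then obtain k where k: "k \<in> int_lattice" "\<gamma> l p v + 2 *\<^sub>R k \<in> ball z r" by (auto simp: mem_pext)
    have "k $ ?j \<in> \<int>"
    proof -
      have "axis ?j 1 \<in> (Basis :: (real^2) set)" by (simp add: axis_in_Basis_iff)
      then have "k \<bullet> axis ?j 1 \<in> \<int>" using k(1) by (auto simp: int_lattice_def)
      then show ?thesis by (simp add: inner_axis)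
    qed
    then obtain n :: int where n: "k $ ?j = of_int n" by (auto elim: Ints_cases)
    have "\<bar>(\<gamma> l p v + 2 *\<^sub>R k - z) $ ?j\<bar> < r"
      using component_le_norm_cart[of "\<gamma> l p v + 2 *\<^sub>R k - z" ?j] k(2) by (simp add: dist_norm norm_minus_commute)
    then have "\<bar>v + 2 * of_int n - z $ ?j\<bar> < r" by (simp add: \<gamma>_nth n)
    moreover have "\<bar>v - p $ ?j\<bar> < 1/2" using \<gamma>_ball[of l p v "rr p"] v rr(2)[of p] by (auto simp: hits_def)
    ultimately show ?thesis by blast
  qed
  obtain v0 where v0: "v0 \<in> hits l p (pbox \<inter> pext (ball z r))" using False by blast
  obtain n0 :: int where n0: "\<bar>v0 + 2 * of_int n0 - z $ ?j\<bar> < r" "\<bar>v0 - p $ ?j\<bar> < 1/2" using near[OF v0] by blast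
  define I where "I n = {z $ ?j - 2 * of_int n - r<..<z $ ?j - 2 * of_int n + r}" for n :: int
  have "hits l p (pbox \<inter> pext (ball z r)) \<subseteq> (\<Union>n\<in>{n0 - 1, n0, n0 + 1}. I n)"
  proof
    fix v assume "v \<in> hits l p (pbox \<inter> pext (ball z r))"
    then obtain n :: int where n: "\<bar>v + 2 * of_int n - z $ ?j\<bar> < r" "\<bar>v - p $ ?j\<bar> < 1/2" using near by blast
    have "\<bar>v - v0\<bar> < 1" using n(2) n0(2) by linarith
    then have "\<bar>2 * real_of_int n - 2 * of_int n0\<bar> < 3" using n(1) n0(1) r by linarith
    then have "n \<in> {n0 - 1, n0, n0 + 1}" by auto
    moreover have "v \<in> I n" using n(1) by (simp add: I_def abs_less_iff)
    ultimately show "v \<in> (\<Union>n\<in>{n0 - 1, n0, n0 + 1}. I n)" by blast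
  qed
  then have "emeasure lborel (hits l p (pbox \<inter> pext (ball z r))) \<le> emeasure lborel (\<Union>n\<in>{n0 - 1, n0, n0 + 1}. I n)"
    by (intro emeasure_mono) (auto simp: I_def)
  also have "\<dots> \<le> (\<Sum>n\<in>{n0 - 1, n0, n0 + 1}. emeasure lborel (I n))"
    by (rule emeasure_subadditive_finite) (auto simp: I_def)
  also have "\<dots> = (\<Sum>n\<in>{n0 - 1, n0, n0 + 1}. ennreal (2 * r))"
    using r by (intro sum.cong) (auto simp: I_def)
  also have "\<dots> = ennreal (6 * r)"
    using r by (simp add: ennreal_mult ennreal_plus[symmetric] del: ennreal_plus)
  finally show ?thesis .
qed simp

lemma total_variation_upper:
  obtains C where "0 \<le> C"
    "\<And>z r. 0 < r \<Longrightarrow> r \<le> 1 \<Longrightarrow> emeasure (total_variation (Nu c)) (pbox \<inter> pext (ball z r)) \<le> ennreal (C * r)"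
proof -
  obtain P N C where C: "vector_measure (Nu c) P N" "0 \<le> C"
    "\<forall>A\<in>sets torus_borel. emeasure (total_variation (Nu c)) A \<le> ennreal C * (\<Sum>(l, p)\<in>J. emeasure lborel (hits l p A))"
    by (rule Nu_vector_measure[of c])
  show thesis
  proof (rule that[of "C * (6 * real (card J))"])
    show "0 \<le> C * (6 * real (card J))" using C(2) by simp
    fix z :: "real^2" and r :: real assume r: "0 < r" "r \<le> 1"
    have A: "pbox \<inter> pext (ball z r) \<in> sets torus_borel" by (simp add: sets_torus_borel)
    have "(\<Sum>(l, p)\<in>J. emeasure lborel (hits l p (pbox \<inter> pext (ball z r)))) \<le> (\<Sum>(l, p)\<in>J. ennreal (6 * r))"
      using hits_ball_small[OF r] by (intro sum_mono) auto
    also have "\<dots> = ennreal (real (card J) * (6 * r))"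
      using r by (simp add: split_beta ennreal_mult ennreal_of_nat_eq_real_of_nat)
    finally have "emeasure (total_variation (Nu c)) (pbox \<inter> pext (ball z r)) \<le> ennreal C * ennreal (real (card J) * (6 * r))"
      by (intro order_trans[OF C(3)[rule_format, OF A]] mult_left_mono) auto
    also have "\<dots> = ennreal (C * (6 * real (card J)) * r)" using C(2) r by (simp add: ennreal_mult[symmetric] mult_ac)
    finally show "emeasure (total_variation (Nu c)) (pbox \<inter> pext (ball z r)) \<le> ennreal (C * (6 * real (card J)) * r)" .
  qed
qed

end

lemma inner_normal_pext:
  assumes k: "k \<in> int_lattice"
  shows "inner_normal (pext S) (x + 2 *\<^sub>R k) N \<longleftrightarrow> inner_normal (pext S) x N"
proof -
  have "x + 2 *\<^sub>R k + t *\<^sub>R w = (x + t *\<^sub>R w) + 2 *\<^sub>R k" for t w by (simp add: add_ac)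
  then show ?thesis unfolding inner_normal_def by (simp only: pext_shift[OF k])
qed

section \<open>Cancellation between domains and the lower bound near boundary points\<close>

context smooth_domains
begin

text \<open>The b-component of the gradient of the single characteristic function of the l-th
  domain, evaluated on A; \<open>Nu\<close> is the combination of these with the coefficients
  c.\<close>

definition V where "V l A b = (\<Sum>p\<in>K. \<integral>v. indicator A (wrap (\<gamma> l p v)) * h l p b v \<partial>lborel)"

definition \<delta> :: "nat \<Rightarrow> nat \<Rightarrow> real" where "\<delta> l = (\<lambda>l'. if l' = l then 1 else 0)"

lemma Nu_V: "b \<in> Basis \<Longrightarrow> Nu c A \<bullet> b = (\<Sum>l<m. c l * V l A b)"
  unfolding Nu_inner V_def sum_distrib_left sum.cartesian_product by (simp add: mult_ac)

lemma Nu_\<delta>: "l < m \<Longrightarrow> b \<in> Basis \<Longrightarrow> Nu (\<delta> l) A \<bullet> b = V l A b"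
  by (simp add: Nu_V \<delta>_def if_distrib[where f="\<lambda>x. x * _"] cong: if_cong)

lemma gradient_Nu_\<delta>: "l < m \<Longrightarrow> gradient_measure (indicator (\<Omega> l)) (Nu (\<delta> l))"
proof -
  assume "l < m"
  then have "u (\<delta> l) = indicator (\<Omega> l)"
    by (intro ext) (simp add: u_def \<delta>_def if_distrib[where f="\<lambda>x. x * _"] cong: if_cong)
  then show ?thesis using gradient_Nu[of "\<delta> l"] by simp
qed

lemma card_K: "0 < card K"
  using \<theta>_sum[of 0] K by (auto simp: card_gt_0_iff)

text \<open>The weights sum to 1, so one of them is at least the average. It supplies a chart in
  which the weight is bounded below by a constant that does not depend on x.\<close>

lemma large_weight:
  obtains p k where "p \<in> K" "k \<in> int_lattice" "x + 2 *\<^sub>R k \<in> ball p (rr p / 2)" "1 / card K \<le> \<theta> p x"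
proof -
  have "\<exists>p\<in>K. 1 / card K \<le> \<theta> p x"
  proof (rule ccontr)
    assume "\<not> (\<exists>p\<in>K. 1 / card K \<le> \<theta> p x)"
    then have "(\<Sum>p\<in>K. \<theta> p x) < (\<Sum>p\<in>K. 1 / card K)" using K card_K by (intro sum_strict_mono) auto
    then show False using \<theta>_sum[of x] card_K by simp
  qed
  then obtain p where p: "p \<in> K" "1 / card K \<le> \<theta> p x" by blast
  then have "\<theta> p x \<noteq> 0" using card_K by auto
  from \<theta>_supp[OF p(1) this] show thesis using that p by (auto simp: mem_pext)
qed

lemma frontier_normal:
  assumes l: "l < m" and x: "x \<in> \<Gamma>i l"
  obtains N where "inner_normal (pext (\<Omega> l)) x N"
proof -
  obtain p k where p: "p \<in> K" "k \<in> int_lattice" "x + 2 *\<^sub>R k \<in> ball p (rr p / 2)" by (rule large_weight)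
  have b: "x + 2 *\<^sub>R k \<in> ball p (rr p)" using p(3) rr(1)[of p] by simp
  have g: "\<gamma> l p ((x + 2 *\<^sub>R k) $ jj p) = x + 2 *\<^sub>R k" by (rule frontier_\<gamma>[OF l b]) (simp add: frontier_pext[OF p(2)] x)
  have "inner_normal (pext (\<Omega> l)) (x + 2 *\<^sub>R k) (nrm l p ((x + 2 *\<^sub>R k) $ jj p))"
    using \<gamma>_normal[OF l, of p "(x + 2 *\<^sub>R k) $ jj p"] b unfolding g by blast
  then show thesis using that by (simp only: inner_normal_pext[OF p(2)])
qed

text \<open>Three normals cannot be pairwise opposite.\<close>

lemma no_triple_points:
  assumes l: "l0 < m" "l1 < m" "l2 < m" "l0 \<noteq> l1" "l0 \<noteq> l2" "l1 \<noteq> l2" and x: "x \<in> \<Gamma>i l0" "x \<in> \<Gamma>i l1" "x \<in> \<Gamma>i l2"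
  shows False
proof -
  obtain N0 where N0: "inner_normal (pext (\<Omega> l0)) x N0" using frontier_normal[OF l(1) x(1)] by blast
  obtain N1 where N1: "inner_normal (pext (\<Omega> l1)) x N1" using frontier_normal[OF l(2) x(2)] by blast
  obtain N2 where N2: "inner_normal (pext (\<Omega> l2)) x N2" using frontier_normal[OF l(3) x(3)] by blast
  obtain a where a: "a > 0" "N1 = - a *\<^sub>R N0" using inner_normal_disjoint[OF N0 N1 \<Omega>_disj] l by auto
  obtain b where b: "b > 0" "N2 = - b *\<^sub>R N0" using inner_normal_disjoint[OF N0 N2 \<Omega>_disj] l by auto
  obtain c where c: "c > 0" "N2 = - c *\<^sub>R N1" using inner_normal_disjoint[OF N1 N2 \<Omega>_disj] l by auto
  have "(c * a + b) *\<^sub>R N0 = 0" using a b c by (simp add: scaleR_left_distrib)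
  moreover have "N0 \<noteq> 0" using N0 by (simp add: inner_normal_def)
  ultimately have "c * a + b = 0" by simp
  then show False using a b c by (smt (verit) mult_pos_pos)
qed

text \<open>Both boundaries are graphs over the same axis, so at a common point they have the same
  parameter. The normals are opposite and their components along axis \<open>ii p\<close> are 1 or
  -1, so the factor between them is exactly -1 and the densities cancel without a rescaling.\<close>

lemma coincide:
  assumes l: "l < m" "l' < m" "l \<noteq> l'" and v: "\<gamma> l p v \<in> ball p (rr p)" "\<gamma> l p v \<in> \<Gamma>i l'"
  shows "\<gamma> l' p v = \<gamma> l p v" "h l' p b v = - h l p b v"
proof -
  show g: "\<gamma> l' p v = \<gamma> l p v" using frontier_\<gamma>[OF l(2) v] by (simp add: \<gamma>_nth)
  have n: "inner_normal (pext (\<Omega> l)) (\<gamma> l p v) (nrm l p v)" by (rule \<gamma>_normal[OF l(1) v(1)])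
  have n': "inner_normal (pext (\<Omega> l')) (\<gamma> l p v) (nrm l' p v)" using \<gamma>_normal[OF l(2), of p v] v g by simp
  obtain a where a: "a > 0" "nrm l' p v = - a *\<^sub>R nrm l p v" using inner_normal_disjoint[OF n n' \<Omega>_disj] l by blast
  have "ss l' p = - a * ss l p" using arg_cong[OF a(2), of "\<lambda>x. x \<bullet> axis (ii p) 1"] by (simp add: nrm_inner)
  then have "a = 1" using chartD(1)[OF l(1), of p] chartD(1)[OF l(2), of p] a(1) by auto
  then show "h l' p b v = - h l p b v" using a(2) g by (simp add: h_def w_def)
qed

lemma V_off: 
  assumes l: "l < m" and A: "A \<inter> \<Gamma>i l = {}"
  shows "V l A b = 0"
proof -
  have z: "indicator A (wrap (\<gamma> l p v)) * h l p b v = 0" for p v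
    using A \<gamma>_frontier[OF l, of p v] wrap_frontier[of "\<gamma> l p v" "\<Omega> l"] w_nonzero[of l p v] by (auto simp: indicator_def h_def)
  show ?thesis unfolding V_def z by simp
qed

text \<open>By \<open>coincide\<close> the integrands are opposite for each chart and each
  parameter, not merely after integration.\<close>

lemma V_opposite:
  assumes l: "l < m" "l' < m" "l \<noteq> l'" and A: "A \<subseteq> \<Gamma>i l \<inter> \<Gamma>i l'"
  shows "V l' A b = - V l A b"
proof -
  have e: "indicator A (wrap (\<gamma> l' p v)) * h l' p b v = - (indicator A (wrap (\<gamma> l p v)) * h l p b v)" for p v
  proof -
    have *: "\<gamma> k p v \<in> ball p (rr p)" "\<gamma> k p v \<in> \<Gamma>i l" "\<gamma> k p v \<in> \<Gamma>i l'" if "indicator A (wrap (\<gamma> k p v)) * h k p b v \<noteq> 0" for k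
      using that A w_nonzero[of k p v] wrap_frontier[of "\<gamma> k p v"] by (auto simp: h_def indicator_def split: if_splits)
    consider "indicator A (wrap (\<gamma> l p v)) * h l p b v \<noteq> 0" | "indicator A (wrap (\<gamma> l' p v)) * h l' p b v \<noteq> 0"
      | (none) "indicator A (wrap (\<gamma> l' p v)) * h l' p b v = 0" "indicator A (wrap (\<gamma> l p v)) * h l p b v = 0" by blast
    then show ?thesis
    proof cases
      case 1
      show ?thesis using coincide(1)[OF l *(1)[OF 1] *(3)[OF 1]] coincide(2)[OF l *(1)[OF 1] *(3)[OF 1], of b] by simp
    next
      case 2
      show ?thesis using coincide(1)[OF l(2,1) l(3)[symmetric] *(1)[OF 2] *(2)[OF 2]] coincide(2)[OF l(2,1) l(3)[symmetric] *(1)[OF 2] *(2)[OF 2], of b] by simp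
    next
      case none
      show ?thesis unfolding none by simp
    qed
  qed
  show ?thesis unfolding V_def e by (simp add: sum_negf)
qed

lemma V_sum:
  assumes l: "l < m" and b: "b \<in> Basis" and I: "finite I" and A: "\<And>i. i \<in> I \<Longrightarrow> A i \<in> sets torus_borel" "disjoint_family_on A I"
  shows "V l (\<Union>i\<in>I. A i) b = (\<Sum>i\<in>I. V l (A i) b)"
proof -
  have int: "integrable lborel (\<lambda>v. indicator (A i) (wrap (\<gamma> l p v)) * h l p b v)" if "i \<in> I" "p \<in> K" for i p
    using integrable_hits[OF l that(2) b A(1)[OF that(1)], of "\<lambda>_. 1"] by simp
  have "(\<integral>v. indicator (\<Union>i\<in>I. A i) (wrap (\<gamma> l p v)) * h l p b v \<partial>lborel) = (\<Sum>i\<in>I. \<integral>v. indicator (A i) (wrap (\<gamma> l p v)) * h l p b v \<partial>lborel)"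
    if p: "p \<in> K" for p
  proof -
    have "(\<integral>v. indicator (\<Union>i\<in>I. A i) (wrap (\<gamma> l p v)) * h l p b v \<partial>lborel) = (\<integral>v. (\<Sum>i\<in>I. indicator (A i) (wrap (\<gamma> l p v)) * h l p b v) \<partial>lborel)"
      by (intro Bochner_Integration.integral_cong refl) (simp add: indicator_UN_disjoint[OF I A(2)] sum_distrib_right)
    also have "\<dots> = (\<Sum>i\<in>I. \<integral>v. indicator (A i) (wrap (\<gamma> l p v)) * h l p b v \<partial>lborel)"
      by (rule Bochner_Integration.integral_sum) (rule int[OF _ p])
    finally show ?thesis .
  qed
  then show ?thesis unfolding V_def by (subst sum.swap) (rule sum.cong[OF refl])
qed

text \<open>Uniform continuity on compact balls for the finitely many weights; the filter at 0 from
  the right collects the finitely many smallness conditions on d.\<close>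

lemma uniform_radius:
  assumes e: "e > 0"
  obtains d where "d > 0" "\<And>p. p \<in> K \<Longrightarrow> d \<le> rr p / 2"
    "\<And>p x y. p \<in> K \<Longrightarrow> x \<in> ball p 1 \<Longrightarrow> y \<in> ball p 1 \<Longrightarrow> dist x y < d \<Longrightarrow> \<bar>\<theta> p x - \<theta> p y\<bar> < e"
proof -
  have one: "eventually (\<lambda>d. d \<le> rr p / 2 \<and> (\<forall>x\<in>ball p 1. \<forall>y\<in>ball p 1. dist x y < d \<longrightarrow> \<bar>\<theta> p x - \<theta> p y\<bar> < e)) (at_right 0)"
    if p: "p \<in> K" for p
  proof -
    have "uniformly_continuous_on (cball p 1) (\<theta> p)"
      by (intro compact_uniformly_continuous continuous_on_subset[OF C1_with_continuous[OF \<theta>_C1[OF p]]]) auto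
    then obtain d where d: "d > 0" "\<And>x y. x \<in> cball p 1 \<Longrightarrow> y \<in> cball p 1 \<Longrightarrow> dist y x < d \<Longrightarrow> dist (\<theta> p y) (\<theta> p x) < e"
      using e unfolding uniformly_continuous_on_def by metis
    have "eventually (\<lambda>d'. d' < min d (rr p / 2)) (at_right 0)"
      using d(1) rr(1)[of p] by (intro eventually_at_rightI[of 0 "min d (rr p / 2)"]) auto
    then show ?thesis
    proof eventually_elim
      case (elim d')
      then show ?case using d(2) by (auto simp: dist_real_def dist_commute)
    qed
  qed
  have "eventually (\<lambda>d. 0 < d \<and> (\<forall>p\<in>K. d \<le> rr p / 2 \<and> (\<forall>x\<in>ball p 1. \<forall>y\<in>ball p 1. dist x y < d \<longrightarrow> \<bar>\<theta> p x - \<theta> p y\<bar> < e))) (at_right (0::real))"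
    by (intro eventually_conj eventually_at_right_less eventually_ball_finite K ballI one)
  then have "\<exists>d::real. 0 < d \<and> (\<forall>p\<in>K. d \<le> rr p / 2 \<and> (\<forall>x\<in>ball p 1. \<forall>y\<in>ball p 1. dist x y < d \<longrightarrow> \<bar>\<theta> p x - \<theta> p y\<bar> < e))"
    by (rule eventually_happens'[rotated]) simp
  then show thesis using that by blast
qed

text \<open>Near a boundary point \<open>q\<close> all charts see the same side of the curve, so there is no
  cancellation between them in the direction of the \<open>ii p\<close> axis.\<close>

lemma hit_sign:
  assumes l: "l < m" and q: "q \<in> ball p (rr p / 2)" "r \<le> rr p / 2" and A: "A \<subseteq> pext (ball q r)" and p': "p' \<in> K"
  shows "0 \<le> ss l p * (indicator A (wrap (\<gamma> l p' v)) * h l p' (axis (ii p) 1) v)"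
proof (cases "wrap (\<gamma> l p' v) \<in> A \<and> \<gamma> l p' v \<in> ball p' (rr p')")
  case False
  then have z: "indicator A (wrap (\<gamma> l p' v)) * h l p' (axis (ii p) 1) v = 0"
    using w_nonzero[of l p' v] by (cases "w l p' v = 0") (auto simp: h_def)
  show ?thesis unfolding z by simp
next
  case True
  then have "\<gamma> l p' v \<in> pext (ball q r)" using A wrap_pext by blast
  then obtain k where k: "k \<in> int_lattice" "\<gamma> l p' v + 2 *\<^sub>R k \<in> ball q r" by (auto simp: mem_pext)
  let ?y = "\<gamma> l p' v + 2 *\<^sub>R k"
  have y: "?y \<in> ball p (rr p)" using k(2) q by (simp, smt (verit) dist_triangle)
  have yf: "?y \<in> \<Gamma>i l" using \<gamma>_frontier[OF l] True by (simp add: frontier_pext[OF k(1)])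
  have "inner_normal (pext (\<Omega> l)) ?y (nrm l p (?y $ jj p))"
    using \<gamma>_normal[OF l, of p "?y $ jj p"] y unfolding frontier_\<gamma>[OF l y yf] by blast
  then have n: "inner_normal (pext (\<Omega> l)) (\<gamma> l p' v) (nrm l p (?y $ jj p))" by (simp only: inner_normal_pext[OF k(1)])
  obtain a where a: "a > 0" "nrm l p' v = a *\<^sub>R nrm l p (?y $ jj p)"
    using inner_normal_unique[OF n \<gamma>_normal[OF l]] True by blast
  have "ss l p * (nrm l p' v \<bullet> axis (ii p) 1) = a * (ss l p * ss l p)" by (simp add: a(2) nrm_inner)
  then have "ss l p * (nrm l p' v \<bullet> axis (ii p) 1) = a" by (simp add: ss2[OF l])
  then have "ss l p * (indicator A (wrap (\<gamma> l p' v)) * h l p' (axis (ii p) 1) v) = indicator A (wrap (\<gamma> l p' v)) * w l p' v * a"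
    by (simp add: h_def mult_ac)
  also have "\<dots> \<ge> 0" using w_bounds(1)[OF p', of l v] a(1) by (simp add: indicator_def)
  finally show ?thesis .
qed

lemma axis_Basis: "axis i 1 \<in> (Basis :: (real^2) set)"
  by (simp add: axis_in_Basis_iff)

lemma ss_V: "ss l p * V l A b = (\<Sum>p'\<in>K. \<integral>v. ss l p * (indicator A (wrap (\<gamma> l p' v)) * h l p' b v) \<partial>lborel)"
  unfolding V_def sum_distrib_left by simp

text \<open>By \<open>hit_sign\<close> every chart contributes with the same sign, so the chart p
  alone bounds the sum from below. The curve has slope at most G, hence stays in the ball for
  parameters within r/(1+G) of that of q; there the integrand is the weight itself, since
  \<open>ss l p\<close> times the i-th component of the normal is 1.\<close>

lemma V_lower:
  assumes l: "l < m" and p: "p \<in> K" and q: "q \<in> ball p (rr p / 2)" "0 < r" "r \<le> rr p / 2" "q \<in> \<Gamma>i l"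
    and \<eta>: "0 \<le> \<eta>" "\<And>y. y \<in> ball q r \<Longrightarrow> \<eta> \<le> \<theta> p y"
    and G: "1 \<le> G" "\<And>v. \<bar>v - p $ jj p\<bar> \<le> 2 \<Longrightarrow> \<bar>gd l p v\<bar> \<le> G"
  shows "\<eta> * (2 * (r / (1 + G))) \<le> ss l p * V l (pbox \<inter> pext (ball q r) \<inter> \<Gamma>i l) (axis (ii p) 1)"
proof -
  let ?A = "pbox \<inter> pext (ball q r) \<inter> \<Gamma>i l" and ?e = "axis (ii p) 1 :: real^2" and ?v = "q $ jj p" and ?\<rho> = "r / (1 + G)"
  let ?I = "{?v - ?\<rho><..<?v + ?\<rho>}"
  let ?f = "\<lambda>p' v. ss l p * (indicator ?A (wrap (\<gamma> l p' v)) * h l p' ?e v)"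
  have A: "?A \<in> sets torus_borel" by (auto simp: sets_torus_borel)
  have \<rho>: "0 < ?\<rho>" using q(2) G(1) by simp
  have \<rho>r: "?\<rho> \<le> r" using q(2) G(1) by (simp add: field_simps)
  have qb: "q \<in> ball p (rr p)" using q(1) rr(1)[of p] by simp
  have \<gamma>v: "\<gamma> l p ?v = q" by (rule frontier_\<gamma>[OF l qb q(4)])
  have vp: "\<bar>?v - p $ jj p\<bar> < 1" using \<gamma>_ball[of l p ?v "rr p"] qb rr(2)[of p] by (simp add: \<gamma>v)
  have near: "\<gamma> l p v \<in> ball q r" if v: "v \<in> ?I" for v
  proof -
    have av: "\<bar>v - ?v\<bar> < ?\<rho>" using v by (simp add: abs_less_iff)
    have "norm (gg l p v - gg l p ?v) \<le> G * norm (v - ?v)"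
    proof (rule field_differentiable_bound[where S="?I" and f'="gd l p"])
      show "(gg l p has_field_derivative gd l p z) (at z within ?I)" for z
        by (rule DERIV_subset[OF chartD(2)[OF l]]) simp
      fix z assume "z \<in> ?I"
      then have "\<bar>z - ?v\<bar> < ?\<rho>" by (simp add: abs_less_iff)
      then have "\<bar>z - p $ jj p\<bar> \<le> 2" using vp \<rho>r q(3) rr(2)[of p] by linarith
      then show "norm (gd l p z) \<le> G" using G(2) by simp
    qed (use v \<rho> in auto)
    then have "\<bar>ss l p * gg l p v - ss l p * gg l p ?v\<bar> \<le> G * \<bar>v - ?v\<bar>"
      using chartD(1)[OF l, of p] by auto
    then have d: "\<bar>(\<gamma> l p v - q) $ ii p\<bar> \<le> G * \<bar>v - ?v\<bar>" "(\<gamma> l p v - q) $ jj p = v - ?v"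
      using \<gamma>_nth[of l p v] \<gamma>_nth(1)[of l p ?v] unfolding \<gamma>v by simp_all
    have U: "UNIV = {ii p, jj p}" using two_cases[OF ij[of p]] by auto
    have "norm (\<gamma> l p v - q) \<le> (\<Sum>i\<in>UNIV. \<bar>(\<gamma> l p v - q) $ i\<bar>)" by (rule norm_le_l1_cart)
    also have "\<dots> = \<bar>(\<gamma> l p v - q) $ ii p\<bar> + \<bar>v - ?v\<bar>" unfolding U d(2)[symmetric] using ij[of p] by simp
    also have "\<dots> \<le> (1 + G) * \<bar>v - ?v\<bar>" using d(1) by (simp add: algebra_simps)
    also have "\<dots> < (1 + G) * ?\<rho>" using av G(1) by (intro mult_strict_left_mono) auto
    also have "\<dots> = r" using G(1) by simp
    finally show ?thesis by (simp add: dist_norm norm_minus_commute)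
  qed
  have "\<eta> * (2 * ?\<rho>) = (\<integral>v. \<eta> * indicator ?I v \<partial>lborel)" using \<rho> by simp
  also have "\<dots> \<le> (\<integral>v. ?f p v \<partial>lborel)"
  proof (rule integral_mono)
    show "integrable lborel (\<lambda>v. \<eta> * indicator ?I v)"
      using \<rho> by (intro integrable_mult_right integrable_real_indicator) auto
    show "integrable lborel (?f p)"
      using integrable_hits[OF l p axis_Basis A, of "\<lambda>_. 1" "ii p"] by (intro integrable_mult_right) simp
    fix v
    show "\<eta> * indicator ?I v \<le> ?f p v"
    proof (cases "v \<in> ?I")
      case True
      have b: "\<gamma> l p v \<in> ball q r" by (rule near[OF True])
      have bp: "\<gamma> l p v \<in> ball p (rr p)" using b q by (simp, smt (verit) dist_triangle)
      have "\<gamma> l p v \<in> pext (ball q r)" using b int_lattice_0 by (auto simp: mem_pext intro!: bexI[of _ 0])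
      then have "wrap (\<gamma> l p v) \<in> ?A" using \<gamma>_frontier[OF l bp] by (simp add: wrap_mem wrap_pext wrap_frontier)
      then have "?f p v = (ss l p * ss l p) * w l p v" by (simp add: h_def nrm_inner)
      also have "\<dots> = \<theta> p (\<gamma> l p v)" using bp by (simp add: ss2[OF l] w_def)
      finally show ?thesis using \<eta>(2)[OF b] True by simp
    next
      case False
      then show ?thesis using hit_sign[OF l q(1,3) _ p, of ?A v] by auto
    qed
  qed
  also have "\<dots> \<le> (\<Sum>p'\<in>K. \<integral>v. ?f p' v \<partial>lborel)"
    by (rule member_le_sum[OF p _ K, of "\<lambda>p'. \<integral>v. ?f p' v \<partial>lborel"]) (rule Bochner_Integration.integral_nonneg, rule hit_sign[OF l q(1,3)], blast, blast)
  also have "\<dots> = ss l p * V l ?A ?e" by (rule ss_V[symmetric])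
  finally show ?thesis .
qed

section \<open>Regularity of the total variation and the theorem\<close>

text \<open>A finite partition of the boundary near q according to the neighbouring domain suffices:
  on each part the gradient of the combination is a fixed jump times the gradient of a single
  domain, and the jumps take only finitely many values.\<close>

lemma total_variation_lower:
  assumes c0: "\<And>l. l < m \<Longrightarrow> c l \<noteq> 0"
    and null: "\<And>l l'. l < m \<Longrightarrow> l' < m \<Longrightarrow> l \<noteq> l' \<Longrightarrow> c l = c l' \<Longrightarrow> emeasure (total_variation (Nu (\<delta> l))) (pbox \<inter> \<Gamma>i l') = 0"
  obtains C r0 where "0 < C" "0 < r0"
    "\<And>q r. q \<in> \<Gamma> \<Longrightarrow> 0 < r \<Longrightarrow> r \<le> r0 \<Longrightarrow> ennreal (C * r) \<le> emeasure (total_variation (Nu c)) (pbox \<inter> pext (ball q r))"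
proof -
  \<comment> \<open>Half of the guaranteed weight 1/card K at q, so that the weight may drop by the
    other half within the radius d.\<close>
  let ?\<eta> = "1 / (2 * real (card K))"
  have \<eta>: "0 < ?\<eta>" using card_K by simp
  obtain d where d: "d > 0" "\<And>p. p \<in> K \<Longrightarrow> d \<le> rr p / 2"
    "\<And>p x y. p \<in> K \<Longrightarrow> x \<in> ball p 1 \<Longrightarrow> y \<in> ball p 1 \<Longrightarrow> dist x y < d \<Longrightarrow> \<bar>\<theta> p x - \<theta> p y\<bar> < ?\<eta>"
    using uniform_radius[OF \<eta>] by blast
  obtain G where G: "G \<ge> 1" "\<And>l p v. l < m \<Longrightarrow> p \<in> K \<Longrightarrow> \<bar>v - p $ jj p\<bar> \<le> 2 \<Longrightarrow> \<bar>gd l p v\<bar> \<le> G" using gd_bound by blast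
  \<comment> \<open>The sizes of all possible nonzero jumps. The additional 1 ensures that the
    minimum is taken over a nonempty set.\<close>
  define X where "X = insert 1 (((\<lambda>l. \<bar>c l\<bar>) ` {..<m} \<union> (\<lambda>(l, l'). \<bar>c l - c l'\<bar>) ` ({..<m} \<times> {..<m})) - {0})"
  define \<kappa> where "\<kappa> = Min X"
  have X: "finite X" "X \<noteq> {}" by (auto simp: X_def)
  have \<kappa>0: "0 < \<kappa>" unfolding \<kappa>_def using X by (subst Min_gr_iff) (auto simp: X_def)
  have \<kappa>_le: "\<kappa> \<le> x" if "x \<in> X" for x unfolding \<kappa>_def using X(1) that by (rule Min_le)
  obtain P N C where vm: "vector_measure (Nu c) P N" by (rule Nu_vector_measure[of c])
  let ?\<mu> = "total_variation (Nu c)"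
  show thesis
  proof (rule that[of "\<kappa> * (?\<eta> * (2 / (1 + G)))" d])
    show "0 < \<kappa> * (?\<eta> * (2 / (1 + G)))" using \<kappa>0 \<eta> G(1) by (intro mult_pos_pos divide_pos_pos) auto
    show "0 < d" by (rule d(1))
    fix q and r :: real assume q: "q \<in> \<Gamma>" and r: "0 < r" "r \<le> d"
    obtain l0 where l0: "l0 < m" "q \<in> \<Gamma>i l0" using q by (auto simp: \<Gamma>_def)
    obtain p k where p: "p \<in> K" and k: "k \<in> int_lattice" and qp: "q + 2 *\<^sub>R k \<in> ball p (rr p / 2)" and \<theta>q: "1 / card K \<le> \<theta> p q"
      by (rule large_weight)
    \<comment> \<open>The translate of q in the ball of the chart p. Balls round q and round q'
      agree modulo periods.\<close>
    define q' where "q' = q + 2 *\<^sub>R k"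
    have q': "q' \<in> ball p (rr p / 2)" "q' \<in> \<Gamma>i l0" using qp l0(2) by (simp_all add: q'_def frontier_pext[OF k])
    have \<theta>q': "2 * ?\<eta> \<le> \<theta> p q'" using \<theta>q periodic_int_lattice[OF \<theta>_per[OF p] k, of q] by (simp add: q'_def)
    have rp: "r \<le> rr p / 2" using r d(2)[OF p] by simp
    have \<theta>y: "?\<eta> \<le> \<theta> p y" if y: "y \<in> ball q' r" for y
    proof -
      have "q' \<in> ball p 1" using q'(1) rr(2)[of p] by simp
      moreover have "y \<in> ball p 1" using y q'(1) rp rr(2)[of p] by (simp, smt (verit) dist_triangle)
      ultimately have "\<bar>\<theta> p q' - \<theta> p y\<bar> < ?\<eta>" using y r by (intro d(3)[OF p]) auto
      then show ?thesis using \<theta>q' by linarith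
    qed
    have Bq: "pext (ball q' r) = pext (ball q r)"
    proof (intro set_eqI iffI)
      fix x assume "x \<in> pext (ball q' r)"
      then obtain j where j: "j \<in> int_lattice" "x + 2 *\<^sub>R j \<in> ball q' r" by (auto simp: mem_pext)
      have "x + 2 *\<^sub>R (j - k) \<in> ball q r" using j(2) by (simp add: q'_def dist_norm algebra_simps)
      then show "x \<in> pext (ball q r)" using int_lattice_diff[OF j(1) k] by (auto simp: mem_pext)
    next
      fix x assume "x \<in> pext (ball q r)"
      then obtain j where j: "j \<in> int_lattice" "x + 2 *\<^sub>R j \<in> ball q r" by (auto simp: mem_pext)
      have "x + 2 *\<^sub>R (j + k) \<in> ball q' r" using j(2) by (simp add: q'_def dist_norm algebra_simps)
      then show "x \<in> pext (ball q' r)" using int_lattice_add[OF j(1) k] by (auto simp: mem_pext)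
    qed
    let ?B = "pbox \<inter> pext (ball q' r)" and ?e = "axis (ii p) 1 :: real^2"
    have e: "?e \<in> Basis" by (rule axis_Basis)
    \<comment> \<open>The jump across the boundary is \<open>c l0\<close> on \<open>A l0\<close>, and \<open>c l0 - c l\<close> on the part \<open>A l\<close> shared with
      the \<open>l\<close>-th domain, where the normals are opposite.\<close>
    define A where "A l = (if l = l0 then ?B \<inter> \<Gamma>i l0 - (\<Union>l\<in>{..<m} - {l0}. \<Gamma>i l) else ?B \<inter> \<Gamma>i l0 \<inter> \<Gamma>i l)" for l
    have Bs: "?B \<in> sets torus_borel" by (simp add: sets_torus_borel)
    have Am: "A l \<in> sets torus_borel" for l
    proof -
      have "?B \<inter> \<Gamma>i l0 - (\<Union>l\<in>{..<m} - {l0}. \<Gamma>i l) \<in> sets borel"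
        by (intro sets.Diff sets.Int sets.finite_UN) auto
      then show ?thesis by (auto simp: A_def sets_torus_borel)
    qed
    have Adis: "disjoint_family_on A {..<m}"
      unfolding disjoint_family_on_def
    proof (intro ballI impI)
      fix l l' assume l: "l \<in> {..<m}" "l' \<in> {..<m}" "l \<noteq> l'"
      show "A l \<inter> A l' = {}"
      proof (cases "l = l0 \<or> l' = l0")
        case True
        then show ?thesis using l by (auto simp: A_def)
      next
        case False
        then show ?thesis using no_triple_points[of l0 l l'] l l0(1) by (auto simp: A_def)
      qed
    qed
    have AU: "(\<Union>l\<in>{..<m}. A l) = ?B \<inter> \<Gamma>i l0"
    proof
      show "(\<Union>l\<in>{..<m}. A l) \<subseteq> ?B \<inter> \<Gamma>i l0" by (auto simp: A_def split: if_splits)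
      show "?B \<inter> \<Gamma>i l0 \<subseteq> (\<Union>l\<in>{..<m}. A l)"
      proof
        fix x assume x: "x \<in> ?B \<inter> \<Gamma>i l0"
        show "x \<in> (\<Union>l\<in>{..<m}. A l)"
        proof (cases "\<exists>l<m. l \<noteq> l0 \<and> x \<in> \<Gamma>i l")
          case True
          then obtain l where "l < m" "l \<noteq> l0" "x \<in> \<Gamma>i l" by blast
          then show ?thesis using x by (intro UN_I[of l]) (auto simp: A_def)
        next
          case False
          then show ?thesis using x l0(1) by (intro UN_I[of l0]) (auto simp: A_def)
        qed
      qed
    qed
    \<comment> \<open>A vanishing jump is harmless: it occurs only for equal coefficients, and then
      the common boundary is null for the total variation of the gradient of the domain
      \<open>l0\<close>, so the contribution of this part is 0 as well.\<close>
    have Nu_A: "\<exists>d. (d = 0 \<or> \<bar>d\<bar> \<in> X) \<and> Nu c (A l) \<bullet> ?e = d * V l0 (A l) ?e \<and> (d = 0 \<longrightarrow> V l0 (A l) ?e = 0)" if l: "l < m" for l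
    proof (cases "l = l0")
      case True
      have "V l' (A l) ?e = 0" if "l' < m" "l' \<noteq> l0" for l'
        using that by (intro V_off) (auto simp: A_def True)
      then have "Nu c (A l) \<bullet> ?e = (\<Sum>l'\<in>{l0}. c l' * V l' (A l) ?e)"
        unfolding Nu_V[OF e] using l0(1) by (intro sum.mono_neutral_right) auto
      moreover have "\<bar>c l0\<bar> \<in> X" using l0(1) c0 by (auto simp: X_def)
      ultimately show ?thesis using c0[OF l0(1)] by (intro exI[of _ "c l0"]) simp
    next
      case False
      have sub: "A l \<subseteq> \<Gamma>i l0 \<inter> \<Gamma>i l" using False by (auto simp: A_def)
      have "V l' (A l) ?e = 0" if "l' < m" "l' \<noteq> l0" "l' \<noteq> l" for l'
        using no_triple_points[OF l0(1) l that(1)] that False sub by (intro V_off) auto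
      then have "Nu c (A l) \<bullet> ?e = (\<Sum>l'\<in>{l0, l}. c l' * V l' (A l) ?e)"
        unfolding Nu_V[OF e] using l0(1) l by (intro sum.mono_neutral_right) auto
      also have "\<dots> = (c l0 - c l) * V l0 (A l) ?e"
        using False V_opposite[OF l0(1) l _ sub, of ?e] by (simp add: algebra_simps)
      finally have 1: "Nu c (A l) \<bullet> ?e = (c l0 - c l) * V l0 (A l) ?e" .
      have 2: "c l0 - c l = 0 \<or> \<bar>c l0 - c l\<bar> \<in> X" using l0(1) l by (auto simp: X_def)
      have 3: "V l0 (A l) ?e = 0" if "c l0 - c l = 0"
      proof -
        obtain P' N' C' where vm': "vector_measure (Nu (\<delta> l0)) P' N'" by (rule Nu_vector_measure[of "\<delta> l0"])
        have s: "pbox \<inter> \<Gamma>i l \<in> sets torus_borel" by (simp add: sets_torus_borel)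
        have "ennreal (norm (Nu (\<delta> l0) (A l))) \<le> emeasure (total_variation (Nu (\<delta> l0))) (A l)"
          by (rule norm_le_total_variation[OF vm' Am])
        also have "\<dots> \<le> emeasure (total_variation (Nu (\<delta> l0))) (pbox \<inter> \<Gamma>i l)"
          using s False by (intro emeasure_mono) (auto simp: A_def sets_tv[OF vm'])
        also have "\<dots> = 0" using that False by (intro null[OF l0(1) l]) auto
        finally have "Nu (\<delta> l0) (A l) = 0" by simp
        then show ?thesis using Nu_\<delta>[OF l0(1) e, of "A l"] by simp
      qed
      show ?thesis using 1 2 3 by blast
    qed
    \<comment> \<open>Only one coordinate of the vector is kept. For a nonzero jump its size is at
      least \<kappa>; for a zero jump the left-hand side is 0.\<close>
    have piece: "\<kappa> * (ss l0 p * V l0 (A l) ?e) \<le> norm (Nu c (A l))" if l: "l < m" for l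
    proof -
      obtain t where t: "t = 0 \<or> \<bar>t\<bar> \<in> X" "Nu c (A l) \<bullet> ?e = t * V l0 (A l) ?e" "t = 0 \<longrightarrow> V l0 (A l) ?e = 0"
        using Nu_A[OF l] by blast
      have "\<kappa> * (ss l0 p * V l0 (A l) ?e) \<le> \<kappa> * \<bar>V l0 (A l) ?e\<bar>"
        using chartD(1)[OF l0(1), of p] \<kappa>0 by (intro mult_left_mono) auto
      also have "\<dots> \<le> \<bar>t\<bar> * \<bar>V l0 (A l) ?e\<bar>"
        using t(1,3) \<kappa>_le[of "\<bar>t\<bar>"] by (cases "t = 0") (auto intro: mult_right_mono)
      also have "\<dots> = \<bar>Nu c (A l) \<bullet> ?e\<bar>" by (simp add: t(2) abs_mult)
      also have "\<dots> \<le> norm (Nu c (A l))" by (rule Basis_le_norm[OF e])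
      finally show ?thesis .
    qed
    have "\<kappa> * (?\<eta> * (2 / (1 + G))) * r = \<kappa> * (?\<eta> * (2 * (r / (1 + G))))" by simp
    also have "\<dots> \<le> \<kappa> * (ss l0 p * V l0 (?B \<inter> \<Gamma>i l0) ?e)"
      using \<kappa>0 V_lower[OF l0(1) p q'(1) r(1) rp q'(2) less_imp_le[OF \<eta>] \<theta>y G(1) G(2)[OF l0(1) p]] by (intro mult_left_mono) auto
    also have "\<dots> = (\<Sum>l<m. \<kappa> * (ss l0 p * V l0 (A l) ?e))"
      unfolding AU[symmetric] by (subst V_sum[OF l0(1) e _ Am Adis]) (auto simp: sum_distrib_left)
    also have "\<dots> \<le> (\<Sum>l<m. norm (Nu c (A l)))" by (intro sum_mono piece) simp
    finally have "ennreal (\<kappa> * (?\<eta> * (2 / (1 + G))) * r) \<le> ennreal (\<Sum>l<m. norm (Nu c (A l)))" by (rule ennreal_leI)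
    also have "\<dots> = (\<Sum>l<m. ennreal (norm (Nu c (A l))))" by (rule sum_ennreal[symmetric]) simp
    also have "\<dots> \<le> (\<Sum>l<m. emeasure ?\<mu> (A l))" by (intro sum_mono norm_le_total_variation[OF vm Am])
    also have "\<dots> = emeasure ?\<mu> (\<Union>l\<in>{..<m}. A l)"
      by (rule sum_emeasure) (use Am Adis in \<open>auto simp: sets_tv[OF vm]\<close>)
    also have "\<dots> \<le> emeasure ?\<mu> ?B"
      unfolding AU using Bs by (intro emeasure_mono) (auto simp: sets_tv[OF vm])
    finally show "ennreal (\<kappa> * (?\<eta> * (2 / (1 + G))) * r) \<le> emeasure ?\<mu> (pbox \<inter> pext (ball q r))" unfolding Bq .
  qed
qed

lemma potential_of_gradient:
  assumes eps: "0 < \<epsilon>" "\<epsilon> < 1" and c0: "\<And>l. l < m \<Longrightarrow> c l \<noteq> 0"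
    and null: "\<And>l l'. l < m \<Longrightarrow> l' < m \<Longrightarrow> l \<noteq> l' \<Longrightarrow> c l = c l' \<Longrightarrow> emeasure (total_variation (Nu (\<delta> l))) (pbox \<inter> \<Gamma>i l') = 0"
  shows "\<exists>\<nu> f. gradient_measure (u c) \<nu> \<and> inv_frac_grad \<epsilon> (total_variation \<nu>) f \<and> continuous_on (- \<Gamma>) f \<and>
     comparable_near \<Gamma> f (\<lambda>x. infdist x \<Gamma> powr (\<epsilon> - 1))"
proof -
  obtain C where C: "0 \<le> C" "\<And>z r. 0 < r \<Longrightarrow> r \<le> 1 \<Longrightarrow> emeasure (total_variation (Nu c)) (pbox \<inter> pext (ball z r)) \<le> ennreal (C * r)"
    by (rule total_variation_upper) blast
  obtain C' r0 where C': "0 < C'" "0 < r0"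
    "\<And>q r. q \<in> \<Gamma> \<Longrightarrow> 0 < r \<Longrightarrow> r \<le> r0 \<Longrightarrow> ennreal (C' * r) \<le> emeasure (total_variation (Nu c)) (pbox \<inter> pext (ball q r))"
    using total_variation_lower[of c, OF c0 null] by blast
  show ?thesis
    by (rule regular_gradient[OF eps gradient_Nu closed_\<Gamma> \<Gamma>_shift total_variation_supp C(1) C'(1,2)]) (use C(2) C'(3) in auto)
qed

end

lemma admissible_combination_potential:
  assumes eps: "0 < \<epsilon>" "\<epsilon> < 1" and adm: "admissible_combination m c \<Omega>" and \<Gamma>: "\<Gamma> = (\<Union>i<m. frontier (pext (\<Omega> i)))"
  shows "\<exists>\<nu> f. gradient_measure (\<lambda>x. \<Sum>i<m. c i * indicator (\<Omega> i) x) \<nu> \<and> inv_frac_grad \<epsilon> (total_variation \<nu>) f \<and>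
     continuous_on (- \<Gamma>) f \<and> comparable_near \<Gamma> f (\<lambda>x. infdist x \<Gamma> powr (\<epsilon> - 1))"
proof -
  have dom: "\<Omega> l \<subseteq> pbox" "open (pext (\<Omega> l))" "smooth_boundary (pext (\<Omega> l))" "c l \<noteq> 0" if "l < m" for l
    using adm that by (auto simp: admissible_combination_def smooth_domain_def)
  have dis: "pext (\<Omega> l) \<inter> pext (\<Omega> l') = {}" if l: "l < m" "l' < m" "l \<noteq> l'" for l l'
  proof (rule ccontr)
    assume "pext (\<Omega> l) \<inter> pext (\<Omega> l') \<noteq> {}"
    then obtain x k k' where k: "k \<in> int_lattice" "x + 2 *\<^sub>R k \<in> \<Omega> l" and k': "k' \<in> int_lattice" "x + 2 *\<^sub>R k' \<in> \<Omega> l'"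
      by (auto simp: mem_pext)
    have "x \<in> cell (- One) 2 (- k)" "x \<in> cell (- One) 2 (- k')"
      using k k' dom(1)[OF l(1)] dom(1)[OF l(2)] by (auto simp: mem_cell_pbox)
    then have "- k = - k'"
      using cell_unique[of 2 x "- One"] int_lattice_uminus[OF k(1)] int_lattice_uminus[OF k'(1)] by (metis zero_less_numeral)
    then have "x + 2 *\<^sub>R k \<in> \<Omega> l \<inter> \<Omega> l'" using k k' by simp
    moreover have "\<Omega> l \<inter> \<Omega> l' = {}" using adm l by (auto simp: admissible_combination_def disjoint_family_on_def)
    ultimately show False by simp
  qed
  \<comment> \<open>Charts are chosen at every point of the plane and not only on the boundaries,
    because the partition of unity asks for a radius at each point.\<close>
  have "\<exists>r i j s g g'. 0 < r \<and> r \<le> 1/2 \<and> i \<noteq> j \<and> (\<forall>l<m. is_chart (pext (\<Omega> l)) p r i j (s l) (g l) (g' l))" for p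
  proof -
    obtain r i j where r: "0 < r" "r \<le> 1/2" "i \<noteq> j" and ch: "\<forall>l<m. \<exists>s g g'. is_chart (pext (\<Omega> l)) p r i j s g g'"
      using common_chart[of m "\<lambda>l. pext (\<Omega> l)" p] dom dis by blast
    obtain s g g' where "\<forall>l<m. is_chart (pext (\<Omega> l)) p r i j (s l) (g l) (g' l)" using ch by metis
    with r show ?thesis by blast
  qed
  then obtain rr ii jj s g g' where ch: "\<And>p. 0 < rr p" "\<And>p. rr p \<le> 1/2" "\<And>p. ii p \<noteq> jj p"
    "\<And>p l. l < m \<Longrightarrow> is_chart (pext (\<Omega> l)) p (rr p) (ii p) (jj p) (s p l) (g p l) (g' p l)"
    by metis
  have rr2: "rr p / 2 > 0" for p using ch(1)[of p] by simp
  obtain K \<theta> D where K: "finite K" "\<And>p. p \<in> K \<Longrightarrow> C1_with (\<theta> p) (D p)" "\<And>p. p \<in> K \<Longrightarrow> periodic (\<theta> p)"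
    "\<And>p x. p \<in> K \<Longrightarrow> 0 \<le> \<theta> p x" "\<And>p x. p \<in> K \<Longrightarrow> \<theta> p x \<noteq> 0 \<Longrightarrow> x \<in> pext (ball p (rr p / 2))"
    "\<And>x. (\<Sum>p\<in>K. \<theta> p x) = 1"
    using periodic_partition_of_unity[of "\<lambda>p. rr p / 2", OF rr2] by blast
  interpret S: smooth_domains \<Omega> m K \<theta> D rr ii jj "\<lambda>l p. s p l" "\<lambda>l p. g p l" "\<lambda>l p. g' p l"
    by unfold_locales (use dom dis K ch in auto)
  have u: "(\<lambda>x. \<Sum>i<m. c i * indicator (\<Omega> i) x) = S.u c" by (simp add: S.u_def fun_eq_iff)
  have \<Gamma>': "\<Gamma> = S.\<Gamma>" by (simp add: \<Gamma> S.\<Gamma>_def)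
  show ?thesis unfolding u \<Gamma>'
  proof (rule S.potential_of_gradient[OF eps dom(4)])
    show "emeasure (total_variation (S.Nu (S.\<delta> l))) (pbox \<inter> frontier (pext (\<Omega> l'))) = 0"
      if "l < m" "l' < m" "l \<noteq> l'" "c l = c l'" for l l'
      using adm that S.gradient_Nu_\<delta>[OF that(1)] unfolding admissible_combination_def by blast
  qed
qed

theorem lemma6p2:
  fixes \<epsilon> :: real
  assumes "0 < \<epsilon>" and "\<epsilon> < 1"
  shows
    "(\<forall>(a::real) b I \<Gamma>. a < b \<and> b - a < 2 \<and> I \<subseteq> pbox \<and> {a<..<b} \<subseteq> I \<and> I \<subseteq> {a..b} \<and>
        \<Gamma> = pext {a, b} \<longrightarrow>
        (\<exists>\<nu> f. gradient_measure (indicator I) \<nu> \<and>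
           inv_frac_grad \<epsilon> (total_variation \<nu>) f \<and>
           continuous_on (- \<Gamma>) f \<and>
           comparable_near \<Gamma> f (\<lambda>x. infdist x \<Gamma> powr (\<epsilon> - 1))))
     \<and>
     (\<forall>(\<Omega>::(real^2) set) \<Gamma>. smooth_domain \<Omega> \<and> \<Gamma> = frontier (pext \<Omega>) \<longrightarrow>
        (\<exists>\<nu> f. gradient_measure (indicator \<Omega>) \<nu> \<and>
           inv_frac_grad \<epsilon> (total_variation \<nu>) f \<and>
           continuous_on (- \<Gamma>) f \<and>
           comparable_near \<Gamma> f (\<lambda>x. infdist x \<Gamma> powr (\<epsilon> - 1))))
     \<and>
     (\<forall>m c (\<Omega>::nat \<Rightarrow> (real^2) set) \<Gamma>. admissible_combination m c \<Omega> \<and>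
        \<Gamma> = (\<Union>i<m. frontier (pext (\<Omega> i))) \<longrightarrow>
        (\<exists>\<nu> f. gradient_measure (\<lambda>x. \<Sum>i<m. c i * indicator (\<Omega> i) x) \<nu> \<and>
           inv_frac_grad \<epsilon> (total_variation \<nu>) f \<and>
           continuous_on (- \<Gamma>) f \<and>
           comparable_near \<Gamma> f (\<lambda>x. infdist x \<Gamma> powr (\<epsilon> - 1))))"
proof (intro conjI allI impI, goal_cases)
  case (1 a b I \<Gamma>)
  then show ?case using assms by (intro interval_gradient) auto
next
  case (2 \<Omega> \<Gamma>)
  \<comment> \<open>With a single index, the disjointness and the condition on equal coefficients
    hold vacuously.\<close>
  then have "admissible_combination 1 (\<lambda>_. 1) (\<lambda>_. \<Omega>)"
    by (simp add: admissible_combination_def disjoint_family_on_def)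
  from admissible_combination_potential[OF assms this refl] show ?case using 2 by (simp add: lessThan_Suc)
next
  case (3 m c \<Omega> \<Gamma>)
  then show ?case by (intro admissible_combination_potential[OF assms]) auto
qed

end
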